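(* Let $\lambda\in\mathbb C\setminus\{0\}$ and $\nu\in\mathbb C$. The Voros coefficient $V(\lambda,\nu;\hbar)$ of the Weber equation $$\left\{\hbar^2\frac{d^2}{dx^2}-\left(\frac{x^2}{4}-\lambda+\frac{\hbar\nu}{2}\right)\right\}\psi=0$$ and the free energy $F(\lambda;\hbar)=\sum_{g\ge 0}\hbar^{2g-2}F_g(\lambda)$ of the Weber curve $y^2-\left(\frac{x^2}{4}-\lambda\right)=0$ are related, as formal series in $\hbar$, by $$V(\lambda,\nu;\hbar)=F\left(\lambda-\frac{\hbar\nu}{2}+\frac{\hbar}{2};\hbar\right)-F\left(\lambda-\frac{\hbar\nu}{2}-\frac{\hbar}{2};\hbar\right)-\frac1\hbar\frac{\partial F_0}{\partial\lambda}(\lambda)+\frac{\nu}{2}\frac{\partial^2F_0}{\partial\lambda^2}(\lambda).$$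
   Context: Shifts: for $c\in\mathbb C$, $F(\lambda+c\hbar;\hbar)$ denotes the formal Laurent series in $\hbar$ obtained by Taylor expansion, $\sum_{n\ge0}\frac{(c\hbar)^n}{n!}\partial_\lambda^nF(\lambda;\hbar)$. Branches of $\sqrt\lambda$ and $\log\lambda$ are fixed. Voros coefficient. Let $S(x,\lambda,\nu;\hbar)=\sum_{m\ge-1}\hbar^mS_m(x,\lambda,\nu)$ be the formal solution of the Riccati equation $\hbar^2\left(\frac{dS}{dx}+S^2\right)=\frac{x^2}{4}-\lambda+\frac{\hbar\nu}{2}$ with $S_{-1}=\sqrt{x^2/4-\lambda}$; once the branch of $S_{-1}$ is chosen, all $S_m$ are determined recursively. Use the parametrization $x(z)=\sqrt\lambda\,(z+1/z)$, $z\in\mathbb P^1$, of the two-sheeted Riemann surface of $S_{-1}$, with the branch $S_{-1}(x(z))=\frac{\sqrt\lambda}{2}(z-1/z)$ (so $S_{-1}\sim x/2$ as $z\to\infty$ and $S_{-1}\sim-x/2$ as $z\to0$). Then $$V(\lambda,\nu;\hbar):=\sum_{m\ge1}\hbar^m\int_\gamma S_m(x,\lambda,\nu)\,dx=\sum_{m\ge1}\hbar^m\int_{z=0}^{z=\infty}S_m(x(z),\lambda,\nu)\,\frac{dx}{dz}\,dz,$$ where $\gamma$ is the image under $x(z)$ of a path in the $z$-plane from $0$ to $\infty$ avoiding $z=\pm1$ (for $m\ge1$ the integrand is a rational differential in $z$ with poles only at $z=\pm1$, with zero residues there). Free energy. The Weber curve is parametrized by $x(z)=\sqrt\lambda\,(z+1/z)$,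 $y(z)=\frac{\sqrt\lambda}{2}(z-1/z)$, $z\in\mathbb P^1$. The ramification points of $x$ are $R=\{1,-1\}$ and the conjugate map is $\overline z=1/z$. The correlation functions $W_{g,n}(z_1,\dots,z_n)$ ($g\ge0,n\ge1$; $W_{g,n}\equiv0$ for $g<0$) are the meromorphic multidifferentials defined by $W_{0,1}(z_0)=y(z_0)dx(z_0)$, $W_{0,2}(z_0,z_1)=B(z_0,z_1)=\frac{dz_0dz_1}{(z_0-z_1)^2}$ and, for $2g+n\ge2$, $$W_{g,n+1}(z_0,\dots,z_n)=\sum_{r\in R}\operatorname{Res}_{z=r}K(z_0,z)\Big[W_{g-1,n+2}(z,\overline z,z_1,\dots,z_n)+\sum{}'\,W_{g_1,|I_1|+1}(z,z_{I_1})W_{g_2,|I_2|+1}(\overline z,z_{I_2})\Big],$$ $K(z_0,z)=\frac{1}{2(y(z)-y(\overline z))dx(z)}\int_{\zeta=\overline z}^{\zeta=z}B(z_0,\zeta)$, where the sum is over $g_1+g_2=g$, $I_1\sqcup I_2=\{1,\dots,n\}$ and the prime means that terms with $(g_i,I_i)=(0,\emptyset)$ are excluded. The free energies are $F_g(\lambda)=\frac{1}{2-2g}\sum_{r\in R}\operatorname{Res}_{z=r}\Phi(z)W_{g,1}(z)$ for $g\ge2$, with $\Phi$ a primitive of $y(z)dx(z)$, and (from the Eynard–Orantin definitions) $F_0(\lambda)=-\frac34\lambda^2+\frac12\lambda^2\log\lambda$, $F_1(\lambda)=-\frac1{12}\log\lambda$. *)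

theory Defs
  imports "HOL-Complex_Analysis.Complex_Analysis"
begin

text \<open>
  Everything is written in the uniformizing coordinate \<open>z\<close>. The parameter \<open>s\<close> is the chosen value
  of \<open>\<surd>\<lambda>\<close>. A multidifferential \<open>w(z\<^sub>1,\<dots>,z\<^sub>n) dz\<^sub>1\<dots>dz\<^sub>n\<close> is represented by its coefficient \<open>w\<close>.
  Formal series in \<open>\<hbar>\<close> are elements of \<^typ>\<open>complex fps\<close> and \<^typ>\<open>complex fls\<close>, with \<^const>\<open>fls_X\<close>
  in the role of \<open>\<hbar>\<close>.
\<close>

definition weber_x :: "complex \<Rightarrow> complex \<Rightarrow> complex" where
  "weber_x s z = s * (z + 1 / z)"

definition weber_y :: "complex \<Rightarrow> complex \<Rightarrow> complex" where
  "weber_y s z = s / 2 * (z - 1 / z)"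

section \<open>Voros coefficient\<close>

text \<open>The derivation \<open>d/dx = (dx/dz)\<inverse> d/dz\<close>, applied coefficientwise.\<close>

definition fls_ddx :: "complex \<Rightarrow> (complex \<Rightarrow> complex fls) \<Rightarrow> complex \<Rightarrow> complex fls" where
  "fls_ddx s S z = Abs_fls (\<lambda>m. deriv (\<lambda>w. fls_nth (S w) m) z / deriv (weber_x s) z)"

text \<open>
  \<open>S z\<close> is the formal series \<open>S(x(z), \<lambda>, \<nu>; \<hbar>)\<close>. The points \<open>0\<close> and \<open>\<plusminus>1\<close>, where \<open>x = \<infinity>\<close> and
  \<open>dx = 0\<close>, are excluded, and the values of \<open>S\<close> there are arbitrary.
\<close>

definition riccati_solution ::
    "complex \<Rightarrow> complex \<Rightarrow> complex \<Rightarrow> (complex \<Rightarrow> complex fls) \<Rightarrow> bool" where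
  "riccati_solution lam s \<nu> S \<longleftrightarrow>
     (\<forall>m. (\<lambda>z. fls_nth (S z) m) holomorphic_on - {0, 1, -1}) \<and>
     (\<forall>z\<in>- {0, 1, -1}.
        (\<forall>m < -1. fls_nth (S z) m = 0) \<and>
        fls_nth (S z) (-1) = weber_y s z \<and>
        fls_X ^ 2 * (fls_ddx s S z + S z ^ 2) =
          fls_const ((weber_x s z)\<^sup>2 / 4 - lam) + fls_const (\<nu> / 2) * fls_X)"

text \<open>
  The path is parametrized by \<open>[0,1)\<close>. It reaches \<open>\<infinity>\<close> only as a limit, so integrals along it are
  improper.
\<close>

definition path_0_to_infinity :: "(real \<Rightarrow> complex) \<Rightarrow> bool" where
  "path_0_to_infinity \<gamma> \<longleftrightarrow>
     \<gamma> 0 = 0 \<and> filterlim \<gamma> at_infinity (at_left 1) \<and>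
     (\<forall>T\<in>{0<..<1}. valid_path (subpath 0 T \<gamma>)) \<and>
     (\<forall>t\<in>{0..<1}. \<gamma> t \<noteq> 1 \<and> \<gamma> t \<noteq> -1)"

text \<open>
  For \<open>m \<ge> 1\<close> the differential \<open>S\<^sub>m(x(z)) (dx/dz) dz\<close> is regular at \<open>z = 0\<close>;
  \<^const>\<open>remove_sings\<close> supplies its value there.
\<close>

definition voros ::
    "complex \<Rightarrow> (complex \<Rightarrow> complex fls) \<Rightarrow> (real \<Rightarrow> complex) \<Rightarrow> complex fps" where
  "voros s S \<gamma> = Abs_fps (\<lambda>m. if m = 0 then 0 else
     Lim (at_left 1) (\<lambda>T. contour_integral (subpath 0 T \<gamma>)
       (remove_sings (\<lambda>z. fls_nth (S z) (int m) * deriv (weber_x s) z))))"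

section \<open>Correlation functions\<close>

definition bergman :: "complex \<Rightarrow> complex \<Rightarrow> complex" where
  "bergman z0 z1 = 1 / (z0 - z1)\<^sup>2"

text \<open>
  The kernel is only used for \<open>z\<close> in a small punctured neighbourhood of \<open>\<plusminus>1\<close>, where the segment
  from \<open>1/z\<close> to \<open>z\<close> does not meet \<open>z0\<close>. Its coefficient is with respect to \<open>dz0 / dz\<close>.
\<close>

definition recursion_kernel :: "complex \<Rightarrow> complex \<Rightarrow> complex \<Rightarrow> complex" where
  "recursion_kernel s z0 z =
     1 / (2 * (weber_y s z - weber_y s (1 / z)) * deriv (weber_x s) z) *
     contour_integral (linepath (1 / z) z) (\<lambda>\<zeta>. bergman z0 \<zeta>)"

lemma recursion_size_less:
  assumes "(h, I) \<in> {..g} \<times> Pow {..<length zs} - {(0, {}), (g, {..<length zs})}"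
  shows "2 * h + length (nths zs I) < 2 * g + length zs"
    and "2 * (g - h) + length (nths zs ({..<length zs} - I)) < 2 * g + length zs"
proof -
  have I: "I \<subseteq> {..<length zs}" "h \<le> g" and fin: "finite I"
    using assms by (auto intro: finite_subset[of _ "{..<length zs}"])
  have len: "length (nths zs J) = card J" if "J \<subseteq> {..<length zs}" for J
  proof -
    have "{i. i < length zs \<and> i \<in> J} = J" using that by auto
    then show ?thesis by (simp add: length_nths)
  qed
  have le: "card I \<le> length zs"
    using card_mono[OF _ I(1)] by simp
  have "h < g \<or> card I < length zs"
    using assms I le card_subset_eq[OF _ I(1)] by force
  then show "2 * h + length (nths zs I) < 2 * g + length zs"
    using len[OF I(1)] I(2) le by auto
  have "h > 0 \<or> card I > 0"
    using assms fin by (auto simp: card_gt_0_iff)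
  moreover have "card ({..<length zs} - I) = length zs - card I"
    using I fin by (simp add: card_Diff_subset)
  ultimately show "2 * (g - h) + length (nths zs ({..<length zs} - I)) < 2 * g + length zs"
    using len[of "{..<length zs} - I"] I(2) le by auto
qed

text \<open>
  \<open>corr_fun s g [z\<^sub>1, \<dots>, z\<^sub>n]\<close> is the coefficient of \<open>W\<^sub>g\<^sub>,\<^sub>n(z\<^sub>1,\<dots>,z\<^sub>n)\<close>. In the sum,
  \<open>I\<close> and its complement index the entries of \<open>zs\<close> that go with \<open>z\<close> and with \<open>1/z\<close>. Each term has
  exactly one argument \<open>1/z\<close>, whose pullback contributes the factor \<open>deriv inverse z\<close>.
\<close>

function corr_fun :: "complex \<Rightarrow> nat \<Rightarrow> complex list \<Rightarrow> complex" where
  "corr_fun s g [] = 0"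
| "corr_fun s g (z0 # zs) =
    (if g = 0 \<and> zs = [] then weber_y s z0 * deriv (weber_x s) z0
     else if g = 0 \<and> length zs = 1 then bergman z0 (hd zs)
     else \<Sum>r\<in>{1, -1}. residue (\<lambda>z. recursion_kernel s z0 z * deriv inverse z *
       ((if g = 0 then 0 else corr_fun s (g - 1) (z # 1 / z # zs)) +
        (\<Sum>(h, I) \<in> {..g} \<times> Pow {..<length zs} - {(0, {}), (g, {..<length zs})}.
           corr_fun s h (z # nths zs I) *
           corr_fun s (g - h) (1 / z # nths zs ({..<length zs} - I))))) r)"
  by pat_completeness auto
termination
proof (relation "Wellfounded.measure (\<lambda>(s, g, zs). 2 * g + length zs)", goal_cases)
  case (3 s g z0 zs r z p h I)
  then show ?case using recursion_size_less(1)[of h I g zs] by simp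
next
  case (4 s g z0 zs r z p h I)
  then show ?case using recursion_size_less(2)[of h I g zs] by simp
qed auto

declare corr_fun.simps(2) [simp del]

section \<open>Free energy\<close>

text \<open>
  A primitive of \<open>y dx\<close> near the ramification points. No global one exists, because of the
  residue of \<open>y dx\<close> at \<open>z = 0\<close>.
\<close>

definition ydx_primitive :: "complex \<Rightarrow> (complex \<Rightarrow> complex) \<Rightarrow> bool" where
  "ydx_primitive s \<Phi> \<longleftrightarrow>
     (\<exists>\<epsilon>>0. \<forall>z \<in> ball 1 \<epsilon> \<union> ball (-1) \<epsilon>.
        (\<Phi> has_field_derivative weber_y s z * deriv (weber_x s) z) (at z))"

text \<open>
  \<open>sq\<close> and \<open>lg\<close> are the branches of \<open>\<surd>\<close> and \<open>log\<close>, and \<open>\<Phi> u\<close> is a primitive of \<open>y dx\<close> on the curve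
  with parameter \<open>u\<close>. All the \<open>F\<^sub>g\<close> are functions of this parameter.
\<close>

definition free_energy ::
    "(complex \<Rightarrow> complex) \<Rightarrow> (complex \<Rightarrow> complex) \<Rightarrow> (complex \<Rightarrow> complex \<Rightarrow> complex) \<Rightarrow>
     nat \<Rightarrow> complex \<Rightarrow> complex" where
  "free_energy sq lg \<Phi> g u =
     (if g = 0 then - 3 / 4 * u\<^sup>2 + 1 / 2 * u\<^sup>2 * lg u
      else if g = 1 then - 1 / 12 * lg u
      else 1 / (2 - 2 * of_nat g) *
        (\<Sum>r\<in>{1, -1}. residue (\<lambda>z. \<Phi> u z * corr_fun (sq u) g [z]) r))"

definition total_free_energy ::
    "(complex \<Rightarrow> complex) \<Rightarrow> (complex \<Rightarrow> complex) \<Rightarrow> (complex \<Rightarrow> complex \<Rightarrow> complex) \<Rightarrow>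
     complex \<Rightarrow> complex fls" where
  "total_free_energy sq lg \<Phi> u =
     fls_X_inv ^ 2 *
     fps_to_fls (Abs_fps (\<lambda>n. if even n then free_energy sq lg \<Phi> (n div 2) u else 0))"

text \<open>
  \<open>hbar_shift c G u\<close> is \<open>G(u + c \<hbar>; \<hbar>)\<close>, that is \<open>\<Sum>n. (c \<hbar>)\<^sup>n / n! \<partial>\<^sup>n G(u; \<hbar>)\<close>, for a series \<open>G\<close>
  that starts at \<open>\<hbar>\<^sup>-\<^sup>2\<close>. This is why the sum in the coefficient of \<open>\<hbar>\<^sup>k\<close> stops at \<open>n = k + 2\<close>.
\<close>

definition hbar_shift :: "complex \<Rightarrow> (complex \<Rightarrow> complex fls) \<Rightarrow> complex \<Rightarrow> complex fls" where
  "hbar_shift c G u = Abs_fls (\<lambda>k. if k < -2 then 0 else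
     (\<Sum>n\<le>nat (k + 2). c ^ n / fact n * (deriv ^^ n) (\<lambda>w. fls_nth (G w) (k - int n)) u))"

lemma fls_nth_hbar_shift:
  "fls_nth (hbar_shift c G u) k = (if k < -2 then 0 else
     (\<Sum>n\<le>nat (k + 2). c ^ n / fact n * (deriv ^^ n) (\<lambda>w. fls_nth (G w) (k - int n)) u))"
  unfolding hbar_shift_def by (rule nth_Abs_fls_lower_bound[of "-2"]) auto

lemma fls_nth_total_free_energy:
  "fls_nth (total_free_energy sq lg \<Phi> u) k =
     (if k \<ge> -2 \<and> even k then free_energy sq lg \<Phi> (nat ((k + 2) div 2)) u else 0)"
proof -
  have "total_free_energy sq lg \<Phi> u = fls_shift 2
     (fps_to_fls (Abs_fps (\<lambda>n. if even n then free_energy sq lg \<Phi> (n div 2) u else 0)))"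
    unfolding total_free_energy_def
    using fls_X_inv_power_times_conv_shift(1)[of 2] by simp
  moreover have "nat (k + 2) div 2 = nat ((k + 2) div 2)"
    by (simp add: nat_div_distrib')
  ultimately show ?thesis
    by (auto simp: even_nat_iff)
qed

section \<open>Existence of the formal solution\<close>

text \<open>\<open>riccati_coeff s \<nu> n\<close> is the coefficient \<open>S\<^sub>n\<^sub>-\<^sub>1\<close>.\<close>

fun riccati_coeff :: "complex \<Rightarrow> complex \<Rightarrow> nat \<Rightarrow> complex \<Rightarrow> complex" where
  "riccati_coeff s \<nu> 0 = weber_y s"
| "riccati_coeff s \<nu> (Suc n) = (\<lambda>z.
     ((if n = 0 then \<nu> / 2 else 0) - deriv (riccati_coeff s \<nu> n) z / deriv (weber_x s) z
      - (\<Sum>i\<in>{1..n}. riccati_coeff s \<nu> i z * riccati_coeff s \<nu> (Suc n - i) z))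
     / (2 * weber_y s z))"

lemma deriv_weber_x: "z \<noteq> 0 \<Longrightarrow> deriv (weber_x s) z = s * (1 - 1 / z\<^sup>2)"
  unfolding weber_x_def[abs_def]
  by (rule DERIV_imp_deriv)
    (auto intro!: derivative_eq_intros simp: power2_eq_square field_simps)

lemma weber_nonzero:
  assumes "s \<noteq> 0" "z \<in> - {0, 1, -1}"
  shows "weber_y s z \<noteq> 0" "deriv (weber_x s) z \<noteq> 0"
proof -
  have "z\<^sup>2 \<noteq> 1"
    using assms by (auto simp: power2_eq_1_iff)
  then show "weber_y s z \<noteq> 0" "deriv (weber_x s) z \<noteq> 0"
    using assms by (auto simp: weber_y_def deriv_weber_x field_simps power2_eq_square)
qed

lemma riccati_coeff_holomorphic:
  assumes "s \<noteq> 0"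
  shows "riccati_coeff s \<nu> n holomorphic_on - {0, 1, -1}"
proof (induction n rule: less_induct)
  case (less n)
  have op: "open (- {0, 1, -1 :: complex})"
    by (intro open_Compl finite_imp_closed) auto
  have y: "weber_y s holomorphic_on - {0, 1, -1}"
    unfolding weber_y_def[abs_def] by (auto intro!: holomorphic_intros)
  have x: "weber_x s holomorphic_on - {0, 1, -1}"
    unfolding weber_x_def[abs_def] by (auto intro!: holomorphic_intros)
  show ?case
  proof (cases n)
    case 0
    with y show ?thesis by simp
  next
    case (Suc m)
    have m: "riccati_coeff s \<nu> i holomorphic_on - {0, 1, -1}" if "i \<le> m" for i
      using less Suc that by auto
    show ?thesis
      unfolding Suc riccati_coeff.simps
      by (intro holomorphic_intros holomorphic_deriv m x y op)
         (use weber_nonzero[OF assms] in auto)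
  qed
qed

lemma riccati_solution_exists:
  assumes "s \<noteq> 0" "s\<^sup>2 = lam"
  shows "\<exists>S. riccati_solution lam s \<nu> S"
proof -
  define a where "a = riccati_coeff s \<nu>"
  define S where "S z = fls_shift 1 (fps_to_fls (Abs_fps (\<lambda>n. a n z)))" for z
  have nth: "fls_nth (S z) m = (if m < -1 then 0 else a (nat (m + 1)) z)" for z m
    by (simp add: S_def)
  have XS: "fls_X * S z = fps_to_fls (Abs_fps (\<lambda>n. a n z))" for z
    by (simp add: S_def fls_X_times_conv_shift)
  have ddx_nth: "fls_nth (fls_ddx s S z) m =
      (if m < -1 then 0 else deriv (a (nat (m + 1))) z / deriv (weber_x s) z)" for z m
    unfolding fls_ddx_def by (subst nth_Abs_fls_lower_bound[of "-1"]) (auto simp: nth)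
  have Xddx: "fls_X * fls_ddx s S z =
      fps_to_fls (Abs_fps (\<lambda>n. deriv (a n) z / deriv (weber_x s) z))" for z
    by (rule fls_eqI) (simp add: fls_X_times_conv_shift ddx_nth)
  have "riccati_solution lam s \<nu> S"
    unfolding riccati_solution_def
  proof (intro conjI allI ballI impI)
    fix m show "(\<lambda>z. fls_nth (S z) m) holomorphic_on - {0, 1, -1}"
      using riccati_coeff_holomorphic[OF assms(1)] by (cases "m < -1") (auto simp: nth a_def)
  next
    fix z :: complex assume z: "z \<in> - {0, 1, -1}"
    show "fls_nth (S z) (-1) = weber_y s z"
      by (simp add: nth a_def)
    let ?D = "Abs_fps (\<lambda>n. deriv (a n) z / deriv (weber_x s) z)"
    let ?A = "Abs_fps (\<lambda>n. a n z)"
    let ?c = "(weber_x s z)\<^sup>2 / 4 - lam"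
    have c: "weber_y s z ^ 2 = ?c"
      using z assms by (auto simp: weber_x_def weber_y_def field_simps power2_eq_square)
    have "fps_X * ?D + ?A ^ 2 = fps_const ?c + fps_const (\<nu> / 2) * fps_X"
    proof (rule fps_ext)
      fix n
      show "fps_nth (fps_X * ?D + ?A ^ 2) n =
        fps_nth (fps_const ?c + fps_const (\<nu> / 2) * fps_X) n"
      proof (cases n)
        case 0
        then show ?thesis using c by (simp add: a_def power2_eq_square fps_mult_nth)
      next
        case (Suc m)
        have "(\<Sum>i=0..Suc m. a i z * a (Suc m - i) z) =
            2 * weber_y s z * a (Suc m) z + (\<Sum>i\<in>{1..m}. a i z * a (Suc m - i) z)"
        proof -
          have "{0..Suc m} = insert 0 (insert (Suc m) {1..m})" by auto
          then show ?thesis by (simp add: a_def del: riccati_coeff.simps(2))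
        qed
        moreover have "2 * weber_y s z * a (Suc m) z =
            (if m = 0 then \<nu> / 2 else 0) - deriv (a m) z / deriv (weber_x s) z
            - (\<Sum>i\<in>{1..m}. a i z * a (Suc m - i) z)"
          using weber_nonzero[OF assms(1) z] by (simp add: a_def)
        ultimately have "(\<Sum>i=0..Suc m. a i z * a (Suc m - i) z) =
            (if m = 0 then \<nu> / 2 else 0) - deriv (a m) z / deriv (weber_x s) z"
          by simp
        then show ?thesis
          using Suc by (simp add: power2_eq_square fps_mult_nth[of ?A ?A])
      qed
    qed
    then have "fls_X * fps_to_fls ?D + fps_to_fls ?A ^ 2 =
        fls_const ?c + fls_const (\<nu> / 2) * fls_X"
      by (subst (asm) fps_to_fls_eq_iff[symmetric])
        (simp add: fls_times_fps_to_fls fps_to_fls_power)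
    moreover have "fls_X ^ 2 * (fls_ddx s S z + S z ^ 2) =
        fls_X * (fls_X * fls_ddx s S z) + (fls_X * S z) ^ 2"
      by (simp add: algebra_simps power2_eq_square)
    ultimately show "fls_X ^ 2 * (fls_ddx s S z + S z ^ 2) =
        fls_const ?c + fls_const (\<nu> / 2) * fls_X"
      by (simp add: XS Xddx)
  qed (simp add: nth)
  then show ?thesis by blast
qed

end

theory Submission
  imports Defs
begin

text \<open>
  In the coordinate \<open>w = (z + 1) / (z - 1)\<close> the conjugation \<open>z \<mapsto> 1/z\<close> is \<open>w \<mapsto> -w\<close>, the ramification points
  are \<open>w = 0\<close> and \<open>w = \<infinity>\<close>, and the endpoints \<open>z = 0\<close> and \<open>z = \<infinity>\<close> of the Voros integral are \<open>w = -1\<close> and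
  \<open>w = 1\<close>. Every stable \<open>W\<^sub>g\<^sub>,\<^sub>n\<close> becomes a Laurent polynomial in the squares \<open>w\<^sub>i\<^sup>2\<close> times \<open>dw\<^sub>1\<dots>dw\<^sub>n\<close>. Such a
  polynomial is a multilinear function on sequences \<open>l\<close>, read off at \<open>l k = w\<^sup>2\<^sup>k\<close>; integrating it along a
  path means inserting the sequence of the integrals of \<open>w\<^sup>2\<^sup>k dw\<close>. This makes the topological recursion an
  algebraic recursion (\<open>corr_fun_cay\<close>) for \<open>conn d\<close>, where \<open>d = 2g - 2 + n\<close> is the power of \<open>\<hbar>\<close>. By
  homogeneity \<open>\<lambda>\<close> enters only through the factor \<open>\<lambda>\<^sup>-\<^sup>d\<close>, so that \<open>\<lambda> = 1\<close> suffices.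

  Exponentiating, one passes to the disconnected correlators \<open>disc\<close>, whose recursion is linear. They are
  symmetric in their arguments (\<open>disc_symmetric\<close>), although the recursion singles out the first one. Inserting
  into all arguments the integration functional \<open>divisor \<nu> w\<close> gives the wave function \<open>Psi \<nu> w\<close>. With the
  symmetry, its derivatives in \<open>w\<close> insert points, and the recursion becomes a second order differential
  equation (\<open>phi_ode\<close>): the Weber equation, after removal of the two leading WKB terms. Hence
  the logarithmic derivative of \<open>Psi\<close> consists of the coefficients \<open>S\<^sub>m\<close> with \<open>m \<ge> 1\<close> (\<open>riccati_eq_chi\<close>), and the
  Voros coefficient is \<open>log Psi\<close> at \<open>w = 1\<close> minus \<open>log Psi\<close> at \<open>w = -1\<close> (\<open>voros_nth\<close>). At these two points the
  functional \<open>divisor \<nu> w\<close> is \<open>1 - \<nu>\<close> and \<open>-1 - \<nu>\<close> times the same functional \<open>half_period\<close>. So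
  \<open>V = G(1 - \<nu>) - G(-1 - \<nu>)\<close>, where the coefficient \<open>G\<^sub>m\<close> of \<open>\<hbar>\<^sup>m\<close> in \<open>G\<close> is a polynomial.

  It remains to see that \<open>G(c)\<close> is \<open>F(\<lambda> + c\<hbar>/2; \<hbar>)\<close> up to terms that cancel or appear in the statement, i.e. that
  integration over the period is differentiation in \<open>\<lambda>\<close>. This is derived from the Riccati equation: the parameters
  \<open>\<lambda>\<close> and \<open>\<nu>\<close> enter only through \<open>\<lambda> - \<hbar>\<nu>/2\<close>, and by homogeneity \<open>\<partial>/\<partial>\<lambda>\<close> can be traded for the dilation
  \<open>x \<partial>/\<partial>x\<close>. So \<open>\<partial>S/\<partial>\<nu>\<close> is expressed by \<open>S\<close> and \<open>x dS/dx\<close> (\<open>riccati_shift\<close>). Integrated from \<open>w = -1\<close> to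
  \<open>w = 1\<close>, it says that \<open>G\<^sub>k\<^sub>+\<^sub>1' + k/2 G\<^sub>k\<close> takes the same value at \<open>1 - \<nu>\<close> and at \<open>-1 - \<nu>\<close>. A periodic polynomial
  is constant, and the value at \<open>0\<close> is the integral of the one-point function over the half period, which the
  definition of \<open>F\<^sub>g\<close> by residues also computes (\<open>free_energy_residue\<close>). Thus \<open>G\<^sub>m\<close> satisfies the recursion
  (\<open>DERIV_log_period_wave\<close>) that Taylor expansion of functions homogeneous in \<open>\<lambda>\<close> satisfies (\<open>DERIV_shift_poly\<close>),
  with the same initial values.
\<close>

section \<open>Sums over sublists\<close>

text \<open>
  Spectators of the recursion are kept in a list. The sums over one entry, over an unordered pair of entries
  and over a splitting into two sublists have recursive definitions, so that exchanges of summations are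
  proved by induction on the list.
\<close>

fun sum_remove :: "('a \<Rightarrow> 'a list \<Rightarrow> complex) \<Rightarrow> 'a list \<Rightarrow> complex" where
  "sum_remove f [] = 0"
| "sum_remove f (x # L) = f x L + sum_remove (\<lambda>y R. f y (x # R)) L"

fun sum_remove2 :: "('a \<Rightarrow> 'a \<Rightarrow> 'a list \<Rightarrow> complex) \<Rightarrow> 'a list \<Rightarrow> complex" where
  "sum_remove2 f [] = 0"
| "sum_remove2 f (x # L) = sum_remove (f x) L + sum_remove2 (\<lambda>y z R. f y z (x # R)) L"

fun sum_split :: "('a list \<Rightarrow> 'a list \<Rightarrow> complex) \<Rightarrow> 'a list \<Rightarrow> complex" where
  "sum_split f [] = f [] []"
| "sum_split f (x # L) = sum_split (\<lambda>A. f (x # A)) L + sum_split (\<lambda>A B. f A (x # B)) L"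

lemma sum_remove_cong:
  "(\<And>x R. mset (x # R) = mset L \<Longrightarrow> f x R = g x R) \<Longrightarrow> sum_remove f L = sum_remove g L"
proof (induction L arbitrary: f g)
  case (Cons a L)
  have "sum_remove (\<lambda>y R. f y (a # R)) L = sum_remove (\<lambda>y R. g y (a # R)) L"
    by (rule Cons.IH, rule Cons.prems) auto
  then show ?case using Cons.prems[of a L] by simp
qed simp

lemma sum_remove2_cong:
  "(\<And>x y R. mset (x # y # R) = mset L \<Longrightarrow> f x y R = g x y R) \<Longrightarrow> sum_remove2 f L = sum_remove2 g L"
proof (induction L arbitrary: f g)
  case (Cons a L)
  have "sum_remove2 (\<lambda>y z R. f y z (a # R)) L = sum_remove2 (\<lambda>y z R. g y z (a # R)) L"
    by (rule Cons.IH, rule Cons.prems) (simp add: add_mset_commute)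
  moreover have "sum_remove (f a) L = sum_remove (g a) L"
    by (rule sum_remove_cong, rule Cons.prems) auto
  ultimately show ?case by simp
qed simp

lemma sum_split_cong:
  "(\<And>A B. mset (A @ B) = mset L \<Longrightarrow> f A B = g A B) \<Longrightarrow> sum_split f L = sum_split g L"
proof (induction L arbitrary: f g)
  case (Cons a L)
  have "sum_split (\<lambda>A. f (a # A)) L = sum_split (\<lambda>A. g (a # A)) L"
    by (rule Cons.IH, rule Cons.prems) auto
  moreover have "sum_split (\<lambda>A B. f A (a # B)) L = sum_split (\<lambda>A B. g A (a # B)) L"
    by (rule Cons.IH, rule Cons.prems) auto
  ultimately show ?case by simp
qed simp

lemma sum_remove_add: "sum_remove (\<lambda>x R. f x R + g x R) L = sum_remove f L + sum_remove g L"
  by (induction L arbitrary: f g) (auto simp: algebra_simps)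

lemma sum_remove_zero: "sum_remove (\<lambda>x R. 0) L = 0"
  by (induction L) auto

lemma sum_remove_mult: "sum_remove (\<lambda>x R. c * f x R) L = c * sum_remove f L"
  by (induction L arbitrary: f) (auto simp: algebra_simps)

lemma sum_remove_sum: "sum_remove (\<lambda>x R. \<Sum>i\<in>I. f i x R) L = (\<Sum>i\<in>I. sum_remove (f i) L)"
  by (induction L arbitrary: f) (auto simp: sum.distrib)

lemma sum_remove2_add:
  "sum_remove2 (\<lambda>x y R. f x y R + g x y R) L = sum_remove2 f L + sum_remove2 g L"
  by (induction L arbitrary: f g) (auto simp: algebra_simps sum_remove_add)

lemma sum_remove2_mult: "sum_remove2 (\<lambda>x y R. c * f x y R) L = c * sum_remove2 f L"
  by (induction L arbitrary: f) (auto simp: algebra_simps sum_remove_mult)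

lemma sum_remove2_zero: "sum_remove2 (\<lambda>x y R. 0) L = 0"
  by (induction L) (auto simp: sum_remove_zero)

lemma sum_split_add: "sum_split (\<lambda>A B. f A B + g A B) L = sum_split f L + sum_split g L"
  by (induction L arbitrary: f g) (auto simp: algebra_simps)

lemma sum_split_zero: "sum_split (\<lambda>A B. 0) L = 0"
  by (induction L) auto

lemma sum_split_mult: "sum_split (\<lambda>A B. c * f A B) L = c * sum_split f L"
  by (induction L arbitrary: f) (auto simp: algebra_simps)

lemma sum_split_sum: "sum_split (\<lambda>A B. \<Sum>i\<in>I. f i A B) L = (\<Sum>i\<in>I. sum_split (f i) L)"
  by (induction L arbitrary: f) (auto simp: sum.distrib)

text \<open>Removing two entries one after the other removes each unordered pair in both orders.\<close>

lemma sum_remove_sum_remove: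
  "sum_remove (\<lambda>x. sum_remove (f x)) L = sum_remove2 (\<lambda>x y R. f x y R + f y x R) L"
  by (induction L arbitrary: f) (auto simp: sum_remove_add sum_remove2_add algebra_simps)

lemma sum_remove_swap:
  "sum_remove (\<lambda>x. sum_remove (f x)) L = sum_remove (\<lambda>x. sum_remove (\<lambda>y. f y x)) L"
  by (simp add: sum_remove_sum_remove add.commute)

lemma sum_remove_sum_remove2:
  "sum_remove (\<lambda>x. sum_remove2 (f x)) L = sum_remove2 (\<lambda>y z. sum_remove (\<lambda>x. f x y z)) L"
proof (induction L arbitrary: f)
  case (Cons a L)
  show ?case
    using Cons[of "\<lambda>x y z R. f x y z (a # R)"] sum_remove_swap[of "\<lambda>x y. f x a y" L]
    by (simp add: sum_remove_add sum_remove2_add)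
qed simp

lemma sum_remove2_swap:
  "sum_remove2 (\<lambda>x y. sum_remove2 (f x y)) L =
   sum_remove2 (\<lambda>z u. sum_remove2 (\<lambda>x y. f x y z u)) L"
proof (induction L arbitrary: f)
  case (Cons a L)
  show ?case
    using Cons[of "\<lambda>x y z u R. f x y z u (a # R)"]
    by (simp add: sum_remove2_add sum_remove_sum_remove2)
qed simp

text \<open>
  Both sides sum over the ordered splittings into three sublists.
\<close>

lemma sum_split_assoc:
  "sum_split (\<lambda>A B. sum_split (\<lambda>A1 A2. f A1 A2 B) A) L =
   sum_split (\<lambda>A B. sum_split (\<lambda>B1 B2. f A B1 B2) B) L"
  by (induction L arbitrary: f) (auto simp: sum_split_add algebra_simps)

lemma sum_split_sum_remove:
  "sum_split (\<lambda>A B. sum_remove (\<lambda>x A'. f x A' B) A) L =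
   sum_remove (\<lambda>x. sum_split (f x)) L"
  by (induction L arbitrary: f) (auto simp: sum_split_add sum_remove_add algebra_simps)

lemma sum_split_Nil_left: "sum_split (\<lambda>A B. if A = [] then f B else 0) L = f L"
proof (induction L arbitrary: f)
  case (Cons a L)
  show ?case using Cons[of "\<lambda>B. f (a # B)"] by (simp add: sum_split_zero)
qed simp

lemma sum_split_single_left:
  "sum_split (\<lambda>A B. if length A = 1 then f (hd A) B else 0) L = sum_remove f L"
proof (induction L arbitrary: f)
  case (Cons a L)
  show ?case using Cons[of "\<lambda>x B. f x (a # B)"] sum_split_Nil_left[of "\<lambda>B. f a B" L]
    by (simp cong: if_cong)
qed simp

lemma sum_split_pair_left:
  "sum_split (\<lambda>A B. if length A = 2 then f (hd A) (hd (tl A)) B else 0) L = sum_remove2 f L"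
proof (induction L arbitrary: f)
  case (Cons a L)
  have "Suc n = 2 \<longleftrightarrow> n = 1" for n by auto
  then show ?case
    using Cons[of "\<lambda>x y B. f x y (a # B)"] sum_split_single_left[of "\<lambda>x B. f a x B" L]
    by (simp cong: if_cong)
qed simp

lemma sum_split_map:
  "sum_split f (map g L) = sum_split (\<lambda>A B. f (map g A) (map g B)) L"
  by (induction L arbitrary: f) auto

lemma sum_remove_map:
  "sum_remove f (map g L) = sum_remove (\<lambda>x R. f (g x) (map g R)) L"
  by (induction L arbitrary: f) auto

text \<open>
  The link with the index subsets in the definition of the correlation functions.
\<close>

lemma sum_split_nths:
  "(\<Sum>I\<in>Pow {..<length L}. f (nths L I) (nths L ({..<length L} - I))) = sum_split f L"
proof (induction L arbitrary: f)
  case (Cons x L)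
  let ?n = "length L"
  let ?g = "\<lambda>I. f (nths (x # L) I) (nths (x # L) ({..<Suc ?n} - I))"
  have split: "Pow {..<Suc ?n} = (\<lambda>J. insert 0 (Suc ` J)) ` Pow {..<?n} \<union> (\<lambda>J. Suc ` J) ` Pow {..<?n}"
  proof -
    have "I \<in> (\<lambda>J. insert 0 (Suc ` J)) ` Pow {..<?n} \<union> (\<lambda>J. Suc ` J) ` Pow {..<?n}"
      if I: "I \<subseteq> {..<Suc ?n}" for I
    proof -
      define J where "J = {j. Suc j \<in> I}"
      have J: "J \<in> Pow {..<?n}" using I by (auto simp: J_def)
      have SJ: "Suc ` J = I - {0}" by (auto simp: J_def image_iff) (metis not0_implies_Suc)
      show ?thesis
      proof (cases "0 \<in> I")
        case True
        then have "I = insert 0 (Suc ` J)" using SJ by auto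
        then show ?thesis using J by blast
      next
        case False
        then have "I = Suc ` J" using SJ by auto
        then show ?thesis using J by blast
      qed
    qed
    then show ?thesis by auto
  qed
  have 1: "{j. Suc j \<in> insert 0 (Suc ` J)} = J" "{j. Suc j \<in> Suc ` J} = J" for J :: "nat set"
    by auto
  have 2: "{j. Suc j \<in> {..<Suc ?n} - insert 0 (Suc ` J)} = {..<?n} - J"
    "{j. Suc j \<in> {..<Suc ?n} - Suc ` J} = {..<?n} - J" for J :: "nat set"
    by auto
  have 3: "nths (x # L) (insert 0 (Suc ` J)) = x # nths L J" "nths (x # L) (Suc ` J) = nths L J"
    "nths (x # L) ({..<Suc ?n} - insert 0 (Suc ` J)) = nths L ({..<?n} - J)"
    "nths (x # L) ({..<Suc ?n} - Suc ` J) = x # nths L ({..<?n} - J)" for J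
    unfolding nths_Cons 1 2 by auto
  have "(\<Sum>I\<in>Pow {..<Suc ?n}. ?g I) =
     (\<Sum>I\<in>(\<lambda>J. insert 0 (Suc ` J)) ` Pow {..<?n}. ?g I) + (\<Sum>I\<in>(\<lambda>J. Suc ` J) ` Pow {..<?n}. ?g I)"
    unfolding split by (rule sum.union_disjoint) auto
  also have "(\<Sum>I\<in>(\<lambda>J. insert 0 (Suc ` J)) ` Pow {..<?n}. ?g I) =
      (\<Sum>J\<in>Pow {..<?n}. f (x # nths L J) (nths L ({..<?n} - J)))"
  proof (subst sum.reindex)
    show "inj_on (\<lambda>J. insert 0 (Suc ` J)) (Pow {..<?n})"
    proof (rule inj_onI)
      fix J K :: "nat set" assume "insert 0 (Suc ` J) = insert 0 (Suc ` K)"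
      then show "J = K" using 1(1)[of J] 1(1)[of K] by simp
    qed
  qed (simp add: 3)
  also have "(\<Sum>I\<in>(\<lambda>J. Suc ` J) ` Pow {..<?n}. ?g I) =
      (\<Sum>J\<in>Pow {..<?n}. f (nths L J) (x # nths L ({..<?n} - J)))"
    by (subst sum.reindex) (auto simp: inj_on_def 3 inj_image_eq_iff)
  finally show ?case
    using Cons[of "\<lambda>A. f (x # A)"] Cons[of "\<lambda>A B. f A (x # B)"] by simp
qed simp

lemma sum_remove_replicate: "sum_remove f (replicate n x) = of_nat n * f x (replicate (n - 1) x)"
proof (induction n arbitrary: f)
  case (Suc n)
  show ?case
    using Suc[of "\<lambda>y R. f y (x # R)"] by (cases n) (auto simp: algebra_simps)
qed simp

lemma sum_remove2_replicate:
  "sum_remove2 f (replicate n x) = of_nat (n choose 2) * f x x (replicate (n - 2) x)"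
proof (induction n arbitrary: f)
  case (Suc n)
  show ?case
  proof (cases n)
    case (Suc k)
    have "of_nat (n choose 2) * f x x (x # replicate (n - 2) x) =
        of_nat (n choose 2) * f x x (replicate (n - 1) x)"
      using Suc by (cases k) auto
    then show ?thesis
      using Suc.IH[of "\<lambda>y z R. f y z (x # R)"]
      by (simp add: sum_remove_replicate numeral_2_eq_2 algebra_simps)
  qed simp
qed simp

section \<open>Linear functionals on Laurent polynomials\<close>

type_synonym functional = "int \<Rightarrow> complex"

text \<open>
  Evaluation of a Laurent polynomial \<open>\<Sum>k. a\<^sub>k v\<^sup>k\<close> at a point \<open>v = w\<^sup>2\<close>, as the sequence that is paired with the
  coefficients \<open>a\<^sub>k\<close>.
\<close>

definition point :: "complex \<Rightarrow> functional" where "point v = (\<lambda>k. v powi k)"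

definition unit_at :: "int \<Rightarrow> functional" where "unit_at k = (\<lambda>j. if j = k then 1 else 0)"

text \<open>
  A Laurent polynomial with exponents between \<open>-N\<close> and \<open>N\<close>, as a linear form on sequences. The bound is part of the
  predicate to keep all sums finite.
\<close>

definition form :: "nat \<Rightarrow> (functional \<Rightarrow> complex) \<Rightarrow> bool" where
  "form N \<phi> \<longleftrightarrow> (\<forall>l. \<phi> l = (\<Sum>k=- int N..int N. \<phi> (unit_at k) * l k))"

lemma formD: "form N \<phi> \<Longrightarrow> \<phi> l = (\<Sum>k=- int N..int N. \<phi> (unit_at k) * l k)"
  unfolding form_def by blast

lemma formI: "(\<And>l. \<phi> l = (\<Sum>k=- int N..int N. c k * l k)) \<Longrightarrow> form N \<phi>"
  unfolding form_def by (auto simp: unit_at_def if_distrib cong: if_cong)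

lemma form_vanish: "form N \<phi> \<Longrightarrow> \<bar>k\<bar> > int N \<Longrightarrow> \<phi> (unit_at k) = 0"
  by (subst formD[of N]) (auto simp: unit_at_def intro!: sum.neutral)

lemma form_mono:
  assumes "form N \<phi>" "N \<le> M" shows "form M \<phi>"
  unfolding form_def
proof
  fix l
  have "\<phi> l = (\<Sum>k=- int N..int N. \<phi> (unit_at k) * l k)" by (rule formD[OF assms(1)])
  also have "\<dots> = (\<Sum>k=- int M..int M. \<phi> (unit_at k) * l k)"
    by (rule sum.mono_neutral_left)
      (use assms in \<open>auto intro!: form_vanish[OF assms(1)]\<close>)
  finally show "\<phi> l = (\<Sum>k=- int M..int M. \<phi> (unit_at k) * l k)" .
qed

lemma form_zero: "form N (\<lambda>l. 0)"
  by (simp add: form_def)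

lemma form_coeff: "\<bar>k\<bar> \<le> int N \<Longrightarrow> form N (\<lambda>l. l k)"
  by (rule formI[where c = "\<lambda>j. if j = k then 1 else 0"])
    (auto simp: if_distrib[of "\<lambda>x. x * _"] cong: if_cong)

lemma form_add: "form N \<phi> \<Longrightarrow> form N \<psi> \<Longrightarrow> form N (\<lambda>l. \<phi> l + \<psi> l)"
proof (rule formI[where c = "\<lambda>k. \<phi> (unit_at k) + \<psi> (unit_at k)"])
  fix l assume "form N \<phi>" "form N \<psi>"
  then show "\<phi> l + \<psi> l = (\<Sum>k=- int N..int N. (\<phi> (unit_at k) + \<psi> (unit_at k)) * l k)"
    unfolding distrib_right sum.distrib by (intro arg_cong2[where f = "(+)"] formD)
qed

lemma form_cmult: "form N \<phi> \<Longrightarrow> form N (\<lambda>l. c * \<phi> l)"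
proof (rule formI[where c = "\<lambda>k. c * \<phi> (unit_at k)"])
  fix l assume "form N \<phi>"
  then show "c * \<phi> l = (\<Sum>k=- int N..int N. c * \<phi> (unit_at k) * l k)"
    unfolding mult.assoc sum_distrib_left[symmetric] by (intro arg_cong[where f = "(*) c"] formD)
qed

lemma form_multc: "form N \<phi> \<Longrightarrow> form N (\<lambda>l. \<phi> l * c)"
  using form_cmult[of N \<phi> c] by (simp add: mult.commute)

lemma form_divide: "form N \<phi> \<Longrightarrow> form N (\<lambda>l. \<phi> l / c)"
  using form_cmult[of N \<phi> "1 / c"] by simp

lemma form_diff: "form N \<phi> \<Longrightarrow> form N \<psi> \<Longrightarrow> form N (\<lambda>l. \<phi> l - \<psi> l)"
  using form_add[of N \<phi> "\<lambda>l. - 1 * \<psi> l"] form_cmult[of N \<psi> "- 1"] by simp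

lemma form_sum: "(\<And>i. i \<in> I \<Longrightarrow> form N (\<phi> i)) \<Longrightarrow> form N (\<lambda>l. \<Sum>i\<in>I. \<phi> i l)"
  by (induction I rule: infinite_finite_induct) (auto intro: form_zero form_add)

lemma form_comp:
  assumes "form N \<phi>" "\<And>k. \<bar>k\<bar> \<le> int N \<Longrightarrow> form M (\<lambda>l. h l k)"
  shows "form M (\<lambda>l. \<phi> (h l))"
proof -
  have "(\<lambda>l. \<phi> (h l)) = (\<lambda>l. \<Sum>k=- int N..int N. \<phi> (unit_at k) * h l k)"
    using formD[OF assms(1)] by blast
  then show ?thesis
    by (auto intro!: form_sum form_cmult assms(2))
qed

lemma form_linear:
  assumes "form N \<phi>"
  shows "\<phi> (\<lambda>k. a * l k + b * l' k) = a * \<phi> l + b * \<phi> l'"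
  unfolding formD[OF assms, of l] formD[OF assms, of l']
    formD[OF assms, of "\<lambda>k. a * l k + b * l' k"]
  by (simp add: algebra_simps sum.distrib sum_distrib_left)

lemma form_scale_arg: "form N \<phi> \<Longrightarrow> \<phi> (\<lambda>k. a * l k) = a * \<phi> l"
  using form_linear[of N \<phi> a l 0 l] by simp

lemma form_zero_arg: "form N \<phi> \<Longrightarrow> \<phi> (\<lambda>k. 0) = 0"
  using form_scale_arg[of N \<phi> 0] by simp

text \<open>A Laurent polynomial with infinitely many zeros vanishes.\<close>

lemma form_eq_0:
  assumes "form N \<phi>" and "infinite V" and V: "\<And>v. v \<in> V \<Longrightarrow> v \<noteq> 0 \<and> \<phi> (point v) = 0"
  shows "\<phi> l = 0"
proof -
  define p where "p = (\<Sum>k=- int N..int N. monom (\<phi> (unit_at k)) (nat (k + int N)))"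
  have poly: "poly p v = v ^ N * \<phi> (point v)" if "v \<noteq> 0" for v
  proof -
    have "\<phi> (unit_at k) * v ^ nat (k + int N) = v ^ N * (\<phi> (unit_at k) * v powi k)"
      if "k \<in> {- int N..int N}" for k
    proof -
      have "v ^ nat (k + int N) = v powi (k + int N)"
        using that by (simp add: power_int_def)
      also have "\<dots> = v powi k * v ^ N" using \<open>v \<noteq> 0\<close> by (simp add: power_int_add)
      finally show ?thesis by simp
    qed
    then show ?thesis
      unfolding p_def poly_sum poly_monom formD[OF assms(1), of "point v"] sum_distrib_left
      by (intro sum.cong) (auto simp: point_def)
  qed
  have "p = 0"
  proof (rule ccontr)
    assume "p \<noteq> 0"
    then have "finite {v. poly p v = 0}" by (rule poly_roots_finite)
    moreover have "V \<subseteq> {v. poly p v = 0}" using V poly by auto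
    ultimately show False using assms(2) finite_subset by blast
  qed
  have "\<phi> (unit_at k) = 0" if "k \<in> {- int N..int N}" for k
  proof -
    have "coeff p (nat (k + int N)) =
        (\<Sum>j=- int N..int N. if j = k then \<phi> (unit_at j) else 0)"
      unfolding p_def coeff_sum coeff_monom
      by (rule sum.cong) (use that in \<open>auto simp: nat_eq_iff\<close>)
    also have "\<dots> = \<phi> (unit_at k)" using that by simp
    finally show ?thesis using \<open>p = 0\<close> by simp
  qed
  then show ?thesis using formD[OF assms(1), of l] by simp
qed

text \<open>
  The principle behind every identity below: by linearity it is enough to verify it at points, and finitely
  many coincidences of points may be left out.
\<close>

lemma form_eq:
  assumes "form N \<phi>" "form M \<psi>" and "finite F"
    and "\<And>v. v \<noteq> 0 \<Longrightarrow> v \<notin> F \<Longrightarrow> \<phi> (point v) = \<psi> (point v)"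
  shows "\<phi> l = \<psi> l"
proof -
  have "form (max N M) (\<lambda>l. \<phi> l - \<psi> l)"
    by (intro form_diff form_mono[OF assms(1)] form_mono[OF assms(2)]) auto
  moreover have "infinite (- insert 0 F :: complex set)"
    using assms(3) infinite_UNIV_char_0 by (metis Compl_eq_Diff_UNIV Diff_infinite_finite finite_insert)
  ultimately have "\<phi> l - \<psi> l = 0"
    by (rule form_eq_0) (use assms(4) in auto)
  then show ?thesis by simp
qed

section \<open>The structure of the recursion\<close>

text \<open>
  The transpose of multiplication by the Laurent polynomial \<open>m\<close> of \<open>mfun\<close>, see \<open>pull_m_point\<close>.
\<close>

definition pull_m :: "functional \<Rightarrow> functional" where
  "pull_m l = (\<lambda>k. (l (k + 2) - 3 * l (k + 1) + 3 * l k - l (k - 1)) / 32)"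

text \<open>
  In the coordinate \<open>v = w\<^sup>2\<close> and for \<open>\<lambda> = 1\<close>, this is what remains of \<open>1 / ((y(z) - y(1/z)) dx)\<close> in the recursion
  kernel. The triple zero at \<open>v = 1\<close> comes from the poles of \<open>y dx\<close> at the two points over \<open>x = \<infinity>\<close>.
\<close>

definition mfun :: "complex \<Rightarrow> complex" where "mfun v = (v - 1) ^ 3 / (32 * v)"

text \<open>
  The residue of the recursion kernel at \<open>x\<close> against \<open>W\<^sub>0\<^sub>,\<^sub>2\<close> at \<open>y\<close>. At points it is the divided-difference
  expression of \<open>quot_points\<close>; expanding the geometric series makes it bilinear in arbitrary sequences.
\<close>

definition quot :: "functional \<Rightarrow> functional \<Rightarrow> functional" where
  "quot x y = (\<lambda>q. if q \<ge> 0 then \<Sum>i\<in>{0..<q}. (4 * of_int i + 2) * x (q - 1 - i) * y i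
     else - (\<Sum>i\<in>{q..<0}. (4 * of_int i + 2) * x (q - 1 - i) * y i))"

definition quot_m :: "functional \<Rightarrow> functional \<Rightarrow> functional" where
  "quot_m x y = pull_m (quot x y)"

text \<open>
  The coefficients of \<open>W\<^sub>0\<^sub>,\<^sub>3\<close>, with one term for each ramification point.
\<close>

definition three_point :: "functional \<Rightarrow> functional \<Rightarrow> functional \<Rightarrow> complex" where
  "three_point x y z = (x 0 * y 0 * z 0 - x (- 1) * y (- 1) * z (- 1)) / 16"

text \<open>
  The coefficients of \<open>W\<^sub>1\<^sub>,\<^sub>1\<close>.
\<close>

definition one_point :: "functional \<Rightarrow> complex" where
  "one_point x = pull_m x (- 1) / 4"

lemma form_pull_m: "\<bar>k\<bar> + 2 \<le> int N \<Longrightarrow> form N (\<lambda>l. pull_m l k)"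
  unfolding pull_m_def by (intro form_divide form_add form_diff form_cmult form_coeff) auto

lemma form_pull_m_comp:
  assumes "\<And>j. \<bar>j\<bar> \<le> \<bar>k\<bar> + 2 \<Longrightarrow> form N (\<lambda>l. h l j)" shows "form N (\<lambda>l. pull_m (h l) k)"
  unfolding pull_m_def by (intro form_divide form_add form_diff form_cmult assms) auto

lemma form_quot_left: "\<bar>q\<bar> + 1 \<le> int N \<Longrightarrow> form N (\<lambda>x. quot x y q)"
  unfolding quot_def
  by (cases "q \<ge> 0")
    (auto intro!: form_sum form_multc form_cmult form_coeff form_diff[OF form_zero, simplified])

lemma form_quot_right: "\<bar>q\<bar> + 1 \<le> int N \<Longrightarrow> form N (\<lambda>y. quot x y q)"
  unfolding quot_def
  by (cases "q \<ge> 0")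
    (auto intro!: form_sum form_multc form_cmult form_coeff form_diff[OF form_zero, simplified])

lemma form_quot_m_left: "\<bar>q\<bar> + 3 \<le> int N \<Longrightarrow> form N (\<lambda>x. quot_m x y q)"
  unfolding quot_m_def by (rule form_pull_m_comp, rule form_quot_left) auto

lemma form_quot_m_right: "\<bar>q\<bar> + 3 \<le> int N \<Longrightarrow> form N (\<lambda>y. quot_m x y q)"
  unfolding quot_m_def by (rule form_pull_m_comp, rule form_quot_right) auto

lemma form_three_point:
  "1 \<le> N \<Longrightarrow> form N (\<lambda>x. three_point x y z)"
  "1 \<le> N \<Longrightarrow> form N (\<lambda>y. three_point x y z)"
  "1 \<le> N \<Longrightarrow> form N (\<lambda>z. three_point x y z)"
  unfolding three_point_def
  by (intro form_divide form_diff form_multc form_cmult form_coeff; simp)+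

lemma form_one_point: "3 \<le> N \<Longrightarrow> form N one_point"
  unfolding one_point_def by (intro form_divide form_pull_m) auto

lemma pull_m_point:
  assumes "v \<noteq> 0" shows "pull_m (point v) k = mfun v * v powi k"
proof -
  have "v powi (k + 2) = v powi k * v ^ 2" "v powi (k + 1) = v powi k * v"
    "v powi (k - 1) = v powi k / v"
    using assms by (simp_all add: power_int_add power_int_diff)
  then have "pull_m (point v) k = v powi k * ((v ^ 2 - 3 * v + 3 - 1 / v) / 32)"
    by (simp add: pull_m_def point_def field_simps)
  also have "(v ^ 2 - 3 * v + 3 - 1 / v) / 32 = mfun v"
    using assms by (simp add: mfun_def field_simps power2_eq_square power3_eq_cube)
  finally show ?thesis by simp
qed

lemma quot_0: "quot x y 0 = 0"
  by (simp add: quot_def)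

text \<open>
  Together with \<open>quot_0\<close> this recurrence determines the sequence, which reduces the closed formulas that follow to
  checking a first-order recurrence in both directions.
\<close>

lemma quot_point_step:
  assumes "a \<noteq> 0"
  shows "quot (point a) y (q + 1) = a * quot (point a) y q + (4 * of_int q + 2) * y q"
proof -
  have s: "a * a powi (q - 1 - i) = a powi (q - i)" for i
    using assms power_int_add_1'[of a "q - 1 - i"] by (simp add: algebra_simps)
  have s': "a * (\<Sum>i\<in>I. (4 * of_int i + 2) * a powi (q - 1 - i) * y i) =
      (\<Sum>i\<in>I. (4 * of_int i + 2) * a powi (q - i) * y i)" for I
    unfolding sum_distrib_left by (rule sum.cong) (simp_all add: s[symmetric])
  show ?thesis
  proof (cases "q \<ge> 0")
    case True
    then have "{0..<q + 1} = insert q {0..<q}" by auto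
    with True show ?thesis by (simp add: quot_def point_def s')
  next
    case False
    then have i: "{q..<0} = insert q {q + 1..<0}" by auto
    have "a * quot (point a) y q = - (\<Sum>i\<in>{q..<0}. (4 * of_int i + 2) * a powi (q - i) * y i)"
      using False by (simp add: quot_def point_def s')
    also have "\<dots> = - (4 * of_int q + 2) * y q
       - (\<Sum>i\<in>{q + 1..<0}. (4 * of_int i + 2) * a powi (q - i) * y i)"
      unfolding i by (simp add: algebra_simps)
    also have "(\<Sum>i\<in>{q + 1..<0}. (4 * of_int i + 2) * a powi (q - i) * y i) =
        - quot (point a) y (q + 1)"
      using False by (auto simp: quot_def point_def)
    finally show ?thesis by (simp add: algebra_simps)
  qed
qed

lemma int_shift_induct:
  fixes P :: "int \<Rightarrow> bool"
  assumes "P 0" "\<And>q. P q \<longleftrightarrow> P (q + 1)" shows "P q"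
proof (induction q rule: int_induct[of _ 0])
  case (step2 i) then show ?case using assms(2)[of "i - 1"] by simp
qed (use assms in auto)

lemma quot_points:
  assumes "a \<noteq> 0" "b \<noteq> 0" "a \<noteq> b"
  shows "quot (point a) (point b) q =
    2 * (a + b) * (a powi q - b powi q) / (a - b)\<^sup>2 - 4 * of_int q * b powi q / (a - b)"
proof -
  define r where "r q = 2 * (a + b) * (a powi q - b powi q) / (a - b)\<^sup>2
    - 4 * of_int q * b powi q / (a - b)" for q
  have r2: "(a - b)\<^sup>2 * r q = 2 * (a + b) * (a powi q - b powi q) - 4 * of_int q * b powi q * (a - b)"
    for q
  proof -
    have "d\<^sup>2 * (x / d\<^sup>2 - y / d) = x - y * d" if "d \<noteq> 0" for d x y :: complex
      using that by (simp add: field_simps power2_eq_square)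
    then show ?thesis unfolding r_def using assms by simp
  qed
  have r: "r (q + 1) = a * r q + (4 * of_int q + 2) * b powi q" for q
  proof -
    have "(a - b)\<^sup>2 * (a * r q + (4 * of_int q + 2) * b powi q) =
        a * ((a - b)\<^sup>2 * r q) + (a - b)\<^sup>2 * (4 * of_int q + 2) * b powi q"
      by (simp add: algebra_simps)
    then have "(a - b)\<^sup>2 * r (q + 1) = (a - b)\<^sup>2 * (a * r q + (4 * of_int q + 2) * b powi q)"
      using assms unfolding r2 by (simp add: power_int_add algebra_simps power2_eq_square)
    then show ?thesis using assms by simp
  qed
  show ?thesis
    unfolding r_def[symmetric]
  proof (induction q rule: int_shift_induct)
    case 1 then show ?case by (simp add: quot_0 r_def)
  next
    case (2 q)
    have "quot (point a) (point b) (q + 1) = a * quot (point a) (point b) q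
        + (4 * of_int q + 2) * b powi q"
      using quot_point_step[OF assms(1), of "point b" q] by (simp add: point_def)
    then show ?case using assms by (simp add: r)
  qed
qed


text \<open>The derivation \<open>v d/dv\<close> applied to evaluation at \<open>b\<close>.\<close>

definition dpoint :: "complex \<Rightarrow> functional" where "dpoint b = (\<lambda>k. of_int k * b powi k)"

lemma quot_dpoint_step:
  assumes "a \<noteq> 0"
  shows "quot (dpoint a) y (q + 1) = a * quot (dpoint a) y q + a * quot (point a) y q"
proof -
  have s: "a * a powi (q - 1 - i) = a powi (q - i)" for i
    using assms power_int_add_1'[of a "q - 1 - i"] by (simp add: algebra_simps)
  have s': "a * (\<Sum>i\<in>I. (4 * of_int i + 2) * (of_int (q - 1 - i) * a powi (q - 1 - i)) * y i) +
      a * (\<Sum>i\<in>I. (4 * of_int i + 2) * a powi (q - 1 - i) * y i) =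
      (\<Sum>i\<in>I. (4 * of_int i + 2) * (of_int (q - i) * a powi (q - i)) * y i)" for I
    unfolding sum_distrib_left sum.distrib[symmetric]
  proof (rule sum.cong)
    fix i
    define e where "e = a powi (q - 1 - i)"
    have "a powi (q - i) = a * e" using s by (simp add: e_def)
    then show "a * ((4 * of_int i + 2) * (of_int (q - 1 - i) * a powi (q - 1 - i)) * y i) +
        a * ((4 * of_int i + 2) * a powi (q - 1 - i) * y i) =
        (4 * of_int i + 2) * (of_int (q - i) * a powi (q - i)) * y i"
      unfolding e_def[symmetric] by (simp add: algebra_simps)
  qed simp
  show ?thesis
  proof (cases "q \<ge> 0")
    case True
    then have "{0..<q + 1} = insert q {0..<q}" by auto
    with True s'[of "{0..<q}"] show ?thesis
      by (simp add: quot_def point_def dpoint_def)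
  next
    case False
    then have i: "{q..<0} = insert q {q + 1..<0}" by auto
    have "a * quot (dpoint a) y q + a * quot (point a) y q =
        - (\<Sum>i\<in>{q..<0}. (4 * of_int i + 2) * (of_int (q - i) * a powi (q - i)) * y i)"
      unfolding s'[of "{q..<0}", symmetric]
      using False by (simp add: quot_def point_def dpoint_def)
    also have "\<dots> = - (\<Sum>i\<in>{q + 1..<0}. (4 * of_int i + 2) * (of_int (q - i) * a powi (q - i)) * y i)"
      unfolding i by simp
    also have "\<dots> = quot (dpoint a) y (q + 1)"
      using False by (auto simp: quot_def dpoint_def)
    finally show ?thesis by simp
  qed
qed

lemma quot_dpoint_point:
  assumes "a \<noteq> 0" "b \<noteq> 0" "a \<noteq> b"
  shows "quot (dpoint a) (point b) q =
    2 * a * (a powi q - b powi q) / (a - b)\<^sup>2 + 2 * (a + b) * of_int q * a powi q / (a - b)\<^sup>2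
    - 4 * a * (a + b) * (a powi q - b powi q) / (a - b) ^ 3
    + 4 * a * of_int q * b powi q / (a - b)\<^sup>2"
proof -
  define r where "r = 1 / (a - b)"
  have ab: "a = b + 1 / r" and r0: "r \<noteq> 0" using assms by (auto simp: r_def)
  define R where "R q = 2 * a * (a powi q - b powi q) * r\<^sup>2 + 2 * (a + b) * of_int q * a powi q * r\<^sup>2
    - 4 * a * (a + b) * (a powi q - b powi q) * r ^ 3
    + 4 * a * of_int q * b powi q * r\<^sup>2" for q
  have R: "R (q + 1) = a * R q + a * quot (point a) (point b) q" for q
  proof -
    have 1: "quot (point a) (point b) q =
        2 * (a + b) * (a powi q - b powi q) * r\<^sup>2 - 4 * of_int q * b powi q * r"
      using quot_points[OF assms] by (simp add: r_def power_one_over field_simps)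
    have "x powi (q + 1) = x powi q * x" if "x \<noteq> 0" for x :: complex
      using that by (simp add: power_int_add)
    then have "R (q + 1) - (a * R q + a * quot (point a) (point b) q) =
        b powi q * (- 2 * a * (b - a) * r\<^sup>2 + 4 * a * (a + b) * (b - a) * r ^ 3
          + 4 * a * b * r\<^sup>2 + 2 * a * (a + b) * r\<^sup>2
          + 4 * of_int q * a * (b - a) * r\<^sup>2 + 4 * of_int q * a * r)"
      unfolding 1 R_def using assms
      by (simp add: algebra_simps power2_eq_square power3_eq_cube)
    also have "\<dots> = 0"
      using r0 by (simp add: ab field_simps power2_eq_square power3_eq_cube)
    finally show ?thesis by simp
  qed
  have "quot (dpoint a) (point b) q = R q"
  proof (induction q rule: int_shift_induct)
    case 1 then show ?case by (simp add: quot_0 R_def)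
  next
    case (2 q) then show ?case using assms by (simp add: quot_dpoint_step R)
  qed
  then show ?thesis by (simp add: R_def r_def power_one_over)
qed

lemma quot_point_dpoint:
  assumes "a \<noteq> 0" "b \<noteq> 0" "a \<noteq> b"
  shows "quot (point a) (dpoint b) q =
    2 * b * (a powi q - b powi q) / (a - b)\<^sup>2 - 2 * (a + b) * of_int q * b powi q / (a - b)\<^sup>2
    + 4 * b * (a + b) * (a powi q - b powi q) / (a - b) ^ 3
    - 4 * (of_int q)\<^sup>2 * b powi q / (a - b) - 4 * b * of_int q * b powi q / (a - b)\<^sup>2"
proof -
  define r where "r = 1 / (a - b)"
  have ab: "a = b + 1 / r" and r0: "r \<noteq> 0" using assms by (auto simp: r_def)
  define R where "R q = 2 * b * (a powi q - b powi q) * r\<^sup>2 - 2 * (a + b) * of_int q * b powi q * r\<^sup>2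
    + 4 * b * (a + b) * (a powi q - b powi q) * r ^ 3
    - 4 * (of_int q)\<^sup>2 * b powi q * r - 4 * b * of_int q * b powi q * r\<^sup>2" for q
  have R: "R (q + 1) = a * R q + (4 * of_int q + 2) * (of_int q * b powi q)" for q
  proof -
    have "x powi (q + 1) = x powi q * x" if "x \<noteq> 0" for x :: complex
      using that by (simp add: power_int_add)
    then have "R (q + 1) - (a * R q + (4 * of_int q + 2) * (of_int q * b powi q)) =
        b powi q * (2 * b * (a - b) * r\<^sup>2 + 4 * b * (a + b) * (a - b) * r ^ 3
          - 2 * (a + b) * b * r\<^sup>2 - 4 * b * r - 4 * b * b * r\<^sup>2
          + of_int q * (2 * (a + b) * (a - b) * r\<^sup>2 - 8 * b * r + 4 * b * (a - b) * r\<^sup>2 - 2)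
          + (of_int q)\<^sup>2 * (4 * (a - b) * r - 4))"
      unfolding R_def using assms
      by (simp add: algebra_simps power2_eq_square power3_eq_cube)
    also have "\<dots> = 0"
      using r0 by (simp add: ab field_simps power2_eq_square power3_eq_cube)
    finally show ?thesis by simp
  qed
  have "quot (point a) (dpoint b) q = R q"
  proof (induction q rule: int_shift_induct)
    case 1 then show ?case by (simp add: quot_0 R_def)
  next
    case (2 q) then show ?case
      using assms quot_point_step[OF assms(1), of "dpoint b" q] by (simp add: R dpoint_def)
  qed
  then show ?thesis by (simp add: R_def r_def power_one_over)
qed


text \<open>
  This is \<open>v m'(v)\<close>.
\<close>

definition mfun1 :: "complex \<Rightarrow> complex" where "mfun1 v = (2 * v\<^sup>2 - 3 * v + 1 / v) / 32"

lemma mfun_expand: "v \<noteq> 0 \<Longrightarrow> mfun v = (v\<^sup>2 - 3 * v + 3 - 1 / v) / 32"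
  by (simp add: mfun_def field_simps power2_eq_square power3_eq_cube)

lemma pull_m_linear:
  "pull_m (\<lambda>q. a * x q + b * y q + c * z q) k = a * pull_m x k + b * pull_m y k + c * pull_m z k"
  by (simp add: pull_m_def field_simps)

lemma pull_m_dpoint:
  assumes "b \<noteq> 0"
  shows "pull_m (dpoint b) k = mfun1 b * b powi k + mfun b * (of_int k * b powi k)"
proof -
  have "b powi (k + 2) = b powi k * b ^ 2" "b powi (k + 1) = b powi k * b"
    "b powi (k - 1) = b powi k / b"
    using assms by (simp_all add: power_int_add power_int_diff)
  then have "pull_m (dpoint b) k = b powi k * ((of_int k + 2) * b ^ 2 - 3 * (of_int k + 1) * b
      + 3 * of_int k - (of_int k - 1) / b) / 32"
    by (simp add: pull_m_def dpoint_def) (simp add: field_simps)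
  also have "\<dots> = mfun1 b * b powi k + mfun b * (of_int k * b powi k)"
    unfolding mfun_expand[OF assms] mfun1_def using assms by (simp add: field_simps)
  finally show ?thesis .
qed

lemma quot_linear_left:
  "quot (\<lambda>q. a * x q + b * y q + c * z q) w k = a * quot x w k + b * quot y w k + c * quot z w k"
  by (simp add: quot_def sum_distrib_left algebra_simps sum.distrib)

lemma quot_linear_right:
  "quot w (\<lambda>q. a * x q + b * y q + c * z q) k = a * quot w x k + b * quot w y k + c * quot w z k"
  by (simp add: quot_def sum_distrib_left algebra_simps sum.distrib)

lemma quot_m_linear_left:
  "quot_m (\<lambda>q. a * x q + b * y q + c * z q) w k =
     a * quot_m x w k + b * quot_m y w k + c * quot_m z w k"
  unfolding quot_m_def quot_linear_left[abs_def] by (rule pull_m_linear)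

lemma quot_m_linear_right:
  "quot_m w (\<lambda>q. a * x q + b * y q + c * z q) k =
     a * quot_m w x k + b * quot_m w y k + c * quot_m w z k"
  unfolding quot_m_def quot_linear_right[abs_def] by (rule pull_m_linear)

text \<open>
  The second power of the derivation \<open>v d/dv\<close>, applied to evaluation at \<open>b\<close>.
\<close>

definition ddpoint :: "complex \<Rightarrow> functional" where "ddpoint b = (\<lambda>k. (of_int k)\<^sup>2 * b powi k)"

lemma quot_m_points:
  assumes "a \<noteq> 0" "b \<noteq> 0" "a \<noteq> b"
  shows "quot_m (point a) (point b) k =
    2 * (a + b) * (pull_m (point a) k - pull_m (point b) k) * (1 / (a - b))\<^sup>2
    - 4 * pull_m (dpoint b) k * (1 / (a - b))"
proof -
  define r where "r = 1 / (a - b)"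
  have "quot (point a) (point b) = (\<lambda>q. (2 * (a + b) * r\<^sup>2) * point a q
     + (- 2 * (a + b) * r\<^sup>2) * point b q + (- 4 * r) * dpoint b q)"
    unfolding quot_points[OF assms, abs_def] r_def
    by (rule ext) (simp add: point_def dpoint_def divide_inverse power_inverse algebra_simps)
  then show ?thesis
    unfolding quot_m_def r_def[symmetric]
    by (simp only: pull_m_linear) (simp add: algebra_simps)
qed

lemma quot_m_dpoint_point:
  assumes "a \<noteq> 0" "b \<noteq> 0" "a \<noteq> b"
  shows "quot_m (dpoint a) (point b) k =
    (2 * a * (1 / (a - b))\<^sup>2 - 4 * a * (a + b) * (1 / (a - b)) ^ 3) *
      (pull_m (point a) k - pull_m (point b) k)
    + 2 * (a + b) * pull_m (dpoint a) k * (1 / (a - b))\<^sup>2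
    + 4 * a * pull_m (dpoint b) k * (1 / (a - b))\<^sup>2"
proof -
  define r where "r = 1 / (a - b)"
  define c where "c = 2 * a * r\<^sup>2 - 4 * a * (a + b) * r ^ 3"
  have "quot (dpoint a) (point b) = (\<lambda>q. 1 * (c * point a q + (- c) * point b q + 0 * point b q)
     + (2 * (a + b) * r\<^sup>2) * dpoint a q + (4 * a * r\<^sup>2) * dpoint b q)"
    unfolding quot_dpoint_point[OF assms, abs_def] r_def c_def
    by (rule ext) (simp add: point_def dpoint_def power_inverse divide_inverse algebra_simps)
  then show ?thesis
    unfolding quot_m_def r_def[symmetric] c_def[symmetric]
    by (simp only: pull_m_linear) (simp add: algebra_simps)
qed

lemma quot_m_point_dpoint:
  assumes "a \<noteq> 0" "b \<noteq> 0" "a \<noteq> b"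
  shows "quot_m (point a) (dpoint b) k =
    (2 * b * (1 / (a - b))\<^sup>2 + 4 * b * (a + b) * (1 / (a - b)) ^ 3) *
      (pull_m (point a) k - pull_m (point b) k)
    - (2 * (a + b) + 4 * b) * pull_m (dpoint b) k * (1 / (a - b))\<^sup>2
    - 4 * pull_m (ddpoint b) k * (1 / (a - b))"
proof -
  define r where "r = 1 / (a - b)"
  define c where "c = 2 * b * r\<^sup>2 + 4 * b * (a + b) * r ^ 3"
  have "quot (point a) (dpoint b) = (\<lambda>q. 1 * (c * point a q + (- c) * point b q + 0 * point b q)
     + (- (2 * (a + b) + 4 * b) * r\<^sup>2) * dpoint b q + (- 4 * r) * ddpoint b q)"
    unfolding quot_point_dpoint[OF assms, abs_def] r_def c_def
    by (rule ext)
      (simp add: point_def dpoint_def ddpoint_def power_inverse divide_inverse algebra_simps)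
  then show ?thesis
    unfolding quot_m_def r_def[symmetric] c_def[symmetric]
    by (simp only: pull_m_linear) (simp add: algebra_simps)
qed

lemma quot_m_points_functional:
  assumes "a \<noteq> 0" "b \<noteq> 0" "a \<noteq> b"
  defines "r \<equiv> 1 / (a - b)"
  shows "quot_m (point a) (point b) = (\<lambda>k. (2 * (a + b) * mfun a * r\<^sup>2) * point a k +
    (- 2 * (a + b) * mfun b * r\<^sup>2 - 4 * mfun1 b * r) * point b k + (- 4 * mfun b * r) * dpoint b k)"
proof
  fix k
  show "quot_m (point a) (point b) k = (2 * (a + b) * mfun a * r\<^sup>2) * point a k +
    (- 2 * (a + b) * mfun b * r\<^sup>2 - 4 * mfun1 b * r) * point b k + (- 4 * mfun b * r) * dpoint b k"
    unfolding quot_m_points[OF assms(1-3)] r_def[symmetric] pull_m_point[OF assms(1)]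
      pull_m_point[OF assms(2)] pull_m_dpoint[OF assms(2)]
    by (simp add: point_def dpoint_def algebra_simps)
qed

text \<open>
  The one place where the exact shape of the function \<open>m\<close> matters: a divided difference of \<open>m\<close> that
  vanishes for linear polynomials.
\<close>

lemma mfun_divided_difference:
  fixes a b v :: complex
  assumes "a \<noteq> 0" "b \<noteq> 0" "v \<noteq> 0" "a \<noteq> b" "a \<noteq> v" "b \<noteq> v"
  defines "r \<equiv> 1 / (a - b)" and "s \<equiv> 1 / (a - v)" and "t \<equiv> 1 / (b - v)"
  shows "- 4 * (a + b) * (b + v) * t\<^sup>2 * r\<^sup>2 * mfun b
     - 4 * r * (mfun1 b * 2 * (b + v) * t\<^sup>2 + mfun b * (2 * b * t\<^sup>2 - 4 * b * (b + v) * t ^ 3))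
     + 4 * (a + v) * s\<^sup>2 * (mfun a * (a + b) * r\<^sup>2 - mfun v * (b + v) * t\<^sup>2)
     - 4 * s * (mfun1 v * 2 * (b + v) * t\<^sup>2 + mfun v * (2 * v * t\<^sup>2 + 4 * v * (b + v) * t ^ 3))
     = (1 - 1 / (a * b * v)) / 8"
proof -
  define K where "K fa fb fv gb gv =
     - 4 * (a + b) * (b + v) * t\<^sup>2 * r\<^sup>2 * fb
     - 4 * r * (gb * 2 * (b + v) * t\<^sup>2 + fb * (2 * b * t\<^sup>2 - 4 * b * (b + v) * t ^ 3))
     + 4 * (a + v) * s\<^sup>2 * (fa * (a + b) * r\<^sup>2 - fv * (b + v) * t\<^sup>2)
     - 4 * s * (gv * 2 * (b + v) * t\<^sup>2 + fv * (2 * v * t\<^sup>2 + 4 * v * (b + v) * t ^ 3))"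
    for fa fb fv gb gv :: complex
  have nz: "r \<noteq> 0" "s \<noteq> 0" "t \<noteq> 0" using assms by (auto simp: r_def s_def t_def)
  define S T where "S = a - v" and "T = b - v"
  have ST: "a = v + S" "b = v + T" "S \<noteq> 0" "T \<noteq> 0" "S \<noteq> T" using assms by (auto simp: S_def T_def)
  have rst: "r = 1 / (S - T)" "s = 1 / S" "t = 1 / T" by (auto simp: r_def s_def t_def S_def T_def)
  have nz': "S - T \<noteq> 0" using ST by simp
  have K0: "K 1 1 1 0 0 = 0"
    unfolding K_def rst ST(1,2) using ST(3,4) nz'
    by (simp add: divide_simps) algebra
  have K1: "K a b v b v = 0"
    unfolding K_def rst ST(1,2) using ST(3,4) nz'
    by (simp add: divide_simps) algebra
  have K2: "K (a\<^sup>2) (b\<^sup>2) (v\<^sup>2) (2 * b\<^sup>2) (2 * v\<^sup>2) = 4"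
    unfolding K_def rst ST(1,2) using ST(3,4) nz'
    by (simp add: divide_simps) algebra
  have Km: "K (1 / a) (1 / b) (1 / v) (- 1 / b) (- 1 / v) = 4 / (a * b * v)"
  proof -
    have "v + S \<noteq> 0" "v + T \<noteq> 0" "v \<noteq> 0" using assms ST by auto
    then show ?thesis
      unfolding K_def rst ST(1,2) using ST(3,4) nz'
      by (simp add: divide_simps) algebra
  qed
  have "K (mfun a) (mfun b) (mfun v) (mfun1 b) (mfun1 v) =
     (K (a\<^sup>2) (b\<^sup>2) (v\<^sup>2) (2 * b\<^sup>2) (2 * v\<^sup>2) - 3 * K a b v b v + 3 * K 1 1 1 0 0
       - K (1 / a) (1 / b) (1 / v) (- 1 / b) (- 1 / v)) / 32"
    unfolding mfun_expand[OF assms(1)] mfun_expand[OF assms(2)] mfun_expand[OF assms(3)] mfun1_def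
      K_def by (simp add: algebra_simps add_divide_distrib diff_divide_distrib)
  also have "\<dots> = (1 - 1 / (a * b * v)) / 8"
    unfolding K0 K1 K2 Km by (simp add: field_simps)
  finally show ?thesis unfolding K_def .
qed

lemma mfun_divided_difference':
  fixes a b v :: complex
  assumes "a \<noteq> 0" "b \<noteq> 0" "v \<noteq> 0" "a \<noteq> b" "a \<noteq> v" "b \<noteq> v"
  defines "r \<equiv> 1 / (a - b)" and "s \<equiv> 1 / (a - v)" and "t \<equiv> 1 / (b - v)"
  shows "(a + b) * r\<^sup>2 * (mfun b * t - mfun a * s) + r * t * (mfun1 b - mfun b * b * t)
        + r * s * (mfun1 a - mfun a * a * s) + v * mfun v * s * t * (t - s) = 0"
proof -
  define K where "K fa fb fv ga gb = (a + b) * r\<^sup>2 * (fb * t - fa * s) + r * t * (gb - fb * b * t)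
        + r * s * (ga - fa * a * s) + v * fv * s * t * (t - s)" for fa fb fv ga gb :: complex
  define S T where "S = a - v" and "T = b - v"
  have ST: "a = v + S" "b = v + T" "S \<noteq> 0" "T \<noteq> 0" "S \<noteq> T" using assms by (auto simp: S_def T_def)
  have rst: "r = 1 / (S - T)" "s = 1 / S" "t = 1 / T" by (auto simp: r_def s_def t_def S_def T_def)
  have nz': "S - T \<noteq> 0" using ST by simp
  have K0: "K 1 1 1 0 0 = 0"
    unfolding K_def rst ST(1,2) using ST(3,4) nz' by (simp add: divide_simps) algebra
  have K1: "K a b v a b = 0"
    unfolding K_def rst ST(1,2) using ST(3,4) nz' by (simp add: divide_simps) algebra
  have K2: "K (a\<^sup>2) (b\<^sup>2) (v\<^sup>2) (2 * a\<^sup>2) (2 * b\<^sup>2) = 0"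
    unfolding K_def rst ST(1,2) using ST(3,4) nz' by (simp add: divide_simps) algebra
  have Km: "K (1 / a) (1 / b) (1 / v) (- 1 / a) (- 1 / b) = 0"
  proof -
    have "v + S \<noteq> 0" "v + T \<noteq> 0" "v \<noteq> 0" using assms ST by auto
    then show ?thesis
      unfolding K_def rst ST(1,2) using ST(3,4) nz' by (simp add: divide_simps) algebra
  qed
  have "K (mfun a) (mfun b) (mfun v) (mfun1 a) (mfun1 b) =
     (K (a\<^sup>2) (b\<^sup>2) (v\<^sup>2) (2 * a\<^sup>2) (2 * b\<^sup>2) - 3 * K a b v a b + 3 * K 1 1 1 0 0
       - K (1 / a) (1 / b) (1 / v) (- 1 / a) (- 1 / b)) / 32"
    unfolding mfun_expand[OF assms(1)] mfun_expand[OF assms(2)] mfun_expand[OF assms(3)] mfun1_def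
      K_def by (simp add: algebra_simps add_divide_distrib diff_divide_distrib)
  then show ?thesis
    unfolding K0 K1 K2 Km by (simp add: K_def)
qed

text \<open>
  The cubic identity behind the symmetry of the correlators: two removals of spectators along a chain
  commute up to the three-point term.
\<close>

text \<open>
  Removing two spectators in succession with either of two roots. Both sides are combinations of the
  evaluations at \<open>a\<close>, \<open>b\<close>, \<open>v\<close> and of their derivatives; the coefficients agree by the divided-difference identity
  for \<open>m\<close>.
\<close>

lemma quot_m_chain_points:
  assumes "a \<noteq> 0" "b \<noteq> 0" "v \<noteq> 0" "a \<noteq> b" "a \<noteq> v" "b \<noteq> v"
  shows "quot_m (quot_m (point a) (point b)) (point v) k
      + quot_m (point b) (quot_m (point a) (point v)) k
      + (pull_m (point a) k - pull_m (point a) (k - 1) / (b * v)) / 8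
    = quot_m (quot_m (point b) (point a)) (point v) k
      + quot_m (point a) (quot_m (point b) (point v)) k
      + (pull_m (point b) k - pull_m (point b) (k - 1) / (a * v)) / 8"
proof -
  define r s t where "r = 1 / (a - b)" and "s = 1 / (a - v)" and "t = 1 / (b - v)"
  have r': "1 / (b - a) = - r" using assms by (simp add: r_def divide_simps)
  define A B G dA dB dG hG where "A = pull_m (point a) k" and "B = pull_m (point b) k"
    and "G = pull_m (point v) k" and "dA = pull_m (dpoint a) k" and "dB = pull_m (dpoint b) k"
    and "dG = pull_m (dpoint v) k" and "hG = pull_m (ddpoint v) k"
  note fold = r_def[symmetric] s_def[symmetric] t_def[symmetric] r' A_def[symmetric]
    B_def[symmetric] G_def[symmetric] dA_def[symmetric] dB_def[symmetric] dG_def[symmetric]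
    hG_def[symmetric]
  define P where "P a b r s t A B dA dB =
      (2 * (a + b) * mfun a * r\<^sup>2) * (2 * (a + v) * (A - G) * s\<^sup>2 - 4 * dG * s)
      + (- 2 * (a + b) * mfun b * r\<^sup>2 - 4 * mfun1 b * r) * (2 * (b + v) * (B - G) * t\<^sup>2 - 4 * dG * t)
      + (- 4 * mfun b * r) * ((2 * b * t\<^sup>2 - 4 * b * (b + v) * t ^ 3) * (B - G)
          + 2 * (b + v) * dB * t\<^sup>2 + 4 * b * dG * t\<^sup>2)
      + (2 * (a + v) * mfun a * s\<^sup>2) * (2 * (b + a) * (B - A) * r\<^sup>2 + 4 * dA * r)
      + (- 2 * (a + v) * mfun v * s\<^sup>2 - 4 * mfun1 v * s) * (2 * (b + v) * (B - G) * t\<^sup>2 - 4 * dG * t)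
      + (- 4 * mfun v * s) * ((2 * v * t\<^sup>2 + 4 * v * (b + v) * t ^ 3) * (B - G)
          - (2 * (b + v) + 4 * v) * dG * t\<^sup>2 - 4 * hG * t)"
    for a b r s t A B dA dB :: complex
  have fun1: "quot_m (quot_m (point a) (point b)) w k =
      (2 * (a + b) * mfun a * (1 / (a - b))\<^sup>2) * quot_m (point a) w k
      + (- 2 * (a + b) * mfun b * (1 / (a - b))\<^sup>2 - 4 * mfun1 b * (1 / (a - b))) * quot_m (point b) w k
      + (- 4 * mfun b * (1 / (a - b))) * quot_m (dpoint b) w k"
    if "a \<noteq> 0" "b \<noteq> 0" "a \<noteq> b" for a b w
    by (subst quot_m_points_functional[OF that]) (rule quot_m_linear_left)
  have fun2: "quot_m w (quot_m (point a) (point b)) k =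
      (2 * (a + b) * mfun a * (1 / (a - b))\<^sup>2) * quot_m w (point a) k
      + (- 2 * (a + b) * mfun b * (1 / (a - b))\<^sup>2 - 4 * mfun1 b * (1 / (a - b))) * quot_m w (point b) k
      + (- 4 * mfun b * (1 / (a - b))) * quot_m w (dpoint b) k"
    if "a \<noteq> 0" "b \<noteq> 0" "a \<noteq> b" for a b w
    by (subst quot_m_points_functional[OF that]) (rule quot_m_linear_right)
  have pm: "pull_m (point c) (k - 1) = pull_m (point c) k / c" if "c \<noteq> 0" for c
    using that by (simp add: pull_m_point power_int_diff)
  have left: "quot_m (quot_m (point a) (point b)) (point v) k
      + quot_m (point b) (quot_m (point a) (point v)) k = P a b r s t A B dA dB"
    unfolding P_def fun1[OF assms(1,2,4)] fun2[OF assms(1,3,5)]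
      quot_m_points[OF assms(1,3,5)] quot_m_points[OF assms(2,3,6)]
      quot_m_points[OF assms(2,1) assms(4)[symmetric]]
      quot_m_dpoint_point[OF assms(2,3,6)] quot_m_point_dpoint[OF assms(2,3,6)] fold
    by simp
  have right: "quot_m (quot_m (point b) (point a)) (point v) k
      + quot_m (point a) (quot_m (point b) (point v)) k = P b a (- r) t s B A dB dA"
    unfolding P_def fun1[OF assms(2,1) assms(4)[symmetric]] fun2[OF assms(2,3,6)]
      quot_m_points[OF assms(1,3,5)] quot_m_points[OF assms(2,3,6)]
      quot_m_points[OF assms(1,2,4)]
      quot_m_dpoint_point[OF assms(1,3,5)] quot_m_point_dpoint[OF assms(1,3,5)] fold
    by simp
  define c where "c = (1 - 1 / (a * b * v)) / 8"
  define K where "K a b r s t =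
    - 4 * (a + b) * (b + v) * t\<^sup>2 * r\<^sup>2 * mfun b
     - 4 * r * (mfun1 b * 2 * (b + v) * t\<^sup>2 + mfun b * (2 * b * t\<^sup>2 - 4 * b * (b + v) * t ^ 3))
     + 4 * (a + v) * s\<^sup>2 * (mfun a * (a + b) * r\<^sup>2 - mfun v * (b + v) * t\<^sup>2)
     - 4 * s * (mfun1 v * 2 * (b + v) * t\<^sup>2 + mfun v * (2 * v * t\<^sup>2 + 4 * v * (b + v) * t ^ 3))"
    for a b r s t
  have K1: "K a b r s t = c"
    using mfun_divided_difference[OF assms] unfolding K_def c_def r_def s_def t_def .
  have K2: "K b a (- r) t s = c"
    using mfun_divided_difference[OF assms(2,1,3) assms(4)[symmetric] assms(6,5)]
    unfolding K_def c_def r'[symmetric] s_def t_def by (simp add: mult.commute)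
  have K0: "P a b r s t 0 0 0 0 = P b a (- r) t s 0 0 0 0"
  proof -
    have "P a b r s t 0 0 0 0 - P b a (- r) t s 0 0 0 0 =
      - G * (K a b r s t - K b a (- r) t s) +
      16 * dG * ((a + b) * r\<^sup>2 * (mfun b * t - mfun a * s) + r * t * (mfun1 b - mfun b * b * t)
        + r * s * (mfun1 a - mfun a * a * s) + v * mfun v * s * t * (t - s))"
      unfolding P_def K_def by (simp add: algebra_simps power2_eq_square power3_eq_cube)
    then show ?thesis
      using mfun_divided_difference' [OF assms] K1 K2 unfolding r_def s_def t_def by simp
  qed
  have m1: "P a b r s t A B dA dB = P a b r s t 0 0 0 0 + K a b r s t * B
      - 8 * (b + v) * t\<^sup>2 * r * mfun b * dB + 8 * (a + v) * s\<^sup>2 * r * mfun a * dA"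
    unfolding P_def K_def by (simp add: algebra_simps)
  have m2: "P b a (- r) t s B A dB dA = P b a (- r) t s 0 0 0 0 + K b a (- r) t s * A
      + 8 * (a + v) * s\<^sup>2 * r * mfun a * dA - 8 * (b + v) * t\<^sup>2 * r * mfun b * dB"
    unfolding P_def K_def by (simp add: algebra_simps)
  have e: "(A - A / a / (b * v)) / 8 = c * A" "(B - B / b / (a * v)) / 8 = c * B"
    using assms by (simp_all add: c_def field_simps)
  show ?thesis
    unfolding left right pm[OF assms(1)] pm[OF assms(2)] A_def[symmetric] B_def[symmetric]
      e m1 m2 K0 K1 K2 by simp
qed

text \<open>The symmetry in the case where the removed point meets the term of the recursion that is quadratic in it.\<close>

lemma quot_m_square_points:
  assumes "a \<noteq> 0" "b \<noteq> 0" "a \<noteq> b"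
  shows "pull_m (quot_m (point a) (point b)) (j + k)
      + pull_m (point a) j * quot_m (point b) (point a) k
      + pull_m (point a) k * quot_m (point b) (point a) j
    = pull_m (quot_m (point b) (point a)) (j + k)
      + pull_m (point b) j * quot_m (point a) (point b) k
      + pull_m (point b) k * quot_m (point a) (point b) j"
proof -
  define r where "r = 1 / (a - b)"
  have r': "1 / (b - a) = - r" using assms by (simp add: r_def divide_simps)
  have p: "x powi (j + k) = x powi j * x powi k" if "x \<noteq> 0" for x :: complex
    using that by (simp add: power_int_add)
  show ?thesis
    unfolding quot_m_points_functional[OF assms]
      quot_m_points_functional[OF assms(2,1) assms(3)[symmetric]] pull_m_linear
      pull_m_point[OF assms(1)] pull_m_point[OF assms(2)]
      pull_m_dpoint[OF assms(1)] pull_m_dpoint[OF assms(2)]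
      p[OF assms(1)] p[OF assms(2)] r_def[symmetric] r'
    by (simp add: point_def dpoint_def algebra_simps power2_eq_square)
qed

lemma quot_values:
  "quot x y 0 = 0" "quot x y 1 = 2 * x 0 * y 0" "quot x y 2 = 2 * x 1 * y 0 + 6 * x 0 * y 1"
  "quot x y (- 1) = 2 * x (- 1) * y (- 1)"
  "quot x y (- 2) = 6 * x (- 1) * y (- 2) + 2 * x (- 2) * y (- 1)"
proof -
  have "{0..<1} = {0::int}" "{0..<2} = {0, 1::int}" "{- 1..<0} = {- 1::int}" "{- 2..<0} = {- 2, - 1::int}"
    by auto
  then show "quot x y 0 = 0" "quot x y 1 = 2 * x 0 * y 0" "quot x y 2 = 2 * x 1 * y 0 + 6 * x 0 * y 1"
    "quot x y (- 1) = 2 * x (- 1) * y (- 1)"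
    "quot x y (- 2) = 6 * x (- 1) * y (- 2) + 2 * x (- 2) * y (- 1)"
    by (simp_all add: quot_def)
qed

lemma quot_m_values:
  "quot_m x y 0 = (2 * x 1 * y 0 + 6 * x 0 * y 1 - 6 * x 0 * y 0 - 2 * x (- 1) * y (- 1)) / 32"
  "quot_m x y (- 1) =
     (2 * x 0 * y 0 + 6 * x (- 1) * y (- 1) - 6 * x (- 1) * y (- 2) - 2 * x (- 2) * y (- 1)) / 32"
  by (simp_all add: quot_m_def pull_m_def quot_values)

text \<open>
  The part of the symmetry where a removed spectator meets a three-point term. It involves only the values
  of the sequences near \<open>0\<close>.
\<close>

lemma three_point_chain:
  "three_point (quot_m x y) z u + three_point y (quot_m x z) u + three_point y (quot_m x u) z =
   three_point (quot_m y x) z u + three_point x (quot_m y z) u + three_point x (quot_m y u) z"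
  by (simp add: three_point_def quot_m_values field_simps)

section \<open>Disconnected correlators and their symmetry\<close>

text \<open>
  A bound for the exponents in a correlator of order \<open>d\<close>. One step of the recursion multiplies exponents by at
  most two and adds a constant.
\<close>

fun width :: "nat \<Rightarrow> nat" where
  "width 0 = 1"
| "width (Suc d) = 2 * width d + 3"

text \<open>
  The sum over all, also disconnected, surfaces of Euler characteristic \<open>-d\<close> with a marked point on every
  component. The four terms are: the two
  branches \<open>z\<close> and \<open>1/z\<close> both continue, one of them ends at a spectator, both end at spectators, or they join.
  The first sum is the evaluation of \<open>m(v) disc d [v, v, \<dots>]\<close>, see \<open>disc_point\<close>.
\<close>

primrec disc :: "nat \<Rightarrow> functional list \<Rightarrow> complex" where
  "disc 0 = (\<lambda>L. if L = [] then 1 else 0)"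
| "disc (Suc d) = (\<lambda>L. case L of [] \<Rightarrow> 0 | x # L \<Rightarrow>
     (\<Sum>j=- int (width d)..int (width d). disc d (unit_at j # (\<lambda>k. pull_m x (j + k)) # L))
     + sum_remove (\<lambda>y R. disc d (quot_m x y # R)) L
     + sum_remove2 (\<lambda>y z R. three_point x y z * disc d R) L
     + one_point x * disc d L)"

lemma disc_Nil: "disc (Suc d) [] = 0"
  by simp

lemma disc_Cons:
  "disc (Suc d) (x # L) =
     (\<Sum>j=- int (width d)..int (width d). disc d (unit_at j # (\<lambda>k. pull_m x (j + k)) # L))
     + sum_remove (\<lambda>y R. disc d (quot_m x y # R)) L
     + sum_remove2 (\<lambda>y z R. three_point x y z * disc d R) L
     + one_point x * disc d L"
  by simp

lemma width_mono: "i \<le> d \<Longrightarrow> width i \<le> width d"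
  by (rule lift_Suc_mono_le[of width]) auto

lemma form_sum_remove_param:
  "(\<And>y R. form N (\<lambda>l. g l y R)) \<Longrightarrow> form N (\<lambda>l. sum_remove (g l) L)"
  by (induction L arbitrary: g) (auto intro: form_zero form_add)

lemma form_sum_remove:
  "(\<And>y R1 R2. form N (\<lambda>l. f y (R1 @ l # R2))) \<Longrightarrow> (\<And>R. form N (\<lambda>l. f l R)) \<Longrightarrow>
    form N (\<lambda>l. sum_remove f (L1 @ l # L2))"
proof (induction L1 arbitrary: f)
  case Nil
  show ?case
    using Nil(1)[of _ "[]"] by (auto intro!: form_add form_sum_remove_param Nil(2))
next
  case (Cons a L1)
  have "form N (\<lambda>l. sum_remove (\<lambda>y R. f y (a # R)) (L1 @ l # L2))"
    by (rule Cons.IH) (use Cons.prems(1)[of _ "a # _"] Cons.prems(2) in auto)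
  then show ?case
    using Cons.prems(1) by (auto intro!: form_add)
qed

lemma form_sum_remove2_param:
  "(\<And>y z R. form N (\<lambda>l. g l y z R)) \<Longrightarrow> form N (\<lambda>l. sum_remove2 (g l) L)"
  by (induction L arbitrary: g) (auto intro!: form_zero form_add form_sum_remove_param)

lemma form_sum_remove2:
  "(\<And>y z R1 R2. form N (\<lambda>l. f y z (R1 @ l # R2))) \<Longrightarrow> (\<And>z R. form N (\<lambda>l. f l z R)) \<Longrightarrow>
    (\<And>y R. form N (\<lambda>l. f y l R)) \<Longrightarrow> form N (\<lambda>l. sum_remove2 f (L1 @ l # L2))"
proof (induction L1 arbitrary: f)
  case Nil
  show ?case
    using Nil(1)[of _ _ "[]"]
    by (auto intro!: form_add form_sum_remove_param form_sum_remove2_param Nil(2))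
next
  case (Cons a L1)
  have "form N (\<lambda>l. sum_remove2 (\<lambda>y z R. f y z (a # R)) (L1 @ l # L2))"
    by (rule Cons.IH) (use Cons.prems(1)[of _ _ "a # _"] Cons.prems(2,3) in auto)
  then show ?case
    using Cons.prems(1,3) by (auto intro!: form_add form_sum_remove)
qed

lemma form_disc: "form (width d) (\<lambda>l. disc d (L1 @ l # L2))"
proof (induction d arbitrary: L1 L2)
  case 0
  show ?case by (simp add: form_zero)
next
  case (Suc d)
  let ?N = "width (Suc d)"
  have le: "width d \<le> ?N" "1 \<le> ?N" "3 \<le> ?N" by auto
  note IH = form_mono[OF Suc.IH le(1)]
  have q1: "form ?N (\<lambda>x. disc d (quot_m x y # R))" for y R
    by (rule form_comp[OF Suc.IH[of "[]", simplified]]) (auto intro!: form_quot_m_left)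
  have q2: "form ?N (\<lambda>y. disc d (quot_m x y # R))" for x R
    by (rule form_comp[OF Suc.IH[of "[]", simplified]]) (auto intro!: form_quot_m_right)
  show ?case
  proof (cases L1)
    case Nil
    have "form ?N (\<lambda>x. disc d (unit_at j # (\<lambda>k. pull_m x (j + k)) # L2))"
      if "j \<in> {- int (width d)..int (width d)}" for j
      by (rule form_comp[OF Suc.IH[of "[unit_at j]", simplified]])
        (use that in \<open>auto intro!: form_pull_m\<close>)
    then show ?thesis
      unfolding Nil append_Nil disc_Cons
      by (intro form_add form_sum form_sum_remove_param form_sum_remove2_param form_multc
          form_three_point form_one_point q1 le)
  next
    case (Cons x L)
    have "form ?N (\<lambda>l. disc d (unit_at j # (\<lambda>k. pull_m x (j + k)) # L @ l # L2))" for j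
      using IH[of "unit_at j # (\<lambda>k. pull_m x (j + k)) # L"] by simp
    moreover have "form ?N (\<lambda>l. disc d (quot_m x y # R1 @ l # R2))" for y R1 R2
      using IH[of "quot_m x y # R1"] by simp
    ultimately show ?thesis
      unfolding Cons append_Cons disc_Cons
      by (intro form_add form_sum form_sum_remove form_sum_remove2 form_multc form_cmult
          form_three_point q2 IH le)
  qed
qed

lemma form_disc_1: "form (width d) (\<lambda>l. disc d (l # L))"
  using form_disc[of d "[]"] by simp

lemma form_disc_2: "form (width d) (\<lambda>l. disc d (x # l # L))"
  using form_disc[of d "[x]"] by simp

lemma form_add_arg: "form N \<phi> \<Longrightarrow> \<phi> (\<lambda>k. l k + l' k) = \<phi> l + \<phi> l'"
  using form_linear[of N \<phi> 1 l 1 l'] by simp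

text \<open>A sum over unit functionals contracts a tensor with two slots of a correlator.\<close>

text \<open>
  This recovers the evaluation at a pair of arguments from their coefficients.
\<close>

lemma disc_contract:
  "(\<Sum>j=- int (width d)..int (width d). disc d (unit_at j # (\<lambda>k. x j * y k) # L)) = disc d (x # y # L)"
proof -
  have "disc d (unit_at j # (\<lambda>k. x j * y k) # L) = disc d (unit_at j # y # L) * x j" for j
    using form_scale_arg[OF form_disc_2] by (simp add: mult.commute)
  then show ?thesis
    using formD[OF form_disc_1, of d x "y # L"] by simp
qed

lemma disc_scale_2: "disc d (x # (\<lambda>k. c * y k) # L) = c * disc d (x # y # L)"
  by (rule form_scale_arg[OF form_disc_2])

lemma disc_scale_1: "disc d ((\<lambda>k. c * y k) # L) = c * disc d (y # L)"
  by (rule form_scale_arg[OF form_disc_1])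

lemma disc_add_1: "disc d ((\<lambda>k. x k + y k) # L) = disc d (x # L) + disc d (y # L)"
  by (rule form_add_arg[OF form_disc_1])

lemma disc_point:
  assumes "v \<noteq> 0"
  shows "disc (Suc d) (point v # L) =
     mfun v * disc d (point v # point v # L)
     + sum_remove (\<lambda>y R. disc d (quot_m (point v) y # R)) L
     + sum_remove2 (\<lambda>y z R. three_point (point v) y z * disc d R) L
     + one_point (point v) * disc d L"
proof -
  have "(\<lambda>k. pull_m (point v) (j + k)) = (\<lambda>k. point v j * (mfun v * point v k))" for j
    unfolding pull_m_point[OF assms] using assms by (simp add: point_def power_int_add mult_ac)
  then show ?thesis
    unfolding disc_Cons by (simp only: disc_contract) (simp only: disc_scale_2)
qed

text \<open>
  Stated for one order \<open>d\<close>, because the induction needs the symmetry at the two preceding orders.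
\<close>

definition disc_sym :: "nat \<Rightarrow> bool" where
  "disc_sym d \<longleftrightarrow> (\<forall>L L'. mset L = mset L' \<longrightarrow> disc d L = disc d L')"

lemma disc_symD: "disc_sym d \<Longrightarrow> mset L = mset L' \<Longrightarrow> disc d L = disc d L'"
  unfolding disc_sym_def by blast

lemma disc_spectators:
  assumes sym: "disc_sym d" and "mset L = mset L'"
  shows "disc (Suc d) (x # L) = disc (Suc d) (x # L')"
proof -
  have r: "sum_remove f L = sum_remove f L'"
    if "\<And>y R R'. mset R = mset R' \<Longrightarrow> f y R = f y R'" "mset L = mset L'"
    for f :: "functional \<Rightarrow> functional list \<Rightarrow> complex" and L L'
    using that
  proof (induction L arbitrary: L' f rule: length_induct)
    case (1 L)
    note p = "1.prems"
    show ?case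
    proof (cases L)
      case Nil
      then show ?thesis using p(2) by simp
    next
      case (Cons a M)
      obtain b M' where L': "L' = b # M'" using p(2) Cons by (cases L') auto
      show ?thesis
      proof (cases "a = b")
        case True
        have M: "mset M = mset M'" using p(2) Cons L' True by simp
        have "sum_remove (\<lambda>y R. f y (a # R)) M = sum_remove (\<lambda>y R. f y (a # R)) M'"
          using "1.IH"[rule_format, of M "\<lambda>y R. f y (a # R)" M'] M p(1) Cons by auto
        then show ?thesis using Cons L' True p(1)[OF M] by simp
      next
        case False
        have "add_mset a (mset M) = add_mset b (mset M')" using p(2) Cons L' by simp
        then obtain K where K: "mset M = add_mset b K" "mset M' = add_mset a K"
          using False by (auto simp: add_eq_conv_ex)
        obtain Q where Q: "mset Q = K" using ex_mset by blast
        have "length M < length L" "length M' < length L" using Cons L' p(2) mset_eq_length[OF p(2)] by auto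
        then have
          "sum_remove (\<lambda>y R. f y (a # R)) M = sum_remove (\<lambda>y R. f y (a # R)) (b # Q)"
          "sum_remove (\<lambda>y R. f y (b # R)) M' = sum_remove (\<lambda>y R. f y (b # R)) (a # Q)"
          using "1.IH"[rule_format, of M "\<lambda>y R. f y (a # R)" "b # Q"]
            "1.IH"[rule_format, of M' "\<lambda>y R. f y (b # R)" "a # Q"] p(1) K Q by auto
        moreover have "f a M = f a (b # Q)" "f b M' = f b (a # Q)"
          using p(1) K Q by auto
        moreover have "sum_remove (\<lambda>y R. f y (a # b # R)) Q = sum_remove (\<lambda>y R. f y (b # a # R)) Q"
          by (rule sum_remove_cong, rule p(1)) simp
        ultimately show ?thesis using Cons L' by simp
      qed
    qed
  qed
  have r2: "2 * sum_remove2 f L = 2 * sum_remove2 f L'"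
    if f: "\<And>y z R R'. mset R = mset R' \<Longrightarrow> f y z R = f y z R'" "\<And>y z R. f y z R = f z y R"
      and L: "mset L = mset L'"
    for f :: "functional \<Rightarrow> functional \<Rightarrow> functional list \<Rightarrow> complex" and L L'
  proof -
    have e: "2 * sum_remove2 f M = sum_remove (\<lambda>x. sum_remove (f x)) M" for M
    proof -
      have "(\<lambda>x y R. f x y R + f y x R) = (\<lambda>x y R. 2 * f x y R)"
        using f(2) by (intro ext) (metis mult_2)
      then show ?thesis unfolding sum_remove_sum_remove by (simp add: sum_remove2_mult)
    qed
    show ?thesis
      unfolding e by (rule r[OF _ L]) (rule r, auto intro: f(1))
  qed
  have "sum_remove2 (\<lambda>y z R. three_point x y z * disc d R) L =
      sum_remove2 (\<lambda>y z R. three_point x y z * disc d R) L'"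
    using r2[of "\<lambda>y z R. three_point x y z * disc d R" L L'] assms(2)
    by (auto intro: disc_symD[OF sym] simp: three_point_def mult_ac)
  moreover have "sum_remove (\<lambda>y R. disc d (quot_m x y # R)) L =
      sum_remove (\<lambda>y R. disc d (quot_m x y # R)) L'"
    by (rule r[OF _ assms(2)]) (auto intro: disc_symD[OF sym])
  moreover have "disc d (unit_at j # (\<lambda>k. pull_m x (j + k)) # L) =
      disc d (unit_at j # (\<lambda>k. pull_m x (j + k)) # L')" for j
    using assms by (auto intro: disc_symD[OF sym])
  moreover have "disc d L = disc d L'" by (rule disc_symD[OF assms])
  ultimately show ?thesis unfolding disc_Cons by simp
qed

text \<open>
  Permutations are generated by those that fix the first entry and by the exchange of the first two entries.
\<close>

lemma disc_symI:
  assumes spec: "\<And>x L L'. mset L = mset L' \<Longrightarrow> disc d (x # L) = disc d (x # L')"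
    and swap: "\<And>x y L. disc d (x # y # L) = disc d (y # x # L)"
  shows "disc_sym d"
  unfolding disc_sym_def
proof (intro allI impI)
  fix L L' :: "functional list" assume m: "mset L = mset L'"
  show "disc d L = disc d L'"
  proof (cases L)
    case Nil
    then show ?thesis using m by simp
  next
    case (Cons a M)
    obtain b M' where L': "L' = b # M'" using m Cons by (cases L') auto
    show ?thesis
    proof (cases "a = b")
      case True
      have "mset M = mset M'" using m Cons L' True by simp
      from spec[OF this, of a] show ?thesis unfolding Cons L' True .
    next
      case False
      have "add_mset a (mset M) = add_mset b (mset M')" using m Cons L' by simp
      then obtain K where K: "mset M = add_mset b K" "mset M' = add_mset a K"
        using False by (auto simp: add_eq_conv_ex)
      obtain Q where Q: "mset Q = K" using ex_mset by blast
      have "disc d L = disc d (a # b # Q)" unfolding Cons by (rule spec) (simp add: K Q)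
      also have "\<dots> = disc d (b # a # Q)" by (rule swap)
      also have "\<dots> = disc d L'" unfolding L' by (rule spec) (simp add: K Q)
      finally show ?thesis .
    qed
  qed
qed


lemma one_point_chain_points:
  assumes "a \<noteq> 0" "b \<noteq> 0" "a \<noteq> b"
  shows "mfun a * three_point (point b) (point a) (point a) + one_point (quot_m (point a) (point b)) =
    mfun b * three_point (point a) (point b) (point b) + one_point (quot_m (point b) (point a))"
proof -
  have e: "mfun a * three_point (point b) (point a) (point a)
     = (pull_m (point a) 0 * quot_m (point b) (point a) (- 1)
       + pull_m (point a) (- 1) * quot_m (point b) (point a) 0) / 4 - mfun a * mfun b / (2 * a * b)"
    if "a \<noteq> 0" "b \<noteq> 0" for a b
    unfolding pull_m_point[OF that(1)] mfun_expand[OF that(2)] three_point_def quot_m_values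
    using that by (simp add: point_def power_int_minus field_simps)
      (simp add: algebra_simps power2_eq_square power3_eq_cube power4_eq_xxxx)?
  have "pull_m (quot_m (point a) (point b)) (- 1) / 4
      + (pull_m (point a) 0 * quot_m (point b) (point a) (- 1)
       + pull_m (point a) (- 1) * quot_m (point b) (point a) 0) / 4 =
      pull_m (quot_m (point b) (point a)) (- 1) / 4
      + (pull_m (point b) 0 * quot_m (point a) (point b) (- 1)
       + pull_m (point b) (- 1) * quot_m (point a) (point b) 0) / 4"
    using quot_m_square_points[OF assms, of 0 "- 1"] by (simp add: add_divide_distrib[symmetric] add.assoc)
  then show ?thesis
    unfolding one_point_def e[OF assms(1,2)] e[OF assms(2,1)] by (simp add: ac_simps)
qed

lemma quot_m_chain:
  assumes "a \<noteq> 0" "b \<noteq> 0" "a \<noteq> b"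
  shows "quot_m (quot_m (point a) (point b)) z k + quot_m (point b) (quot_m (point a) z) k
      + 2 * mfun a * three_point (point b) (point a) z * point a k
    = quot_m (quot_m (point b) (point a)) z k + quot_m (point a) (quot_m (point b) z) k
      + 2 * mfun b * three_point (point a) (point b) z * point b k"
proof -
  let ?N = "nat \<bar>k\<bar> + 6"
  have f: "form ?N (\<lambda>z. quot_m (quot_m x y) z k + quot_m y (quot_m x z) k
      + 2 * c * three_point y x z * d)" for x y c d
  proof (intro form_add form_cmult form_multc form_three_point form_quot_m_right)
    show "form ?N (\<lambda>z. quot_m y (quot_m x z) k)"
      by (rule form_comp[OF form_quot_m_right[of k "nat \<bar>k\<bar> + 3"]])
        (auto intro!: form_quot_m_right)
  qed auto
  show ?thesis
  proof (rule form_eq[OF f f, of "{a, b}"])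
    fix v :: complex assume v: "v \<noteq> 0" "v \<notin> {a, b}"
    have e: "2 * mfun a * three_point (point b) (point a) (point v) * point a k =
        (pull_m (point a) k - pull_m (point a) (k - 1) / (b * v)) / 8"
      if "a \<noteq> 0" "b \<noteq> 0" for a b
      using that v by (simp add: pull_m_point power_int_diff three_point_def)
        (simp add: point_def power_int_minus field_simps)
    show "quot_m (quot_m (point a) (point b)) (point v) k + quot_m (point b) (quot_m (point a) (point v)) k
        + 2 * mfun a * three_point (point b) (point a) (point v) * point a k
      = quot_m (quot_m (point b) (point a)) (point v) k + quot_m (point a) (quot_m (point b) (point v)) k
        + 2 * mfun b * three_point (point a) (point b) (point v) * point b k"
      unfolding e[OF assms(1,2)] e[OF assms(2,1)]
      by (rule quot_m_chain_points) (use assms v in auto)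
  qed simp
qed

text \<open>
  Expand the recursion at \<open>a\<close>, and in the result at \<open>b\<close>. The terms of order two in \<open>m\<close> are visibly symmetric; the
  others are matched by the quadratic identity, the cubic chain identity and its one-point and three-point
  degenerations.
\<close>

lemma disc_swap_points:
  assumes sym: "disc_sym d" "disc_sym (Suc d)" and ab: "a \<noteq> 0" "b \<noteq> 0" "a \<noteq> b"
  shows "disc (Suc (Suc d)) (point a # point b # L) = disc (Suc (Suc d)) (point b # point a # L)"
proof -
  note D = disc_symD[OF sym(1)] and D' = disc_symD[OF sym(2)]
  let ?D = "disc d"
  define X1 where "X1 a b = mfun a * mfun b * ?D (point b # point b # point a # point a # L)" for a b
  define X2 where "X2 a b =
    mfun a * sum_remove (\<lambda>y R. ?D (quot_m (point b) y # point a # point a # R)) L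
    + mfun b * sum_remove (\<lambda>y R. ?D (point b # point b # quot_m (point a) y # R)) L" for a b
  define X3 where "X3 a b =
    2 * mfun a * ?D (quot_m (point b) (point a) # point a # L)
    + (\<Sum>j=- int (width d)..int (width d).
        ?D (unit_at j # (\<lambda>k. pull_m (quot_m (point a) (point b)) (j + k)) # L))" for a b
  define X4 where "X4 a b = sum_remove (\<lambda>z R.
      ?D (quot_m (quot_m (point a) (point b)) z # R) + ?D (quot_m (point b) (quot_m (point a) z) # R)
      + 2 * mfun a * three_point (point b) (point a) z * ?D (point a # R)) L" for a b
  define X5 where "X5 a b = (mfun a * three_point (point b) (point a) (point a)
      + one_point (quot_m (point a) (point b))) * ?D L" for a b
  define X6 where "X6 a b =
    mfun a * sum_remove2 (\<lambda>y z R. three_point (point b) y z * ?D (point a # point a # R)) L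
    + mfun b * sum_remove2 (\<lambda>y z R. three_point (point a) y z * ?D (point b # point b # R)) L" for a b
  define X7 where "X7 a b = mfun a * one_point (point b) * ?D (point a # point a # L)
    + one_point (point a) * mfun b * ?D (point b # point b # L)" for a b
  define X8 where "X8 a b = sum_remove2 (\<lambda>y z R.
      (three_point (quot_m (point a) (point b)) y z + three_point (point b) (quot_m (point a) y) z
       + three_point (point b) (quot_m (point a) z) y) * ?D R) L" for a b
  define X9 where "X9 a b = sum_remove (\<lambda>y. sum_remove (\<lambda>z R.
      ?D (quot_m (point b) z # quot_m (point a) y # R))) L" for a b
  define X10 where "X10 a b =
    sum_remove2 (\<lambda>z u. sum_remove (\<lambda>y R. three_point (point b) z u * ?D (quot_m (point a) y # R))) L
    + sum_remove2 (\<lambda>z u. sum_remove (\<lambda>y R. three_point (point a) z u * ?D (quot_m (point b) y # R))) L"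
    for a b
  define X11 where "X11 a b = one_point (point b) * sum_remove (\<lambda>y R. ?D (quot_m (point a) y # R)) L
    + one_point (point a) * sum_remove (\<lambda>y R. ?D (quot_m (point b) y # R)) L" for a b
  define X12 where "X12 a b = sum_remove (\<lambda>z R. three_point (point a) (point b) z * disc (Suc d) R) L"
    for a b
  define X13 where "X13 a b = sum_remove2 (\<lambda>y z. sum_remove2 (\<lambda>u w R.
      three_point (point a) y z * three_point (point b) u w * ?D R)) L" for a b
  define X14 where "X14 a b =
    one_point (point b) * sum_remove2 (\<lambda>y z R. three_point (point a) y z * ?D R) L
    + one_point (point a) * sum_remove2 (\<lambda>y z R. three_point (point b) y z * ?D R) L" for a b
  define X15 where "X15 a b = one_point (point a) * one_point (point b) * ?D L" for a b
  have expand: "disc (Suc (Suc d)) (point a # point b # L) =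
      X1 a b + X2 a b + X3 a b + X4 a b + X5 a b + X6 a b + X7 a b + X8 a b + X9 a b + X10 a b
      + X11 a b + X12 a b + X13 a b + X14 a b + X15 a b"
    if ab: "a \<noteq> 0" "b \<noteq> 0" for a b
  proof -
    let ?pa = "point a" and ?pb = "point b"
    have s1: "disc (Suc d) (?pa # ?pa # ?pb # L) = disc (Suc d) (?pb # ?pa # ?pa # L)"
      by (rule D') simp
    have s2: "sum_remove (\<lambda>y R. disc (Suc d) (quot_m ?pa y # ?pb # R)) L =
        sum_remove (\<lambda>y R. disc (Suc d) (?pb # quot_m ?pa y # R)) L"
      by (rule sum_remove_cong, rule D') simp
    have s3: "disc (Suc d) (?pa # ?pb # L) = disc (Suc d) (?pb # ?pa # L)"
      by (rule D') simp
    have "disc (Suc (Suc d)) (?pa # ?pb # L) =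
        mfun a * disc (Suc d) (?pb # ?pa # ?pa # L)
        + disc (Suc d) (quot_m ?pa ?pb # L)
        + sum_remove (\<lambda>y R. disc (Suc d) (?pb # quot_m ?pa y # R)) L
        + X12 a b
        + sum_remove2 (\<lambda>y z R. three_point ?pa y z * disc (Suc d) (?pb # R)) L
        + one_point ?pa * disc (Suc d) (?pb # L)"
      unfolding disc_point[OF ab(1), of "Suc d"] X12_def by (simp add: s1 s2 del: disc.simps)
    moreover have "mfun a * disc (Suc d) (?pb # ?pa # ?pa # L) =
        X1 a b + 2 * mfun a * ?D (quot_m ?pb ?pa # ?pa # L)
        + mfun a * sum_remove (\<lambda>y R. ?D (quot_m ?pb y # ?pa # ?pa # R)) L
        + mfun a * three_point ?pb ?pa ?pa * ?D L
        + sum_remove (\<lambda>z R. 2 * mfun a * three_point ?pb ?pa z * ?D (?pa # R)) L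
        + mfun a * sum_remove2 (\<lambda>y z R. three_point ?pb y z * ?D (?pa # ?pa # R)) L
        + mfun a * one_point ?pb * ?D (?pa # ?pa # L)"
      unfolding disc_point[OF ab(2)] X1_def sum_remove_mult[symmetric]
      by (simp add: algebra_simps sum_remove_mult flip: sum_remove_add)
    moreover have "disc (Suc d) (quot_m ?pa ?pb # L) =
        (\<Sum>j=- int (width d)..int (width d). ?D (unit_at j # (\<lambda>k. pull_m (quot_m ?pa ?pb) (j + k)) # L))
        + sum_remove (\<lambda>z R. ?D (quot_m (quot_m ?pa ?pb) z # R)) L
        + sum_remove2 (\<lambda>y z R. three_point (quot_m ?pa ?pb) y z * ?D R) L
        + one_point (quot_m ?pa ?pb) * ?D L"
      by (rule disc_Cons)
    moreover have "sum_remove (\<lambda>y R. disc (Suc d) (?pb # quot_m ?pa y # R)) L =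
        mfun b * sum_remove (\<lambda>y R. ?D (?pb # ?pb # quot_m ?pa y # R)) L
        + sum_remove (\<lambda>y R. ?D (quot_m ?pb (quot_m ?pa y) # R)) L
        + X9 a b
        + sum_remove2 (\<lambda>y z R. (three_point ?pb (quot_m ?pa y) z + three_point ?pb (quot_m ?pa z) y) * ?D R) L
        + sum_remove2 (\<lambda>z u. sum_remove (\<lambda>y R. three_point ?pb z u * ?D (quot_m ?pa y # R))) L
        + one_point ?pb * sum_remove (\<lambda>y R. ?D (quot_m ?pa y # R)) L"
      unfolding disc_point[OF ab(2)] X9_def sum_remove_sum_remove2[symmetric] distrib_right
        sum_remove_sum_remove[of "\<lambda>y z R. three_point ?pb (quot_m ?pa y) z * ?D R", symmetric]
      by (simp add: sum_remove_add sum_remove_mult algebra_simps)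
    moreover have "sum_remove2 (\<lambda>y z R. three_point ?pa y z * disc (Suc d) (?pb # R)) L =
        mfun b * sum_remove2 (\<lambda>y z R. three_point ?pa y z * ?D (?pb # ?pb # R)) L
        + sum_remove2 (\<lambda>z u. sum_remove (\<lambda>y R. three_point ?pa z u * ?D (quot_m ?pb y # R))) L
        + X13 a b
        + one_point ?pb * sum_remove2 (\<lambda>y z R. three_point ?pa y z * ?D R) L"
      unfolding disc_point[OF ab(2)] X13_def
      by (simp add: distrib_left sum_remove2_add sum_remove_mult sum_remove2_mult
          sum_remove_mult[abs_def] sum_remove2_mult[abs_def] mult.left_commute mult.assoc)
    moreover have "one_point ?pa * disc (Suc d) (?pb # L) =
        one_point ?pa * mfun b * ?D (?pb # ?pb # L)
        + one_point ?pa * sum_remove (\<lambda>y R. ?D (quot_m ?pb y # R)) L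
        + one_point ?pa * sum_remove2 (\<lambda>y z R. three_point ?pb y z * ?D R) L + X15 a b"
      unfolding disc_point[OF ab(2)] X15_def by (simp add: algebra_simps)
    ultimately show ?thesis
      unfolding X2_def X3_def X4_def X5_def X6_def X7_def X8_def X10_def X11_def X14_def
        distrib_right sum_remove_add sum_remove2_add
      by (simp only: ac_simps)
  qed
  have 1: "X1 a b = X1 b a"
    unfolding X1_def by (subst D[of _ "point a # point a # point b # point b # L"]) auto
  have 2: "X2 a b = X2 b a"
  proof -
    have "sum_remove (\<lambda>y R. ?D (point b # point b # quot_m (point a) y # R)) L =
      sum_remove (\<lambda>y R. ?D (quot_m (point a) y # point b # point b # R)) L" for a b
      by (rule sum_remove_cong, rule D) simp
    then show ?thesis unfolding X2_def by simp
  qed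
  have 3: "X3 a b = X3 b a"
  proof -
    have "X3 a b = (\<Sum>j=- int (width d)..int (width d). ?D (unit_at j # (\<lambda>k.
        pull_m (quot_m (point a) (point b)) (j + k)
        + pull_m (point a) j * quot_m (point b) (point a) k
        + pull_m (point a) k * quot_m (point b) (point a) j) # L))"
      if ab: "a \<noteq> 0" "b \<noteq> 0" for a b
    proof -
      have m: "pull_m (point a) = (\<lambda>k. mfun a * point a k)"
        using pull_m_point[OF ab(1)] by (auto simp: point_def)
      have "?D (point a # quot_m (point b) (point a) # L) = ?D (quot_m (point b) (point a) # point a # L)"
        by (rule D) simp
      then have "2 * mfun a * ?D (quot_m (point b) (point a) # point a # L) =
        ?D (pull_m (point a) # quot_m (point b) (point a) # L)
        + ?D (quot_m (point b) (point a) # pull_m (point a) # L)"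
        unfolding m disc_scale_1 disc_scale_2 by simp
      also have "\<dots> = (\<Sum>j=- int (width d)..int (width d).
          ?D (unit_at j # (\<lambda>k. pull_m (point a) j * quot_m (point b) (point a) k) # L)
          + ?D (unit_at j # (\<lambda>k. quot_m (point b) (point a) j * pull_m (point a) k) # L))"
        unfolding sum.distrib disc_contract ..
      finally show ?thesis
        unfolding X3_def form_add_arg[OF form_disc_2] sum.distrib
        by (simp add: ac_simps)
    qed
    note e = this[OF ab(1,2)] this[OF ab(2,1)]
    show ?thesis
      unfolding e using quot_m_square_points[OF ab] by (simp add: add.assoc)
  qed
  have 4: "X4 a b = X4 b a"
  proof -
    have "?D (quot_m (quot_m (point a) (point b)) z # R) + ?D (quot_m (point b) (quot_m (point a) z) # R)
      + 2 * mfun a * three_point (point b) (point a) z * ?D (point a # R) =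
      ?D ((\<lambda>k. quot_m (quot_m (point a) (point b)) z k + quot_m (point b) (quot_m (point a) z) k
      + 2 * mfun a * three_point (point b) (point a) z * point a k) # R)" for a b z R
      unfolding disc_add_1 disc_scale_1 ..
    then show ?thesis
      unfolding X4_def by (simp only: quot_m_chain[OF ab])
  qed
  have 5: "X5 a b = X5 b a" unfolding X5_def one_point_chain_points[OF ab] ..
  have 6: "X6 a b = X6 b a" unfolding X6_def by simp
  have 7: "X7 a b = X7 b a" unfolding X7_def by simp
  have 8: "X8 a b = X8 b a" unfolding X8_def three_point_chain ..
  have 9: "X9 a b = X9 b a"
  proof -
    have "X9 a b = sum_remove (\<lambda>y. sum_remove (\<lambda>z R. ?D (quot_m (point b) y # quot_m (point a) z # R))) L"
      unfolding X9_def by (rule sum_remove_swap)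
    also have "\<dots> = X9 b a"
      unfolding X9_def by (intro sum_remove_cong D) simp
    finally show ?thesis .
  qed
  have 10: "X10 a b = X10 b a" unfolding X10_def by simp
  have 11: "X11 a b = X11 b a" unfolding X11_def by simp
  have 12: "X12 a b = X12 b a" unfolding X12_def by (simp add: three_point_def mult_ac)
  have 13: "X13 a b = X13 b a"
    unfolding X13_def by (subst sum_remove2_swap) (simp add: mult_ac)
  have 14: "X14 a b = X14 b a" unfolding X14_def by simp
  have 15: "X15 a b = X15 b a" unfolding X15_def by simp
  show ?thesis
    unfolding expand[OF ab(1,2)] expand[OF ab(2,1)] 1 2 3 4 5 6 7 8 9 10 11 12 13 14 15 ..
qed

text \<open>
  By \<open>form_eq\<close> in two arguments it is enough to exchange distinct points. Order one is checked separately,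
  since the expansion twice over starts at order two.
\<close>

theorem disc_symmetric: "disc_sym d"
proof (induction d rule: less_induct)
  case (less d)
  show ?case
  proof (cases d)
    case 0
    then show ?thesis by (auto simp: disc_sym_def)
  next
    case (Suc d1)
    have sym1: "disc_sym d1" using less Suc by simp
    show ?thesis
      unfolding Suc
    proof (rule disc_symI)
      show "disc (Suc d1) (x # L) = disc (Suc d1) (x # L')" if "mset L = mset L'" for x L L'
        by (rule disc_spectators[OF sym1 that])
      show "disc (Suc d1) (x # y # L) = disc (Suc d1) (y # x # L)" for x y L
      proof (cases d1)
        case 0
        have e: "disc 0 (f # M) = 0" for f M by simp
        have "disc (Suc 0) (x # y # L) = sum_remove (\<lambda>z R. three_point x y z * disc 0 R) L" for x y
        proof -
          show ?thesis
            unfolding disc_Cons sum_remove2.simps e mult_zero_right sum_remove_zero sum_remove2_zero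
            by simp
        qed
        moreover have "three_point x y = three_point y x" by (intro ext) (simp add: three_point_def mult_ac)
        ultimately show ?thesis unfolding 0 by metis
      next
        case (Suc d2)
        have sym2: "disc_sym d2" using less \<open>d = Suc d1\<close> Suc by simp
        have pts: "disc (Suc d1) (point a # point b # L) = disc (Suc d1) (point b # point a # L)"
          if "a \<noteq> 0" "b \<noteq> 0" "a \<noteq> b" for a b
          using disc_swap_points[OF sym2 sym1[unfolded Suc] that] unfolding Suc .
        have pt: "disc (Suc d1) (point a # y # L) = disc (Suc d1) (y # point a # L)" if "a \<noteq> 0" for a
        proof (rule form_eq[OF form_disc_2 form_disc_1, of "{a}"])
          fix v :: complex assume "v \<noteq> 0" "v \<notin> {a}"
          then show "disc (Suc d1) (point a # point v # L) = disc (Suc d1) (point v # point a # L)"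
            by (intro pts that) auto
        qed simp
        show ?thesis
        proof (rule form_eq[OF form_disc_1 form_disc_2, of "{}"])
          fix v :: complex assume "v \<noteq> 0"
          then show "disc (Suc d1) (point v # y # L) = disc (Suc d1) (y # point v # L)"
            by (rule pt)
        qed simp
      qed
    qed
  qed
qed

section \<open>Connected correlators\<close>

text \<open>
  The correlators of connected surfaces of Euler characteristic \<open>-d\<close>. The number of arguments and \<open>d\<close>
  determine the genus, so the topological recursion can be written without reference to the genus; the
  terms that contain \<open>W\<^sub>0\<^sub>,\<^sub>2\<close> are written separately.
\<close>

fun conn :: "nat \<Rightarrow> functional list \<Rightarrow> complex" where
  "conn 0 L = 0"
| "conn (Suc d) [] = 0"
| "conn (Suc d) (x # L) =
     (\<Sum>j=- int (width d)..int (width d). conn d (unit_at j # (\<lambda>k. pull_m x (j + k)) # L))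
     + (\<Sum>j=- int (width d)..int (width d). \<Sum>i\<in>{..d}. sum_split (\<lambda>A B.
          conn i (unit_at j # A) * conn (d - i) ((\<lambda>k. pull_m x (j + k)) # B)) L)
     + sum_remove (\<lambda>y R. conn d (quot_m x y # R)) L
     + (if d = 0 \<and> length L = 2 then three_point x (hd L) (hd (tl L)) else 0)
     + (if d = 0 \<and> L = [] then one_point x else 0)"

lemma form_if: "form N \<phi> \<Longrightarrow> form N (\<lambda>l. if b then \<phi> l else 0)"
  by (cases b) (auto intro: form_zero)

lemma form_sum_split_param:
  "(\<And>A B. form N (\<lambda>l. g l A B)) \<Longrightarrow> form N (\<lambda>l. sum_split (g l) L)"
  by (induction L arbitrary: g) (auto intro!: form_add)

lemma form_sum_split:
  "(\<And>A1 A2 B. form N (\<lambda>l. f (A1 @ l # A2) B)) \<Longrightarrow> (\<And>A B1 B2. form N (\<lambda>l. f A (B1 @ l # B2))) \<Longrightarrow>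
    form N (\<lambda>l. sum_split f (L1 @ l # L2))"
proof (induction L1 arbitrary: f)
  case Nil
  show ?case
    using Nil(1)[of "[]"] Nil(2)[of _ "[]"] by (auto intro!: form_add form_sum_split_param)
next
  case (Cons a L1)
  have "form N (\<lambda>l. sum_split (\<lambda>A. f (a # A)) (L1 @ l # L2))"
    by (rule Cons.IH) (use Cons.prems(1)[of "a # _"] Cons.prems(2) in auto)
  moreover have "form N (\<lambda>l. sum_split (\<lambda>A B. f A (a # B)) (L1 @ l # L2))"
    by (rule Cons.IH) (use Cons.prems(2)[of _ "a # _"] Cons.prems(1) in auto)
  ultimately show ?case by (auto intro!: form_add)
qed

lemma form_conn_root:
  assumes IH: "\<And>i L1 L2. i \<le> d \<Longrightarrow> form (width i) (\<lambda>l. conn i (L1 @ l # L2))"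
  shows "form (width (Suc d)) (\<lambda>x.
    (\<Sum>j=- int (width d)..int (width d). conn d (unit_at j # (\<lambda>k. pull_m x (j + k)) # L))
    + (\<Sum>j=- int (width d)..int (width d). \<Sum>i\<in>{..d}. sum_split (\<lambda>A B.
        conn i (unit_at j # A) * conn (d - i) ((\<lambda>k. pull_m x (j + k)) # B)) L))"
proof -
  let ?N = "width (Suc d)"
  have h: "form ?N (\<lambda>x. pull_m x (j + k))"
    if "j \<in> {- int (width d)..int (width d)}" "\<bar>k\<bar> \<le> int (width i)" "i \<le> d" for i j k
    using that width_mono[OF that(3)] by (auto intro!: form_pull_m)
  have "form ?N (\<lambda>x. conn d (unit_at j # (\<lambda>k. pull_m x (j + k)) # L))"
    if "j \<in> {- int (width d)..int (width d)}" for j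
    by (rule form_comp[OF IH[of d "[unit_at j]", simplified]]) (use h that in auto)
  moreover have "form ?N (\<lambda>x. conn (d - i) ((\<lambda>k. pull_m x (j + k)) # B))"
    if "j \<in> {- int (width d)..int (width d)}" for i j B
    by (rule form_comp[OF IH[of "d - i" "[]", simplified]]) (use h that in auto)
  ultimately show ?thesis
    by (intro form_add form_sum form_sum_split_param form_cmult) simp_all
qed

lemma form_conn: "form (width d) (\<lambda>l. conn d (L1 @ l # L2))"
proof (induction d arbitrary: L1 L2 rule: less_induct)
  case (less d')
  show ?case
  proof (cases d')
    case 0
    show ?thesis by (simp add: 0 form_zero)
  next
    case (Suc d)
    let ?N = "width (Suc d)"
    have le: "1 \<le> ?N" "3 \<le> ?N" by auto
    have IH0: "form (width i) (\<lambda>l. conn i (L1 @ l # L2))" if "i \<le> d" for i L1 L2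
      using less.IH that Suc by simp
    have IH: "form ?N (\<lambda>l. conn i (L1 @ l # L2))" if "i \<le> d" for i L1 L2
      by (rule form_mono[OF IH0[OF that]]) (use that in \<open>auto simp del: width.simps intro!: width_mono\<close>)
    have q1: "form ?N (\<lambda>x. conn d (quot_m x y # R))" for y R
      by (rule form_comp[OF IH0[of d "[]", simplified]]) (auto intro!: form_quot_m_left)
    have q2: "form ?N (\<lambda>y. conn d (quot_m x y # R))" for x R
      by (rule form_comp[OF IH0[of d "[]", simplified]]) (auto intro!: form_quot_m_right)
    show ?thesis
    proof (cases L1)
      case Nil
      have root: "form ?N (\<lambda>x.
          (\<Sum>j=- int (width d)..int (width d). conn d (unit_at j # (\<lambda>k. pull_m x (j + k)) # L2))
          + (\<Sum>j=- int (width d)..int (width d). \<Sum>i\<in>{..d}. sum_split (\<lambda>A B.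
            conn i (unit_at j # A) * conn (d - i) ((\<lambda>k. pull_m x (j + k)) # B)) L2))"
        by (rule form_conn_root) (rule IH0)
      have src:
        "form ?N (\<lambda>x. if d = 0 \<and> length L2 = 2 then three_point x (hd L2) (hd (tl L2)) else 0)"
        "form ?N (\<lambda>x. if d = 0 \<and> L2 = [] then one_point x else 0)"
        by (intro form_if form_three_point form_one_point le)+
      show ?thesis
        unfolding Suc Nil append_Nil conn.simps
        by (rule form_add[OF form_add[OF form_add[OF root form_sum_remove_param] src(1)] src(2)])
          (rule q1)
    next
      case (Cons x L)
      have 1: "form ?N (\<lambda>l. conn d (unit_at j # (\<lambda>k. pull_m x (j + k)) # L @ l # L2))" for j
        using IH[of d "unit_at j # (\<lambda>k. pull_m x (j + k)) # L"] by simp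
      have 2: "form ?N (\<lambda>l. conn i (y # R1 @ l # R2))" if "i \<le> d" for i y R1 R2
        using IH[OF that, of "y # R1"] by simp
      have 3: "form ?N (\<lambda>l. if d = 0 \<and> length (L @ l # L2) = 2
          then three_point x (hd (L @ l # L2)) (hd (tl (L @ l # L2))) else 0)"
      proof (cases L)
        case Nil
        then show ?thesis
          by (simp only: append_Nil list.sel length_Cons) (intro form_if form_three_point le)
      next
        case (Cons y L')
        then show ?thesis
        proof (cases L')
          case Nil
          show ?thesis
            unfolding Cons Nil append_Cons append_Nil list.sel length_Cons
            by (intro form_if form_three_point le)
        next
          case (Cons a M)
          then show ?thesis using \<open>L = y # L'\<close> by (simp add: form_zero)
        qed
      qed
      show ?thesis
        unfolding Suc Cons append_Cons conn.simps
        by (intro form_add form_sum form_sum_remove form_sum_split form_multc form_cmult 1 2 3 q2)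
          (auto intro: form_zero)
    qed
  qed
qed

lemma form_conn_1: "form (width d) (\<lambda>l. conn d (l # L))"
  using form_conn[of d "[]"] by simp

lemma form_conn_2: "form (width d) (\<lambda>l. conn d (x # l # L))"
  using form_conn[of d "[x]"] by simp

lemma conn_outside: "i \<le> d \<Longrightarrow> \<bar>j\<bar> > int (width i) \<Longrightarrow> conn i (unit_at j # L) = 0"
  by (rule form_vanish[OF form_conn_1])

lemma sum_triangle:
  fixes f :: "nat \<Rightarrow> nat \<Rightarrow> complex"
  shows "(\<Sum>p\<le>d. \<Sum>q\<le>d - p. f p q) = (\<Sum>i\<le>d. \<Sum>p\<le>i. f p (i - p))"
proof -
  have "(\<Sum>p\<le>d. \<Sum>q\<le>d - p. f p q) = (\<Sum>(p, q)\<in>(SIGMA p:{..d}. {..d - p}). f p q)"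
    by (rule sum.Sigma) auto
  also have "(SIGMA p:{..d}. {..d - p}) = {(p, q). p + q \<le> d}" by auto
  also have "(\<Sum>(p, q)\<in>{(p, q). p + q \<le> d}. f p q) = (\<Sum>i\<le>d. \<Sum>p\<le>i. f p (i - p))"
    by (rule sum.triangle_reindex_eq)
  finally show ?thesis .
qed

text \<open>
  Splitting off the connected component of the root turns the quadratic recursion for \<open>conn\<close> into
  the linear recursion for \<open>disc\<close>.
\<close>

text \<open>
  The component of the root is connected, and the remaining ones are arbitrary.
\<close>

theorem disc_eq_conn:
  "disc d (x # L) = (\<Sum>i\<le>d. sum_split (\<lambda>A B. conn i (x # A) * disc (d - i) B) L)"
proof (induction d arbitrary: x L rule: less_induct)
  case (less d')
  show ?case
  proof (cases d')
    case 0
    then show ?thesis by (simp add: sum_split_zero)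
  next
    case (Suc d)
    define W where "W i = {- int (width i)..int (width i)}" for i
    define g where "g j = (\<lambda>k. pull_m x (j + k))" for j
    have IH: "disc e (x # L) = (\<Sum>i\<le>e. sum_split (\<lambda>A B. conn i (x # A) * disc (e - i) B) L)"
      if "e \<le> d" for e x L
      using less.IH[of e] that Suc by simp
    have 1: "(\<Sum>j\<in>W d. disc d (unit_at j # g j # L)) =
      (\<Sum>i\<le>d. \<Sum>j\<in>W d. sum_split (\<lambda>A B. conn i (unit_at j # g j # A) * disc (d - i) B) L)
      + (\<Sum>i\<le>d. \<Sum>j\<in>W d. \<Sum>p\<le>i. sum_split (\<lambda>A B. sum_split (\<lambda>A1 A2.
           conn p (unit_at j # A1) * conn (i - p) (g j # A2)) A * disc (d - i) B) L)"
    proof -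
      have "(\<Sum>i\<le>d. sum_split (\<lambda>A B. conn i (unit_at j # A) * disc (d - i) (g j # B)) L) =
        (\<Sum>i\<le>d. \<Sum>p\<le>i. sum_split (\<lambda>A B. sum_split (\<lambda>A1 A2.
           conn p (unit_at j # A1) * conn (i - p) (g j # A2)) A * disc (d - i) B) L)" for j
      proof -
        have "(\<Sum>i\<le>d. sum_split (\<lambda>A B. conn i (unit_at j # A) * disc (d - i) (g j # B)) L) =
          (\<Sum>p\<le>d. \<Sum>q\<le>d - p. sum_split (\<lambda>A B. sum_split (\<lambda>B1 B2.
            conn p (unit_at j # A) * conn q (g j # B1) * disc (d - p - q) B2) B) L)"
          by (simp add: IH sum_distrib_left sum_split_sum sum_split_mult[abs_def] mult.assoc)
        also have "\<dots> = (\<Sum>i\<le>d. \<Sum>p\<le>i. sum_split (\<lambda>A B. sum_split (\<lambda>B1 B2.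
            conn p (unit_at j # A) * conn (i - p) (g j # B1) * disc (d - p - (i - p)) B2) B) L)"
          by (rule sum_triangle)
        also have "\<dots> = (\<Sum>i\<le>d. \<Sum>p\<le>i. sum_split (\<lambda>A B. sum_split (\<lambda>A1 A2.
            conn p (unit_at j # A1) * conn (i - p) (g j # A2) * disc (d - i) B) A) L)"
          by (intro sum.cong refl) (simp add: sum_split_assoc)
        finally show ?thesis
          by (simp add: sum_split_mult[abs_def] mult.commute[of _ "disc _ _"])
      qed
      then show ?thesis
        by (simp add: IH sum.distrib sum.swap[of _ _ "W d"])
    qed
    have 2: "sum_remove (\<lambda>y R. disc d (quot_m x y # R)) L =
      (\<Sum>i\<le>d. sum_split (\<lambda>A B. sum_remove (\<lambda>y R. conn i (quot_m x y # R)) A * disc (d - i) B) L)"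
    proof -
      have "sum_split (\<lambda>A B. sum_remove (\<lambda>y R. conn i (quot_m x y # R)) A * disc (d - i) B) L =
        sum_remove (\<lambda>y R. sum_split (\<lambda>A B. conn i (quot_m x y # A) * disc (d - i) B) R) L" for i
        using sum_split_sum_remove[of "\<lambda>y A B. disc (d - i) B * conn i (quot_m x y # A)" L]
        by (simp add: sum_remove_mult mult.commute)
      then show ?thesis by (simp add: IH sum_remove_sum)
    qed
    have 3: "sum_remove2 (\<lambda>y z R. three_point x y z * disc d R) L =
      (\<Sum>i\<le>d. sum_split (\<lambda>A B. (if i = 0 \<and> length A = 2 then three_point x (hd A) (hd (tl A)) else 0)
        * disc (d - i) B) L)"
    proof -
      have "sum_split (\<lambda>A B. (if i = 0 \<and> length A = 2 then three_point x (hd A) (hd (tl A)) else 0)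
        * disc (d - i) B) L = (if i = 0 then sum_remove2 (\<lambda>y z R. three_point x y z * disc d R) L else 0)"
        for i
        using sum_split_pair_left[of "\<lambda>y z R. three_point x y z * disc d R" L]
        by (simp add: sum_split_zero if_distrib[of "\<lambda>u. u * _"] cong: if_cong)
      then show ?thesis by simp
    qed
    have 4: "one_point x * disc d L =
      (\<Sum>i\<le>d. sum_split (\<lambda>A B. (if i = 0 \<and> A = [] then one_point x else 0) * disc (d - i) B) L)"
    proof -
      have "sum_split (\<lambda>A B. (if i = 0 \<and> A = [] then one_point x else 0) * disc (d - i) B) L =
         (if i = 0 then one_point x * disc d L else 0)" for i
        using sum_split_Nil_left[of "\<lambda>R. one_point x * disc d R" L]
        by (simp add: sum_split_zero if_distrib[of "\<lambda>u. u * _"] cong: if_cong)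
      then show ?thesis by simp
    qed
    have conn_W: "conn (Suc i) (x # A) =
      (\<Sum>j\<in>W d. conn i (unit_at j # g j # A))
      + (\<Sum>j\<in>W d. \<Sum>p\<in>{..i}. sum_split (\<lambda>A1 A2. conn p (unit_at j # A1) * conn (i - p) (g j # A2)) A)
      + sum_remove (\<lambda>y R. conn i (quot_m x y # R)) A
      + (if i = 0 \<and> length A = 2 then three_point x (hd A) (hd (tl A)) else 0)
      + (if i = 0 \<and> A = [] then one_point x else 0)" if "i \<le> d" for i A
    proof -
      have z: "conn p (unit_at j # A) = 0" if "p \<le> i" "j \<in> W d - W i" for p j A
        using conn_outside[OF that(1), of j A] width_mono[OF that(1)] that(2) by (auto simp: W_def)
      have sub: "W i \<subseteq> W d" using width_mono[OF \<open>i \<le> d\<close>] by (auto simp: W_def)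
      have "(\<Sum>j\<in>W i. conn i (unit_at j # g j # A)) = (\<Sum>j\<in>W d. conn i (unit_at j # g j # A))"
        by (rule sum.mono_neutral_left) (use sub z in \<open>auto simp: W_def\<close>)
      moreover have "(\<Sum>j\<in>W i. \<Sum>p\<in>{..i}. sum_split (\<lambda>A1 A2. conn p (unit_at j # A1) * conn (i - p) (g j # A2)) A) =
        (\<Sum>j\<in>W d. \<Sum>p\<in>{..i}. sum_split (\<lambda>A1 A2. conn p (unit_at j # A1) * conn (i - p) (g j # A2)) A)"
        by (rule sum.mono_neutral_left) (use sub z in \<open>auto simp: W_def sum_split_zero\<close>)
      ultimately show ?thesis by (simp add: W_def g_def)
    qed
    have "(\<Sum>i\<le>Suc d. sum_split (\<lambda>A B. conn i (x # A) * disc (Suc d - i) B) L) =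
       (\<Sum>i\<le>d. sum_split (\<lambda>A B. conn (Suc i) (x # A) * disc (d - i) B) L)"
      unfolding sum.atMost_Suc_shift by (simp add: sum_split_zero)
    also have "\<dots> = (\<Sum>j\<in>W d. disc d (unit_at j # g j # L))
      + sum_remove (\<lambda>y R. disc d (quot_m x y # R)) L
      + sum_remove2 (\<lambda>y z R. three_point x y z * disc d R) L + one_point x * disc d L"
    proof -
      have "sum_split (\<lambda>A B. conn (Suc i) (x # A) * disc (d - i) B) L =
         (\<Sum>j\<in>W d. sum_split (\<lambda>A B. conn i (unit_at j # g j # A) * disc (d - i) B) L) +
         (\<Sum>j\<in>W d. \<Sum>p\<le>i. sum_split (\<lambda>A B. sum_split (\<lambda>A1 A2.
           conn p (unit_at j # A1) * conn (i - p) (g j # A2)) A * disc (d - i) B) L) +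
         sum_split (\<lambda>A B. sum_remove (\<lambda>y R. conn i (quot_m x y # R)) A * disc (d - i) B) L +
         sum_split (\<lambda>A B. (if i = 0 \<and> length A = 2 then three_point x (hd A) (hd (tl A)) else 0)
            * disc (d - i) B) L +
         sum_split (\<lambda>A B. (if i = 0 \<and> A = [] then one_point x else 0) * disc (d - i) B) L"
        if "i \<le> d" for i
        by (simp only: conn_W[OF that] sum_distrib_right distrib_right sum_split_add sum_split_sum)
      then show ?thesis
        unfolding 1 2 3 4 by (simp add: sum.distrib)
    qed
    finally show ?thesis
      unfolding Suc disc_Cons W_def g_def by (rule sym)
  qed
qed

lemma disc_single: "disc d [x] = conn d [x]"
proof -
  have "conn i [x] * disc (d - i) [] = (if i = d then conn d [x] else 0)" if "i \<le> d" for i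
  proof (cases "i = d")
    case False
    then have "d - i = Suc (d - i - 1)" using that by simp
    then obtain e where "d - i = Suc e" by blast
    then show ?thesis using False by simp
  qed simp
  then have "(\<Sum>i\<le>d. conn i [x] * disc (d - i) []) = (\<Sum>i\<le>d. if i = d then conn d [x] else 0)"
    by (intro sum.cong) auto
  then show ?thesis using disc_eq_conn[of d x "[]"] by simp
qed

text \<open>
  If \<open>d = 2g - 2 + n\<close> has no solution \<open>g\<close>, there is no surface: the recursion preserves the parity of \<open>d + n\<close>.
\<close>

lemma conn_parity: "(\<And>g. d + 1 \<noteq> 2 * g + length L) \<Longrightarrow> conn d (x # L) = 0"
proof (induction d arbitrary: x L rule: less_induct)
  case (less d')
  show ?case
  proof (cases d')
    case (Suc d)
    have IH: "conn e (x # L) = 0" if "e \<le> d" "\<And>g. e + 1 \<noteq> 2 * g + length L" for e x L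
      using less.IH[of e L x] that Suc by simp
    have 1: "conn d (y # z # L) = 0" for y z
      by (rule IH) (use less.prems[of "Suc _"] Suc in auto)
    have 2: "sum_split (\<lambda>A B. conn i (y # A) * conn (d - i) (z # B)) L = sum_split (\<lambda>A B. 0) L"
      if id: "i \<le> d" for i y z
    proof (rule sum_split_cong)
      fix A B assume "mset (A @ B) = mset L"
      then have len: "length L = length A + length B"
        using mset_eq_length by fastforce
      show "conn i (y # A) * conn (d - i) (z # B) = 0"
      proof (rule ccontr)
        assume "\<not> ?thesis"
        then have "conn i (y # A) \<noteq> 0" "conn (d - i) (z # B) \<noteq> 0" by auto
        moreover obtain g where "i + 1 = 2 * g + length A"
          using IH[OF id, of A y] calculation(1) by metis
        moreover obtain h where "d - i + 1 = 2 * h + length B"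
          using IH[OF diff_le_self, of i B z] calculation(2) by metis
        ultimately have "i + 1 + (d - i + 1) = 2 * g + length A + (2 * h + length B)" by simp
        then have "d' + 1 = 2 * (g + h) + length L" using that len Suc by simp
        then show False using less.prems by blast
      qed
    qed
    have 3: "sum_remove (\<lambda>y R. conn d (quot_m x y # R)) L = sum_remove (\<lambda>y R. 0) L"
    proof (rule sum_remove_cong)
      fix y R assume "mset (y # R) = mset L"
      then have "length L = Suc (length R)" using mset_eq_length by fastforce
      then show "conn d (quot_m x y # R) = 0"
        using less.prems Suc by (intro IH) auto
    qed
    have 4: "\<not> (d = 0 \<and> length L = 2)" "\<not> (d = 0 \<and> L = [])"
      using less.prems[of 0] less.prems[of 1] Suc by auto
    then have 4: "(if d = 0 \<and> length L = 2 then three_point x (hd L) (hd (tl L)) else 0) = 0"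
      "(if d = 0 \<and> L = [] then one_point x else 0) = 0" by meson+
    show ?thesis
      unfolding Suc conn.simps 4 by (simp add: 1 2 3 sum_split_zero sum_remove_zero)
  qed simp
qed

lemma conn_point:
  assumes "v \<noteq> 0"
  shows "(\<Sum>j=- int (width d)..int (width d). conn d (unit_at j # (\<lambda>k. pull_m (point v) (j + k)) # L)) =
      mfun v * conn d (point v # point v # L)"
    and "i \<le> d \<Longrightarrow> (\<Sum>j=- int (width d)..int (width d).
        conn i (unit_at j # A) * conn (d - i) ((\<lambda>k. pull_m (point v) (j + k)) # B)) =
      mfun v * (conn i (point v # A) * conn (d - i) (point v # B))"
proof -
  have p: "(\<lambda>k. pull_m (point v) (j + k)) = (\<lambda>k. (mfun v * point v j) * point v k)" for j
    unfolding pull_m_point[OF assms] using assms by (simp add: point_def power_int_add mult_ac)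
  show "(\<Sum>j=- int (width d)..int (width d). conn d (unit_at j # (\<lambda>k. pull_m (point v) (j + k)) # L)) =
      mfun v * conn d (point v # point v # L)"
    unfolding p form_scale_arg[OF form_conn_2] formD[OF form_conn_1, of d "point v" "point v # L"]
    by (simp add: sum_distrib_left mult_ac)
  assume "i \<le> d"
  have f: "form (width d) (\<lambda>l. conn i (l # A))"
    by (rule form_mono[OF form_conn_1 width_mono[OF \<open>i \<le> d\<close>]])
  show "(\<Sum>j=- int (width d)..int (width d).
        conn i (unit_at j # A) * conn (d - i) ((\<lambda>k. pull_m (point v) (j + k)) # B)) =
      mfun v * (conn i (point v # A) * conn (d - i) (point v # B))"
    unfolding p form_scale_arg[OF form_conn_1] formD[OF f, of "point v"]
    by (simp add: sum_distrib_left sum_distrib_right mult_ac)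
qed

section \<open>Residues at the ramification points\<close>

definition cay :: "complex \<Rightarrow> complex" where "cay z = (z + 1) / (z - 1)"

definition dcay :: "complex \<Rightarrow> complex" where "dcay z = - 2 / (z - 1)\<^sup>2"

lemma has_field_derivative_cay: "z \<noteq> 1 \<Longrightarrow> (cay has_field_derivative dcay z) (at z within S)"
  unfolding cay_def[abs_def] dcay_def
  by (auto intro!: derivative_eq_intros simp: power2_eq_square)

lemma cay_nonzero: "z \<noteq> 1 \<Longrightarrow> z \<noteq> - 1 \<Longrightarrow> cay z \<noteq> 0"
  by (simp add: cay_def eq_neg_iff_add_eq_0)

lemma holomorphic_cay: "1 \<notin> S \<Longrightarrow> cay holomorphic_on S"
  unfolding cay_def[abs_def] by (auto intro!: holomorphic_intros)

lemma holomorphic_dcay: "1 \<notin> S \<Longrightarrow> dcay holomorphic_on S"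
  unfolding dcay_def[abs_def] by (auto intro!: holomorphic_intros)

lemma holomorphic_cay_powi:
  assumes "1 \<notin> S" "- 1 \<notin> S" shows "(\<lambda>z. cay z powi k) holomorphic_on S"
proof (rule holomorphic_on_power_int[OF _ holomorphic_cay[OF assms(1)]])
  have "cay z \<noteq> 0" if "z \<in> S" for z
    using assms that by (intro cay_nonzero) auto
  then show "0 \<le> k \<or> (\<forall>z\<in>S. cay z \<noteq> 0)" by blast
qed

lemma cay_inverse: "z \<noteq> 0 \<Longrightarrow> z \<noteq> 1 \<Longrightarrow> cay (1 / z) = - cay z"
  by (simp add: cay_def divide_simps) (simp add: algebra_simps)

lemma dcay_inverse: "z \<noteq> 0 \<Longrightarrow> z \<noteq> 1 \<Longrightarrow> dcay (1 / z) = z\<^sup>2 * dcay z"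
  by (simp add: dcay_def divide_simps) (simp add: algebra_simps power2_eq_square)

text \<open>
  The functions of \<open>z\<close> whose residues at the ramification points can be added.
\<close>

definition punct :: "(complex \<Rightarrow> complex) \<Rightarrow> bool" where
  "punct f \<longleftrightarrow> (\<forall>r\<in>{1, - 1}. \<exists>S. open S \<and> r \<in> S \<and> f holomorphic_on S - {r})"

text \<open>
  The operation \<open>\<Sum>r. Res\<close> of the recursion.
\<close>

definition res2 :: "(complex \<Rightarrow> complex) \<Rightarrow> complex" where
  "res2 f = residue f 1 + residue f (- 1)"

lemma punctI:
  assumes "f holomorphic_on - A" "finite A" shows "punct f"
  unfolding punct_def
proof
  fix r :: complex
  have "open (- (A - {r}))"
    by (rule open_Compl, rule finite_imp_closed) (simp add: assms(2))
  moreover have "f holomorphic_on - (A - {r}) - {r}"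
    by (rule holomorphic_on_subset[OF assms(1)]) auto
  ultimately show "\<exists>S. open S \<and> r \<in> S \<and> f holomorphic_on S - {r}" by auto
qed

lemma punct_pair:
  assumes "punct f" "punct g" "r \<in> {1, - 1}"
  obtains S where "open S" "r \<in> S" "f holomorphic_on S - {r}" "g holomorphic_on S - {r}"
proof -
  obtain S T where "open S" "r \<in> S" "f holomorphic_on S - {r}" "open T" "r \<in> T" "g holomorphic_on T - {r}"
    using assms unfolding punct_def by metis
  then show ?thesis
    by (intro that[of "S \<inter> T"]) (auto intro: holomorphic_on_subset)
qed

lemma punct_add: "punct f \<Longrightarrow> punct g \<Longrightarrow> punct (\<lambda>z. f z + g z)"
  unfolding punct_def[of "\<lambda>z. f z + g z"]
  by (metis punct_pair holomorphic_on_add)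

lemma punct_mult: "punct f \<Longrightarrow> punct g \<Longrightarrow> punct (\<lambda>z. f z * g z)"
  unfolding punct_def[of "\<lambda>z. f z * g z"]
  by (metis punct_pair holomorphic_on_mult)

lemma punct_const: "punct (\<lambda>z. c)"
  by (rule punctI[of _ "{}"]) (auto intro: holomorphic_intros)

lemma punct_cmult: "punct f \<Longrightarrow> punct (\<lambda>z. c * f z)"
  by (rule punct_mult[OF punct_const])

lemma punct_sum: "(\<And>i. i \<in> I \<Longrightarrow> punct (f i)) \<Longrightarrow> punct (\<lambda>z. \<Sum>i\<in>I. f i z)"
  by (induction I rule: infinite_finite_induct) (auto intro: punct_const punct_add)

lemma res2_add: "punct f \<Longrightarrow> punct g \<Longrightarrow> res2 (\<lambda>z. f z + g z) = res2 f + res2 g"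
proof -
  assume p: "punct f" "punct g"
  have "residue (\<lambda>z. f z + g z) r = residue f r + residue g r" if "r \<in> {1, - 1}" for r
    by (rule punct_pair[OF p that]) (rule residue_add)
  then show ?thesis by (simp add: res2_def)
qed

lemma res2_cmult: "punct f \<Longrightarrow> res2 (\<lambda>z. c * f z) = c * res2 f"
proof -
  assume p: "punct f"
  have "residue (\<lambda>z. c * f z) r = c * residue f r" if "r \<in> {1, - 1}" for r
    by (rule punct_pair[OF p p that]) (rule residue_lmul)
  then show ?thesis by (simp add: res2_def algebra_simps)
qed

lemma res2_zero: "res2 (\<lambda>z. 0) = 0"
  by (simp add: res2_def residue_const)

lemma res2_sum:
  "(\<And>i. i \<in> I \<Longrightarrow> punct (f i)) \<Longrightarrow> res2 (\<lambda>z. \<Sum>i\<in>I. f i z) = (\<Sum>i\<in>I. res2 (f i))"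
  by (induction I rule: infinite_finite_induct) (auto simp: res2_zero res2_add punct_sum)

lemma res2_cong:
  assumes "\<And>r. r \<in> {1, - 1} \<Longrightarrow> eventually (\<lambda>z. f z = g z) (at r)"
  shows "res2 f = res2 g"
  unfolding res2_def using assms by (intro arg_cong2[where f = "(+)"] residue_cong) auto

lemma eventually_not_in_finite:
  fixes A :: "complex set"
  shows "finite A \<Longrightarrow> eventually (\<lambda>z. z \<notin> A) (at r)"
proof -
  assume "finite A"
  then have "open (- (A - {r}))" by (intro open_Compl finite_imp_closed) simp
  then have "eventually (\<lambda>z. z \<in> - (A - {r}) - {r}) (at r)"
    by (intro eventually_at_in_open) auto
  then show ?thesis by eventually_elim auto
qed

lemma res2_cong_finite:
  assumes "finite A" "\<And>z. z \<notin> A \<Longrightarrow> f z = g z"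
  shows "res2 f = res2 g"
  by (rule res2_cong, rule eventually_mono[OF eventually_not_in_finite[OF assms(1)] assms(2)])

lemma residue_deriv_eq_0:
  assumes "open S" "r \<in> S" "\<And>z. z \<in> S - {r} \<Longrightarrow> (F has_field_derivative f z) (at z)"
  shows "residue f r = 0"
proof -
  obtain e where e: "e > 0" "cball r e \<subseteq> S"
    using assms open_contains_cball_eq by blast
  have "open (S - {r})" using assms(1) by auto
  then have "f holomorphic_on S - {r}"
    using assms(3) by (meson DERIV_deriv_iff_field_differentiable derivative_is_holomorphic
        has_field_derivative_at_within)
  then have "(f has_contour_integral 2 * pi * \<i> * residue f r) (circlepath r e)"
    using base_residue[OF assms(1,2) e(1)] e(2) by blast
  moreover have "(f has_contour_integral
      (F (pathfinish (circlepath r e)) - F (pathstart (circlepath r e)))) (circlepath r e)"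
    by (rule contour_integral_primitive[of "S - {r}"])
      (use assms(3) e in \<open>auto intro: has_field_derivative_at_within simp: path_image_circlepath\<close>)
  ultimately have "2 * pi * \<i> * residue f r = 0"
    using has_contour_integral_unique by fastforce
  then show ?thesis by simp
qed

text \<open>
  An exact differential has no residues, which allows integration by parts.
\<close>

lemma res2_deriv_eq_0:
  assumes "finite A" "\<And>z. z \<notin> A \<Longrightarrow> (F has_field_derivative f z) (at z)"
  shows "res2 f = 0"
proof -
  have "residue f r = 0" for r
  proof (rule residue_deriv_eq_0[of "- (A - {r})" _ F])
    show "open (- (A - {r}))" using assms(1) by (intro open_Compl finite_imp_closed) simp
  qed (use assms(2) in auto)
  then show ?thesis by (simp add: res2_def)
qed

lemma punct_cay_powi: "punct (\<lambda>z. cay z powi k * dcay z)"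
  by (rule punctI[of _ "{1, - 1}"])
    (auto intro!: holomorphic_intros holomorphic_cay_powi holomorphic_dcay)

lemma has_field_derivative_cay_powi:
  assumes "z \<noteq> 1" "z \<noteq> - 1"
  shows "((\<lambda>z. cay z powi k) has_field_derivative of_int k * cay z powi (k - 1) * dcay z) (at z)"
  using DERIV_power_int[OF has_field_derivative_cay[OF assms(1)] disjI2[OF cay_nonzero[OF assms]]]
  by (simp add: mult_ac)

lemma res2_cay_powi: "res2 (\<lambda>z. cay z powi k * dcay z) = 0"
proof (cases "k = - 1")
  case False
  then have k: "complex_of_int (k + 1) \<noteq> 0" by (metis add.inverse_unique add.commute of_int_eq_0_iff)
  show ?thesis
  proof (rule res2_deriv_eq_0[of "{1, - 1}" "\<lambda>z. cay z powi (k + 1) / of_int (k + 1)"])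
    fix z :: complex assume "z \<notin> {1, - 1}"
    then show "((\<lambda>z. cay z powi (k + 1) / of_int (k + 1)) has_field_derivative cay z powi k * dcay z) (at z)"
      using DERIV_cdivide[OF has_field_derivative_cay_powi[of z "k + 1"], of "of_int (k + 1)"] k
      by (simp del: of_int_add)
  qed simp
next
  case True
  have e: "cay z powi k * dcay z = - 2 / (z + 1) / (z - 1)" "cay z powi k * dcay z = - 2 / (z - 1) / (z + 1)"
    if "z \<notin> {1, - 1}" for z
  proof -
    have e: "b / a * (- (2 / b\<^sup>2)) = - (2 / (a * b))" if "a \<noteq> 0" "b \<noteq> 0" for a b :: complex
      using that by (simp add: power2_eq_square)
    have c: "cay z powi k = (z - 1) / (z + 1)" "dcay z = - (2 / (z - 1)\<^sup>2)"
      by (simp_all add: True power_int_minus cay_def dcay_def)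
    have "z + 1 \<noteq> 0" "z - 1 \<noteq> 0" using that by (auto simp: eq_neg_iff_add_eq_0)
    then show "cay z powi k * dcay z = - 2 / (z + 1) / (z - 1)" "cay z powi k * dcay z = - 2 / (z - 1) / (z + 1)"
      using e[of "z + 1" "z - 1"] unfolding c by (simp_all add: mult.commute)
  qed
  have "residue (\<lambda>z. cay z powi k * dcay z) 1 = residue (\<lambda>z. - 2 / (z + 1) / (z - 1)) 1"
    by (rule residue_cong, rule eventually_mono[OF eventually_not_in_finite[of "{1, - 1}"]])
      (use e in auto)
  also have "\<dots> = - 2 / (1 + 1)"
    by (rule residue_simple[of "- {- 1}"])
      (auto intro!: holomorphic_intros simp: eq_neg_iff_add_eq_0)
  finally have 1: "residue (\<lambda>z. cay z powi k * dcay z) 1 = - 1" by simp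
  have "residue (\<lambda>z. cay z powi k * dcay z) (- 1) = residue (\<lambda>z. - 2 / (z - 1) / (z - (- 1))) (- 1)"
    by (rule residue_cong, rule eventually_mono[OF eventually_not_in_finite[of "{1, - 1}"]])
      (use e in auto)
  also have "\<dots> = - 2 / (- 1 - 1)"
    by (rule residue_simple[of "- {1}"]) (auto intro!: holomorphic_intros)
  finally show ?thesis using 1 by (simp add: res2_def)
qed

text \<open>
  The solutions of \<open>w(z)\<^sup>2 = v\<close>, with denominators cleared, so that they form the zero set of a polynomial in \<open>z\<close>.
\<close>

definition fibre :: "complex \<Rightarrow> complex set" where
  "fibre v = {z. v * (z - 1)\<^sup>2 = (z + 1)\<^sup>2}"

lemma finite_fibre: "finite (fibre v)"
proof -
  have "fibre v = {z. poly [:v - 1, - 2 * v - 2, v - 1:] z = 0}"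
    by (auto simp: fibre_def algebra_simps power2_eq_square)
  moreover have "[:v - 1, - 2 * v - 2, v - 1:] \<noteq> 0"
  proof
    assume "[:v - 1, - 2 * v - 2, v - 1:] = 0"
    then have "v = 1" "v + 1 = 0" by (auto simp: algebra_simps add_eq_0_iff)
    then show False by simp
  qed
  ultimately show ?thesis using poly_roots_finite by metis
qed

lemma cay_fibre: "z \<noteq> 1 \<Longrightarrow> (cay z)\<^sup>2 = v \<longleftrightarrow> z \<in> fibre v"
  by (auto simp: cay_def fibre_def power_divide field_simps)

lemma fibre_not: "v \<noteq> 0 \<Longrightarrow> 1 \<notin> fibre v \<and> - 1 \<notin> fibre v"
  by (auto simp: fibre_def)

text \<open>
  The recursion kernel in the Cayley coordinate, without the factor \<open>m\<close>.
\<close>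

definition Kern :: "complex \<Rightarrow> complex \<Rightarrow> complex" where
  "Kern v0 z = cay z * dcay z / (v0 - (cay z)\<^sup>2)"

text \<open>
  The sum \<open>1/(w - b)\<^sup>2 + 1/(w + b)\<^sup>2\<close> with \<open>v = b\<^sup>2\<close>: a spectator of type \<open>W\<^sub>0\<^sub>,\<^sub>2\<close> can be attached to \<open>z\<close> or to
  \<open>1/z\<close>.
\<close>

definition Berg :: "complex \<Rightarrow> complex \<Rightarrow> complex" where
  "Berg v z = 2 * ((cay z)\<^sup>2 + v) / ((cay z)\<^sup>2 - v)\<^sup>2"

lemma holomorphic_Kern:
  assumes "1 \<notin> S" "S \<inter> fibre v0 = {}" shows "Kern v0 holomorphic_on S"
proof -
  have "(cay z)\<^sup>2 \<noteq> v0 \<and> v0 \<noteq> (cay z)\<^sup>2" if "z \<in> S" for z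
    using assms that cay_fibre[of z v0] by fastforce
  then show ?thesis
    unfolding Kern_def[abs_def]
    by (intro holomorphic_intros holomorphic_cay holomorphic_dcay assms(1)) simp_all
qed

lemma holomorphic_Berg:
  assumes "1 \<notin> S" "S \<inter> fibre v = {}" shows "Berg v holomorphic_on S"
proof -
  have "(cay z)\<^sup>2 \<noteq> v \<and> v \<noteq> (cay z)\<^sup>2" if "z \<in> S" for z
    using assms that cay_fibre[of z v] by fastforce
  then show ?thesis
    unfolding Berg_def[abs_def]
    by (intro holomorphic_intros holomorphic_cay holomorphic_dcay assms(1)) simp_all
qed

lemma punct_Kern: "punct (Kern v0)"
  by (rule punctI[of _ "insert 1 (fibre v0)"]) (auto intro!: holomorphic_Kern finite_fibre)

lemma punct_Berg: "punct (Berg v0)"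
  by (rule punctI[of _ "insert 1 (fibre v0)"]) (auto intro!: holomorphic_Berg finite_fibre)

lemma punct_powi: "punct (\<lambda>z. cay z powi k)"
  by (rule punctI[of _ "{1, - 1}"]) (auto intro!: holomorphic_cay_powi)

lemma Kern_eq:
  assumes "z \<noteq> 1"
  shows "Kern v0 z = - 2 * (z + 1) / (v0 * (z - 1)\<^sup>2 - (z + 1)\<^sup>2) / (z - 1)"
proof -
  define D where "D = v0 - (cay z)\<^sup>2"
  have "Kern v0 z = ((z + 1) * (- 2)) / ((z - 1) * ((z - 1)\<^sup>2 * D))"
    unfolding Kern_def D_def[symmetric] cay_def dcay_def times_divide_times_eq divide_divide_eq_left
    by (simp only: D_def cay_def mult.assoc)
  then have "Kern v0 z = ((z + 1) * (- 2)) / ((z - 1) * ((z - 1)\<^sup>2 * (v0 - (cay z)\<^sup>2)))"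
    unfolding D_def .
  also have "(z - 1)\<^sup>2 * (v0 - (cay z)\<^sup>2) = v0 * (z - 1)\<^sup>2 - (z + 1)\<^sup>2"
    using assms by (simp add: cay_def power_divide algebra_simps)
  finally show ?thesis by (simp add: mult_ac)
qed

lemma Berg_eq:
  assumes "z \<noteq> 1"
  shows "Berg v z = 2 * (z - 1)\<^sup>2 * ((z + 1)\<^sup>2 + v * (z - 1)\<^sup>2) / ((z + 1)\<^sup>2 - v * (z - 1)\<^sup>2)\<^sup>2"
proof -
  have "((z - 1)\<^sup>2)\<^sup>2 * ((cay z)\<^sup>2 - v)\<^sup>2 = ((z - 1)\<^sup>2 * ((cay z)\<^sup>2 - v))\<^sup>2"
    by (simp add: power_mult_distrib)
  also have "(z - 1)\<^sup>2 * ((cay z)\<^sup>2 - v) = (z + 1)\<^sup>2 - v * (z - 1)\<^sup>2"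
    using assms by (simp add: cay_def power_divide algebra_simps)
  finally have 1: "((z + 1)\<^sup>2 - v * (z - 1)\<^sup>2)\<^sup>2 = ((z - 1)\<^sup>2)\<^sup>2 * ((cay z)\<^sup>2 - v)\<^sup>2" ..
  have 2: "(z + 1)\<^sup>2 + v * (z - 1)\<^sup>2 = (z - 1)\<^sup>2 * ((cay z)\<^sup>2 + v)"
    using assms by (simp add: cay_def power_divide algebra_simps)
  show ?thesis
    unfolding 1 2 Berg_def using assms by (simp add: power2_eq_square)
qed

lemma res2_Kern:
  assumes "v0 \<noteq> 0" shows "res2 (Kern v0) = 1"
proof -
  define S where "S = - fibre v0"
  have S: "open S" "1 \<in> S" "- 1 \<in> S"
    using fibre_not[OF assms] by (auto simp: S_def intro!: open_Compl finite_imp_closed finite_fibre)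
  have h: "(\<lambda>z. - 2 * (z + 1) / (v0 * (z - 1)\<^sup>2 - (z + 1)\<^sup>2)) holomorphic_on S"
    by (intro holomorphic_intros) (auto simp: S_def fibre_def)
  have "residue (Kern v0) 1 = residue (\<lambda>z. - 2 * (z + 1) / (v0 * (z - 1)\<^sup>2 - (z + 1)\<^sup>2) / (z - 1)) 1"
    by (rule residue_cong, rule eventually_mono[OF eventually_not_in_finite[of "{1}"]])
      (use Kern_eq in auto)
  also have "\<dots> = - 2 * (1 + 1) / (v0 * (1 - 1)\<^sup>2 - (1 + 1)\<^sup>2)"
    by (rule residue_simple[OF S(1,2) h])
  finally have 1: "residue (Kern v0) 1 = 1" by simp
  have "residue (Kern v0) (- 1) = 0"
    by (rule residue_holo[of "- insert 1 (fibre v0)"])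
      (use fibre_not[OF assms] in \<open>auto intro!: holomorphic_Kern open_Compl finite_imp_closed finite_fibre\<close>)
  then show ?thesis using 1 by (simp add: res2_def)
qed

text \<open>
  The kernel reproduces Laurent polynomials in \<open>w\<^sup>2\<close>: passing from \<open>k\<close> to \<open>k + 1\<close> changes the differential by
  a multiple of \<open>w\<^sup>2\<^sup>k\<^sup>+\<^sup>1 dw\<close>, which has zero total residue.
\<close>

lemma res2_powi_Kern:
  assumes "v0 \<noteq> 0"
  shows "res2 (\<lambda>z. cay z powi (2 * k) * Kern v0 z) = v0 powi k"
proof (induction k rule: int_shift_induct)
  case 1
  show ?case using res2_Kern[OF assms] by simp
next
  case (2 k)
  have "res2 (\<lambda>z. cay z powi (2 * (k + 1)) * Kern v0 z) =
      res2 (\<lambda>z. v0 * (cay z powi (2 * k) * Kern v0 z) + (- 1) * (cay z powi (2 * k + 1) * dcay z))"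
  proof (rule res2_cong_finite[of "{1, - 1} \<union> fibre v0"])
    fix z assume z: "z \<notin> {1, - 1} \<union> fibre v0"
    then have c: "cay z \<noteq> 0" "v0 - (cay z)\<^sup>2 \<noteq> 0" using cay_nonzero cay_fibre by auto
    then have "cay z powi (2 * (k + 1)) = cay z powi (2 * k) * (cay z)\<^sup>2"
      "cay z powi (2 * k + 1) = cay z powi (2 * k) * cay z"
      by (simp_all add: power_int_add distrib_left)
    then show "cay z powi (2 * (k + 1)) * Kern v0 z =
        v0 * (cay z powi (2 * k) * Kern v0 z) + (- 1) * (cay z powi (2 * k + 1) * dcay z)"
      using c by (simp add: Kern_def field_simps)
  qed (simp add: finite_fibre)
  also have "\<dots> = v0 * res2 (\<lambda>z. cay z powi (2 * k) * Kern v0 z)"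
    by (simp only: res2_add[OF punct_cmult punct_cmult] res2_cmult punct_mult punct_powi punct_Kern
        punct_cay_powi res2_cay_powi mult_zero_right add_0_right)
  finally show ?case using assms by (simp add: power_int_add)
qed

lemma res2_powi_Berg:
  assumes "v \<noteq> 0"
  shows "res2 (\<lambda>z. cay z powi (2 * q + 1) * dcay z * Berg v z) = - (4 * of_int q + 2) * v powi q"
proof -
  define F where "F z = 2 * cay z powi (2 * q + 2) / ((cay z)\<^sup>2 - v)" for z
  define f where "f z = (2 * of_int (2 * q + 2) * cay z powi (2 * q + 1) * ((cay z)\<^sup>2 - v)
      - 4 * cay z powi (2 * q + 3)) * dcay z / ((cay z)\<^sup>2 - v)\<^sup>2" for z
  let ?A = "{1, - 1} \<union> fibre v"
  have fin: "finite ?A" by (simp add: finite_fibre)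
  have F: "(F has_field_derivative f z) (at z)" if "z \<notin> ?A" for z
  proof -
    have c: "cay z \<noteq> 0" "(cay z)\<^sup>2 - v \<noteq> 0" using that cay_nonzero cay_fibre by auto
    have d1: "((\<lambda>z. 2 * cay z powi (2 * q + 2)) has_field_derivative
        2 * (of_int (2 * q + 2) * cay z powi (2 * q + 2 - 1) * dcay z)) (at z)"
      by (intro DERIV_cmult has_field_derivative_cay_powi) (use that in auto)
    have d2: "((\<lambda>z. (cay z)\<^sup>2 - v) has_field_derivative 2 * cay z * dcay z) (at z)"
      using that by (auto intro!: derivative_eq_intros has_field_derivative_cay)
    have p: "cay z powi (2 * q + 2 - 1) = cay z powi (2 * q + 1)"
      "cay z powi (2 * q + 3) = cay z powi (2 * q + 2) * cay z"
      using c power_int_add_1[of "cay z" "2 * q + 2"] by (simp_all add: add.commute)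
    show ?thesis
      unfolding F_def[abs_def] f_def
      by (rule DERIV_cong[OF DERIV_divide[OF d1 d2 c(2)]])
        (simp only: p, simp add: algebra_simps power2_eq_square)
  qed
  have pf: "punct f"
    by (rule punctI[OF _ fin], unfold f_def[abs_def],
        intro holomorphic_intros holomorphic_cay_powi holomorphic_cay holomorphic_dcay)
      (use cay_fibre in auto)
  have "res2 (\<lambda>z. cay z powi (2 * q + 1) * dcay z * Berg v z) =
      res2 (\<lambda>z. (- 1) * f z + (- (4 * of_int q + 2)) * (cay z powi (2 * q) * Kern v z))"
  proof (rule res2_cong_finite[OF fin])
    fix z assume z: "z \<notin> ?A"
    define D where "D = (cay z)\<^sup>2 - v"
    have c: "cay z \<noteq> 0" "D \<noteq> 0" using z cay_nonzero cay_fibre by (auto simp: D_def)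
    have p: "cay z powi (2 * q + 1) = cay z powi (2 * q) * cay z"
      "cay z powi (2 * q + 3) = cay z powi (2 * q) * cay z * (cay z)\<^sup>2"
      using c by (simp_all add: power_int_add power3_eq_cube power2_eq_square)
    have v: "v = (cay z)\<^sup>2 - D" "v - (cay z)\<^sup>2 = - D" by (simp_all add: D_def)
    show "cay z powi (2 * q + 1) * dcay z * Berg v z =
        (- 1) * f z + (- (4 * of_int q + 2)) * (cay z powi (2 * q) * Kern v z)"
      unfolding f_def p Berg_def Kern_def D_def[symmetric] v(2) using c
      by (simp add: divide_simps) (simp add: v(1) algebra_simps power2_eq_square)
  qed
  also have "\<dots> = (- 1) * res2 f + (- (4 * of_int q + 2)) * res2 (\<lambda>z. cay z powi (2 * q) * Kern v z)"
    by (simp only: res2_add[OF punct_cmult punct_cmult] res2_cmult punct_mult punct_powi punct_Kern pf)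
  also have "res2 f = 0" by (rule res2_deriv_eq_0[OF fin F])
  finally show ?thesis by (simp add: res2_powi_Kern[OF assms])
qed

lemma res2_Kern_Berg:
  assumes "v0 \<noteq> 0" "v \<noteq> 0" shows "res2 (\<lambda>z. Kern v0 z * Berg v z) = 0"
proof -
  define f where "f z = - 4 * (z + 1) * (z - 1) * ((z + 1)\<^sup>2 + v * (z - 1)\<^sup>2) /
    ((v0 * (z - 1)\<^sup>2 - (z + 1)\<^sup>2) * ((z + 1)\<^sup>2 - v * (z - 1)\<^sup>2)\<^sup>2)" for z
  let ?S = "- (fibre v0 \<union> fibre v)"
  have e: "Kern v0 z * Berg v z = f z" if "z \<notin> {1}" for z
  proof -
    have "a / d / b * (2 * b\<^sup>2 * c / e) = 2 * a * b * c / (d * e)" if "b \<noteq> 0" for a b c d e :: complex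
      using that by (simp add: power2_eq_square)
    from this[of "z - 1"] have "Kern v0 z * Berg v z =
        2 * (- 2 * (z + 1)) * (z - 1) * ((z + 1)\<^sup>2 + v * (z - 1)\<^sup>2) /
        ((v0 * (z - 1)\<^sup>2 - (z + 1)\<^sup>2) * ((z + 1)\<^sup>2 - v * (z - 1)\<^sup>2)\<^sup>2)"
      using that Kern_eq[of z v0] Berg_eq[of z v] by simp
    also have "2 * (- 2 * (z + 1)) * (z - 1) = - 4 * (z + 1) * (z - 1)" by simp
    finally show ?thesis unfolding f_def .
  qed
  have o: "open ?S" by (intro open_Compl finite_imp_closed finite_UnI finite_fibre)
  have h: "f holomorphic_on ?S"
    unfolding f_def[abs_def] by (intro holomorphic_intros) (auto simp: fibre_def)
  have "residue f r = 0" if "r \<in> {1, - 1}" for r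
    by (rule residue_holo[OF o _ h]) (use fibre_not assms that in auto)
  then have "res2 f = 0" by (simp add: res2_def)
  then show ?thesis using res2_cong_finite[of "{1}", OF _ e] by simp
qed

lemma res2_powi_Kern_Berg:
  assumes "v0 \<noteq> 0" "v \<noteq> 0"
  shows "res2 (\<lambda>z. cay z powi (2 * q) * (Kern v0 z * Berg v z)) = quot (point v0) (point v) q"
proof (induction q rule: int_shift_induct)
  case 1
  show ?case using res2_Kern_Berg[OF assms] by (simp add: quot_0)
next
  case (2 k)
  have "res2 (\<lambda>z. cay z powi (2 * (k + 1)) * (Kern v0 z * Berg v z)) =
      res2 (\<lambda>z. v0 * (cay z powi (2 * k) * (Kern v0 z * Berg v z))
        + (- 1) * (cay z powi (2 * k + 1) * dcay z * Berg v z))"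
  proof (rule res2_cong_finite[of "{1, - 1} \<union> fibre v0"])
    fix z assume z: "z \<notin> {1, - 1} \<union> fibre v0"
    then have c: "cay z \<noteq> 0" "v0 - (cay z)\<^sup>2 \<noteq> 0" using cay_nonzero cay_fibre by auto
    then have p: "cay z powi (2 * (k + 1)) = cay z powi (2 * k) * (cay z)\<^sup>2"
      "cay z powi (2 * k + 1) = cay z powi (2 * k) * cay z"
      by (simp_all add: power_int_add distrib_left)
    have "(cay z)\<^sup>2 * Kern v0 z = v0 * Kern v0 z - cay z * dcay z"
      using c by (simp add: Kern_def field_simps)
    then show "cay z powi (2 * (k + 1)) * (Kern v0 z * Berg v z) =
        v0 * (cay z powi (2 * k) * (Kern v0 z * Berg v z))
        + (- 1) * (cay z powi (2 * k + 1) * dcay z * Berg v z)"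
    proof -
      have "cay z powi (2 * (k + 1)) * (Kern v0 z * Berg v z) =
          cay z powi (2 * k) * Berg v z * ((cay z)\<^sup>2 * Kern v0 z)"
        unfolding p by (simp add: mult_ac)
      then show ?thesis
        unfolding \<open>(cay z)\<^sup>2 * Kern v0 z = v0 * Kern v0 z - cay z * dcay z\<close> p
        by (simp add: algebra_simps)
    qed
  qed (simp add: finite_fibre)
  also have "\<dots> = v0 * res2 (\<lambda>z. cay z powi (2 * k) * (Kern v0 z * Berg v z))
      + (4 * of_int k + 2) * v powi k"
    by (simp only: res2_add[OF punct_cmult punct_cmult] res2_cmult punct_mult punct_powi punct_Kern
        punct_Berg punct_cay_powi res2_powi_Berg[OF assms(2)]) (simp add: algebra_simps)
  finally show ?case
    using assms quot_point_step[OF assms(1), of "point v" k] by (simp add: point_def)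
qed

lemma point_cay: "point ((cay z)\<^sup>2) k = cay z powi (2 * k)"
  by (simp add: point_def power_int_mult)

lemma punct_form: "form N \<phi> \<Longrightarrow> punct (\<lambda>z. \<phi> (point ((cay z)\<^sup>2)))"
  by (subst formD[of N \<phi>], assumption) (auto simp: point_cay intro!: punct_sum punct_cmult punct_powi)

lemma res2_form_Kern:
  assumes "form N \<phi>" "v0 \<noteq> 0"
  shows "res2 (\<lambda>z. \<phi> (point ((cay z)\<^sup>2)) * Kern v0 z) = \<phi> (point v0)"
proof -
  have "res2 (\<lambda>z. \<phi> (point ((cay z)\<^sup>2)) * Kern v0 z) =
    res2 (\<lambda>z. \<Sum>k=- int N..int N. \<phi> (unit_at k) * (cay z powi (2 * k) * Kern v0 z))"
    by (subst formD[OF assms(1)]) (simp add: point_cay sum_distrib_right mult.assoc)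
  also have "\<dots> = (\<Sum>k=- int N..int N. \<phi> (unit_at k) * v0 powi k)"
    by (subst res2_sum) (simp_all only: res2_cmult punct_cmult punct_mult punct_powi punct_Kern
        res2_powi_Kern[OF assms(2)])
  finally show ?thesis using formD[OF assms(1), of "point v0"] by (simp add: point_def)
qed

lemma res2_form_Kern_Berg:
  assumes "form N \<phi>" "v0 \<noteq> 0" "v \<noteq> 0"
  shows "res2 (\<lambda>z. \<phi> (point ((cay z)\<^sup>2)) * (Kern v0 z * Berg v z)) = \<phi> (quot (point v0) (point v))"
proof -
  have "res2 (\<lambda>z. \<phi> (point ((cay z)\<^sup>2)) * (Kern v0 z * Berg v z)) =
    res2 (\<lambda>z. \<Sum>k=- int N..int N. \<phi> (unit_at k) * (cay z powi (2 * k) * (Kern v0 z * Berg v z)))"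
    by (subst formD[OF assms(1)]) (simp add: point_cay sum_distrib_right mult.assoc)
  also have "\<dots> = (\<Sum>k=- int N..int N. \<phi> (unit_at k) * quot (point v0) (point v) k)"
    by (subst res2_sum) (simp_all only: res2_cmult punct_cmult punct_mult punct_powi punct_Kern
        punct_Berg res2_powi_Kern_Berg[OF assms(2,3)])
  finally show ?thesis using formD[OF assms(1), of "quot (point v0) (point v)"] by simp
qed

section \<open>Topological recursion in the Cayley coordinate\<close>

lemma cay_inj: "z \<noteq> 1 \<Longrightarrow> w \<noteq> 1 \<Longrightarrow> cay z = cay w \<longleftrightarrow> z = w"
  by (simp add: cay_def divide_simps) (simp add: algebra_simps, algebra)

lemma bergman_cay:
  assumes "z \<noteq> 1" "w \<noteq> 1" "z \<noteq> w"
  shows "bergman z w = dcay z * dcay w / (cay z - cay w)\<^sup>2"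
proof -
  define a b where "a = z - 1" and "b = w - 1"
  have nz: "a \<noteq> 0" "b \<noteq> 0" "a \<noteq> b" and zw: "z = a + 1" "w = b + 1"
    using assms by (auto simp: a_def b_def)
  have "cay z - cay w = 2 * (b - a) / (a * b)"
    unfolding zw cay_def using nz by (simp add: field_simps)
  then show ?thesis
    unfolding bergman_def dcay_def zw using nz
    by (simp add: power_divide power_mult_distrib) (simp add: divide_simps, simp add: power2_eq_square algebra_simps)
qed

lemma mfun_cay:
  assumes "z \<noteq> 1" "z \<noteq> - 1" "z \<noteq> 0"
  shows "mfun ((cay z)\<^sup>2) = 2 * z ^ 3 / ((z - 1) ^ 4 * (z + 1)\<^sup>2)"
proof -
  have nz: "z - 1 \<noteq> 0" "z + 1 \<noteq> 0" using assms by (auto simp: eq_neg_iff_add_eq_0)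
  have "(cay z)\<^sup>2 - 1 = 4 * z / (z - 1)\<^sup>2"
    unfolding cay_def using nz by (simp add: power_divide divide_simps) (simp add: power2_eq_square algebra_simps)
  then have "mfun ((cay z)\<^sup>2) = (4 * z / (z - 1)\<^sup>2) ^ 3 / (32 * ((z + 1)\<^sup>2 / (z - 1)\<^sup>2))"
    by (simp add: mfun_def cay_def power_divide)
  also have "\<dots> = 2 * z ^ 3 / ((z - 1) ^ 4 * (z + 1)\<^sup>2)"
    using nz by (simp add: power_divide power_mult_distrib divide_simps)?
  finally show ?thesis .
qed

lemma recursion_kernel_cay:
  assumes "z \<noteq> 0" "z \<noteq> 1" "z \<noteq> - 1" "z0 \<noteq> 1" "s \<noteq> 0" "z0 \<notin> closed_segment (1 / z) z"
  shows "recursion_kernel s z0 z * deriv inverse z * (dcay z * dcay (1 / z)) =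
    1 / s\<^sup>2 * dcay z0 * (mfun ((cay z)\<^sup>2) * Kern ((cay z0)\<^sup>2) z)"
proof -
  have z0: "z0 \<noteq> z" "z0 \<noteq> 1 / z" using assms(6) by auto
  have "(bergman z0 has_contour_integral
      (1 / (z0 - pathfinish (linepath (1 / z) z)) - 1 / (z0 - pathstart (linepath (1 / z) z)))) (linepath (1 / z) z)"
  proof (rule contour_integral_primitive[of "closed_segment (1 / z) z"])
    fix x assume "x \<in> closed_segment (1 / z) z"
    then have "z0 - x \<noteq> 0" using assms(6) by auto
    then show "((\<lambda>x. 1 / (z0 - x)) has_field_derivative bergman z0 x) (at x within closed_segment (1 / z) z)"
      unfolding bergman_def by (auto intro!: derivative_eq_intros simp: power2_eq_square)
  qed auto
  then have int: "contour_integral (linepath (1 / z) z) (bergman z0) = 1 / (z0 - z) - 1 / (z0 - 1 / z)"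
    by (simp add: contour_integral_unique)
  have nz: "z - 1 \<noteq> 0" "z + 1 \<noteq> 0" "z0 - 1 \<noteq> 0" "z0 - z \<noteq> 0" "z * z0 - 1 \<noteq> 0"
    using assms(1-4) z0 by (auto simp: eq_neg_iff_add_eq_0 field_simps)
  have sq: "(cay z0)\<^sup>2 - (cay z)\<^sup>2 = - 4 * (z0 - z) * (z * z0 - 1) / ((z0 - 1)\<^sup>2 * (z - 1)\<^sup>2)"
    using nz by (simp add: cay_def power_divide divide_simps) (simp add: power2_eq_square algebra_simps)
  have K: "Kern ((cay z0)\<^sup>2) z =
      (z + 1) * (z0 - 1)\<^sup>2 / (2 * (z - 1) * (z0 - z) * (z * z0 - 1))"
    unfolding Kern_def sq using nz
    by (simp add: cay_def dcay_def divide_simps) (simp add: power2_eq_square algebra_simps)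
  have d: "1 / (z0 - z) - 1 / (z0 - 1 / z) = (z\<^sup>2 - 1) / ((z0 - z) * (z * z0 - 1))"
  proof -
    have "z0 - 1 / z = (z * z0 - 1) / z" using assms(1) by (simp add: field_simps)
    then show ?thesis using nz assms(1) by (simp add: divide_simps) (simp add: power2_eq_square algebra_simps)
  qed
  have y: "weber_y s z - weber_y s (1 / z) = s * (z\<^sup>2 - 1) / z"
    using assms(1) by (simp add: weber_y_def field_simps power2_eq_square)
  have x: "deriv (weber_x s) z = s * (z\<^sup>2 - 1) / z\<^sup>2"
    using assms(1) by (simp add: deriv_weber_x field_simps)
  have i: "deriv inverse z = - 1 / z\<^sup>2"
    using assms(1) by (simp add: DERIV_imp_deriv[OF DERIV_inverse] power2_eq_square field_simps)
  have z2: "z\<^sup>2 - 1 = (z - 1) * (z + 1)" by (simp add: power2_eq_square algebra_simps)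
  show ?thesis
    unfolding recursion_kernel_def int d y x i K mfun_cay[OF assms(2,3,1)]
      dcay_inverse[OF assms(1,2)] z2 dcay_def
    using nz assms(1,5) by (simp add: divide_simps) (simp add: eval_nat_numeral algebra_simps)
qed

text \<open>
  Near a ramification point the segment from \<open>1/z\<close> to \<open>z\<close> is short, so that it avoids \<open>z0\<close>.
\<close>

lemma eventually_kernel_ok:
  fixes z0 :: complex
  assumes "r \<in> {1, - 1}" "z0 \<noteq> 1" "z0 \<noteq> - 1"
  shows "eventually (\<lambda>z. z0 \<notin> closed_segment (1 / z) z) (at r)"
proof -
  define e where "e = dist z0 r"
  have e: "e > 0" using assms by (auto simp: e_def)
  have "((\<lambda>z. 1 / z) \<longlongrightarrow> 1 / r) (at r)" using assms(1) by (intro tendsto_intros) auto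
  moreover have "1 / r = r" using assms(1) by auto
  ultimately have "((\<lambda>z. 1 / z) \<longlongrightarrow> r) (at r)" by simp
  then have "eventually (\<lambda>z. dist (1 / z) r < e) (at r)" using e by (rule tendstoD)
  moreover have "eventually (\<lambda>z. dist z r < e) (at r)"
    by (rule tendstoD[OF tendsto_ident_at e])
  ultimately show ?thesis
  proof eventually_elim
    case (elim z)
    then have "closed_segment (1 / z) z \<subseteq> ball r e"
      by (intro closed_segment_subset) (auto simp: dist_commute)
    then show ?case by (auto simp: e_def dist_commute)
  qed
qed

lemma sum_split_commute: "sum_split f L = sum_split (\<lambda>A B. f B A) L"
proof (induction L arbitrary: f)
  case (Cons a L)
  show ?case
    using Cons[of "\<lambda>A. f (a # A)"] Cons[of "\<lambda>A B. f A (a # B)"] by simp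
qed simp

definition pt :: "complex \<Rightarrow> functional" where "pt z = point ((cay z)\<^sup>2)"

text \<open>
  The Jacobian of the change of variables in all arguments.
\<close>

definition jac :: "complex list \<Rightarrow> complex" where "jac zs = prod_list (map dcay zs)"

lemma jac_mset: "mset (A @ B) = mset L \<Longrightarrow> jac A * jac B = jac L"
proof -
  assume "mset (A @ B) = mset L"
  then have "image_mset dcay (mset (A @ B)) = image_mset dcay (mset L)" by simp
  then have "prod_mset (image_mset dcay (mset (A @ B))) = prod_mset (image_mset dcay (mset L))"
    by (rule arg_cong)
  then show ?thesis
    by (simp add: jac_def flip: prod_mset_prod_list)
qed

text \<open>
  Summation over the order of a factor is summation over its genus.
\<close>

lemma conn_genus_sum:
  assumes "length A + length B + 2 * g = d + 2"
  shows "(\<Sum>h\<le>g. (c ^ (2 * h + length A - 1) * conn (2 * h + length A - 1) (x # A)) *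
      (c ^ (2 * (g - h) + length B - 1) * conn (2 * (g - h) + length B - 1) (y # B))) =
    c ^ d * (\<Sum>i\<le>d. conn i (x # A) * conn (d - i) (y # B))"
proof -
  define H where "H = {h. h \<le> g \<and> 2 \<le> 2 * h + length A \<and> 2 \<le> 2 * (g - h) + length B}"
  define f where "f h = 2 * h + length A - 1" for h
  have fd: "2 * (g - h) + length B - 1 = d - f h" "f h + (d - f h) = d" if "h \<in> H" for h
    using that assms by (auto simp: H_def f_def)
  have "(\<Sum>h\<le>g. (c ^ (2 * h + length A - 1) * conn (2 * h + length A - 1) (x # A)) *
      (c ^ (2 * (g - h) + length B - 1) * conn (2 * (g - h) + length B - 1) (y # B))) =
    (\<Sum>h\<in>H. (c ^ (2 * h + length A - 1) * conn (2 * h + length A - 1) (x # A)) *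
      (c ^ (2 * (g - h) + length B - 1) * conn (2 * (g - h) + length B - 1) (y # B)))"
  proof (rule sum.mono_neutral_right)
    show "\<forall>h\<in>{..g} - H. (c ^ (2 * h + length A - 1) * conn (2 * h + length A - 1) (x # A)) *
      (c ^ (2 * (g - h) + length B - 1) * conn (2 * (g - h) + length B - 1) (y # B)) = 0"
    proof
      fix h assume "h \<in> {..g} - H"
      then have "2 * h + length A - 1 = 0 \<or> 2 * (g - h) + length B - 1 = 0" by (auto simp: H_def)
      then show "(c ^ (2 * h + length A - 1) * conn (2 * h + length A - 1) (x # A)) *
        (c ^ (2 * (g - h) + length B - 1) * conn (2 * (g - h) + length B - 1) (y # B)) = 0"
        by (elim disjE) (simp_all only: conn.simps mult_zero_right mult_zero_left)
    qed
  qed (auto simp: H_def)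
  also have "\<dots> = (\<Sum>h\<in>H. c ^ d * (conn (f h) (x # A) * conn (d - f h) (y # B)))"
  proof (rule sum.cong[OF refl])
    fix h assume h: "h \<in> H"
    have "c ^ d = c ^ f h * c ^ (d - f h)" using fd(2)[OF h] by (metis power_add)
    then show "(c ^ (2 * h + length A - 1) * conn (2 * h + length A - 1) (x # A)) *
      (c ^ (2 * (g - h) + length B - 1) * conn (2 * (g - h) + length B - 1) (y # B)) =
      c ^ d * (conn (f h) (x # A) * conn (d - f h) (y # B))"
      unfolding fd(1)[OF h] f_def[symmetric] by simp
  qed
  also have "\<dots> = (\<Sum>i\<in>f ` H. c ^ d * (conn i (x # A) * conn (d - i) (y # B)))"
    by (subst sum.reindex) (auto simp: inj_on_def f_def H_def)
  also have "\<dots> = (\<Sum>i\<le>d. c ^ d * (conn i (x # A) * conn (d - i) (y # B)))"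
  proof (rule sum.mono_neutral_left)
    show "f ` H \<subseteq> {..d}" using assms by (auto simp: f_def H_def)
    show "\<forall>i\<in>{..d} - f ` H. c ^ d * (conn i (x # A) * conn (d - i) (y # B)) = 0"
    proof
      fix i assume i: "i \<in> {..d} - f ` H"
      show "c ^ d * (conn i (x # A) * conn (d - i) (y # B)) = 0"
      proof (rule ccontr)
        assume "\<not> ?thesis"
        then have nz: "conn i (x # A) \<noteq> 0" "conn (d - i) (y # B) \<noteq> 0" by auto
        have i0: "i \<noteq> 0" "d - i \<noteq> 0" using nz by (metis conn.simps(1))+
        obtain h where h: "i + 1 = 2 * h + length A" using conn_parity[of i A x] nz by metis
        obtain h' where h': "d - i + 1 = 2 * h' + length B" using conn_parity[of "d - i" B y] nz by metis
        have "i \<le> d" using i by simp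
        then have "h + h' = g" using h h' assms by arith
        then have "h \<in> H" "i = f h" using h h' i0 by (auto simp: H_def f_def)
        then show False using i by blast
      qed
    qed
  qed simp
  finally show ?thesis by (simp add: sum_distrib_left)
qed


lemma res2_sum_remove:
  assumes "\<And>y R. mset (y # R) = mset L \<Longrightarrow> punct (f y R)"
  shows "punct (\<lambda>z. sum_remove (\<lambda>y R. f y R z) L)
    \<and> res2 (\<lambda>z. sum_remove (\<lambda>y R. f y R z) L) = sum_remove (\<lambda>y R. res2 (f y R)) L"
  using assms
proof (induction L arbitrary: f)
  case Nil
  then show ?case by (simp add: punct_const res2_zero)
next
  case (Cons a L)
  have IH: "punct (\<lambda>z. sum_remove (\<lambda>y R. f y (a # R) z) L)
    \<and> res2 (\<lambda>z. sum_remove (\<lambda>y R. f y (a # R) z) L) = sum_remove (\<lambda>y R. res2 (f y (a # R))) L"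
    by (rule Cons.IH, rule Cons.prems) auto
  have "punct (f a L)" by (rule Cons.prems) auto
  then show ?case using IH by (simp add: punct_add res2_add)
qed

lemma pt_nonzero: "z \<noteq> 1 \<Longrightarrow> z \<noteq> - 1 \<Longrightarrow> (cay z)\<^sup>2 \<noteq> 0"
  using cay_nonzero by simp

lemma punct_mfun: "punct (\<lambda>z. mfun ((cay z)\<^sup>2))"
  by (rule punctI[of _ "{1, - 1}"])
    (auto simp: mfun_def intro!: holomorphic_intros holomorphic_cay dest: cay_nonzero)

text \<open>
  The one case where both branches end at spectators, so that no Laurent polynomial is left over to be reproduced
  by the kernel.
\<close>

lemma res2_three_point:
  assumes "w0 \<noteq> 0" "w1 \<noteq> 0" "w2 \<noteq> 0"
  shows "punct (\<lambda>z. mfun ((cay z)\<^sup>2) * Kern (w0\<^sup>2) z * (1 / ((cay z - w1)\<^sup>2 * (cay z + w2)\<^sup>2)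
      + 1 / ((cay z - w2)\<^sup>2 * (cay z + w1)\<^sup>2)))"
    and "res2 (\<lambda>z. mfun ((cay z)\<^sup>2) * Kern (w0\<^sup>2) z * (1 / ((cay z - w1)\<^sup>2 * (cay z + w2)\<^sup>2)
      + 1 / ((cay z - w2)\<^sup>2 * (cay z + w1)\<^sup>2))) =
      three_point (point (w0\<^sup>2)) (point (w1\<^sup>2)) (point (w2\<^sup>2))"
proof -
  define f where "f z = mfun ((cay z)\<^sup>2) * Kern (w0\<^sup>2) z * (1 / ((cay z - w1)\<^sup>2 * (cay z + w2)\<^sup>2)
      + 1 / ((cay z - w2)\<^sup>2 * (cay z + w1)\<^sup>2))" for z
  define a where "a c z = (z + 1) - c * (z - 1)" for c z :: complex
  define S where "S = - (fibre (w0\<^sup>2) \<union> fibre (w1\<^sup>2) \<union> fibre (w2\<^sup>2))"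
  have o: "open S" unfolding S_def by (intro open_Compl finite_imp_closed finite_UnI finite_fibre)
  have mem: "1 \<in> S" "- 1 \<in> S" using fibre_not assms by (auto simp: S_def)
  have anz: "a w1 z \<noteq> 0" "a (- w1) z \<noteq> 0" "a w2 z \<noteq> 0" "a (- w2) z \<noteq> 0"
    "w0\<^sup>2 * (z - 1)\<^sup>2 - (z + 1)\<^sup>2 \<noteq> 0" if "z \<in> S" for z
  proof -
    have "a w z \<noteq> 0 \<and> a (- w) z \<noteq> 0" if "z \<notin> fibre (w\<^sup>2)" for w
    proof -
      have "w\<^sup>2 * (z - 1)\<^sup>2 = (z + 1)\<^sup>2" if "a w z = 0 \<or> a (- w) z = 0"
      proof -
        have "z + 1 = w * (z - 1) \<or> z + 1 = - w * (z - 1)" using that by (auto simp: a_def algebra_simps)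
        then show ?thesis by (auto simp: power_mult_distrib)
      qed
      then show ?thesis using \<open>z \<notin> fibre (w\<^sup>2)\<close> by (auto simp: fibre_def)
    qed
    then show "a w1 z \<noteq> 0" "a (- w1) z \<noteq> 0" "a w2 z \<noteq> 0" "a (- w2) z \<noteq> 0"
      "w0\<^sup>2 * (z - 1)\<^sup>2 - (z + 1)\<^sup>2 \<noteq> 0"
      using that by (auto simp: S_def fibre_def)
  qed
  define h where "h z = - 4 * z ^ 3 / (w0\<^sup>2 * (z - 1)\<^sup>2 - (z + 1)\<^sup>2) *
    (1 / ((a w1 z)\<^sup>2 * (a (- w2) z)\<^sup>2) + 1 / ((a w2 z)\<^sup>2 * (a (- w1) z)\<^sup>2))" for z
  have hol: "h holomorphic_on S"
  proof -
    have "(\<lambda>z. a c z) holomorphic_on S" for c unfolding a_def by (intro holomorphic_intros)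
    then show ?thesis unfolding h_def[abs_def] using anz by (intro holomorphic_intros) auto
  qed
  have e: "f z = h z / ((z + 1) * (z - 1))" if z: "z \<noteq> 1" "z \<noteq> - 1" "z \<noteq> 0" for z
  proof -
    have nz: "z - 1 \<noteq> 0" "z + 1 \<noteq> 0" using z by (auto simp: eq_neg_iff_add_eq_0)
    have c: "cay z - c = a c z / (z - 1)" "cay z + c = a (- c) z / (z - 1)" for c
      using nz by (simp_all add: cay_def a_def field_simps)
    define X where "X = w0\<^sup>2 * (z - 1)\<^sup>2 - (z + 1)\<^sup>2"
    define P where "P = 1 / ((a w1 z)\<^sup>2 * (a (- w2) z)\<^sup>2) + 1 / ((a w2 z)\<^sup>2 * (a (- w1) z)\<^sup>2)"
    have p: "1 / ((x / t)\<^sup>2 * (y / t)\<^sup>2) = t ^ 4 * (1 / (x\<^sup>2 * y\<^sup>2))" if "t \<noteq> 0" for x y t :: complex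
      using that by (simp add: power_divide field_simps) (simp add: eval_nat_numeral)?
    have "f z = (2 * z ^ 3 / ((z - 1) ^ 4 * (z + 1)\<^sup>2)) * (- 2 * (z + 1) / X / (z - 1)) * ((z - 1) ^ 4 * P)"
      unfolding f_def mfun_cay[OF z] Kern_eq[OF z(1)] X_def P_def c p[OF nz(1)] distrib_left ..
    also have "\<dots> = - 4 * z ^ 3 / X * P / ((z + 1) * (z - 1))"
    proof -
      have "(2 * u / (t ^ 4 * q\<^sup>2)) * (- 2 * q / X / t) * (t ^ 4 * P) = - 4 * u / X * P / (q * t)"
        if "t \<noteq> 0" "q \<noteq> 0" for u t q
        using that by (cases "X = 0") (simp_all add: field_simps power2_eq_square)
      then show ?thesis using nz by blast
    qed
    finally show ?thesis unfolding h_def X_def P_def .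
  qed
  have "residue f 1 = residue (\<lambda>z. h z / (z + 1) / (z - 1)) 1"
    by (rule residue_cong, rule eventually_mono[OF eventually_not_in_finite[of "{0, 1, - 1}"]])
      (use e in auto)
  also have "\<dots> = h 1 / (1 + 1)"
    by (rule residue_simple[of "S - {- 1}"])
      (use o mem in \<open>auto intro!: holomorphic_intros holomorphic_on_subset[OF hol]
        simp: eq_neg_iff_add_eq_0\<close>)
  also have "\<dots> = 1 / 16" by (simp add: h_def a_def)
  finally have 1: "residue f 1 = 1 / 16" .
  have "residue f (- 1) = residue (\<lambda>z. h z / (z - 1) / (z - (- 1))) (- 1)"
    by (rule residue_cong, rule eventually_mono[OF eventually_not_in_finite[of "{0, 1, - 1}"]])
      (use e in \<open>auto simp: mult.commute\<close>)
  also have "\<dots> = h (- 1) / (- 1 - 1)"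
    by (rule residue_simple[of "S - {1}"])
      (use o mem in \<open>auto intro!: holomorphic_intros holomorphic_on_subset[OF hol]\<close>)
  also have "\<dots> = - 1 / (16 * w0\<^sup>2 * w1\<^sup>2 * w2\<^sup>2)"
    using assms by (simp add: h_def a_def power_mult_distrib)
  finally have 2: "residue f (- 1) = - 1 / (16 * w0\<^sup>2 * w1\<^sup>2 * w2\<^sup>2)" .
  show "res2 (\<lambda>z. mfun ((cay z)\<^sup>2) * Kern (w0\<^sup>2) z * (1 / ((cay z - w1)\<^sup>2 * (cay z + w2)\<^sup>2)
      + 1 / ((cay z - w2)\<^sup>2 * (cay z + w1)\<^sup>2))) =
      three_point (point (w0\<^sup>2)) (point (w1\<^sup>2)) (point (w2\<^sup>2))"
    unfolding f_def[symmetric] res2_def 1 2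
    using assms by (simp add: three_point_def point_def power_int_minus field_simps)
  have "f holomorphic_on - (- S \<union> {0, 1, - 1})"
  proof (rule holomorphic_transform)
    show "(\<lambda>z. h z / ((z + 1) * (z - 1))) holomorphic_on - (- S \<union> {0, 1, - 1})"
      by (intro holomorphic_intros holomorphic_on_subset[OF hol]) (auto simp: eq_neg_iff_add_eq_0)
  qed (use e in auto)
  then show "punct (\<lambda>z. mfun ((cay z)\<^sup>2) * Kern (w0\<^sup>2) z * (1 / ((cay z - w1)\<^sup>2 * (cay z + w2)\<^sup>2)
      + 1 / ((cay z - w2)\<^sup>2 * (cay z + w1)\<^sup>2)))"
    unfolding f_def[symmetric] by (rule punctI) (auto simp: S_def finite_fibre)
qed

text \<open>
  The terms excluded from the sum are those where one factor would be \<open>W\<^sub>0\<^sub>,\<^sub>1\<close>.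
\<close>

lemma recursion_sum_split:
  "(\<Sum>(h, I) \<in> {..g} \<times> Pow {..<length zs} - {(0, {}), (g, {..<length zs})}.
           corr_fun s h (z # nths zs I) * corr_fun s (g - h) (z' # nths zs ({..<length zs} - I))) =
    (\<Sum>h\<le>g. sum_split (\<lambda>A B. if (h = 0 \<and> A = []) \<or> (h = g \<and> B = []) then 0 else
      corr_fun s h (z # A) * corr_fun s (g - h) (z' # B)) zs)"
proof -
  let ?n = "length zs"
  let ?f = "\<lambda>h A B. if (h = 0 \<and> A = []) \<or> (h = g \<and> B = []) then 0 else
      corr_fun s h (z # A) * corr_fun s (g - h) (z' # B)"
  have len: "length (nths zs J) = card J" if "J \<subseteq> {..<?n}" for J
  proof -
    have "{i. i < ?n \<and> i \<in> J} = J" using that by auto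
    then show ?thesis by (simp add: length_nths)
  qed
  have e: "nths zs J = [] \<longleftrightarrow> J = {}" if "J \<subseteq> {..<?n}" for J
  proof -
    have "finite J" using that finite_subset by blast
    then show ?thesis using len[OF that] by (metis card_0_eq length_0_conv)
  qed
  have "(\<Sum>h\<le>g. sum_split (?f h) zs) = (\<Sum>h\<le>g. \<Sum>I\<in>Pow {..<?n}. ?f h (nths zs I) (nths zs ({..<?n} - I)))"
    by (rule sum.cong[OF refl], rule sum_split_nths[symmetric])
  also have "\<dots> = (\<Sum>(h, I)\<in>{..g} \<times> Pow {..<?n}. ?f h (nths zs I) (nths zs ({..<?n} - I)))"
    by (simp add: sum.cartesian_product)
  also have "\<dots> = (\<Sum>(h, I)\<in>{..g} \<times> Pow {..<?n} - {(0, {}), (g, {..<?n})}.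
      ?f h (nths zs I) (nths zs ({..<?n} - I)))"
    by (rule sum.mono_neutral_right) (auto simp: e)
  also have "\<dots> = (\<Sum>(h, I) \<in> {..g} \<times> Pow {..<?n} - {(0, {}), (g, {..<?n})}.
           corr_fun s h (z # nths zs I) * corr_fun s (g - h) (z' # nths zs ({..<?n} - I)))"
  proof (rule sum.cong[OF refl])
    fix p assume p: "p \<in> {..g} \<times> Pow {..<?n} - {(0, {}), (g, {..<?n})}"
    obtain h I where hI: "p = (h, I)" by (cases p)
    have "I \<subseteq> {..<?n}" "\<not> (h = 0 \<and> I = {})" "\<not> (h = g \<and> {..<?n} - I = {})"
      using p unfolding hI by auto
    then have "\<not> (h = 0 \<and> nths zs I = [] \<or> h = g \<and> nths zs ({..<?n} - I) = [])"
      using e[of I] e[of "{..<?n} - I"] by blast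
    then show "(case p of (h, I) \<Rightarrow> ?f h (nths zs I) (nths zs ({..<?n} - I))) =
      (case p of (h, I) \<Rightarrow> corr_fun s h (z # nths zs I) * corr_fun s (g - h) (z' # nths zs ({..<?n} - I)))"
      unfolding hI prod.case by (rule if_not_P)
  qed
  finally show ?thesis ..
qed


text \<open>
  Induction along the recursion. Near the ramification points the kernel is \<open>m\<close> times \<open>Kern\<close>, the two ways of
  attaching a spectator by \<open>W\<^sub>0\<^sub>,\<^sub>2\<close> add up to \<open>Berg\<close>, and everything else is a Laurent polynomial in \<open>w\<^sup>2\<close>, whose
  residue against these is given by \<open>res2_form_Kern\<close> and \<open>res2_form_Kern_Berg\<close>.
\<close>

theorem corr_fun_cay:
  assumes s: "s \<noteq> 0"
  shows "2 \<le> 2 * g + length zs \<Longrightarrow> z0 \<notin> {1, - 1} \<Longrightarrow> set zs \<inter> {1, - 1} = {} \<Longrightarrow>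
    corr_fun s g (z0 # zs) = (1 / s\<^sup>2) ^ (2 * g + length zs - 1) * (dcay z0 * jac zs) *
      conn (2 * g + length zs - 1) (pt z0 # map pt zs)"
proof (induction "2 * g + length zs" arbitrary: g z0 zs rule: less_induct)
  case less
  define c where "c = 1 / s\<^sup>2"
  obtain d where d: "2 * g + length zs = d + 2" using less.prems(1) by (metis le_Suc_ex add.commute)
  define L where "L = map pt zs"
  have z0: "z0 \<noteq> 1" "z0 \<noteq> - 1" using less.prems by auto
  have zs: "y \<noteq> 1" "y \<noteq> - 1" if "y \<in> set zs" for y using less.prems that by auto
  define v0 where "v0 = (cay z0)\<^sup>2"
  have v0: "v0 \<noteq> 0" using pt_nonzero[OF z0] by (simp add: v0_def)
  have IH: "corr_fun s h (z # A) = c ^ (2 * h + length A - 1) * (dcay z * jac A) *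
      conn (2 * h + length A - 1) (pt z # map pt A)"
    if "2 * h + length A < d + 2" "2 \<le> 2 * h + length A" "z \<notin> {1, - 1}" "set A \<inter> {1, - 1} = {}" for h z A
    using less.hyps[of h A z] that d unfolding c_def by simp
  define w02 where "w02 z = 1 / ((cay z - cay (hd zs))\<^sup>2 * (cay z + cay (hd (tl zs)))\<^sup>2)
      + 1 / ((cay z - cay (hd (tl zs)))\<^sup>2 * (cay z + cay (hd zs))\<^sup>2)" for z
  define Q where "Q z =
      (if g = 0 then 0 else corr_fun s (g - 1) (z # 1 / z # zs)) +
      (\<Sum>(h, I) \<in> {..g} \<times> Pow {..<length zs} - {(0, {}), (g, {..<length zs})}.
         corr_fun s h (z # nths zs I) * corr_fun s (g - h) (1 / z # nths zs ({..<length zs} - I)))" for z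
  define T where "T z = conn d (pt z # pt z # L)
      + (\<Sum>i\<le>d. sum_split (\<lambda>A B. conn i (pt z # A) * conn (d - i) (pt z # B)) L)
      + sum_remove (\<lambda>y R. conn d (pt z # map pt R) * Berg ((cay y)\<^sup>2) z) zs
      + (if d = 0 \<and> zs = [] then 1 / (4 * (cay z)\<^sup>2) else 0)
      + (if d = 0 \<and> length zs = 2 then w02 z else 0)" for z
  let ?A = "{0, 1, - 1} \<union> set zs \<union> (\<lambda>y. 1 / y) ` set zs"
  have bracket: "Q z = c ^ d * (dcay z * dcay (1 / z)) * jac zs * T z" if z: "z \<notin> ?A" for z
  proof -
    have z': "z \<noteq> 0" "z \<noteq> 1" "z \<noteq> - 1" "1 / z \<noteq> 1" "1 / z \<noteq> - 1"
      using z by (auto simp: divide_simps minus_equation_iff[of z 1])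
    have pz: "pt (1 / z) = pt z" using cay_inverse[OF z'(1,2)] by (simp add: pt_def)
    have zy: "z \<noteq> y" "1 / z \<noteq> y" if "y \<in> set zs" for y
    proof -
      have "z \<noteq> 1 / y" using z imageI[OF that, of "\<lambda>y. 1 / y"] by blast
      then show "z \<noteq> y" "1 / z \<noteq> y" using z that by auto
    qed
    have b1: "bergman z y = dcay z * dcay y / (cay z - cay y)\<^sup>2" if "y \<in> set zs" for y
      by (rule bergman_cay[OF z'(2) zs(1)[OF that] zy(1)[OF that]])
    have b2: "bergman (1 / z) y = dcay (1 / z) * dcay y / (cay z + cay y)\<^sup>2" if "y \<in> set zs" for y
      unfolding bergman_cay[OF z'(4) zs(1)[OF that] zy(2)[OF that]] cay_inverse[OF z'(1,2)]
      by (simp add: power2_eq_square algebra_simps)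
    have B: "1 / (cay z - cay y)\<^sup>2 + 1 / (cay z + cay y)\<^sup>2 = Berg ((cay y)\<^sup>2) z" if "y \<in> set zs" for y
    proof -
      have n1: "cay z - cay y \<noteq> 0" using cay_inj[of z y] z' zs[OF that] zy(1)[OF that] by simp
      have n2: "cay z + cay y \<noteq> 0"
        using cay_inj[of "1 / z" y] z' zs[OF that] zy(2)[OF that] cay_inverse[OF z'(1,2)]
        by (simp add: add_eq_0_iff)
      have "(cay z)\<^sup>2 - (cay y)\<^sup>2 = (cay z - cay y) * (cay z + cay y)"
        by (simp add: power2_eq_square algebra_simps)
      then show ?thesis
        unfolding Berg_def using n1 n2
        by (simp add: power_mult_distrib divide_simps) (simp add: power2_eq_square algebra_simps)
    qed
    have one: "(if g = 0 then 0 else corr_fun s (g - 1) (z # 1 / z # zs)) =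
        c ^ d * (dcay z * dcay (1 / z)) * jac zs * (conn d (pt z # pt z # L)
          + (if d = 0 \<and> zs = [] then 1 / (4 * (cay z)\<^sup>2) else 0))"
    proof (cases "g = 0")
      case True
      have "conn d (pt z # pt z # L) = 0"
        by (rule conn_parity) (use d True in \<open>auto simp: L_def\<close>)
      then show ?thesis using True d by auto
    next
      case False
      show ?thesis
      proof (cases "d = 0")
        case True
        then have g: "g = 1" "zs = []" using d False by (auto simp: length_0_conv[symmetric] simp del: length_0_conv)
        have "z \<noteq> 1 / z" using z' by (auto simp: field_simps power2_eq_square[symmetric] power2_eq_1_iff)
        then have "bergman z (1 / z) = dcay z * dcay (1 / z) / (4 * (cay z)\<^sup>2)"
          using bergman_cay[OF z'(2,4)] cay_inverse[OF z'(1,2)] by (simp add: power2_eq_square)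
        then show ?thesis using g True by (simp add: corr_fun.simps(2) jac_def)
      next
        case False
        have e: "2 * (g - 1) + length (1 / z # zs) = Suc d" using d \<open>g \<noteq> 0\<close> by simp
        have "corr_fun s (g - 1) (z # 1 / z # zs) =
            c ^ d * (dcay z * jac (1 / z # zs)) * conn d (pt z # map pt (1 / z # zs))"
          using IH[of "g - 1" "1 / z # zs" z] e False z' less.prems(3) by simp
        then show ?thesis using False \<open>g \<noteq> 0\<close> pz by (simp add: jac_def L_def)
      qed
    qed
    define st where "st h x A = c ^ (2 * h + length A - 1) * (dcay x * jac A) *
        conn (2 * h + length A - 1) (pt x # map pt A)" for h x A
    define bg where "bg h x A = (if h = 0 \<and> length A = 1 then bergman x (hd A) else 0)"
      for h :: nat and x A
    have st0: "st 0 x A = 0" if "length A \<le> 1" for x A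
    proof -
      have "length A - 1 = 0" using that by simp
      then show ?thesis by (simp only: st_def mult_zero_right add_0 conn.simps)
    qed
    have Y: "corr_fun s h (x # A) = st h x A + bg h x A"
      if "2 * h + length A < d + 2" "\<not> (h = 0 \<and> A = [])" "x \<in> {z, 1 / z}" "set A \<subseteq> set zs" for h x A
    proof (cases "2 \<le> 2 * h + length A")
      case True
      have "set A \<inter> {1, - 1} = {}" "x \<notin> {1, - 1}" using that z' less.prems(3) by auto
      then have "corr_fun s h (x # A) = st h x A" unfolding st_def using IH that True by blast
      moreover have "bg h x A = 0" using True by (auto simp: bg_def)
      ultimately show ?thesis by simp
    next
      case False
      then have h: "h = 0" and l1: "length A \<le> 1" by auto
      have l0: "length A \<noteq> 0" using that(2) h by simp
      have "h = 0" "length A = 1" using h l0 l1 by linarith+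
      then show ?thesis using st0[of A x] by (cases A) (auto simp: bg_def corr_fun.simps(2))
    qed
    have prod: "(if (h = 0 \<and> A = []) \<or> (h = g \<and> B = []) then 0 else
        corr_fun s h (z # A) * corr_fun s (g - h) (1 / z # B)) =
        (st h z A + bg h z A) * (st (g - h) (1 / z) B + bg (g - h) (1 / z) B)"
      if h: "h \<le> g" and m: "mset (A @ B) = mset zs" for h A B
    proof -
      have len: "length A + length B = length zs" using mset_eq_length[OF m] by simp
      have sub: "set A \<subseteq> set zs" "set B \<subseteq> set zs" using mset_eq_setD[OF m] by auto
      show ?thesis
      proof (cases "(h = 0 \<and> A = []) \<or> (h = g \<and> B = [])")
        case True
        have "st 0 x [] = 0" "bg 0 x [] = 0" for x using st0 by (auto simp: bg_def)
        then show ?thesis using True by auto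
      next
        case False
        have 1: "2 * h + length A < d + 2" using False h len d by (cases "h = g"; cases B) auto
        have 2: "2 * (g - h) + length B < d + 2" using False h len d by (cases "h = 0"; cases A) auto
        have 3: "\<not> (g - h = 0 \<and> B = [])" using False h by auto
        show ?thesis
          using False Y[OF 1 _ _ sub(1)] Y[OF 2 3 _ sub(2)] by auto
      qed
    qed
    have "(\<Sum>h\<le>g. sum_split (\<lambda>A B. if (h = 0 \<and> A = []) \<or> (h = g \<and> B = []) then 0 else
        corr_fun s h (z # A) * corr_fun s (g - h) (1 / z # B)) zs) =
      (\<Sum>h\<le>g. sum_split (\<lambda>A B. (st h z A + bg h z A) * (st (g - h) (1 / z) B + bg (g - h) (1 / z) B)) zs)"
      by (intro sum.cong refl sum_split_cong prod) auto
    also have "\<dots> = (\<Sum>h\<le>g. sum_split (\<lambda>A B. st h z A * st (g - h) (1 / z) B) zs)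
      + (\<Sum>h\<le>g. sum_split (\<lambda>A B. bg h z A * st (g - h) (1 / z) B) zs)
      + (\<Sum>h\<le>g. sum_split (\<lambda>A B. st h z A * bg (g - h) (1 / z) B) zs)
      + (\<Sum>h\<le>g. sum_split (\<lambda>A B. bg h z A * bg (g - h) (1 / z) B) zs)"
      by (simp add: sum.distrib[symmetric] sum_split_add[symmetric] algebra_simps)
    also have "(\<Sum>h\<le>g. sum_split (\<lambda>A B. st h z A * st (g - h) (1 / z) B) zs) =
      c ^ d * (dcay z * dcay (1 / z)) * jac zs *
        (\<Sum>i\<le>d. sum_split (\<lambda>A B. conn i (pt z # A) * conn (d - i) (pt z # B)) L)"
    proof -
      have "(\<Sum>h\<le>g. sum_split (\<lambda>A B. st h z A * st (g - h) (1 / z) B) zs) =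
        sum_split (\<lambda>A B. \<Sum>h\<le>g. st h z A * st (g - h) (1 / z) B) zs"
        by (simp add: sum_split_sum)
      also have "\<dots> = sum_split (\<lambda>A B. c ^ d * (dcay z * dcay (1 / z)) * jac zs *
          (\<Sum>i\<le>d. conn i (pt z # map pt A) * conn (d - i) (pt z # map pt B))) zs"
      proof (rule sum_split_cong)
        fix A B assume m: "mset (A @ B) = mset zs"
        have len: "length (map pt A) + length (map pt B) + 2 * g = d + 2"
          using mset_eq_length[OF m] d by simp
        have "(\<Sum>h\<le>g. st h z A * st (g - h) (1 / z) B) = (dcay z * dcay (1 / z)) * (jac A * jac B) *
          (\<Sum>h\<le>g. (c ^ (2 * h + length (map pt A) - 1) * conn (2 * h + length (map pt A) - 1) (pt z # map pt A)) *
            (c ^ (2 * (g - h) + length (map pt B) - 1) * conn (2 * (g - h) + length (map pt B) - 1) (pt z # map pt B)))"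
          unfolding sum_distrib_left st_def pz by (intro sum.cong) (simp_all add: mult_ac)
        then show "(\<Sum>h\<le>g. st h z A * st (g - h) (1 / z) B) = c ^ d * (dcay z * dcay (1 / z)) * jac zs *
          (\<Sum>i\<le>d. conn i (pt z # map pt A) * conn (d - i) (pt z # map pt B))"
          unfolding conn_genus_sum[OF len] jac_mset[OF m] by (simp add: mult_ac)
      qed
      finally show ?thesis
        by (simp add: sum_split_mult sum_split_sum L_def sum_split_map)
    qed
    also have "(\<Sum>h\<le>g. sum_split (\<lambda>A B. bg h z A * st (g - h) (1 / z) B) zs) =
      sum_remove (\<lambda>y R. bergman z y * st g (1 / z) R) zs"
    proof -
      have "(\<Sum>h\<le>g. sum_split (\<lambda>A B. bg h z A * st (g - h) (1 / z) B) zs) =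
        (\<Sum>h\<le>g. if h = 0 then sum_split (\<lambda>A B. bg 0 z A * st g (1 / z) B) zs else 0)"
        by (intro sum.cong) (auto simp: bg_def sum_split_zero)
      also have "\<dots> = sum_split (\<lambda>A B. if length A = 1 then bergman z (hd A) * st g (1 / z) B else 0) zs"
        by (auto simp: bg_def intro!: sum_split_cong)
      also have "\<dots> = sum_remove (\<lambda>y R. bergman z y * st g (1 / z) R) zs"
        by (rule sum_split_single_left)
      finally show ?thesis .
    qed
    also have "(\<Sum>h\<le>g. sum_split (\<lambda>A B. st h z A * bg (g - h) (1 / z) B) zs) =
      sum_remove (\<lambda>y R. bergman (1 / z) y * st g z R) zs"
    proof -
      have "(\<Sum>h\<le>g. sum_split (\<lambda>A B. st h z A * bg (g - h) (1 / z) B) zs) =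
        (\<Sum>h\<le>g. if h = g then sum_split (\<lambda>A B. st g z A * bg 0 (1 / z) B) zs else 0)"
        by (intro sum.cong) (auto simp: bg_def sum_split_zero)
      also have "\<dots> = sum_split (\<lambda>A B. st g z A * bg 0 (1 / z) B) zs" by simp
      also have "\<dots> = sum_split (\<lambda>A B. st g z B * bg 0 (1 / z) A) zs"
        by (rule sum_split_commute)
      also have "\<dots> = sum_split (\<lambda>A B. if length A = 1 then bergman (1 / z) (hd A) * st g z B else 0) zs"
        by (auto simp: bg_def intro!: sum_split_cong)
      also have "\<dots> = sum_remove (\<lambda>y R. bergman (1 / z) y * st g z R) zs"
        by (rule sum_split_single_left)
      finally show ?thesis .
    qed
    also have "(\<Sum>h\<le>g. sum_split (\<lambda>A B. bg h z A * bg (g - h) (1 / z) B) zs) =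
      c ^ d * (dcay z * dcay (1 / z)) * jac zs * (if d = 0 \<and> length zs = 2 then w02 z else 0)"
    proof (cases "d = 0 \<and> length zs = 2")
      case True
      then obtain a b where ab: "zs = [a, b]" by (metis length_0_conv length_Suc_conv numeral_2_eq_2)
      have "g = 0" using True d by simp
      then show ?thesis
        using True b1 b2 unfolding w02_def ab by (simp add: bg_def jac_def field_simps)
    next
      case False
      have "sum_split (\<lambda>A B. bg h z A * bg (g - h) (1 / z) B) zs = sum_split (\<lambda>A B. 0) zs" if "h \<le> g" for h
      proof (rule sum_split_cong)
        fix A B assume "mset (A @ B) = mset zs"
        then have "length A + length B = length zs" using mset_eq_length by fastforce
        then show "bg h z A * bg (g - h) (1 / z) B = 0" using False d that by (auto simp: bg_def)
      qed
      then show ?thesis unfolding if_not_P[OF False] by (simp add: sum_split_zero)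
    qed
    finally have two: "(\<Sum>h\<le>g. sum_split (\<lambda>A B. if (h = 0 \<and> A = []) \<or> (h = g \<and> B = []) then 0 else
        corr_fun s h (z # A) * corr_fun s (g - h) (1 / z # B)) zs) =
      c ^ d * (dcay z * dcay (1 / z)) * jac zs *
        ((\<Sum>i\<le>d. sum_split (\<lambda>A B. conn i (pt z # A) * conn (d - i) (pt z # B)) L)
         + (if d = 0 \<and> length zs = 2 then w02 z else 0))
      + sum_remove (\<lambda>y R. bergman z y * st g (1 / z) R + bergman (1 / z) y * st g z R) zs"
      by (simp add: sum_remove_add distrib_left)
    have three: "sum_remove (\<lambda>y R. bergman z y * st g (1 / z) R + bergman (1 / z) y * st g z R) zs =
      c ^ d * (dcay z * dcay (1 / z)) * jac zs *
        sum_remove (\<lambda>y R. conn d (pt z # map pt R) * Berg ((cay y)\<^sup>2) z) zs"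
      unfolding sum_remove_mult[symmetric]
    proof (rule sum_remove_cong)
      fix y R assume m: "mset (y # R) = mset zs"
      have y: "y \<in> set zs" using mset_eq_setD[OF m] by auto
      have len: "2 * g + length R - 1 = d" using mset_eq_length[OF m] d by simp
      have j: "jac zs = dcay y * jac R" using jac_mset[of "[y]" R zs] m by (simp add: jac_def)
      show "bergman z y * st g (1 / z) R + bergman (1 / z) y * st g z R =
        c ^ d * (dcay z * dcay (1 / z)) * jac zs * (conn d (pt z # map pt R) * Berg ((cay y)\<^sup>2) z)"
        unfolding b1[OF y] b2[OF y] st_def len pz j B[OF y, symmetric]
        by (simp add: algebra_simps)
    qed
    show ?thesis
      unfolding Q_def recursion_sum_split one two three T_def by (simp add: algebra_simps)
  qed
  have "corr_fun s g (z0 # zs) = res2 (\<lambda>z. recursion_kernel s z0 z * deriv inverse z * Q z)"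
  proof -
    have ne: "\<not> (g = 0 \<and> zs = [])" "\<not> (g = 0 \<and> length zs = 1)" using less.prems(1) by auto
    have "corr_fun s g (z0 # zs) =
        (\<Sum>r\<in>{1, - 1}. residue (\<lambda>z. recursion_kernel s z0 z * deriv inverse z * Q z) r)"
      unfolding corr_fun.simps(2)[of s g z0 zs] Q_def using ne by presburger
    then show ?thesis by (simp add: res2_def)
  qed
  also have "\<dots> = res2 (\<lambda>z. (c ^ Suc d * (dcay z0 * jac zs)) * (mfun ((cay z)\<^sup>2) * Kern v0 z * T z))"
  proof (rule res2_cong)
    fix r :: complex assume r: "r \<in> {1, - 1}"
    have "finite ?A" by simp
    from eventually_not_in_finite[OF this] eventually_kernel_ok[OF r z0]
    show "eventually (\<lambda>z. recursion_kernel s z0 z * deriv inverse z * Q z =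
        (c ^ Suc d * (dcay z0 * jac zs)) * (mfun ((cay z)\<^sup>2) * Kern v0 z * T z)) (at r)"
    proof eventually_elim
      case (elim z)
      then have z: "z \<noteq> 0" "z \<noteq> 1" "z \<noteq> - 1" by auto
      have "recursion_kernel s z0 z * deriv inverse z * Q z =
        (recursion_kernel s z0 z * deriv inverse z * (dcay z * dcay (1 / z))) * (c ^ d * jac zs * T z)"
        unfolding bracket[OF elim(1)] by (simp add: mult_ac)
      also have "\<dots> = (c ^ Suc d * (dcay z0 * jac zs)) * (mfun ((cay z)\<^sup>2) * Kern v0 z * T z)"
        unfolding recursion_kernel_cay[OF z z0(1) s elim(2)] c_def[symmetric] v0_def[symmetric]
        by (simp add: mult_ac)
      finally show ?case .
    qed
  qed
  also have "\<dots> = (c ^ Suc d * (dcay z0 * jac zs)) * conn (Suc d) (pt z0 # L)"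
  proof -
    define \<phi> where "\<phi> x =
      (\<Sum>j=- int (width d)..int (width d). conn d (unit_at j # (\<lambda>k. pull_m x (j + k)) # L))
      + (\<Sum>j=- int (width d)..int (width d). \<Sum>i\<in>{..d}. sum_split (\<lambda>A B.
          conn i (unit_at j # A) * conn (d - i) ((\<lambda>k. pull_m x (j + k)) # B)) L)" for x
    have form_phi: "form (width (Suc d)) \<phi>"
      unfolding \<phi>_def[abs_def] by (rule form_conn_root) (rule form_conn)
    have phi: "\<phi> (point v) = mfun v * (conn d (point v # point v # L)
      + (\<Sum>i\<le>d. sum_split (\<lambda>A B. conn i (point v # A) * conn (d - i) (point v # B)) L))"
      if "v \<noteq> 0" for v
    proof -
      have "(\<Sum>j=- int (width d)..int (width d). \<Sum>i\<in>{..d}. sum_split (\<lambda>A B.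
          conn i (unit_at j # A) * conn (d - i) ((\<lambda>k. pull_m (point v) (j + k)) # B)) L) =
        (\<Sum>i\<le>d. sum_split (\<lambda>A B. \<Sum>j=- int (width d)..int (width d).
          conn i (unit_at j # A) * conn (d - i) ((\<lambda>k. pull_m (point v) (j + k)) # B)) L)"
        by (subst sum.swap) (simp add: sum_split_sum)
      also have "\<dots> = (\<Sum>i\<le>d. mfun v * sum_split (\<lambda>A B. conn i (point v # A) * conn (d - i) (point v # B)) L)"
        by (intro sum.cong refl) (simp add: conn_point(2)[OF that] sum_split_mult)
      finally show ?thesis
        unfolding \<phi>_def conn_point(1)[OF that] by (simp add: sum_distrib_left distrib_left)
    qed
    define f1 where "f1 z = \<phi> (pt z) * Kern v0 z" for z
    define f2 where "f2 z = sum_remove (\<lambda>y R. mfun ((cay z)\<^sup>2) * conn d (pt z # map pt R) *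
        (Kern v0 z * Berg ((cay y)\<^sup>2) z)) zs" for z
    define f3 where "f3 z = (if d = 0 \<and> zs = [] then one_point (pt z) * Kern v0 z else 0)" for z
    define f4 where "f4 z = (if d = 0 \<and> length zs = 2 then mfun ((cay z)\<^sup>2) * Kern v0 z * w02 z else 0)" for z
    have r1: "punct f1" "res2 f1 = \<phi> (pt z0)"
      unfolding f1_def[abs_def] pt_def v0_def[symmetric]
      by (intro punct_mult punct_form[OF form_phi] punct_Kern res2_form_Kern[OF form_phi v0])+
    have cm: "form (width d + 2) (\<lambda>x. conn d (pull_m x # M))" for M
      by (rule form_comp[OF form_conn_1]) (auto intro!: form_pull_m)
    have cm': "mfun ((cay z)\<^sup>2) * conn d (pt z # M) = conn d (pull_m (point ((cay z)\<^sup>2)) # M)"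
      if "z \<notin> {1, - 1}" for z M
    proof -
      have nz: "(cay z)\<^sup>2 \<noteq> 0" using that by (auto dest: cay_nonzero)
      have e: "pull_m (pt z) = (\<lambda>k. mfun ((cay z)\<^sup>2) * pt z k)"
        unfolding pt_def using pull_m_point[OF nz] by (auto simp: point_def)
      show ?thesis
        using form_scale_arg[OF form_conn_1[of d M], of "mfun ((cay z)\<^sup>2)" "pt z"]
        unfolding pt_def[symmetric] e ..
    qed
    have r2: "punct f2 \<and> res2 f2 = sum_remove (\<lambda>y R. conn d (quot_m (pt z0) y # R)) L"
    proof -
      have p: "punct (\<lambda>z. mfun ((cay z)\<^sup>2) * conn d (pt z # M) * (Kern v0 z * Berg ((cay y)\<^sup>2) z))" for y M
        unfolding pt_def by (intro punct_mult punct_mfun punct_form[OF form_conn_1] punct_Kern punct_Berg)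
      have r: "res2 (\<lambda>z. mfun ((cay z)\<^sup>2) * conn d (pt z # M) * (Kern v0 z * Berg ((cay y)\<^sup>2) z)) =
        conn d (quot_m (pt z0) (pt y) # M)" if "y \<in> set zs" for y M
      proof -
        have "res2 (\<lambda>z. mfun ((cay z)\<^sup>2) * conn d (pt z # M) * (Kern v0 z * Berg ((cay y)\<^sup>2) z)) =
          res2 (\<lambda>z. conn d (pull_m (point ((cay z)\<^sup>2)) # M) * (Kern v0 z * Berg ((cay y)\<^sup>2) z))"
        proof (rule res2_cong_finite[of "{1, - 1}"])
          fix z :: complex assume z: "z \<notin> {1, - 1}"
          show "mfun ((cay z)\<^sup>2) * conn d (pt z # M) * (Kern v0 z * Berg ((cay y)\<^sup>2) z) =
            conn d (pull_m (point ((cay z)\<^sup>2)) # M) * (Kern v0 z * Berg ((cay y)\<^sup>2) z)"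
            unfolding cm'[OF z] ..
        qed simp
        also have "\<dots> = conn d (pull_m (quot (point v0) (point ((cay y)\<^sup>2))) # M)"
          by (rule res2_form_Kern_Berg[OF cm v0 pt_nonzero[OF zs[OF that]]])
        finally show ?thesis by (simp add: quot_m_def pt_def v0_def)
      qed
      have "punct f2 \<and> res2 f2 = sum_remove (\<lambda>y R. res2 (\<lambda>z. mfun ((cay z)\<^sup>2) * conn d (pt z # map pt R) *
          (Kern v0 z * Berg ((cay y)\<^sup>2) z))) zs"
        unfolding f2_def[abs_def] by (rule res2_sum_remove) (rule p)
      also have "sum_remove (\<lambda>y R. res2 (\<lambda>z. mfun ((cay z)\<^sup>2) * conn d (pt z # map pt R) *
          (Kern v0 z * Berg ((cay y)\<^sup>2) z))) zs = sum_remove (\<lambda>y R. conn d (quot_m (pt z0) (pt y) # map pt R)) zs"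
        by (rule sum_remove_cong, rule r) (metis list.set_intros(1) mset_eq_setD)
      finally show ?thesis unfolding L_def sum_remove_map .
    qed
    have r3: "punct f3 \<and> res2 f3 = (if d = 0 \<and> L = [] then one_point (pt z0) else 0)"
    proof (cases "d = 0 \<and> zs = []")
      case True
      have f: "form 3 one_point" by (rule form_one_point) simp
      have "punct (\<lambda>z. one_point (pt z) * Kern v0 z)"
        unfolding pt_def by (intro punct_mult punct_form[OF f] punct_Kern)
      moreover have "res2 (\<lambda>z. one_point (pt z) * Kern v0 z) = one_point (pt z0)"
        unfolding pt_def v0_def[symmetric] by (rule res2_form_Kern[OF f v0])
      moreover have "f3 = (\<lambda>z. one_point (pt z) * Kern v0 z)" using True by (auto simp: f3_def)
      ultimately show ?thesis using True by (simp add: L_def)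
    next
      case False
      have "f3 = (\<lambda>z. 0)" unfolding f3_def if_not_P[OF False] ..
      then show ?thesis using False by (auto simp: punct_const res2_zero L_def)
    qed
    have r4: "punct f4 \<and> res2 f4 = (if d = 0 \<and> length L = 2 then three_point (pt z0) (hd L) (hd (tl L)) else 0)"
    proof (cases "d = 0 \<and> length zs = 2")
      case True
      then obtain a b where ab: "zs = [a, b]" by (metis length_0_conv length_Suc_conv numeral_2_eq_2)
      have nz: "cay z0 \<noteq> 0" "cay a \<noteq> 0" "cay b \<noteq> 0"
        using cay_nonzero z0 zs[of a] zs[of b] by (auto simp: ab)
      have "f4 = (\<lambda>z. mfun ((cay z)\<^sup>2) * Kern ((cay z0)\<^sup>2) z *
         (1 / ((cay z - cay a)\<^sup>2 * (cay z + cay b)\<^sup>2) + 1 / ((cay z - cay b)\<^sup>2 * (cay z + cay a)\<^sup>2)))"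
        using True by (intro ext) (simp add: f4_def w02_def ab v0_def)
      then show ?thesis
        using res2_three_point[OF nz] True by (simp add: ab L_def pt_def)
    next
      case False
      have "f4 = (\<lambda>z. 0)" unfolding f4_def if_not_P[OF False] ..
      then show ?thesis using False by (auto simp: punct_const res2_zero L_def)
    qed
    have e: "mfun ((cay z)\<^sup>2) * Kern v0 z * T z = f1 z + f2 z + f3 z + f4 z" if "z \<notin> {1, - 1}" for z
    proof -
      have nz: "(cay z)\<^sup>2 \<noteq> 0" using that by (auto dest: cay_nonzero)
      have 1: "one_point (pt z) = mfun ((cay z)\<^sup>2) * (1 / (4 * (cay z)\<^sup>2))"
        unfolding one_point_def pt_def pull_m_point[OF nz] using nz by (simp add: power_int_minus field_simps)
      have 2: "f2 z = mfun ((cay z)\<^sup>2) * Kern v0 z *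
          sum_remove (\<lambda>y R. conn d (pt z # map pt R) * Berg ((cay y)\<^sup>2) z) zs"
        unfolding f2_def sum_remove_mult[symmetric] by (intro sum_remove_cong) (simp add: mult_ac)
      show ?thesis
        unfolding T_def 2 f1_def f3_def f4_def 1[unfolded pt_def] pt_def phi[OF nz]
        by (simp add: algebra_simps)
    qed
    have "res2 (\<lambda>z. (c ^ Suc d * (dcay z0 * jac zs)) * (mfun ((cay z)\<^sup>2) * Kern v0 z * T z)) =
        res2 (\<lambda>z. (c ^ Suc d * (dcay z0 * jac zs)) * (f1 z + f2 z + f3 z + f4 z))"
      by (rule res2_cong_finite[of "{1, - 1}"]) (use e in auto)
    also have "\<dots> = (c ^ Suc d * (dcay z0 * jac zs)) * (res2 f1 + res2 f2 + res2 f3 + res2 f4)"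
      using r1 r2 r3 r4 by (simp add: res2_cmult res2_add punct_add)
    also have "res2 f1 + res2 f2 + res2 f3 + res2 f4 = conn (Suc d) (pt z0 # L)"
      using r1 r2 r3 r4 by (simp add: \<phi>_def)
    finally show ?thesis .
  qed
  finally show ?case using d by (simp add: c_def L_def)
qed

section \<open>Free energies as periods of one-point functions\<close>

text \<open>
  Half the integral of \<open>w\<^sup>2\<^sup>k dw\<close> from \<open>-1\<close> to \<open>1\<close>, the endpoints of the Voros path. For
  negative \<open>k\<close> the value is that of the primitive, which is single-valued since \<open>2k \<noteq> -1\<close>.
\<close>

definition half_period :: functional where "half_period = (\<lambda>k. 1 / (2 * of_int k + 1))"

lemma odd_nonzero: "2 * complex_of_int k + 1 \<noteq> 0"
proof -
  have "2 * k + 1 \<noteq> 0" by presburger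
  then have "complex_of_int (2 * k + 1) \<noteq> 0" by (subst of_int_eq_0_iff)
  then show ?thesis by simp
qed

text \<open>
  One-point functions are divisible by \<open>m\<close>, which has a triple zero at \<open>v = 1\<close>; this gives linear
  relations between their coefficients.
\<close>

lemma conn_single_pull_m: "pull_m x = (\<lambda>k. 0) \<Longrightarrow> conn d [x] = 0"
proof (cases d)
  case (Suc e)
  assume x: "pull_m x = (\<lambda>k. 0)"
  then have "pull_m x i = 0" for i by simp
  then show ?thesis
    unfolding Suc by (simp add: form_zero_arg[OF form_conn_2] form_zero_arg[OF form_conn_1] one_point_def)
qed simp

text \<open>
  The sequence \<open>2k + 1\<close> is in the kernel of the transposed multiplication by \<open>m\<close>, since \<open>m\<close> vanishes to third
  order at \<open>v = 1\<close> while the sequence is linear in \<open>k\<close>.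
\<close>

lemma conn_single_odd: "conn d [\<lambda>k. 2 * of_int k + 1] = 0"
  by (rule conn_single_pull_m) (simp add: pull_m_def)

definition ydx :: "complex \<Rightarrow> complex \<Rightarrow> complex" where
  "ydx s z = weber_y s z * deriv (weber_x s) z"

lemma ydx_eq: "z \<noteq> 0 \<Longrightarrow> ydx s z = s\<^sup>2 / 2 * (z\<^sup>2 - 1)\<^sup>2 / z ^ 3"
  by (simp add: ydx_def weber_y_def deriv_weber_x field_simps power2_eq_square power3_eq_cube)

lemma holomorphic_ydx: "0 \<notin> S \<Longrightarrow> ydx s holomorphic_on S"
proof -
  assume S: "0 \<notin> S"
  have "(\<lambda>z. s\<^sup>2 / 2 * (z\<^sup>2 - 1)\<^sup>2 / z ^ 3) holomorphic_on S"
    using S by (intro holomorphic_intros) auto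
  then show ?thesis
    by (rule holomorphic_transform) (use S ydx_eq in metis)
qed

lemma punct_ydx: "punct (ydx s)"
  by (rule punctI[of _ "{0}"]) (auto intro: holomorphic_ydx)

lemma ydx_cay:
  assumes "z \<noteq> 0" "z \<noteq> 1"
  shows "((cay z)\<^sup>2 - 1) ^ 3 * ydx s z = - 16 * s\<^sup>2 * (cay z)\<^sup>2 * dcay z"
proof -
  have nz: "z - 1 \<noteq> 0" using assms by simp
  have "(cay z)\<^sup>2 - 1 = 4 * z / (z - 1)\<^sup>2"
    unfolding cay_def using nz by (simp add: power_divide divide_simps) (simp add: power2_eq_square algebra_simps)
  moreover have "z\<^sup>2 - 1 = (z - 1) * (z + 1)" by (simp add: power2_eq_square algebra_simps)
  ultimately show ?thesis
    unfolding ydx_eq[OF assms(1)] dcay_def cay_def using nz assms(1)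
    by (simp add: power_divide power_mult_distrib divide_simps)
qed

lemma res2_ydx: "res2 (\<lambda>z. cay z powi (2 * k + 1) * ydx s z) = 8 * s\<^sup>2 * of_int k * (of_int k + 1)"
proof -
  define \<rho> where "\<rho> k = res2 (\<lambda>z. cay z powi (2 * k + 1) * ydx s z)" for k
  have rec: "\<rho> (k + 3) - 3 * \<rho> (k + 2) + 3 * \<rho> (k + 1) - \<rho> k = 0" for k
  proof -
    have p: "punct (\<lambda>z. c * (cay z powi j * ydx s z))" "punct (\<lambda>z. cay z powi j * ydx s z)" for c j
      by (intro punct_cmult punct_mult punct_powi punct_ydx)+
    have "res2 (\<lambda>z. (- 16 * s\<^sup>2) * (cay z powi (2 * k + 3) * dcay z)) =
        res2 (\<lambda>z. cay z powi (2 * (k + 3) + 1) * ydx s z + (- 3) * (cay z powi (2 * (k + 2) + 1) * ydx s z)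
          + 3 * (cay z powi (2 * (k + 1) + 1) * ydx s z) + (- 1) * (cay z powi (2 * k + 1) * ydx s z))"
    proof (rule res2_cong_finite[of "{0, 1, - 1}"])
      fix z :: complex assume z: "z \<notin> {0, 1, - 1}"
      have c: "cay z \<noteq> 0" using z cay_nonzero by auto
      have e: "cay z powi (2 * k + 1 + 2 * int n) = cay z powi (2 * k + 1) * ((cay z)\<^sup>2) ^ n" for n
        using c by (simp add: power_int_add power_int_mult power_mult flip: power_mult)
      have "cay z powi (2 * k + 3) = cay z powi (2 * k + 1) * (cay z)\<^sup>2"
        "cay z powi (2 * (k + 1) + 1) = cay z powi (2 * k + 1) * (cay z)\<^sup>2"
        "cay z powi (2 * (k + 2) + 1) = cay z powi (2 * k + 1) * ((cay z)\<^sup>2)\<^sup>2"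
        "cay z powi (2 * (k + 3) + 1) = cay z powi (2 * k + 1) * ((cay z)\<^sup>2) ^ 3"
        using e[of 1] e[of 2] e[of 3] by (simp_all add: algebra_simps)
      then have "cay z powi (2 * (k + 3) + 1) * ydx s z + (- 3) * (cay z powi (2 * (k + 2) + 1) * ydx s z)
          + 3 * (cay z powi (2 * (k + 1) + 1) * ydx s z) + (- 1) * (cay z powi (2 * k + 1) * ydx s z) =
          cay z powi (2 * k + 1) * (((cay z)\<^sup>2 - 1) ^ 3 * ydx s z)"
        by (simp add: algebra_simps power2_eq_square power3_eq_cube)
      also have "\<dots> = (- 16 * s\<^sup>2) * (cay z powi (2 * k + 1) * (cay z)\<^sup>2 * dcay z)"
        using ydx_cay[of z s] z by simp
      finally show "(- 16 * s\<^sup>2) * (cay z powi (2 * k + 3) * dcay z) =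
          cay z powi (2 * (k + 3) + 1) * ydx s z + (- 3) * (cay z powi (2 * (k + 2) + 1) * ydx s z)
          + 3 * (cay z powi (2 * (k + 1) + 1) * ydx s z) + (- 1) * (cay z powi (2 * k + 1) * ydx s z)"
        using \<open>cay z powi (2 * k + 3) = _\<close> by simp
    qed simp
    moreover have "res2 (\<lambda>z. (- 16 * s\<^sup>2) * (cay z powi (2 * k + 3) * dcay z)) = 0"
      by (simp only: res2_cmult[OF punct_cay_powi] res2_cay_powi mult_zero_right)
    moreover have "res2 (\<lambda>z. cay z powi (2 * (k + 3) + 1) * ydx s z + (- 3) * (cay z powi (2 * (k + 2) + 1) * ydx s z)
          + 3 * (cay z powi (2 * (k + 1) + 1) * ydx s z) + (- 1) * (cay z powi (2 * k + 1) * ydx s z)) =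
        \<rho> (k + 3) + (- 3) * \<rho> (k + 2) + 3 * \<rho> (k + 1) + (- 1) * \<rho> k"
      unfolding \<rho>_def by (simp only: res2_add punct_add res2_cmult p)
    ultimately have "\<rho> (k + 3) + (- 3) * \<rho> (k + 2) + 3 * \<rho> (k + 1) + (- 1) * \<rho> k = 0" by (simp only:)
    then show ?thesis by simp
  qed
  have zero: "\<rho> 0 = 0" "\<rho> (- 1) = 0"
  proof -
    have "f holomorphic_on - {0} \<Longrightarrow> res2 f = 0" for f
      unfolding res2_def
      using open_Compl[OF closed_singleton[of "0 :: complex"]] residue_holo[of "- {0}" 1 f] residue_holo[of "- {0}" "- 1" f] by simp
    note h = this
    have "\<rho> 0 = res2 (\<lambda>z. s\<^sup>2 / 2 * (z + 1) ^ 3 * (z - 1) / z ^ 3)"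
      unfolding \<rho>_def
      by (rule res2_cong_finite[of "{0, 1}"])
        (auto simp: ydx_eq cay_def divide_simps, auto simp: power2_eq_square power3_eq_cube algebra_simps)
    also have "\<dots> = 0" by (rule h) (auto intro!: holomorphic_intros)
    finally show "\<rho> 0 = 0" .
    have "\<rho> (- 1) = res2 (\<lambda>z. s\<^sup>2 / 2 * (z - 1) ^ 3 * (z + 1) / z ^ 3)"
      unfolding \<rho>_def
    proof (rule res2_cong_finite[of "{0, 1, - 1}"])
      fix z :: complex assume "z \<notin> {0, 1, - 1}"
      then have nz: "z \<noteq> 0" "z - 1 \<noteq> 0" "z + 1 \<noteq> 0" by (auto simp: eq_neg_iff_add_eq_0)
      show "cay z powi (2 * - 1 + 1) * ydx s z = s\<^sup>2 / 2 * (z - 1) ^ 3 * (z + 1) / z ^ 3"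
        unfolding ydx_eq[OF nz(1)] using nz
        by (simp add: power_int_minus cay_def divide_simps) (simp add: power2_eq_square power3_eq_cube algebra_simps)
    qed simp
    also have "\<dots> = 0" by (rule h) (auto intro!: holomorphic_intros)
    finally show "\<rho> (- 1) = 0" .
  qed
  have one: "\<rho> 1 = 16 * s\<^sup>2"
  proof -
    have e: "cay z powi (2 * 1 + 1) * ydx s z = s\<^sup>2 / 2 * (z + 1) ^ 5 / z ^ 3 / (z - 1)"
      if "z \<notin> {0, 1}" for z
    proof -
      have nz: "z \<noteq> 0" "z - 1 \<noteq> 0" using that by auto
      have "cay z powi 3 = cay z ^ 3" by simp
      moreover have "z\<^sup>2 - 1 = (z - 1) * (z + 1)" by (simp add: power2_eq_square algebra_simps)
      ultimately show ?thesis
        unfolding ydx_eq[OF nz(1)] using nz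
        by (simp add: cay_def power_divide power_mult_distrib divide_simps) (simp add: eval_nat_numeral)
    qed
    have h: "(\<lambda>z. s\<^sup>2 / 2 * (z + 1) ^ 5 / z ^ 3) holomorphic_on - {0}" by (auto intro!: holomorphic_intros)
    have "residue (\<lambda>z. cay z powi (2 * 1 + 1) * ydx s z) 1 = residue (\<lambda>z. s\<^sup>2 / 2 * (z + 1) ^ 5 / z ^ 3 / (z - 1)) 1"
      by (rule residue_cong, rule eventually_mono[OF eventually_not_in_finite[of "{0, 1}"] e]) auto
    also have "\<dots> = s\<^sup>2 / 2 * (1 + 1) ^ 5 / 1 ^ 3"
      by (rule residue_simple[OF _ _ h]) auto
    finally have 1: "residue (\<lambda>z. cay z powi (2 * 1 + 1) * ydx s z) 1 = 16 * s\<^sup>2" by simp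
    have "residue (\<lambda>z. cay z powi (2 * 1 + 1) * ydx s z) (- 1) = residue (\<lambda>z. s\<^sup>2 / 2 * (z + 1) ^ 5 / z ^ 3 / (z - 1)) (- 1)"
      by (rule residue_cong, rule eventually_mono[OF eventually_not_in_finite[of "{0, 1}"] e]) auto
    also have "\<dots> = 0"
      by (rule residue_holo[of "- {0, 1}"]) (auto intro!: holomorphic_intros)
    finally show ?thesis using 1 by (simp add: \<rho>_def res2_def)
  qed
  define e where "e k = 8 * s\<^sup>2 * of_int k * (of_int k + 1)" for k
  have rec_e: "e (k + 3) - 3 * e (k + 2) + 3 * e (k + 1) - e k = 0" for k
    by (simp add: e_def algebra_simps)
  have "\<rho> (q - 1) = e (q - 1) \<and> \<rho> q = e q \<and> \<rho> (q + 1) = e (q + 1)" for q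
  proof (induction q rule: int_shift_induct)
    case 1
    show ?case using zero one by (simp add: e_def)
  next
    case (2 q)
    have "q - 1 + 3 = q + 1 + 1" "q - 1 + 2 = q + 1" "q - 1 + 1 = q" "q + 1 - 1 = q" by simp_all
    then have "\<rho> (q + 1 + 1) - 3 * \<rho> (q + 1) + 3 * \<rho> q - \<rho> (q - 1) = 0"
      "e (q + 1 + 1) - 3 * e (q + 1) + 3 * e q - e (q - 1) = 0"
      using rec[of "q - 1"] rec_e[of "q - 1"] by metis+
    then have up: "\<rho> (q + 1 + 1) = 3 * \<rho> (q + 1) - 3 * \<rho> q + \<rho> (q - 1)"
        "e (q + 1 + 1) = 3 * e (q + 1) - 3 * e q + e (q - 1)"
      and down: "\<rho> (q - 1) = \<rho> (q + 1 + 1) - 3 * \<rho> (q + 1) + 3 * \<rho> q"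
        "e (q - 1) = e (q + 1 + 1) - 3 * e (q + 1) + 3 * e q"
      by (simp_all add: algebra_simps eq_diff_eq)
    show ?case
      unfolding \<open>q + 1 - 1 = q\<close>
    proof
      assume "\<rho> (q - 1) = e (q - 1) \<and> \<rho> q = e q \<and> \<rho> (q + 1) = e (q + 1)"
      then show "\<rho> q = e q \<and> \<rho> (q + 1) = e (q + 1) \<and> \<rho> (q + 1 + 1) = e (q + 1 + 1)"
        unfolding up by simp
    next
      assume "\<rho> q = e q \<and> \<rho> (q + 1) = e (q + 1) \<and> \<rho> (q + 1 + 1) = e (q + 1 + 1)"
      then show "\<rho> (q - 1) = e (q - 1) \<and> \<rho> q = e q \<and> \<rho> (q + 1) = e (q + 1)"
        unfolding down by simp
    qed
  qed
  then show ?thesis unfolding \<rho>_def e_def by blast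
qed

text \<open>
  Integration by parts turns \<open>\<Sum> Res \<Phi> W\<^sub>g\<^sub>,\<^sub>1\<close> into minus the residue of \<open>y dx\<close> against the primitive of \<open>W\<^sub>g\<^sub>,\<^sub>1\<close>, a
  Laurent polynomial in \<open>w\<close> with coefficients \<open>a\<^sub>k / (2k + 1)\<close>. The residues of \<open>w\<^sup>2\<^sup>k\<^sup>+\<^sup>1 y dx\<close> are \<open>8 k (k + 1)\<close> up to the
  factor \<open>s\<^sup>2\<close>, and \<open>8 k (k + 1) / (2k + 1)\<close> differs from a multiple of \<open>1 / (2k + 1)\<close> by the sequence of
  \<open>conn_single_odd\<close>.
\<close>

theorem free_energy_residue:
  assumes s: "s \<noteq> 0" and g: "1 \<le> g" and Phi: "ydx_primitive s \<Phi>"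
  shows "(\<Sum>r\<in>{1, - 1}. residue (\<lambda>z. \<Phi> z * corr_fun s g [z]) r) =
    2 * s\<^sup>2 * (1 / s\<^sup>2) ^ (2 * g - 1) * conn (2 * g - 1) [half_period]"
proof -
  define d where "d = 2 * g - 1"
  define c where "c = (1 / s\<^sup>2) ^ d"
  define N where "N = width d"
  define a where "a k = conn d [unit_at k]" for k
  have conn1: "conn d [x] = (\<Sum>k=- int N..int N. a k * x k)" for x
    using formD[OF form_conn_1[of d "[]"], of x] by (simp add: a_def N_def)
  define P where "P z = (\<Sum>k=- int N..int N. a k / (2 * of_int k + 1) * cay z powi (2 * k + 1))" for z
  obtain \<epsilon> where eps: "\<epsilon> > 0"
    "\<And>z. z \<in> ball 1 \<epsilon> \<union> ball (- 1) \<epsilon> \<Longrightarrow> (\<Phi> has_field_derivative ydx s z) (at z)"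
    using Phi unfolding ydx_primitive_def ydx_def by blast
  define e where "e = min \<epsilon> 1"
  have e: "e > 0" "\<And>z. z \<in> ball 1 e \<union> ball (- 1) e \<Longrightarrow> (\<Phi> has_field_derivative ydx s z) (at z)"
    using eps by (auto simp: e_def)
  have P': "(P has_field_derivative conn d [pt z] * dcay z) (at z)" if "z \<notin> {1, - 1}" for z
  proof -
    have "(P has_field_derivative (\<Sum>k=- int N..int N. a k / (2 * of_int k + 1) *
        (of_int (2 * k + 1) * cay z powi (2 * k + 1 - 1) * dcay z))) (at z)"
      unfolding P_def[abs_def]
      by (intro DERIV_sum DERIV_cmult has_field_derivative_cay_powi) (use that in auto)
    moreover have "a k / (2 * of_int k + 1) * (of_int (2 * k + 1) * cay z powi (2 * k + 1 - 1) * dcay z) =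
        a k * pt z k * dcay z" for k
      using odd_nonzero[of k] by (simp add: pt_def point_cay)
    ultimately show ?thesis
      unfolding conn1 sum_distrib_right by simp
  qed
  have pP: "punct (\<lambda>z. P z * ydx s z)"
    unfolding P_def by (intro punct_mult punct_sum punct_cmult punct_powi punct_ydx)
  have res: "residue (\<lambda>z. \<Phi> z * corr_fun s g [z]) r = - c * residue (\<lambda>z. P z * ydx s z) r"
    if r: "r \<in> {1, - 1}" for r
  proof -
    define B where "B = ball r e"
    have B: "open B" "r \<in> B" "z \<in> B - {r} \<Longrightarrow> z \<notin> {0, 1, - 1}" for z
    proof -
      show "open B" "r \<in> B" using e by (auto simp: B_def)
      assume "z \<in> B - {r}"
      then have "dist r z < 1" "z \<noteq> r" by (auto simp: B_def e_def)
      moreover have "dist (1 :: complex) (- 1) = 2" "dist (- 1 :: complex) 1 = 2" "dist (1 :: complex) 0 = 1"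
        "dist (- 1 :: complex) 0 = 1"
        by (simp_all add: dist_norm)
      ultimately show "z \<notin> {0, 1, - 1}" using r by auto
    qed
    have dPhi: "(\<Phi> has_field_derivative ydx s z) (at z)" if "z \<in> B" for z
      using e(2) that r by (auto simp: B_def)
    have hP: "(\<lambda>z. P z * ydx s z) holomorphic_on B - {r}"
    proof -
      have "P holomorphic_on B - {r}"
        unfolding P_def[abs_def]
        by (intro holomorphic_on_sum holomorphic_on_mult holomorphic_on_const holomorphic_cay_powi)
          (use B(3) in blast)+
      moreover have "ydx s holomorphic_on B - {r}" by (rule holomorphic_ydx) (use B(3) in blast)
      ultimately show ?thesis by (rule holomorphic_on_mult)
    qed
    have hPhi: "\<Phi> holomorphic_on B"
      using dPhi B(1) by (meson DERIV_deriv_iff_field_differentiable field_differentiable_at_within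
          field_differentiable_def holomorphic_on_def)
    have hW: "(\<lambda>z. \<Phi> z * (conn d [pt z] * dcay z)) holomorphic_on B - {r}"
    proof -
      have "(\<lambda>z. conn d [pt z]) holomorphic_on B - {r}"
        unfolding conn1 pt_def point_cay
        by (intro holomorphic_on_sum holomorphic_on_mult holomorphic_on_const holomorphic_cay_powi)
          (use B(3) in blast)+
      moreover have "dcay holomorphic_on B - {r}" by (rule holomorphic_dcay) (use B(3) in blast)
      ultimately show ?thesis
        by (intro holomorphic_on_mult holomorphic_on_subset[OF hPhi]) auto
    qed
    have "residue (\<lambda>z. \<Phi> z * (conn d [pt z] * dcay z) + P z * ydx s z) r = 0"
    proof (rule residue_deriv_eq_0[OF B(1,2), of "\<lambda>z. \<Phi> z * P z"])
      fix z assume z: "z \<in> B - {r}"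
      have dP: "(P has_field_derivative conn d [pt z] * dcay z) (at z)" by (rule P') (use B(3) z in blast)
      show "((\<lambda>z. \<Phi> z * P z) has_field_derivative \<Phi> z * (conn d [pt z] * dcay z) + P z * ydx s z) (at z)"
        by (rule DERIV_cong[OF DERIV_mult[OF dPhi dP]]) (use z in \<open>simp_all add: algebra_simps\<close>)
    qed
    then have 1: "residue (\<lambda>z. \<Phi> z * (conn d [pt z] * dcay z)) r = - residue (\<lambda>z. P z * ydx s z) r"
      using residue_add[OF B(1,2) hW hP] by (simp add: eq_neg_iff_add_eq_0)
    have "residue (\<lambda>z. \<Phi> z * corr_fun s g [z]) r = residue (\<lambda>z. c * (\<Phi> z * (conn d [pt z] * dcay z))) r"
    proof (rule residue_cong)
      show "eventually (\<lambda>z. \<Phi> z * corr_fun s g [z] = c * (\<Phi> z * (conn d [pt z] * dcay z))) (at r)"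
      proof (rule eventually_mono[OF eventually_not_in_finite[of "{1, - 1}"]])
        fix z :: complex assume "z \<notin> {1, - 1}"
        then show "\<Phi> z * corr_fun s g [z] = c * (\<Phi> z * (conn d [pt z] * dcay z))"
          using corr_fun_cay[OF s, of g "[]" z] g by (simp add: c_def d_def jac_def)
      qed simp
    qed simp
    also have "\<dots> = c * residue (\<lambda>z. \<Phi> z * (conn d [pt z] * dcay z)) r"
      by (rule residue_lmul[OF B(1,2) hW])
    finally show ?thesis using 1 by simp
  qed
  have "(\<Sum>r\<in>{1, - 1}. residue (\<lambda>z. \<Phi> z * corr_fun s g [z]) r) = - c * res2 (\<lambda>z. P z * ydx s z)"
    by (simp add: res res2_def algebra_simps)
  also have "res2 (\<lambda>z. P z * ydx s z) =
      res2 (\<lambda>z. \<Sum>k=- int N..int N. a k / (2 * of_int k + 1) * (cay z powi (2 * k + 1) * ydx s z))"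
    by (simp add: P_def sum_distrib_right mult.assoc)
  also have "\<dots> = (\<Sum>k=- int N..int N. a k / (2 * of_int k + 1) * (8 * s\<^sup>2 * of_int k * (of_int k + 1)))"
    by (subst res2_sum) (simp_all only: res2_cmult punct_cmult punct_mult punct_powi punct_ydx res2_ydx)
  also have "\<dots> = (\<Sum>k=- int N..int N. a k * (2 * s\<^sup>2 * (2 * of_int k + 1) + (- 2 * s\<^sup>2) * half_period k))"
  proof (rule sum.cong[OF refl])
    fix k :: int
    have "8 * of_int k * (of_int k + 1) / (2 * of_int k + 1) =
        2 * (2 * of_int k + 1) - 2 / (2 * of_int k + 1 :: complex)"
      using odd_nonzero[of k] by (simp add: divide_simps) (simp add: algebra_simps)
    then have "a k * s\<^sup>2 * (8 * of_int k * (of_int k + 1) / (2 * of_int k + 1)) =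
      a k * s\<^sup>2 * (2 * (2 * of_int k + 1) - 2 / (2 * of_int k + 1))" by simp
    then show "a k / (2 * of_int k + 1) * (8 * s\<^sup>2 * of_int k * (of_int k + 1)) =
      a k * (2 * s\<^sup>2 * (2 * of_int k + 1) + (- 2 * s\<^sup>2) * half_period k)"
      by (simp add: half_period_def algebra_simps add_divide_distrib)
  qed
  also have "\<dots> = 2 * s\<^sup>2 * conn d [\<lambda>k. 2 * of_int k + 1] + (- 2 * s\<^sup>2) * conn d [half_period]"
    unfolding conn1[symmetric] by (rule form_linear[OF form_conn_1])
  finally show ?thesis by (simp add: conn_single_odd c_def d_def)
qed

section \<open>The wave function\<close>

text \<open>
  The primitives of \<open>w\<^sup>2\<^sup>k dw\<close>, normalized by \<open>\<nu>\<close>: the base point of the integration is spread over \<open>w = 1\<close> and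
  \<open>w = -1\<close> with weights that depend on \<open>\<nu>\<close>. This choice produces the term \<open>\<hbar>\<nu>/2\<close> of the Weber equation.
\<close>

definition divisor :: "complex \<Rightarrow> complex \<Rightarrow> functional" where
  "divisor \<nu> w = (\<lambda>k. (w powi (2 * k + 1) - \<nu>) / (2 * of_int k + 1))"

text \<open>
  The coefficient of \<open>\<hbar>\<^sup>d\<close> in the wave function. The exponential of the integrated connected correlators is the
  generating series of the integrated disconnected ones, and it has finitely many terms by \<open>disc_long\<close>.
\<close>

definition psi :: "nat \<Rightarrow> complex \<Rightarrow> complex \<Rightarrow> complex" where
  "psi d \<nu> w = (\<Sum>n\<le>3 * d. disc d (replicate n (divisor \<nu> w)) / fact n)"

text \<open>
  The coefficients of the derivative of the wave function in \<open>w\<close>: differentiating one integration leaves a point.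
\<close>

definition phi :: "nat \<Rightarrow> complex \<Rightarrow> complex \<Rightarrow> complex" where
  "phi d \<nu> w = (\<Sum>n\<le>3 * d. disc d (point (w\<^sup>2) # replicate n (divisor \<nu> w)) / fact n)"

lemma sum_remove_length_0:
  "(\<And>y R. Suc (length R) = length L \<Longrightarrow> f y R = 0) \<Longrightarrow> sum_remove f L = 0"
proof -
  assume f: "\<And>y R. Suc (length R) = length L \<Longrightarrow> f y R = 0"
  have "sum_remove f L = sum_remove (\<lambda>y R. 0) L"
    by (rule sum_remove_cong, rule f) (metis length_Cons mset_eq_length)
  then show ?thesis by (simp add: sum_remove_zero)
qed

lemma sum_remove2_length_0:
  "(\<And>y z R. Suc (Suc (length R)) = length L \<Longrightarrow> f y z R = 0) \<Longrightarrow> sum_remove2 f L = 0"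
proof -
  assume f: "\<And>y z R. Suc (Suc (length R)) = length L \<Longrightarrow> f y z R = 0"
  have "sum_remove2 f L = sum_remove2 (\<lambda>y z R. 0) L"
    by (rule sum_remove2_cong, rule f) (metis length_Cons mset_eq_length)
  then show ?thesis by (simp add: sum_remove2_zero)
qed

text \<open>
  A stable component with \<open>n\<close> marked points has \<open>n \<le> 3d\<close>, with equality for three-punctured spheres.
\<close>

lemma disc_long: "3 * d < length L \<Longrightarrow> disc d L = 0"
proof (induction d arbitrary: L)
  case (Suc d)
  then obtain x M where L: "L = x # M" by (cases L) auto
  have "sum_remove (\<lambda>y R. disc d (quot_m x y # R)) M = 0"
    by (rule sum_remove_length_0, rule Suc.IH) (use Suc.prems L in simp)
  moreover have "sum_remove2 (\<lambda>y z R. three_point x y z * disc d R) M = 0"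
    by (rule sum_remove2_length_0) (use Suc.prems L Suc.IH in simp)
  ultimately show ?case
    using Suc.prems by (simp add: L Suc.IH)
qed auto

lemma disc_perm: "mset L = mset L' \<Longrightarrow> disc d L = disc d L'"
  using disc_symD[OF disc_symmetric] .

lemma disc_expand: "disc d (x # L) = (\<Sum>k=- int (width d)..int (width d). disc d (unit_at k # L) * x k)"
  by (rule formD[OF form_disc_1])

lemma disc_expand_2:
  "disc d (x # y # L) = (\<Sum>k=- int (width d)..int (width d). disc d (x # unit_at k # L) * y k)"
  by (rule formD[OF form_disc_2])

text \<open>
  By multilinearity and symmetry, all \<open>n\<close> arguments contribute equally.
\<close>

lemma DERIV_disc_replicate:
  assumes f: "\<And>k. ((\<lambda>w. f w k) has_field_derivative f' k) (at w0)"
  shows "((\<lambda>w. disc d (P @ replicate n (f w))) has_field_derivative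
    of_nat n * disc d (f' # P @ replicate (n - 1) (f w0))) (at w0)"
proof (induction n arbitrary: P)
  case 0
  show ?case by simp
next
  case (Suc n)
  let ?W = "{- int (width d)..int (width d)}"
  have "disc d (P @ replicate (Suc n) (f w)) = (\<Sum>k\<in>?W. disc d ((unit_at k # P) @ replicate n (f w)) * f w k)" for w
  proof -
    have "disc d (P @ replicate (Suc n) (f w)) = disc d (f w # P @ replicate n (f w))"
      by (rule disc_perm) simp
    then show ?thesis using disc_expand[of d "f w"] by simp
  qed
  moreover have "((\<lambda>w. \<Sum>k\<in>?W. disc d ((unit_at k # P) @ replicate n (f w)) * f w k) has_field_derivative
     (\<Sum>k\<in>?W. of_nat n * disc d (f' # (unit_at k # P) @ replicate (n - 1) (f w0)) * f w0 k
        + f' k * disc d ((unit_at k # P) @ replicate n (f w0)))) (at w0)"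
    by (intro DERIV_sum DERIV_mult Suc.IH f)
  moreover have "(\<Sum>k\<in>?W. of_nat n * disc d (f' # (unit_at k # P) @ replicate (n - 1) (f w0)) * f w0 k
        + f' k * disc d ((unit_at k # P) @ replicate n (f w0))) =
     of_nat (Suc n) * disc d (f' # P @ replicate n (f w0))"
  proof -
    have "(\<Sum>k\<in>?W. of_nat n * disc d (f' # (unit_at k # P) @ replicate (n - 1) (f w0)) * f w0 k) =
      of_nat n * disc d (f' # f w0 # P @ replicate (n - 1) (f w0))"
      using disc_expand_2[of d f' "f w0" "P @ replicate (n - 1) (f w0)"] by (simp add: sum_distrib_left mult.assoc)
    also have "\<dots> = of_nat n * disc d (f' # P @ replicate n (f w0))"
    proof (cases n)
      case (Suc j)
      have "disc d (f' # f w0 # P @ replicate j (f w0)) = disc d (f' # P @ replicate n (f w0))"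
        by (rule disc_perm) (simp add: Suc)
      then show ?thesis by (simp add: Suc)
    qed simp
    moreover have "(\<Sum>k\<in>?W. f' k * disc d ((unit_at k # P) @ replicate n (f w0))) = disc d (f' # P @ replicate n (f w0))"
      using disc_expand[of d f' "P @ replicate n (f w0)"] by (simp add: mult.commute)
    ultimately show ?thesis by (simp add: sum.distrib algebra_simps)
  qed
  ultimately show ?case by simp
qed

lemma DERIV_disc_Cons_replicate:
  assumes f: "\<And>k. ((\<lambda>w. f w k) has_field_derivative f' k) (at w0)"
    and g: "\<And>k. ((\<lambda>w. g w k) has_field_derivative g' k) (at w0)"
  shows "((\<lambda>w. disc d (g w # replicate n (f w))) has_field_derivative
    disc d (g' # replicate n (f w0)) + of_nat n * disc d (f' # g w0 # replicate (n - 1) (f w0))) (at w0)"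
proof -
  let ?W = "{- int (width d)..int (width d)}"
  have "((\<lambda>w. \<Sum>k\<in>?W. disc d ([unit_at k] @ replicate n (f w)) * g w k) has_field_derivative
     (\<Sum>k\<in>?W. of_nat n * disc d (f' # [unit_at k] @ replicate (n - 1) (f w0)) * g w0 k
        + g' k * disc d ([unit_at k] @ replicate n (f w0)))) (at w0)"
    by (intro DERIV_sum DERIV_mult DERIV_disc_replicate f g)
  moreover have "(\<Sum>k\<in>?W. disc d ([unit_at k] @ replicate n (f w)) * g w k) = disc d (g w # replicate n (f w))" for w
    using disc_expand[of d "g w" "replicate n (f w)"] by simp
  moreover have "(\<Sum>k\<in>?W. of_nat n * disc d (f' # [unit_at k] @ replicate (n - 1) (f w0)) * g w0 k
        + g' k * disc d ([unit_at k] @ replicate n (f w0))) =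
    disc d (g' # replicate n (f w0)) + of_nat n * disc d (f' # g w0 # replicate (n - 1) (f w0))"
    using disc_expand[of d g' "replicate n (f w0)"] disc_expand_2[of d f' "g w0" "replicate (n - 1) (f w0)"]
    by (simp add: sum.distrib sum_distrib_left mult_ac)
  ultimately show ?thesis by simp
qed

lemma DERIV_divisor: "w \<noteq> 0 \<Longrightarrow> ((\<lambda>w. divisor \<nu> w k) has_field_derivative point (w\<^sup>2) k) (at w)"
proof -
  assume w: "w \<noteq> 0"
  have "((\<lambda>w. (w powi (2 * k + 1) - \<nu>) / (2 * of_int k + 1)) has_field_derivative
      (of_int (2 * k + 1) * w powi (2 * k + 1 - 1) * 1 - 0) / (2 * of_int k + 1)) (at w)"
    by (intro DERIV_cdivide DERIV_diff DERIV_const DERIV_power_int DERIV_ident) (use w in simp)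
  then show ?thesis
    unfolding divisor_def using odd_nonzero[of k] by (simp add: point_def power_int_mult)
qed

definition point' :: "complex \<Rightarrow> functional" where
  "point' w = (\<lambda>k. 2 / w * dpoint (w\<^sup>2) k)"

lemma DERIV_point_square: "w \<noteq> 0 \<Longrightarrow> ((\<lambda>w. point (w\<^sup>2) k) has_field_derivative point' w k) (at w)"
proof -
  assume w: "w \<noteq> 0"
  have d: "((\<lambda>w. (w\<^sup>2) powi k) has_field_derivative of_int k * (w\<^sup>2) powi (k - 1) * (2 * w)) (at w)"
    by (rule DERIV_power_int) (use w in \<open>auto intro!: derivative_eq_intros\<close>)
  have e: "of_int k * (w\<^sup>2) powi (k - 1) * (2 * w) = 2 / w * (of_int k * (w\<^sup>2) powi k)"
    using w by (simp add: power_int_diff power2_eq_square)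
  show ?thesis
    unfolding point_def point'_def dpoint_def by (rule DERIV_cong[OF d e])
qed

lemma sum_extend_0:
  fixes f :: "nat \<Rightarrow> complex"
  assumes "m \<le> n" "\<And>i. m < i \<Longrightarrow> f i = 0" shows "(\<Sum>i\<le>n. f i) = (\<Sum>i\<le>m. f i)"
  by (rule sum.mono_neutral_right) (use assms in auto)

lemma sum_fact_shift:
  "(\<Sum>n\<le>Suc M. of_nat n * X (n - 1) / fact n) = (\<Sum>n\<le>M. X n / fact n :: complex)"
proof -
  have "of_nat (Suc n) * X n / fact (Suc n) = X n / fact n" for n
    unfolding fact_Suc using of_nat_neq_0[of n, where 'a = complex] by (simp del: of_nat_Suc)
  then show ?thesis
    unfolding sum.atMost_Suc_shift by simp
qed

lemma sum_fact_shift2: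
  "(\<Sum>n\<le>Suc (Suc M). of_nat (n choose 2) * Y (n - 2) / fact n) = (\<Sum>n\<le>M. Y n / fact n :: complex) / 2"
proof -
  have "of_nat (Suc (Suc n) choose 2) * Y n / fact (Suc (Suc n)) = Y n / fact n / 2" for n
  proof -
    have "of_nat (Suc (Suc n) choose 2) = (fact (Suc (Suc n)) / (fact 2 * fact (Suc (Suc n) - 2)) :: complex)"
      by (rule binomial_fact) simp
    then show ?thesis by (simp del: fact_Suc add: fact_2)
  qed
  then show ?thesis
    unfolding sum.atMost_Suc_shift by (simp add: numeral_2_eq_2 sum_divide_distrib)
qed

lemma psi_eq: "3 * d \<le> M \<Longrightarrow> (\<Sum>n\<le>M. disc d (replicate n (divisor \<nu> w)) / fact n) = psi d \<nu> w"
  unfolding psi_def by (rule sum_extend_0) (auto simp: disc_long)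

lemma phi_eq: "3 * d \<le> M \<Longrightarrow> (\<Sum>n\<le>M. disc d (point (w\<^sup>2) # replicate n (divisor \<nu> w)) / fact n) = phi d \<nu> w"
  unfolding phi_def by (rule sum_extend_0) (auto simp: disc_long)

lemma DERIV_psi: "w \<noteq> 0 \<Longrightarrow> ((\<lambda>w. psi d \<nu> w) has_field_derivative phi d \<nu> w) (at w)"
proof -
  assume w: "w \<noteq> 0"
  have "((\<lambda>w. \<Sum>n\<le>Suc (3 * d). disc d ([] @ replicate n (divisor \<nu> w)) / fact n) has_field_derivative
    (\<Sum>n\<le>Suc (3 * d). of_nat n * disc d (point (w\<^sup>2) # [] @ replicate (n - 1) (divisor \<nu> w)) / fact n)) (at w)"
    by (intro DERIV_sum DERIV_cdivide DERIV_disc_replicate DERIV_divisor w)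
  moreover have "(\<Sum>n\<le>Suc (3 * d). of_nat n * disc d (point (w\<^sup>2) # [] @ replicate (n - 1) (divisor \<nu> w)) / fact n) =
    phi d \<nu> w"
    by (subst sum_fact_shift) (simp add: phi_def)
  ultimately show ?thesis
    using psi_eq[of d "Suc (3 * d)"] by simp
qed

text \<open>
  The coefficients of the second derivative of the wave function: either the point is moved, or a second one
  is created.
\<close>

definition dphi :: "nat \<Rightarrow> complex \<Rightarrow> complex \<Rightarrow> complex" where
  "dphi d \<nu> w = (\<Sum>n\<le>3 * d. disc d (point' w # replicate n (divisor \<nu> w)) / fact n)
     + (\<Sum>n\<le>3 * d. disc d (point (w\<^sup>2) # point (w\<^sup>2) # replicate n (divisor \<nu> w)) / fact n)"

lemma DERIV_phi: "w \<noteq> 0 \<Longrightarrow> ((\<lambda>w. phi d \<nu> w) has_field_derivative dphi d \<nu> w) (at w)"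
proof -
  assume w: "w \<noteq> 0"
  let ?M = "Suc (3 * d)"
  have "((\<lambda>w. \<Sum>n\<le>?M. disc d (point (w\<^sup>2) # replicate n (divisor \<nu> w)) / fact n) has_field_derivative
    (\<Sum>n\<le>?M. (disc d (point' w # replicate n (divisor \<nu> w))
       + of_nat n * disc d (point (w\<^sup>2) # point (w\<^sup>2) # replicate (n - 1) (divisor \<nu> w))) / fact n)) (at w)"
    by (intro DERIV_sum DERIV_cdivide DERIV_disc_Cons_replicate DERIV_divisor DERIV_point_square w)
  moreover have "(\<Sum>n\<le>?M. (disc d (point' w # replicate n (divisor \<nu> w))
       + of_nat n * disc d (point (w\<^sup>2) # point (w\<^sup>2) # replicate (n - 1) (divisor \<nu> w))) / fact n) = dphi d \<nu> w"
  proof -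
    have "(\<Sum>n\<le>?M. disc d (point' w # replicate n (divisor \<nu> w)) / fact n) =
      (\<Sum>n\<le>3 * d. disc d (point' w # replicate n (divisor \<nu> w)) / fact n)"
      by (rule sum_extend_0) (auto simp: disc_long)
    then show ?thesis
      unfolding add_divide_distrib sum.distrib dphi_def
      by (subst sum_fact_shift) simp
  qed
  ultimately show ?thesis
    using phi_eq[of d ?M] by simp
qed

text \<open>
  The coefficients \<open>coeff_c\<close> and \<open>coeff_b\<close> of the differential equation come from the terms of the recursion in
  which one or two integrated spectators are removed, with the one-point term added to the latter.
\<close>

definition coeff_c :: "complex \<Rightarrow> complex \<Rightarrow> complex" where
  "coeff_c \<nu> w = 2 * mfun1 (w\<^sup>2) / w - 2 * \<nu> * mfun (w\<^sup>2) / (w\<^sup>2 - 1)"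

definition coeff_b :: "complex \<Rightarrow> complex \<Rightarrow> complex" where
  "coeff_b \<nu> w = ((w - \<nu>)\<^sup>2 - (1 / w - \<nu>)\<^sup>2 / w\<^sup>2) / 32 + mfun (w\<^sup>2) / (4 * w\<^sup>2)"

lemma quot_divisor:
  assumes "w \<noteq> 0" "w\<^sup>2 \<noteq> 1"
  shows "quot (point (w\<^sup>2)) (divisor \<nu> w) q =
    2 / w * dpoint (w\<^sup>2) q + (- 2 * \<nu> / (w\<^sup>2 - 1)) * point (w\<^sup>2) q + (2 * \<nu> / (w\<^sup>2 - 1)) * 1"
proof -
  define v where "v = w\<^sup>2"
  have v: "v \<noteq> 0" "v - 1 \<noteq> 0" using assms by (auto simp: v_def)
  define r where "r = 1 / (v - 1)"
  have r: "r * (v - 1) = 1" using v by (simp add: r_def)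
  define R where "R q = 2 / w * dpoint v q + (- 2 * \<nu> * r) * point v q + (2 * \<nu> * r) * 1" for q
  have R: "R (q + 1) = v * R q + (4 * of_int q + 2) * divisor \<nu> w q" for q
  proof -
    have p: "v powi (q + 1) = v * v powi q" using v(1) by (simp add: power_int_add)
    have wp: "w powi (2 * q + 1) = v / w * v powi q"
      using assms(1) by (simp add: v_def power_int_add power_int_mult power2_eq_square)
    have d: "(4 * of_int q + 2) * divisor \<nu> w q = 2 * (w powi (2 * q + 1) - \<nu>)"
    proof -
      have "2 * t * (x / t) = 2 * x" if "t \<noteq> 0" for t x :: complex using that by simp
      moreover have "4 * of_int q + 2 = 2 * (2 * of_int q + 1 :: complex)" by simp
      ultimately show ?thesis unfolding divisor_def using odd_nonzero[of q] by metis
    qed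
    have "R (q + 1) - (v * R q + (4 * of_int q + 2) * divisor \<nu> w q) = 2 * \<nu> * (1 - r * (v - 1))"
      unfolding R_def d wp dpoint_def point_def p by (simp add: algebra_simps)
    then show ?thesis using r by simp
  qed
  have "quot (point v) (divisor \<nu> w) q = R q"
  proof (induction q rule: int_shift_induct)
    case 1 then show ?case by (simp add: quot_0 R_def dpoint_def point_def)
  next
    case (2 q) then show ?case using v by (simp add: quot_point_step R)
  qed
  then show ?thesis by (simp add: R_def v_def r_def)
qed

text \<open>
  Removing an integrated spectator gives the derivative of a point and a multiple of the point itself, so the
  recursion closes on the wave function and its two derivatives.
\<close>

lemma quot_m_divisor:
  assumes "w \<noteq> 0" "w\<^sup>2 \<noteq> 1"
  shows "quot_m (point (w\<^sup>2)) (divisor \<nu> w) =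
    (\<lambda>k. mfun (w\<^sup>2) * point' w k + coeff_c \<nu> w * point (w\<^sup>2) k)"
proof
  fix k
  have v: "w\<^sup>2 \<noteq> 0" using assms by simp
  have "quot_m (point (w\<^sup>2)) (divisor \<nu> w) k = 2 / w * pull_m (dpoint (w\<^sup>2)) k
      + (- 2 * \<nu> / (w\<^sup>2 - 1)) * pull_m (point (w\<^sup>2)) k + (2 * \<nu> / (w\<^sup>2 - 1)) * pull_m (\<lambda>q. 1) k"
    unfolding quot_m_def quot_divisor[OF assms, abs_def] by (rule pull_m_linear)
  moreover have "pull_m (\<lambda>q. 1) k = 0" by (simp add: pull_m_def)
  ultimately show "quot_m (point (w\<^sup>2)) (divisor \<nu> w) k =
      mfun (w\<^sup>2) * point' w k + coeff_c \<nu> w * point (w\<^sup>2) k"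
    unfolding pull_m_dpoint[OF v] pull_m_point[OF v] coeff_c_def point'_def
    by (simp add: dpoint_def point_def algebra_simps add_divide_distrib)
qed

text \<open>
  The recursion at the root \<open>point (w\<^sup>2)\<close>, with all spectators equal and summed with weights \<open>1 / n!\<close>.
\<close>

lemma phi_ode:
  assumes w: "w \<noteq> 0" "w\<^sup>2 \<noteq> 1"
  shows "phi (Suc d) \<nu> w = mfun (w\<^sup>2) * dphi d \<nu> w + coeff_c \<nu> w * phi d \<nu> w + coeff_b \<nu> w * psi d \<nu> w"
proof -
  let ?M = "3 * d" and ?D = "divisor \<nu> w" and ?p = "point (w\<^sup>2)"
  have v: "w\<^sup>2 \<noteq> 0" using w by simp
  have e: "disc (Suc d) (?p # replicate n ?D) =
      mfun (w\<^sup>2) * disc d (?p # ?p # replicate n ?D)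
      + of_nat n * disc d (quot_m ?p ?D # replicate (n - 1) ?D)
      + three_point ?p ?D ?D * (of_nat (n choose 2) * disc d (replicate (n - 2) ?D))
      + one_point ?p * disc d (replicate n ?D)" for n
    unfolding disc_point[OF v] sum_remove_replicate sum_remove2_replicate by (simp add: mult_ac)
  have "phi (Suc d) \<nu> w = (\<Sum>n\<le>Suc (Suc (Suc ?M)). disc (Suc d) (?p # replicate n ?D) / fact n)"
    by (rule phi_eq[symmetric]) simp
  also have "\<dots> = mfun (w\<^sup>2) * (\<Sum>n\<le>Suc (Suc (Suc ?M)). disc d (?p # ?p # replicate n ?D) / fact n)
      + (\<Sum>n\<le>Suc (Suc (Suc ?M)). of_nat n * disc d (quot_m ?p ?D # replicate (n - 1) ?D) / fact n)
      + three_point ?p ?D ?D * (\<Sum>n\<le>Suc (Suc (Suc ?M)). of_nat (n choose 2) * disc d (replicate (n - 2) ?D) / fact n)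
      + one_point ?p * (\<Sum>n\<le>Suc (Suc (Suc ?M)). disc d (replicate n ?D) / fact n)"
    unfolding e add_divide_distrib sum.distrib sum_distrib_left by (simp only: times_divide_eq_right)
  also have "(\<Sum>n\<le>Suc (Suc (Suc ?M)). disc d (?p # ?p # replicate n ?D) / fact n) =
      (\<Sum>n\<le>?M. disc d (?p # ?p # replicate n ?D) / fact n)"
    by (rule sum_extend_0) (auto simp: disc_long)
  also have "(\<Sum>n\<le>Suc (Suc (Suc ?M)). of_nat n * disc d (quot_m ?p ?D # replicate (n - 1) ?D) / fact n) =
      (\<Sum>n\<le>Suc (Suc ?M). disc d (quot_m ?p ?D # replicate n ?D) / fact n)"
    by (rule sum_fact_shift)
  also have "\<dots> = (\<Sum>n\<le>?M. disc d (quot_m ?p ?D # replicate n ?D) / fact n)"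
    by (rule sum_extend_0) (auto simp: disc_long)
  also have "\<dots> = mfun (w\<^sup>2) * (\<Sum>n\<le>?M. disc d (point' w # replicate n ?D) / fact n) + coeff_c \<nu> w * phi d \<nu> w"
    unfolding quot_m_divisor[OF w] form_linear[OF form_disc_1] phi_def
    by (simp add: add_divide_distrib sum.distrib sum_distrib_left)
  also have "(\<Sum>n\<le>Suc (Suc (Suc ?M)). of_nat (n choose 2) * disc d (replicate (n - 2) ?D) / fact n) =
      (\<Sum>n\<le>Suc ?M. disc d (replicate n ?D) / fact n) / 2"
    by (rule sum_fact_shift2)
  also have "(\<Sum>n\<le>Suc ?M. disc d (replicate n ?D) / fact n) = psi d \<nu> w" by (rule psi_eq) simp
  also have "(\<Sum>n\<le>Suc (Suc (Suc ?M)). disc d (replicate n ?D) / fact n) = psi d \<nu> w" by (rule psi_eq) simp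
  finally have "phi (Suc d) \<nu> w = mfun (w\<^sup>2) * dphi d \<nu> w + coeff_c \<nu> w * phi d \<nu> w
      + (three_point ?p ?D ?D / 2 + one_point ?p) * psi d \<nu> w"
    unfolding dphi_def by (simp add: algebra_simps)
  moreover have "three_point ?p ?D ?D / 2 + one_point ?p = coeff_b \<nu> w"
  proof -
    define t where "t = 1 / w"
    have D: "?D (- 1) = \<nu> - t" "?D 0 = w - \<nu>"
      by (simp_all add: divisor_def power_int_minus inverse_eq_divide t_def)
    have p: "?p 0 = 1" "?p (- 1) = t\<^sup>2"
      by (simp_all add: point_def power_int_minus inverse_eq_divide t_def power_one_over)
    have "three_point ?p ?D ?D = ((w - \<nu>)\<^sup>2 - (t - \<nu>)\<^sup>2 * t\<^sup>2) / 16"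
      unfolding three_point_def D p by (simp add: power2_eq_square algebra_simps)
    moreover have "one_point ?p = mfun (w\<^sup>2) / (4 * w\<^sup>2)"
      unfolding one_point_def pull_m_point[OF v] by (simp add: power_int_minus inverse_eq_divide)
    ultimately show ?thesis
      unfolding coeff_b_def by (simp only:) (simp add: t_def power_one_over)
  qed
  ultimately show ?thesis by simp
qed

section \<open>Logarithms of parametrized power series\<close>

text \<open>Coefficientwise derivative with respect to a parameter.\<close>

definition fps_has_deriv :: "(complex \<Rightarrow> complex fps) \<Rightarrow> complex fps \<Rightarrow> complex \<Rightarrow> bool" where
  "fps_has_deriv F F' w \<longleftrightarrow>
     (\<forall>n. ((\<lambda>w. fps_nth (F w) n) has_field_derivative fps_nth F' n) (at w))"

lemma fps_has_deriv_mult: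
  assumes "fps_has_deriv F F' w" "fps_has_deriv G G' w"
  shows "fps_has_deriv (\<lambda>w. F w * G w) (F' * G w + F w * G') w"
  unfolding fps_has_deriv_def
proof
  fix n
  have "((\<lambda>w. \<Sum>i=0..n. fps_nth (F w) i * fps_nth (G w) (n - i)) has_field_derivative
    (\<Sum>i=0..n. fps_nth F' i * fps_nth (G w) (n - i) + fps_nth G' (n - i) * fps_nth (F w) i)) (at w)"
    by (intro DERIV_sum DERIV_mult) (use assms in \<open>simp_all add: fps_has_deriv_def\<close>)
  then show "((\<lambda>w. fps_nth (F w * G w) n) has_field_derivative fps_nth (F' * G w + F w * G') n) (at w)"
    by (simp add: fps_mult_nth sum.distrib mult.commute[of "fps_nth G' _"])
qed

lemma fps_has_deriv_fps_deriv:
  "fps_has_deriv F F' w \<Longrightarrow> fps_has_deriv (\<lambda>w. fps_deriv (F w)) (fps_deriv F') w"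
  unfolding fps_has_deriv_def by (auto intro!: DERIV_cmult simp del: of_nat_Suc)

lemma fps_has_deriv_unique: "fps_has_deriv F A w \<Longrightarrow> fps_has_deriv F B w \<Longrightarrow> A = B"
  unfolding fps_has_deriv_def by (metis DERIV_unique fps_ext)

text \<open>
  The coefficients of an inverse series are polynomials in those of the series. So any property of functions
  that is closed under sums and products passes to them; it is applied to differentiability in one parameter,
  to the existence of commuting mixed derivatives, and to being a polynomial.
\<close>

lemma inverse_coeff_closed:
  fixes F :: "'a \<Rightarrow> complex fps"
  assumes F0: "\<And>x. fps_nth (F x) 0 = 1" and F: "\<And>n. P (\<lambda>x. fps_nth (F x) n)"
    and const: "\<And>c. P (\<lambda>x. c)" and add: "\<And>f g. P f \<Longrightarrow> P g \<Longrightarrow> P (\<lambda>x. f x + g x)"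
    and mult: "\<And>f g. P f \<Longrightarrow> P g \<Longrightarrow> P (\<lambda>x. f x * g x)"
  shows "P (\<lambda>x. fps_nth (inverse (F x)) n)"
proof (induction n rule: less_induct)
  case (less n)
  have sum: "P (\<lambda>x. \<Sum>i\<in>I. f i x)" if "\<And>i. i \<in> I \<Longrightarrow> P (f i)" "finite I" for I :: "nat set" and f
    using that(2,1) by (induction I) (auto intro: const add)
  show ?case
  proof (cases "n = 0")
    case True
    then show ?thesis using const[of 1] by (simp add: F0)
  next
    case False
    have "fps_nth (inverse (F x)) n = - 1 * (\<Sum>i\<in>{1..n}. fps_nth (F x) i * fps_nth (inverse (F x)) (n - i))" for x
    proof -
      have "fps_nth (F x * inverse (F x)) n = 0"
        using False F0[of x] by (simp add: inverse_mult_eq_1')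
      then have "(\<Sum>i=0..n. fps_nth (F x) i * fps_nth (inverse (F x)) (n - i)) = 0"
        by (simp add: fps_mult_nth)
      moreover have "{0..n} = insert 0 {1..n}" by auto
      ultimately show ?thesis using F0[of x] by (simp add: eq_neg_iff_add_eq_0)
    qed
    moreover have "P (\<lambda>x. - 1 * (\<Sum>i\<in>{1..n}. fps_nth (F x) i * fps_nth (inverse (F x)) (n - i)))"
      by (intro mult const sum F less.IH) auto
    ultimately show ?thesis by simp
  qed
qed

lemma mult_coeff_closed:
  fixes F G :: "'a \<Rightarrow> complex fps"
  assumes F: "\<And>n. P (\<lambda>x. fps_nth (F x) n)" and G: "\<And>n. P (\<lambda>x. fps_nth (G x) n)"
    and const: "\<And>c. P (\<lambda>x. c)" and add: "\<And>f g. P f \<Longrightarrow> P g \<Longrightarrow> P (\<lambda>x. f x + g x)"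
    and mult: "\<And>f g. P f \<Longrightarrow> P g \<Longrightarrow> P (\<lambda>x. f x * g x)"
  shows "P (\<lambda>x. fps_nth (F x * G x) n)"
proof -
  have sum: "P (\<lambda>x. \<Sum>i\<in>I. f i x)" if "finite I" "\<And>i. i \<in> I \<Longrightarrow> P (f i)" for I :: "nat set" and f
    using that by (induction I) (auto intro: const add)
  show ?thesis
    unfolding fps_mult_nth by (intro sum mult F G) auto
qed

text \<open>
  The logarithm of a series with constant term \<open>1\<close>, characterized by its logarithmic derivative.
\<close>

definition fps_log :: "complex fps \<Rightarrow> complex fps" where
  "fps_log F = fps_integral0 (fps_deriv F * inverse F)"

lemma fps_log_nth_0: "fps_nth (fps_log F) 0 = 0"
  by (simp add: fps_log_def)

lemma fps_log_nth_Suc: "fps_nth (fps_log F) (Suc n) = fps_nth (fps_deriv F * inverse F) n / of_nat (Suc n)"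
  by (simp add: fps_log_def fps_integral_def field_simps)

lemma fps_log_coeff_closed:
  fixes F :: "'a \<Rightarrow> complex fps"
  assumes F0: "\<And>x. fps_nth (F x) 0 = 1" and F: "\<And>n. P (\<lambda>x. fps_nth (F x) n)"
    and const: "\<And>c. P (\<lambda>x. c)" and add: "\<And>f g. P f \<Longrightarrow> P g \<Longrightarrow> P (\<lambda>x. f x + g x)"
    and mult: "\<And>f g. P f \<Longrightarrow> P g \<Longrightarrow> P (\<lambda>x. f x * g x)"
  shows "P (\<lambda>x. fps_nth (fps_log (F x)) n)"
proof (cases n)
  case 0
  then show ?thesis using const by (simp add: fps_log_nth_0)
next
  case (Suc k)
  have "P (\<lambda>x. fps_nth (fps_deriv (F x) * inverse (F x)) k)"
  proof (rule mult_coeff_closed[OF _ _ const add mult])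
    show "P (\<lambda>x. fps_nth (fps_deriv (F x)) n)" for n
      unfolding fps_deriv_nth by (intro mult const F)
    show "P (\<lambda>x. fps_nth (inverse (F x)) n)" for n
      by (rule inverse_coeff_closed[OF F0 F const add mult])
  qed
  from mult[OF this const[of "1 / of_nat (Suc k)"]] show ?thesis
    unfolding Suc fps_log_nth_Suc by (simp del: of_nat_Suc)
qed

lemma fps_has_deriv_inverse:
  assumes F0: "\<And>x. fps_nth (F x) 0 = 1" and F: "fps_has_deriv F F' w"
  shows "fps_has_deriv (\<lambda>w. inverse (F w)) (- F' * (inverse (F w))\<^sup>2) w"
proof -
  have "(\<lambda>x. fps_nth (inverse (F x)) n) field_differentiable at w" for n
  proof (rule inverse_coeff_closed[OF F0])
    show "(\<lambda>x. fps_nth (F x) n) field_differentiable at w" for n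
      using F unfolding fps_has_deriv_def field_differentiable_def by blast
  qed (auto intro: field_differentiable_const field_differentiable_add field_differentiable_mult)
  then obtain D where D: "\<And>n. ((\<lambda>x. fps_nth (inverse (F x)) n) has_field_derivative D n) (at w)"
    unfolding field_differentiable_def by metis
  define I where "I = Abs_fps D"
  have I: "fps_has_deriv (\<lambda>w. inverse (F w)) I w"
    using D by (simp add: fps_has_deriv_def I_def)
  have inv: "F x * inverse (F x) = 1" for x using F0[of x] by (simp add: inverse_mult_eq_1')
  have "fps_has_deriv (\<lambda>w. 1) (F' * inverse (F w) + F w * I) w"
    using fps_has_deriv_mult[OF F I] by (simp add: inv)
  moreover have "fps_has_deriv (\<lambda>w. 1 :: complex fps) 0 w" by (simp add: fps_has_deriv_def)
  ultimately have "F' * inverse (F w) + F w * I = 0" by (rule fps_has_deriv_unique)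
  then have "inverse (F w) * (F' * inverse (F w) + F w * I) = 0" by simp
  moreover have "inverse (F w) * (F' * inverse (F w) + F w * I) =
      F' * (inverse (F w))\<^sup>2 + (F w * inverse (F w)) * I"
    by (simp add: algebra_simps power2_eq_square)
  ultimately have "F' * (inverse (F w))\<^sup>2 + 1 * I = 0"
    unfolding inv by (simp only:)
  then have "I = - (F' * (inverse (F w))\<^sup>2)"
    by (simp add: eq_neg_iff_add_eq_0 add.commute)
  then have "I = - F' * (inverse (F w))\<^sup>2" by simp
  then show ?thesis using I by simp
qed

lemma fps_has_deriv_log:
  assumes F0: "\<And>x. fps_nth (F x) 0 = 1" and F: "fps_has_deriv F F' w"
  shows "fps_has_deriv (\<lambda>w. fps_log (F w)) (F' * inverse (F w)) w"
  unfolding fps_has_deriv_def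
proof
  fix n
  let ?I = "inverse (F w)"
  show "((\<lambda>w. fps_nth (fps_log (F w)) n) has_field_derivative fps_nth (F' * ?I) n) (at w)"
  proof (cases n)
    case 0
    have "((\<lambda>x. fps_nth (F x) 0) has_field_derivative 0) (at w)" by (simp add: F0)
    moreover have "((\<lambda>x. fps_nth (F x) 0) has_field_derivative fps_nth F' 0) (at w)"
      using F by (simp add: fps_has_deriv_def)
    ultimately have "fps_nth F' 0 = 0" using DERIV_unique by blast
    then show ?thesis by (simp add: 0 fps_log_nth_0)
  next
    case (Suc k)
    have "fps_has_deriv (\<lambda>w. fps_deriv (F w) * inverse (F w))
        (fps_deriv F' * ?I + fps_deriv (F w) * (- F' * ?I\<^sup>2)) w"
      by (intro fps_has_deriv_mult fps_has_deriv_fps_deriv fps_has_deriv_inverse F F0)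
    also have "fps_deriv F' * ?I + fps_deriv (F w) * (- F' * ?I\<^sup>2) = fps_deriv (F' * ?I)"
      using F0[of w] by (simp add: fps_inverse_deriv algebra_simps)
    finally have "((\<lambda>w. fps_nth (fps_deriv (F w) * inverse (F w)) k / of_nat (Suc k)) has_field_derivative
        fps_nth (fps_deriv (F' * ?I)) k / of_nat (Suc k)) (at w)"
      unfolding fps_has_deriv_def by (intro DERIV_cdivide) blast
    moreover have "fps_nth (fps_deriv (F' * ?I)) k / of_nat (Suc k) = fps_nth (F' * ?I) (Suc k)"
      unfolding fps_deriv_nth Suc_eq_plus1[symmetric]
      using of_nat_neq_0[of k, where 'a = complex] by (simp del: of_nat_Suc)
    ultimately show ?thesis unfolding Suc fps_log_nth_Suc by metis
  qed
qed

section \<open>The quantum curve\<close>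

definition Psi :: "complex \<Rightarrow> complex \<Rightarrow> complex fps" where "Psi \<nu> w = Abs_fps (\<lambda>d. psi d \<nu> w)"

definition Phi1 :: "complex \<Rightarrow> complex \<Rightarrow> complex fps" where "Phi1 \<nu> w = Abs_fps (\<lambda>d. phi d \<nu> w)"

definition Phi2 :: "complex \<Rightarrow> complex \<Rightarrow> complex fps" where "Phi2 \<nu> w = Abs_fps (\<lambda>d. dphi d \<nu> w)"

definition chi :: "complex \<Rightarrow> complex \<Rightarrow> complex fps" where
  "chi \<nu> w = Phi1 \<nu> w * inverse (Psi \<nu> w)"

definition dchi :: "complex \<Rightarrow> complex \<Rightarrow> complex fps" where
  "dchi \<nu> w = Phi2 \<nu> w * inverse (Psi \<nu> w) - (chi \<nu> w)\<^sup>2"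

lemma Psi_nth_0: "fps_nth (Psi \<nu> w) 0 = 1"
  by (simp add: Psi_def psi_def)

lemma chi_nth_0: "fps_nth (chi \<nu> w) 0 = 0"
  by (simp add: chi_def Phi1_def phi_def)

lemma fps_has_deriv_Psi: "w \<noteq> 0 \<Longrightarrow> fps_has_deriv (Psi \<nu>) (Phi1 \<nu> w) w"
  by (simp add: fps_has_deriv_def Psi_def Phi1_def DERIV_psi)

lemma fps_has_deriv_Phi1: "w \<noteq> 0 \<Longrightarrow> fps_has_deriv (Phi1 \<nu>) (Phi2 \<nu> w) w"
  by (simp add: fps_has_deriv_def Phi1_def Phi2_def DERIV_phi)

lemma fps_has_deriv_log_Psi: "w \<noteq> 0 \<Longrightarrow> fps_has_deriv (\<lambda>w. fps_log (Psi \<nu> w)) (chi \<nu> w) w"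
  unfolding chi_def by (rule fps_has_deriv_log[OF Psi_nth_0 fps_has_deriv_Psi])

lemma fps_has_deriv_chi: "w \<noteq> 0 \<Longrightarrow> fps_has_deriv (chi \<nu>) (dchi \<nu> w) w"
  using fps_has_deriv_mult[OF fps_has_deriv_Phi1 fps_has_deriv_inverse[OF Psi_nth_0 fps_has_deriv_Psi], of w \<nu> \<nu>]
  unfolding chi_def[abs_def] dchi_def by (simp add: power2_eq_square mult_ac)

text \<open>
  The linear equation for \<open>Psi\<close>, divided by \<open>Psi\<close>.
\<close>

lemma chi_ode:
  assumes "w \<noteq> 0" "w\<^sup>2 \<noteq> 1"
  shows "chi \<nu> w = fps_X * (fps_const (mfun (w\<^sup>2)) * (dchi \<nu> w + (chi \<nu> w)\<^sup>2)
    + fps_const (coeff_c \<nu> w) * chi \<nu> w + fps_const (coeff_b \<nu> w))"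
proof -
  have "Phi1 \<nu> w = fps_X * (fps_const (mfun (w\<^sup>2)) * Phi2 \<nu> w + fps_const (coeff_c \<nu> w) * Phi1 \<nu> w
      + fps_const (coeff_b \<nu> w) * Psi \<nu> w)"
  proof (rule fps_ext)
    fix n show "fps_nth (Phi1 \<nu> w) n = fps_nth (fps_X * (fps_const (mfun (w\<^sup>2)) * Phi2 \<nu> w
        + fps_const (coeff_c \<nu> w) * Phi1 \<nu> w + fps_const (coeff_b \<nu> w) * Psi \<nu> w)) n"
      by (cases n) (simp_all add: Phi1_def Phi2_def Psi_def phi_ode[OF assms], simp add: phi_def)
  qed
  then have "chi \<nu> w = fps_X * (fps_const (mfun (w\<^sup>2)) * Phi2 \<nu> w + fps_const (coeff_c \<nu> w) * Phi1 \<nu> w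
      + fps_const (coeff_b \<nu> w) * Psi \<nu> w) * inverse (Psi \<nu> w)"
    unfolding chi_def by (rule arg_cong)
  also have "\<dots> = fps_X * (fps_const (mfun (w\<^sup>2)) * (Phi2 \<nu> w * inverse (Psi \<nu> w))
      + fps_const (coeff_c \<nu> w) * chi \<nu> w + fps_const (coeff_b \<nu> w) * (Psi \<nu> w * inverse (Psi \<nu> w)))"
    unfolding chi_def by (simp add: algebra_simps)
  also have "Psi \<nu> w * inverse (Psi \<nu> w) = 1" by (simp add: inverse_mult_eq_1' Psi_nth_0)
  finally show ?thesis unfolding dchi_def by simp
qed

lemma chi_nth_Suc:
  assumes "w \<noteq> 0" "w\<^sup>2 \<noteq> 1"
  shows "fps_nth (chi \<nu> w) (Suc k) = mfun (w\<^sup>2) * (fps_nth (dchi \<nu> w) k + fps_nth ((chi \<nu> w)\<^sup>2) k)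
    + coeff_c \<nu> w * fps_nth (chi \<nu> w) k + (if k = 0 then coeff_b \<nu> w else 0)"
proof -
  have "fps_nth (chi \<nu> w) (Suc k) = fps_nth (fps_X * (fps_const (mfun (w\<^sup>2)) * (dchi \<nu> w + (chi \<nu> w)\<^sup>2)
    + fps_const (coeff_c \<nu> w) * chi \<nu> w + fps_const (coeff_b \<nu> w))) (Suc k)"
    using chi_ode[OF assms] by (rule arg_cong)
  then show ?thesis by simp
qed

section \<open>The Riccati equation\<close>

lemma cay_square_minus_1: "z \<noteq> 1 \<Longrightarrow> (cay z)\<^sup>2 - 1 = 4 * z / (z - 1)\<^sup>2"
  unfolding cay_def by (simp add: power_divide divide_simps) (simp add: power2_eq_square algebra_simps)

lemma mfun1_cay:
  assumes "z \<noteq> 1" "z \<noteq> - 1" "z \<noteq> 0"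
  shows "mfun1 ((cay z)\<^sup>2) = z\<^sup>2 * (3 * z\<^sup>2 + 2 * z + 3) / (2 * (z - 1) ^ 4 * (z + 1)\<^sup>2)"
proof -
  have nz: "z - 1 \<noteq> 0" "z + 1 \<noteq> 0" using assms by (auto simp: eq_neg_iff_add_eq_0)
  have v: "mfun1 v = (v - 1)\<^sup>2 * (2 * v + 1) / (32 * v)" if "v \<noteq> 0" for v
    using that by (simp add: mfun1_def field_simps power2_eq_square)
  have "2 * (cay z)\<^sup>2 + 1 = (3 * z\<^sup>2 + 2 * z + 3) / (z - 1)\<^sup>2"
    unfolding cay_def using nz by (simp add: power_divide divide_simps) (simp add: power2_eq_square algebra_simps)
  then have "mfun1 ((cay z)\<^sup>2) = (4 * z / (z - 1)\<^sup>2)\<^sup>2 * ((3 * z\<^sup>2 + 2 * z + 3) / (z - 1)\<^sup>2) /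
      (32 * ((z + 1)\<^sup>2 / (z - 1)\<^sup>2))"
    unfolding v[OF pt_nonzero[OF assms(1,2)]] cay_square_minus_1[OF assms(1)]
    by (simp add: cay_def power_divide)
  also have "\<dots> = z\<^sup>2 * (3 * z\<^sup>2 + 2 * z + 3) / (2 * (z - 1) ^ 4 * (z + 1)\<^sup>2)"
    using nz by (simp add: power_divide power_mult_distrib divide_simps)
  finally show ?thesis .
qed

text \<open>
  The derivative of the Cayley coordinate \<open>w\<close> with respect to \<open>x\<close>.
\<close>

definition dw_dx :: "complex \<Rightarrow> complex" where "dw_dx z = - 2 * z\<^sup>2 / ((z - 1) ^ 3 * (z + 1))"

context
  fixes z :: complex
  assumes z: "z \<noteq> 0" "z \<noteq> 1" "z \<noteq> - 1"
begin

lemma z_nonzero: "z - 1 \<noteq> 0" "z + 1 \<noteq> 0" "z\<^sup>2 - 1 \<noteq> 0"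
  using z by (auto simp: eq_neg_iff_add_eq_0 power2_eq_1_iff)

lemma deriv_x_eq: "deriv (weber_x 1) z = (z\<^sup>2 - 1) / z\<^sup>2"
  using z by (simp add: deriv_weber_x field_simps)

lemma dw_dx_eq: "dw_dx z * deriv (weber_x 1) z = dcay z"
proof -
  have "z\<^sup>2 - 1 = (z - 1) * (z + 1)" by (simp add: power2_eq_square algebra_simps)
  then show ?thesis
    unfolding deriv_x_eq dw_dx_def dcay_def using z z_nonzero
    by (simp add: divide_simps) (simp add: eval_nat_numeral)
qed

lemma DERIV_dw_dx:
  "(dw_dx has_field_derivative dw_dx z * (2 / z - 3 / (z - 1) - 1 / (z + 1))) (at z)"
proof -
  define a b where "a = z - 1" and "b = z + 1"
  have ab: "a \<noteq> 0" "b \<noteq> 0" using z_nonzero by (auto simp: a_def b_def)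
  have "((\<lambda>z. (z - 1) ^ 3 * (z + 1)) has_field_derivative 3 * (z - 1)\<^sup>2 * (z + 1) + (z - 1) ^ 3) (at z)"
    by (auto intro!: derivative_eq_intros)
  moreover have "((\<lambda>z. - 2 * z\<^sup>2) has_field_derivative - 4 * z) (at z)"
    by (auto intro!: derivative_eq_intros)
  ultimately have "(dw_dx has_field_derivative (- 4 * z * ((z - 1) ^ 3 * (z + 1))
      - (- 2 * z\<^sup>2) * (3 * (z - 1)\<^sup>2 * (z + 1) + (z - 1) ^ 3)) /
      ((z - 1) ^ 3 * (z + 1) * ((z - 1) ^ 3 * (z + 1)))) (at z)"
    unfolding dw_dx_def[abs_def] by (intro DERIV_divide) (use z_nonzero in auto)
  moreover have "(- 4 * z * ((z - 1) ^ 3 * (z + 1))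
      - (- 2 * z\<^sup>2) * (3 * (z - 1)\<^sup>2 * (z + 1) + (z - 1) ^ 3)) /
      ((z - 1) ^ 3 * (z + 1) * ((z - 1) ^ 3 * (z + 1))) = dw_dx z * (2 / z - 3 / (z - 1) - 1 / (z + 1))"
    unfolding dw_dx_def a_def[symmetric] b_def[symmetric] using ab z
    by (simp add: divide_simps) (simp add: eval_nat_numeral algebra_simps)
  ultimately show ?thesis by metis
qed

lemma weber_y_eq: "2 * weber_y 1 z = (z\<^sup>2 - 1) / z"
  using z by (simp add: weber_y_def field_simps power2_eq_square)

lemma riccati_first:
  "riccati_coeff 1 \<nu> 1 z = z * (\<nu> * (z\<^sup>2 - 1) - (z\<^sup>2 + 1)) / (2 * (z\<^sup>2 - 1)\<^sup>2)"
proof -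
  have "deriv (weber_y 1) z = (z\<^sup>2 + 1) / (2 * z\<^sup>2)"
    unfolding weber_y_def[abs_def] using z
    by (intro DERIV_imp_deriv) (auto intro!: derivative_eq_intros simp: field_simps power2_eq_square)
  then have "riccati_coeff 1 \<nu> 1 z = (\<nu> / 2 - (z\<^sup>2 + 1) / (2 * z\<^sup>2) / ((z\<^sup>2 - 1) / z\<^sup>2)) / ((z\<^sup>2 - 1) / z)"
    by (simp add: deriv_x_eq weber_y_eq)
  also have "\<dots> = z * (\<nu> * (z\<^sup>2 - 1) - (z\<^sup>2 + 1)) / (2 * (z\<^sup>2 - 1)\<^sup>2)"
    using z z_nonzero(3) by (simp add: divide_simps) (simp add: power2_eq_square algebra_simps)
  finally show ?thesis .
qed

lemma y_mfun: "2 * weber_y 1 z * mfun ((cay z)\<^sup>2) = - dw_dx z"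
proof -
  have "z\<^sup>2 - 1 = (z - 1) * (z + 1)" by (simp add: power2_eq_square algebra_simps)
  then show ?thesis
    unfolding weber_y_eq mfun_cay[OF z(2,3,1)] dw_dx_def using z z_nonzero
    by (simp add: divide_simps) (simp add: eval_nat_numeral algebra_simps)
qed

lemma y_coeff_c:
  "2 * weber_y 1 z * coeff_c \<nu> (cay z) =
     - (2 / z - 3 / (z - 1) - 1 / (z + 1)) / deriv (weber_x 1) z - 2 * riccati_coeff 1 \<nu> 1 z"
proof -
  define a b where "a = z - 1" and "b = z + 1"
  have ab: "a \<noteq> 0" "b \<noteq> 0" "z\<^sup>2 - 1 = a * b" "z = (a + b) / 2"
    using z_nonzero by (auto simp: a_def b_def power2_eq_square algebra_simps)
  have cc: "coeff_c \<nu> (cay z) = z\<^sup>2 * (3 * z\<^sup>2 + 2 * z + 3) / (a ^ 3 * b ^ 3) - \<nu> * z\<^sup>2 / (a\<^sup>2 * b\<^sup>2)"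
    unfolding coeff_c_def mfun_cay[OF z(2,3,1)] mfun1_cay[OF z(2,3,1)] cay_square_minus_1[OF z(2)]
    unfolding cay_def a_def[symmetric] b_def[symmetric] using ab(1,2) z
    by (simp add: divide_simps) (simp add: eval_nat_numeral algebra_simps)
  have "2 * weber_y 1 z * coeff_c \<nu> (cay z) =
      z * (3 * z\<^sup>2 + 2 * z + 3) / (a\<^sup>2 * b\<^sup>2) - \<nu> * z / (a * b)"
    unfolding weber_y_eq ab(3) cc using ab(1,2) z
    by (simp add: divide_simps) (simp add: eval_nat_numeral algebra_simps)
  moreover have "- (2 / z - 3 / (z - 1) - 1 / (z + 1)) / deriv (weber_x 1) z =
      z * (2 * z\<^sup>2 + 2 * z + 2) / (a\<^sup>2 * b\<^sup>2)"
    unfolding deriv_x_eq ab(3) a_def[symmetric] b_def[symmetric] using ab(1,2) z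
    by (simp add: divide_simps) (simp add: a_def b_def eval_nat_numeral algebra_simps)
  moreover have "2 * riccati_coeff 1 \<nu> 1 z = \<nu> * z / (a * b) - z * (z\<^sup>2 + 1) / (a\<^sup>2 * b\<^sup>2)"
    unfolding riccati_first ab(3) using ab(1,2)
    by (simp add: divide_simps) (simp add: eval_nat_numeral algebra_simps)
  moreover have "z * (3 * z\<^sup>2 + 2 * z + 3) / (a\<^sup>2 * b\<^sup>2) - \<nu> * z / (a * b) =
    z * (2 * z\<^sup>2 + 2 * z + 2) / (a\<^sup>2 * b\<^sup>2) - (\<nu> * z / (a * b) - z * (z\<^sup>2 + 1) / (a\<^sup>2 * b\<^sup>2))"
    using ab(1,2) by (simp add: divide_simps) (simp add: eval_nat_numeral algebra_simps)
  ultimately show ?thesis by simp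
qed

end

lemma y_coeff_b:
  assumes z: "z \<noteq> 0" "z \<noteq> 1" "z \<noteq> - 1"
  shows "2 * weber_y 1 z * coeff_b \<nu> (cay z) * dw_dx z =
     - deriv (riccati_coeff 1 \<nu> 1) z / deriv (weber_x 1) z - (riccati_coeff 1 \<nu> 1 z)\<^sup>2"
proof -
  define a b where "a = z - 1" and "b = z + 1"
  have ab: "a \<noteq> 0" "b \<noteq> 0" "z\<^sup>2 - 1 = a * b"
    using z_nonzero[OF z] by (auto simp: a_def b_def power2_eq_square algebra_simps)
  define D where "D = a * b"
  have D: "D \<noteq> 0" "D = z\<^sup>2 - 1" using ab by (auto simp: D_def)
  have d1: "deriv (riccati_coeff 1 \<nu> 1) z =
      ((\<nu> * (3 * z\<^sup>2 - 1) - (3 * z\<^sup>2 + 1)) * D - 4 * z\<^sup>2 * (\<nu> * D - (z\<^sup>2 + 1))) / (2 * D ^ 3)"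
  proof -
    have "((\<lambda>z. z * (\<nu> * (z\<^sup>2 - 1) - (z\<^sup>2 + 1))) has_field_derivative
        \<nu> * (3 * z\<^sup>2 - 1) - (3 * z\<^sup>2 + 1)) (at z)"
      by (auto intro!: derivative_eq_intros simp: algebra_simps power2_eq_square)
    moreover have "((\<lambda>z. 2 * (z\<^sup>2 - 1)\<^sup>2) has_field_derivative 8 * z * (z\<^sup>2 - 1)) (at z)"
      by (auto intro!: derivative_eq_intros simp: algebra_simps power2_eq_square)
    ultimately have "((\<lambda>z. z * (\<nu> * (z\<^sup>2 - 1) - (z\<^sup>2 + 1)) / (2 * (z\<^sup>2 - 1)\<^sup>2)) has_field_derivative
      ((\<nu> * (3 * z\<^sup>2 - 1) - (3 * z\<^sup>2 + 1)) * (2 * (z\<^sup>2 - 1)\<^sup>2)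
        - z * (\<nu> * (z\<^sup>2 - 1) - (z\<^sup>2 + 1)) * (8 * z * (z\<^sup>2 - 1))) /
        ((2 * (z\<^sup>2 - 1)\<^sup>2) * (2 * (z\<^sup>2 - 1)\<^sup>2))) (at z)"
      by (intro DERIV_divide) (use z_nonzero[OF z] in auto)
    moreover have "((\<nu> * (3 * z\<^sup>2 - 1) - (3 * z\<^sup>2 + 1)) * (2 * (z\<^sup>2 - 1)\<^sup>2)
        - z * (\<nu> * (z\<^sup>2 - 1) - (z\<^sup>2 + 1)) * (8 * z * (z\<^sup>2 - 1))) /
        ((2 * (z\<^sup>2 - 1)\<^sup>2) * (2 * (z\<^sup>2 - 1)\<^sup>2)) =
      ((\<nu> * (3 * z\<^sup>2 - 1) - (3 * z\<^sup>2 + 1)) * D - 4 * z\<^sup>2 * (\<nu> * D - (z\<^sup>2 + 1))) / (2 * D ^ 3)"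
      unfolding D(2)[symmetric] using D(1)
      by (simp add: divide_simps) (simp add: eval_nat_numeral algebra_simps)
    moreover have "eventually (\<lambda>z. z * (\<nu> * (z\<^sup>2 - 1) - (z\<^sup>2 + 1)) / (2 * (z\<^sup>2 - 1)\<^sup>2) =
        riccati_coeff 1 \<nu> 1 z) (nhds z)"
    proof -
      have "open (- {0, 1, - 1 :: complex})" by (intro open_Compl finite_imp_closed) auto
      then have "eventually (\<lambda>z. z \<in> - {0, 1, - 1}) (nhds z)"
        by (rule eventually_nhds_in_open) (use z in auto)
      then show ?thesis by eventually_elim (rule riccati_first[symmetric]; simp)
    qed
    ultimately have "(riccati_coeff 1 \<nu> 1 has_field_derivative
      ((\<nu> * (3 * z\<^sup>2 - 1) - (3 * z\<^sup>2 + 1)) * D - 4 * z\<^sup>2 * (\<nu> * D - (z\<^sup>2 + 1))) / (2 * D ^ 3)) (at z)"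
      by (simp only: DERIV_cong_ev[OF refl])
    then show ?thesis by (rule DERIV_imp_deriv)
  qed
  have gen: "(((P / a)\<^sup>2 - (Q / b)\<^sup>2 / (b / a)\<^sup>2) / 32 + M / (4 * (b / a)\<^sup>2)) * (32 * a\<^sup>2 * b ^ 4) =
      P\<^sup>2 * b ^ 4 - Q\<^sup>2 * a ^ 4 + 8 * (M * a ^ 4 * b\<^sup>2)" for P Q M
    using ab(1,2) by (simp add: divide_simps) (simp add: eval_nat_numeral algebra_simps)
  have w: "cay z = b / a" by (simp add: cay_def a_def b_def)
  have t: "b / a - \<nu> = (b - \<nu> * a) / a" "1 / (b / a) - \<nu> = (a - \<nu> * b) / b"
    using ab(1,2) by (auto simp: field_simps)
  have m: "mfun ((cay z)\<^sup>2) * a ^ 4 * b\<^sup>2 = 2 * z ^ 3"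
    unfolding mfun_cay[OF z(2,3,1)] using ab(1,2) unfolding a_def b_def
    by (simp add: divide_simps) (simp add: eval_nat_numeral algebra_simps)?
  have bn: "coeff_b \<nu> (cay z) * (32 * a\<^sup>2 * b ^ 4) =
      (b - \<nu> * a)\<^sup>2 * b ^ 4 - (a - \<nu> * b)\<^sup>2 * a ^ 4 + 16 * z ^ 3"
    using gen[of "b - \<nu> * a" "a - \<nu> * b" "mfun ((cay z)\<^sup>2)"] m unfolding coeff_b_def w t by simp
  have key: "(b - \<nu> * a)\<^sup>2 * b ^ 4 - (a - \<nu> * b)\<^sup>2 * a ^ 4 + 16 * z ^ 3 =
     4 * z * (2 * ((\<nu> * (3 * z\<^sup>2 - 1) - (3 * z\<^sup>2 + 1)) * (z\<^sup>2 - 1) - 4 * z\<^sup>2 * (\<nu> * (z\<^sup>2 - 1) - (z\<^sup>2 + 1)))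
       + (\<nu> * (z\<^sup>2 - 1) - (z\<^sup>2 + 1))\<^sup>2)"
    unfolding a_def b_def by (simp add: eval_nat_numeral algebra_simps)
  have "2 * weber_y 1 z * coeff_b \<nu> (cay z) * dw_dx z =
     - (coeff_b \<nu> (cay z) * (32 * a\<^sup>2 * b ^ 4)) * z / (16 * D ^ 4)"
    unfolding weber_y_eq[OF z] dw_dx_def ab(3) a_def[symmetric] b_def[symmetric] D_def using ab(1,2) z
    by (simp add: divide_simps) (simp add: eval_nat_numeral algebra_simps)
  also have "\<dots> = - deriv (riccati_coeff 1 \<nu> 1) z / deriv (weber_x 1) z - (riccati_coeff 1 \<nu> 1 z)\<^sup>2"
    unfolding bn key d1 deriv_x_eq[OF z] riccati_first[OF z] D(2)[symmetric] using D(1) z(1)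
    by (simp add: divide_simps) (simp add: eval_nat_numeral algebra_simps)
  finally show ?thesis .
qed


text \<open>
  The WKB coefficients are the logarithmic derivative of the wave function, because both satisfy the same
  recursion: \<open>chi_nth_Suc\<close> is the recursion of \<open>riccati_coeff\<close> in the coordinate \<open>w\<close>. The terms with \<open>S\<^sub>-\<^sub>1\<close> and \<open>S\<^sub>0\<close>
  are the coefficients \<open>m\<close> and \<open>coeff_c\<close>, and \<open>coeff_b\<close> is the inhomogeneity left over from \<open>S\<^sub>0\<close>.
\<close>

theorem riccati_eq_chi:
  assumes "z \<in> - {0, 1, - 1}" "1 \<le> k"
  shows "riccati_coeff 1 \<nu> (Suc k) z = fps_nth (chi \<nu> (cay z)) k * dw_dx z"
  using assms
proof (induction k arbitrary: z rule: less_induct)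
  case (less k)
  then have z: "z \<noteq> 0" "z \<noteq> 1" "z \<noteq> - 1" by auto
  define w where "w = cay z"
  have w: "w \<noteq> 0" using cay_nonzero z by (simp add: w_def)
  have w2: "w\<^sup>2 \<noteq> 1"
    using cay_square_minus_1[OF z(2)] z unfolding w_def by auto
  have y0: "2 * weber_y 1 z \<noteq> 0" using z z_nonzero[OF z] by (simp add: weber_y_eq[OF z])
  show ?case
  proof (cases "k = 1")
    case True
    have "riccati_coeff 1 \<nu> (Suc 1) z =
      (- deriv (riccati_coeff 1 \<nu> 1) z / deriv (weber_x 1) z - (riccati_coeff 1 \<nu> 1 z)\<^sup>2) / (2 * weber_y 1 z)"
      unfolding riccati_coeff.simps(2)[of 1 \<nu> 1] by (simp add: power2_eq_square)
    also have "\<dots> = coeff_b \<nu> w * dw_dx z"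
      unfolding y_coeff_b[OF z, symmetric] using y0 by (simp add: w_def)
    also have "coeff_b \<nu> w = fps_nth (chi \<nu> w) 1"
    proof -
      have "fps_nth (dchi \<nu> w) 0 = 0"
        by (simp add: dchi_def Phi2_def dphi_def power2_eq_square chi_nth_0)
      then show ?thesis
        using chi_nth_Suc[OF w w2, of \<nu> 0] by (simp add: chi_nth_0 power2_eq_square)
    qed
    finally show ?thesis using True by (simp add: w_def)
  next
    case False
    then obtain n where n: "k = Suc n" "1 \<le> n" using less.prems by (cases k) auto
    have IH: "riccati_coeff 1 \<nu> (Suc j) z = fps_nth (chi \<nu> (cay z)) j * dw_dx z"
      if "1 \<le> j" "j \<le> n" "z \<in> - {0, 1, - 1}" for j z
      using less.IH[of j z] that n by simp
    define e1 where "e1 = 2 / z - 3 / (z - 1) - 1 / (z + 1)"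
    have d: "deriv (riccati_coeff 1 \<nu> (Suc n)) z =
        fps_nth (dchi \<nu> w) n * dcay z * dw_dx z + fps_nth (chi \<nu> w) n * (dw_dx z * e1)"
    proof -
      have c: "((\<lambda>z. fps_nth (chi \<nu> (cay z)) n) has_field_derivative fps_nth (dchi \<nu> w) n * dcay z) (at z)"
        using fps_has_deriv_chi[OF w, of \<nu>] unfolding fps_has_deriv_def w_def
        by (intro DERIV_chain2[of "\<lambda>w. fps_nth (chi \<nu> w) n"] has_field_derivative_cay z(2)) blast
      have op: "open (- {0, 1, - 1 :: complex})" by (intro open_Compl finite_imp_closed) auto
      have "((\<lambda>z. fps_nth (chi \<nu> (cay z)) n * dw_dx z) has_field_derivative
        fps_nth (dchi \<nu> w) n * dcay z * dw_dx z + dw_dx z * e1 * fps_nth (chi \<nu> w) n) (at z)"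
        using DERIV_mult[OF c DERIV_dw_dx[OF z]] unfolding w_def e1_def .
      from has_field_derivative_transform_within_open[OF this op less.prems(1)]
      have "(riccati_coeff 1 \<nu> (Suc n) has_field_derivative
        fps_nth (dchi \<nu> w) n * dcay z * dw_dx z + dw_dx z * e1 * fps_nth (chi \<nu> w) n) (at z)"
        using IH[of n] n by (simp del: riccati_coeff.simps)
      then show ?thesis by (simp add: DERIV_imp_deriv mult_ac)
    qed
    have sum: "(\<Sum>i\<in>{1..Suc n}. riccati_coeff 1 \<nu> i z * riccati_coeff 1 \<nu> (Suc (Suc n) - i) z) =
        2 * riccati_coeff 1 \<nu> 1 z * (fps_nth (chi \<nu> w) n * dw_dx z) + (dw_dx z)\<^sup>2 * fps_nth ((chi \<nu> w)\<^sup>2) n"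
    proof -
      have "{1..Suc n} = insert 1 (insert (Suc n) {2..n})" using n by auto
      moreover have "riccati_coeff 1 \<nu> (Suc n) z = fps_nth (chi \<nu> w) n * dw_dx z"
        using IH[of n z] n z by (simp add: w_def)
      ultimately have 1: "(\<Sum>i\<in>{1..Suc n}. riccati_coeff 1 \<nu> i z * riccati_coeff 1 \<nu> (Suc (Suc n) - i) z) =
        2 * riccati_coeff 1 \<nu> 1 z * (fps_nth (chi \<nu> w) n * dw_dx z)
        + (\<Sum>i\<in>{2..n}. riccati_coeff 1 \<nu> i z * riccati_coeff 1 \<nu> (Suc (Suc n) - i) z)"
        using n by (simp del: riccati_coeff.simps)
      have "(\<Sum>i\<in>{2..n}. riccati_coeff 1 \<nu> i z * riccati_coeff 1 \<nu> (Suc (Suc n) - i) z) =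
        (\<Sum>j\<in>{1..n - 1}. riccati_coeff 1 \<nu> (Suc j) z * riccati_coeff 1 \<nu> (Suc (n - j)) z)"
        by (rule sum.reindex_bij_witness[of _ Suc "\<lambda>i. i - 1"])
          (auto simp: Suc_diff_le simp del: riccati_coeff.simps)
      also have "\<dots> = (\<Sum>j\<in>{1..n - 1}. (dw_dx z)\<^sup>2 * (fps_nth (chi \<nu> w) j * fps_nth (chi \<nu> w) (n - j)))"
        by (rule sum.cong[OF refl])
          (use IH z in \<open>auto simp: w_def power2_eq_square simp del: riccati_coeff.simps\<close>)
      also have "\<dots> = (dw_dx z)\<^sup>2 * (\<Sum>j\<in>{1..n - 1}. fps_nth (chi \<nu> w) j * fps_nth (chi \<nu> w) (n - j))"
        by (simp add: sum_distrib_left)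
      also have "(\<Sum>j\<in>{1..n - 1}. fps_nth (chi \<nu> w) j * fps_nth (chi \<nu> w) (n - j)) =
        (\<Sum>j=0..n. fps_nth (chi \<nu> w) j * fps_nth (chi \<nu> w) (n - j))"
      proof (rule sum.mono_neutral_left)
        show "\<forall>j\<in>{0..n} - {1..n - 1}. fps_nth (chi \<nu> w) j * fps_nth (chi \<nu> w) (n - j) = 0"
        proof
          fix j assume "j \<in> {0..n} - {1..n - 1}"
          then have "j = 0 \<or> n - j = 0" by auto
          then show "fps_nth (chi \<nu> w) j * fps_nth (chi \<nu> w) (n - j) = 0" by (auto simp: chi_nth_0)
        qed
      qed auto
      finally show ?thesis using 1 by (simp add: fps_mult_nth power2_eq_square[of "chi \<nu> w"])
    qed
    have x: "deriv (weber_x 1) z \<noteq> 0" using z z_nonzero[OF z] by (simp add: deriv_x_eq[OF z])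
    have "2 * weber_y 1 z * riccati_coeff 1 \<nu> (Suc (Suc n)) z =
       - deriv (riccati_coeff 1 \<nu> (Suc n)) z / deriv (weber_x 1) z
       - (\<Sum>i\<in>{1..Suc n}. riccati_coeff 1 \<nu> i z * riccati_coeff 1 \<nu> (Suc (Suc n) - i) z)"
      unfolding riccati_coeff.simps(2)[of 1 \<nu> "Suc n"] using y0 by simp
    also have "\<dots> = dw_dx z * ((- dw_dx z) * (fps_nth (dchi \<nu> w) n + fps_nth ((chi \<nu> w)\<^sup>2) n)
        + (- e1 / deriv (weber_x 1) z - 2 * riccati_coeff 1 \<nu> 1 z) * fps_nth (chi \<nu> w) n)"
    proof -
      have "- (A * (e * x) * e + X * (e * e1)) / x - (2 * r * (X * e) + e\<^sup>2 * B) =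
          e * ((- e) * (A + B) + (- e1 / x - 2 * r) * X)" if "x \<noteq> 0" for A B X e r x :: complex
        using that by (simp add: field_simps power2_eq_square)
      from this[OF x] show ?thesis unfolding d sum dw_dx_eq[OF z, symmetric] .
    qed
    also have "\<dots> = dw_dx z * ((2 * weber_y 1 z * mfun (w\<^sup>2)) * (fps_nth (dchi \<nu> w) n + fps_nth ((chi \<nu> w)\<^sup>2) n)
        + (2 * weber_y 1 z * coeff_c \<nu> w) * fps_nth (chi \<nu> w) n)"
      unfolding w_def y_mfun[OF z] y_coeff_c[OF z] e1_def ..
    also have "\<dots> = 2 * weber_y 1 z * (fps_nth (chi \<nu> w) (Suc n) * dw_dx z)"
      using n unfolding chi_nth_Suc[OF w w2] by (simp add: algebra_simps)
    finally show ?thesis using y0 unfolding n w_def by simp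
  qed
qed

lemma deriv_weber_x_scale: "z \<noteq> 0 \<Longrightarrow> deriv (weber_x s) z = s * deriv (weber_x 1) z"
  by (simp add: deriv_weber_x)

text \<open>
  Homogeneity: \<open>x\<close> and \<open>y\<close> are proportional to \<open>s\<close>, and \<open>\<hbar>\<close> has weight two.
\<close>

lemma riccati_coeff_scale:
  assumes s: "s \<noteq> 0" and "z \<in> - {0, 1, - 1}"
  shows "riccati_coeff s \<nu> n z = s powi (1 - 2 * int n) * riccati_coeff 1 \<nu> n z"
  using assms(2)
proof (induction n arbitrary: z rule: less_induct)
  case (less n)
  have op: "open (- {0, 1, - 1 :: complex})" by (intro open_Compl finite_imp_closed) auto
  show ?case
  proof (cases n)
    case 0
    then show ?thesis by (simp add: weber_y_def)
  next
    case (Suc k)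
    let ?R = "riccati_coeff 1 \<nu>"
    have IH: "riccati_coeff s \<nu> j z = s powi (1 - 2 * int j) * ?R j z" if "j \<le> k" "z \<in> - {0, 1, - 1}" for j z
      using less.IH[of j z] that Suc by auto
    define p where "p = s powi (- 2 * int k)"
    have p1: "s powi (1 - 2 * int k) = s * p"
      using s by (simp add: p_def power_int_diff power_int_minus divide_inverse)
    have "s powi (- 2 * int k - 1) = s powi (- 2 * int k) / s powi 1"
      by (rule power_int_diff) (use s in simp)
    moreover have "1 - 2 * int (Suc k) = - 2 * int k - 1" by simp
    ultimately have p2: "s powi (1 - 2 * int (Suc k)) = p / s"
      by (simp only: p_def power_int_1_right)
    have d: "deriv (riccati_coeff s \<nu> k) z = s * p * deriv (?R k) z"
    proof -
      have hol: "?R k holomorphic_on - {0, 1, - 1}" by (rule riccati_coeff_holomorphic) simp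
      have "deriv (riccati_coeff s \<nu> k) z = deriv (\<lambda>z. (s * p) * ?R k z) z"
        by (rule complex_derivative_transform_within_open[OF riccati_coeff_holomorphic[OF s] _ op less.prems])
          (auto intro!: holomorphic_intros hol simp: IH p1)
      also have "\<dots> = (s * p) * deriv (?R k) z"
        by (rule deriv_cmult) (rule holomorphic_on_imp_differentiable_at[OF hol op less.prems])
      finally show ?thesis .
    qed
    have sm: "(\<Sum>i\<in>{1..k}. riccati_coeff s \<nu> i z * riccati_coeff s \<nu> (Suc k - i) z) =
      p * (\<Sum>i\<in>{1..k}. ?R i z * ?R (Suc k - i) z)"
      unfolding sum_distrib_left
    proof (rule sum.cong[OF refl])
      fix i assume i: "i \<in> {1..k}"
      have "s powi (1 - 2 * int i) * s powi (1 - 2 * int (Suc k - i)) = s powi (1 - 2 * int i + (1 - 2 * int (Suc k - i)))"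
        by (rule power_int_add[symmetric]) (use s in simp)
      also have "1 - 2 * int i + (1 - 2 * int (Suc k - i)) = - 2 * int k" using i by auto
      finally have e: "s powi (1 - 2 * int i) * s powi (1 - 2 * int (Suc k - i)) = p" by (simp add: p_def)
      have "i \<le> k" "Suc k - i \<le> k" using i by auto
      then have "riccati_coeff s \<nu> i z * riccati_coeff s \<nu> (Suc k - i) z =
          (s powi (1 - 2 * int i) * s powi (1 - 2 * int (Suc k - i))) * (?R i z * ?R (Suc k - i) z)"
        using IH[of i z] IH[of "Suc k - i" z] less.prems by (simp only: mult_ac)
      then show "riccati_coeff s \<nu> i z * riccati_coeff s \<nu> (Suc k - i) z = p * (?R i z * ?R (Suc k - i) z)"
        unfolding e .
    qed
    have src: "(if k = 0 then \<nu> / 2 else 0) = p * (if k = 0 then \<nu> / 2 else 0)"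
      by (simp add: p_def)
    have y: "weber_y s z = s * weber_y 1 z" by (simp add: weber_y_def)
    have x: "deriv (weber_x s) z = s * deriv (weber_x 1) z" by (rule deriv_weber_x_scale) (use less.prems in auto)
    have alg: "(p * A - s * p * B / (s * C) - p * D) / (2 * (s * Y)) = p / s * ((A - B / C - D) / (2 * Y))"
      for A B C D Y :: complex
    proof -
      have "p * A - s * p * B / (s * C) - p * D = p * (A - B / C - D)"
        using s by (simp add: algebra_simps)
      then show ?thesis by (simp only: times_divide_times_eq mult_ac)
    qed
    have "riccati_coeff s \<nu> (Suc k) z = (p * (if k = 0 then \<nu> / 2 else 0) - s * p * deriv (?R k) z / (s * deriv (weber_x 1) z)
        - p * (\<Sum>i\<in>{1..k}. ?R i z * ?R (Suc k - i) z)) / (2 * (s * weber_y 1 z))"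
      unfolding riccati_coeff.simps(2)[of s] d sm x y src[symmetric] ..
    then show ?thesis
      unfolding Suc p2 riccati_coeff.simps(2)[of 1] alg .
  qed
qed

section \<open>Shifting the energy\<close>

text \<open>
  Functions of the parameter \<open>\<nu>\<close> and of a point \<open>w\<close> that have first derivatives and commuting mixed second
  derivatives. The predicate is closed under sums and products, hence applies to everything built from the
  wave function.
\<close>

definition smooth2 :: "complex set \<Rightarrow> (complex \<times> complex \<Rightarrow> complex) \<Rightarrow> bool" where
  "smooth2 S f \<longleftrightarrow> (\<exists>f1 f2 f12. \<forall>\<nu>. \<forall>w\<in>S.
     ((\<lambda>\<nu>. f (\<nu>, w)) has_field_derivative f1 \<nu> w) (at \<nu>) \<and>
     ((\<lambda>w. f (\<nu>, w)) has_field_derivative f2 \<nu> w) (at w) \<and>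
     ((\<lambda>w. f1 \<nu> w) has_field_derivative f12 \<nu> w) (at w) \<and>
     ((\<lambda>\<nu>. f2 \<nu> w) has_field_derivative f12 \<nu> w) (at \<nu>))"

lemma smooth2E:
  assumes "smooth2 S f"
  obtains f1 f2 f12 where
    "\<And>\<nu> w. w \<in> S \<Longrightarrow> ((\<lambda>\<nu>. f (\<nu>, w)) has_field_derivative f1 \<nu> w) (at \<nu>)"
    "\<And>\<nu> w. w \<in> S \<Longrightarrow> ((\<lambda>w. f (\<nu>, w)) has_field_derivative f2 \<nu> w) (at w)"
    "\<And>\<nu> w. w \<in> S \<Longrightarrow> ((\<lambda>w. f1 \<nu> w) has_field_derivative f12 \<nu> w) (at w)"
    "\<And>\<nu> w. w \<in> S \<Longrightarrow> ((\<lambda>\<nu>. f2 \<nu> w) has_field_derivative f12 \<nu> w) (at \<nu>)"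
proof -
  from assms obtain f1 f2 f12 where "\<forall>\<nu>. \<forall>w\<in>S.
     ((\<lambda>\<nu>. f (\<nu>, w)) has_field_derivative f1 \<nu> w) (at \<nu>) \<and>
     ((\<lambda>w. f (\<nu>, w)) has_field_derivative f2 \<nu> w) (at w) \<and>
     ((\<lambda>w. f1 \<nu> w) has_field_derivative f12 \<nu> w) (at w) \<and>
     ((\<lambda>\<nu>. f2 \<nu> w) has_field_derivative f12 \<nu> w) (at \<nu>)"
    unfolding smooth2_def by blast
  then show thesis by (intro that[of f1 f2 f12]) blast+
qed

lemma smooth2I:
  assumes "\<And>\<nu> w. w \<in> S \<Longrightarrow> ((\<lambda>\<nu>. f (\<nu>, w)) has_field_derivative fa \<nu> w) (at \<nu>)"
    "\<And>\<nu> w. w \<in> S \<Longrightarrow> ((\<lambda>w. f (\<nu>, w)) has_field_derivative fb \<nu> w) (at w)"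
    "\<And>\<nu> w. w \<in> S \<Longrightarrow> ((\<lambda>w. fa \<nu> w) has_field_derivative fc \<nu> w) (at w)"
    "\<And>\<nu> w. w \<in> S \<Longrightarrow> ((\<lambda>\<nu>. fb \<nu> w) has_field_derivative fc \<nu> w) (at \<nu>)"
  shows "smooth2 S f"
  unfolding smooth2_def using assms by blast

lemma smooth2_snd: "open S \<Longrightarrow> a holomorphic_on S \<Longrightarrow> smooth2 S (\<lambda>x. a (snd x))"
  by (rule smooth2I[where fa = "\<lambda>\<nu> w. 0" and fb = "\<lambda>\<nu>. deriv a" and fc = "\<lambda>\<nu> w. 0"])
    (auto intro: holomorphic_derivI)

lemma smooth2_fst: "smooth2 S fst"
  by (rule smooth2I[where fa = "\<lambda>\<nu> w. 1" and fb = "\<lambda>\<nu> w. 0" and fc = "\<lambda>\<nu> w. 0"])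
    (auto intro: DERIV_ident)

lemma smooth2_const: "smooth2 S (\<lambda>x. c)"
  by (rule smooth2I[where fa = "\<lambda>\<nu> w. 0" and fb = "\<lambda>\<nu> w. 0" and fc = "\<lambda>\<nu> w. 0"]) auto

lemma smooth2_add:
  assumes "smooth2 S f" "smooth2 S g" shows "smooth2 S (\<lambda>x. f x + g x)"
proof -
  from assms(1) obtain f1 f2 f12 where f: "\<And>\<nu> w. w \<in> S \<Longrightarrow> ((\<lambda>\<nu>. f (\<nu>, w)) has_field_derivative f1 \<nu> w) (at \<nu>)"
    "\<And>\<nu> w. w \<in> S \<Longrightarrow> ((\<lambda>w. f (\<nu>, w)) has_field_derivative f2 \<nu> w) (at w)"
    "\<And>\<nu> w. w \<in> S \<Longrightarrow> ((\<lambda>w. f1 \<nu> w) has_field_derivative f12 \<nu> w) (at w)"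
    "\<And>\<nu> w. w \<in> S \<Longrightarrow> ((\<lambda>\<nu>. f2 \<nu> w) has_field_derivative f12 \<nu> w) (at \<nu>)" by (rule smooth2E) blast
  from assms(2) obtain g1 g2 g12 where g: "\<And>\<nu> w. w \<in> S \<Longrightarrow> ((\<lambda>\<nu>. g (\<nu>, w)) has_field_derivative g1 \<nu> w) (at \<nu>)"
    "\<And>\<nu> w. w \<in> S \<Longrightarrow> ((\<lambda>w. g (\<nu>, w)) has_field_derivative g2 \<nu> w) (at w)"
    "\<And>\<nu> w. w \<in> S \<Longrightarrow> ((\<lambda>w. g1 \<nu> w) has_field_derivative g12 \<nu> w) (at w)"
    "\<And>\<nu> w. w \<in> S \<Longrightarrow> ((\<lambda>\<nu>. g2 \<nu> w) has_field_derivative g12 \<nu> w) (at \<nu>)" by (rule smooth2E) blast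
  show ?thesis
    by (rule smooth2I[where fa = "\<lambda>\<nu> w. f1 \<nu> w + g1 \<nu> w" and fb = "\<lambda>\<nu> w. f2 \<nu> w + g2 \<nu> w"
          and fc = "\<lambda>\<nu> w. f12 \<nu> w + g12 \<nu> w"]) (intro DERIV_add f g; assumption)+
qed

lemma smooth2_mult:
  assumes "smooth2 S f" "smooth2 S g" shows "smooth2 S (\<lambda>x. f x * g x)"
proof -
  from assms(1) obtain f1 f2 f12 where f: "\<And>\<nu> w. w \<in> S \<Longrightarrow> ((\<lambda>\<nu>. f (\<nu>, w)) has_field_derivative f1 \<nu> w) (at \<nu>)"
    "\<And>\<nu> w. w \<in> S \<Longrightarrow> ((\<lambda>w. f (\<nu>, w)) has_field_derivative f2 \<nu> w) (at w)"
    "\<And>\<nu> w. w \<in> S \<Longrightarrow> ((\<lambda>w. f1 \<nu> w) has_field_derivative f12 \<nu> w) (at w)"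
    "\<And>\<nu> w. w \<in> S \<Longrightarrow> ((\<lambda>\<nu>. f2 \<nu> w) has_field_derivative f12 \<nu> w) (at \<nu>)" by (rule smooth2E) blast
  from assms(2) obtain g1 g2 g12 where g: "\<And>\<nu> w. w \<in> S \<Longrightarrow> ((\<lambda>\<nu>. g (\<nu>, w)) has_field_derivative g1 \<nu> w) (at \<nu>)"
    "\<And>\<nu> w. w \<in> S \<Longrightarrow> ((\<lambda>w. g (\<nu>, w)) has_field_derivative g2 \<nu> w) (at w)"
    "\<And>\<nu> w. w \<in> S \<Longrightarrow> ((\<lambda>w. g1 \<nu> w) has_field_derivative g12 \<nu> w) (at w)"
    "\<And>\<nu> w. w \<in> S \<Longrightarrow> ((\<lambda>\<nu>. g2 \<nu> w) has_field_derivative g12 \<nu> w) (at \<nu>)" by (rule smooth2E) blast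
  show ?thesis
  proof (rule smooth2I[where fa = "\<lambda>\<nu> w. f1 \<nu> w * g (\<nu>, w) + g1 \<nu> w * f (\<nu>, w)"
        and fb = "\<lambda>\<nu> w. f2 \<nu> w * g (\<nu>, w) + g2 \<nu> w * f (\<nu>, w)"
        and fc = "\<lambda>\<nu> w. (f12 \<nu> w * g (\<nu>, w) + g2 \<nu> w * f1 \<nu> w) + (g12 \<nu> w * f (\<nu>, w) + f2 \<nu> w * g1 \<nu> w)"])
    fix \<nu> w assume w: "w \<in> S"
    show "((\<lambda>\<nu>. f (\<nu>, w) * g (\<nu>, w)) has_field_derivative f1 \<nu> w * g (\<nu>, w) + g1 \<nu> w * f (\<nu>, w)) (at \<nu>)"
      by (rule DERIV_mult f g w)+
    show "((\<lambda>w. f (\<nu>, w) * g (\<nu>, w)) has_field_derivative f2 \<nu> w * g (\<nu>, w) + g2 \<nu> w * f (\<nu>, w)) (at w)"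
      by (rule DERIV_mult f g w)+
    show "((\<lambda>w. f1 \<nu> w * g (\<nu>, w) + g1 \<nu> w * f (\<nu>, w)) has_field_derivative
        (f12 \<nu> w * g (\<nu>, w) + g2 \<nu> w * f1 \<nu> w) + (g12 \<nu> w * f (\<nu>, w) + f2 \<nu> w * g1 \<nu> w)) (at w)"
      by (rule DERIV_add DERIV_mult f g w)+
    have "((\<lambda>\<nu>. f2 \<nu> w * g (\<nu>, w) + g2 \<nu> w * f (\<nu>, w)) has_field_derivative
        (f12 \<nu> w * g (\<nu>, w) + g1 \<nu> w * f2 \<nu> w) + (g12 \<nu> w * f (\<nu>, w) + f1 \<nu> w * g2 \<nu> w)) (at \<nu>)"
      by (rule DERIV_add DERIV_mult f g w)+
    then show "((\<lambda>\<nu>. f2 \<nu> w * g (\<nu>, w) + g2 \<nu> w * f (\<nu>, w)) has_field_derivative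
        (f12 \<nu> w * g (\<nu>, w) + g2 \<nu> w * f1 \<nu> w) + (g12 \<nu> w * f (\<nu>, w) + f2 \<nu> w * g1 \<nu> w)) (at \<nu>)"
      by (rule DERIV_cong) (simp add: algebra_simps)
  qed
qed

lemma smooth2_sum: "finite I \<Longrightarrow> (\<And>i. i \<in> I \<Longrightarrow> smooth2 S (f i)) \<Longrightarrow> smooth2 S (\<lambda>x. \<Sum>i\<in>I. f i x)"
  by (induction I rule: finite_induct) (auto intro: smooth2_const smooth2_add)

lemma smooth2_comp:
  assumes "smooth2 S f" "\<And>z. z \<in> T \<Longrightarrow> h z \<in> S" "\<And>z. z \<in> T \<Longrightarrow> (h has_field_derivative h' z) (at z)"
  shows "smooth2 T (\<lambda>x. f (fst x, h (snd x)))"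
proof -
  from assms(1) obtain f1 f2 f12 where f: "\<And>\<nu> w. w \<in> S \<Longrightarrow> ((\<lambda>\<nu>. f (\<nu>, w)) has_field_derivative f1 \<nu> w) (at \<nu>)"
    "\<And>\<nu> w. w \<in> S \<Longrightarrow> ((\<lambda>w. f (\<nu>, w)) has_field_derivative f2 \<nu> w) (at w)"
    "\<And>\<nu> w. w \<in> S \<Longrightarrow> ((\<lambda>w. f1 \<nu> w) has_field_derivative f12 \<nu> w) (at w)"
    "\<And>\<nu> w. w \<in> S \<Longrightarrow> ((\<lambda>\<nu>. f2 \<nu> w) has_field_derivative f12 \<nu> w) (at \<nu>)" by (rule smooth2E) blast
  show ?thesis
  proof (rule smooth2I[where fa = "\<lambda>\<nu> z. f1 \<nu> (h z)" and fb = "\<lambda>\<nu> z. f2 \<nu> (h z) * h' z"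
          and fc = "\<lambda>\<nu> z. f12 \<nu> (h z) * h' z"])
    fix \<nu> z assume z: "z \<in> T"
    note h = assms(2)[OF z] assms(3)[OF z]
    show "((\<lambda>\<nu>. f (fst (\<nu>, z), h (snd (\<nu>, z)))) has_field_derivative f1 \<nu> (h z)) (at \<nu>)"
      using f(1)[OF h(1)] by simp
    show "((\<lambda>w. f (fst (\<nu>, w), h (snd (\<nu>, w)))) has_field_derivative f2 \<nu> (h z) * h' z) (at z)"
      using DERIV_chain2[OF f(2)[OF h(1)] h(2)] by simp
    show "((\<lambda>w. f1 \<nu> (h w)) has_field_derivative f12 \<nu> (h z) * h' z) (at z)"
      by (rule DERIV_chain2[OF f(3)[OF h(1)] h(2)])
    show "((\<lambda>\<nu>. f2 \<nu> (h z) * h' z) has_field_derivative f12 \<nu> (h z) * h' z) (at \<nu>)"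
      by (rule DERIV_cmult_right[OF f(4)[OF h(1)]])
  qed
qed

lemma smooth2_cong:
  assumes "smooth2 S f" "open S" and eq: "\<And>\<nu> w. w \<in> S \<Longrightarrow> f (\<nu>, w) = g (\<nu>, w)"
  shows "smooth2 S g"
proof -
  from assms(1) obtain f1 f2 f12 where f: "\<And>\<nu> w. w \<in> S \<Longrightarrow> ((\<lambda>\<nu>. f (\<nu>, w)) has_field_derivative f1 \<nu> w) (at \<nu>)"
    "\<And>\<nu> w. w \<in> S \<Longrightarrow> ((\<lambda>w. f (\<nu>, w)) has_field_derivative f2 \<nu> w) (at w)"
    "\<And>\<nu> w. w \<in> S \<Longrightarrow> ((\<lambda>w. f1 \<nu> w) has_field_derivative f12 \<nu> w) (at w)"
    "\<And>\<nu> w. w \<in> S \<Longrightarrow> ((\<lambda>\<nu>. f2 \<nu> w) has_field_derivative f12 \<nu> w) (at \<nu>)" by (rule smooth2E) blast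
  show ?thesis
  proof (rule smooth2I[where fa = f1 and fb = f2 and fc = f12])
    fix \<nu> w assume w: "w \<in> S"
    show "((\<lambda>\<nu>. g (\<nu>, w)) has_field_derivative f1 \<nu> w) (at \<nu>)" using f(1)[OF w] by (simp add: eq w)
    show "((\<lambda>w. g (\<nu>, w)) has_field_derivative f2 \<nu> w) (at w)"
      by (rule has_field_derivative_transform_within_open[OF f(2)[OF w] assms(2) w]) (rule eq)
  qed (rule f; assumption)+
qed

text \<open>
  The form in which commuting derivatives are used: both first derivatives are known explicitly.
\<close>

lemma mixed_partials:
  assumes "smooth2 S f" "open S"
    and g1: "\<And>\<nu> w. w \<in> S \<Longrightarrow> ((\<lambda>\<nu>. f (\<nu>, w)) has_field_derivative g1 \<nu> w) (at \<nu>)"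
    and g2: "\<And>\<nu> w. w \<in> S \<Longrightarrow> ((\<lambda>w. f (\<nu>, w)) has_field_derivative g2 \<nu> w) (at w)"
    and w: "w \<in> S" and D: "((\<lambda>w. g1 \<nu> w) has_field_derivative D) (at w)"
  shows "((\<lambda>\<nu>. g2 \<nu> w) has_field_derivative D) (at \<nu>)"
proof -
  from assms(1) obtain f1 f2 f12 where f: "\<And>\<nu> w. w \<in> S \<Longrightarrow> ((\<lambda>\<nu>. f (\<nu>, w)) has_field_derivative f1 \<nu> w) (at \<nu>)"
    "\<And>\<nu> w. w \<in> S \<Longrightarrow> ((\<lambda>w. f (\<nu>, w)) has_field_derivative f2 \<nu> w) (at w)"
    "\<And>\<nu> w. w \<in> S \<Longrightarrow> ((\<lambda>w. f1 \<nu> w) has_field_derivative f12 \<nu> w) (at w)"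
    "\<And>\<nu> w. w \<in> S \<Longrightarrow> ((\<lambda>\<nu>. f2 \<nu> w) has_field_derivative f12 \<nu> w) (at \<nu>)" by (rule smooth2E) blast
  have "((\<lambda>w. g1 \<nu> w) has_field_derivative f12 \<nu> w) (at w)"
    by (rule has_field_derivative_transform_within_open[OF f(3)[OF w] assms(2) w])
      (rule DERIV_unique[OF f(1) g1])
  then have "f12 \<nu> w = D" using D by (rule DERIV_unique)
  moreover have "f2 \<nu> w = g2 \<nu> w" for \<nu> by (rule DERIV_unique[OF f(2)[OF w] g2[OF w]])
  ultimately show ?thesis using f(4)[OF w, of \<nu>] by simp
qed

lemma smooth2_disc:
  assumes "\<And>k. smooth2 S (\<lambda>x. f x k)"
  shows "smooth2 S (\<lambda>x. disc d (P @ replicate n (f x)))"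
proof (induction n arbitrary: P)
  case 0
  show ?case by (simp add: smooth2_const)
next
  case (Suc n)
  have "disc d (P @ replicate (Suc n) (f x)) =
    (\<Sum>k\<in>{- int (width d)..int (width d)}. disc d ((unit_at k # P) @ replicate n (f x)) * f x k)" for x
  proof -
    have "disc d (P @ replicate (Suc n) (f x)) = disc d (f x # P @ replicate n (f x))"
      by (rule disc_perm) simp
    then show ?thesis using disc_expand[of d "f x"] by simp
  qed
  then show ?case by (auto intro!: smooth2_sum smooth2_mult assms Suc.IH simp del: append_Cons)
qed

lemma open_punctured: "open (- {0 :: complex})"
  by auto

lemma smooth2_divisor: "smooth2 (- {0}) (\<lambda>x. divisor (fst x) (snd x) k)"
proof -
  have "(\<lambda>w. w powi (2 * k + 1)) holomorphic_on - {0 :: complex}"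
    by (auto intro!: holomorphic_intros)
  then have "smooth2 (- {0}) (\<lambda>x. (snd x powi (2 * k + 1) + (- 1) * fst x) * (1 / (2 * of_int k + 1)))"
    by (intro smooth2_mult smooth2_add smooth2_const smooth2_fst smooth2_snd[OF open_punctured])
  then show ?thesis by (simp add: divisor_def)
qed

lemma smooth2_psi: "smooth2 (- {0}) (\<lambda>x. psi d (fst x) (snd x))"
proof -
  have "smooth2 (- {0}) (\<lambda>x. \<Sum>n\<le>3 * d. disc d ([] @ replicate n (divisor (fst x) (snd x))) * (1 / fact n))"
    by (intro smooth2_sum smooth2_mult smooth2_const smooth2_disc smooth2_divisor) auto
  then show ?thesis by (simp add: psi_def)
qed

lemma smooth2_phi: "smooth2 (- {0}) (\<lambda>x. phi d (fst x) (snd x))"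
proof -
  have hol: "(\<lambda>w. point (w\<^sup>2) k) holomorphic_on - {0 :: complex}" for k
    unfolding point_def by (auto intro!: holomorphic_intros)
  have "smooth2 (- {0}) (\<lambda>x. \<Sum>n\<le>3 * d. (\<Sum>k\<in>{- int (width d)..int (width d)}.
      disc d ([unit_at k] @ replicate n (divisor (fst x) (snd x))) * point ((snd x)\<^sup>2) k) * (1 / fact n))"
    by (intro smooth2_sum smooth2_mult smooth2_const smooth2_disc smooth2_divisor
        smooth2_snd[OF open_punctured hol]) auto
  then show ?thesis by (simp add: phi_def disc_expand[of d "point _", symmetric])
qed

lemma smooth2_log_Psi: "smooth2 (- {0}) (\<lambda>x. fps_nth (fps_log (Psi (fst x) (snd x))) m)"
  by (rule fps_log_coeff_closed[where F = "\<lambda>x. Psi (fst x) (snd x)", OF Psi_nth_0 _ smooth2_const smooth2_add smooth2_mult])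
    (simp_all add: Psi_def smooth2_psi)

lemma smooth2_chi: "smooth2 (- {0}) (\<lambda>x. fps_nth (chi (fst x) (snd x)) m)"
  unfolding chi_def
proof (rule mult_coeff_closed[OF _ _ smooth2_const smooth2_add smooth2_mult])
  show "smooth2 (- {0}) (\<lambda>x. fps_nth (Phi1 (fst x) (snd x)) n)" for n
    by (simp add: Phi1_def smooth2_phi)
  show "smooth2 (- {0}) (\<lambda>x. fps_nth (inverse (Psi (fst x) (snd x))) n)" for n
    by (rule inverse_coeff_closed[where F = "\<lambda>x. Psi (fst x) (snd x)", OF Psi_nth_0 _ smooth2_const smooth2_add smooth2_mult])
      (simp_all add: Psi_def smooth2_psi)
qed

lemma open_regular: "open (- {0, 1, - 1 :: complex})"
  by (intro open_Compl finite_imp_closed) auto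

lemma dw_dx_holomorphic: "dw_dx holomorphic_on - {0, 1, - 1}"
  unfolding dw_dx_def[abs_def] by (auto intro!: holomorphic_intros simp: eq_neg_iff_add_eq_0)

lemma smooth2_riccati: "smooth2 (- {0, 1, - 1}) (\<lambda>x. riccati_coeff 1 (fst x) n (snd x))"
proof -
  consider "n = 0" | "n = 1" | k where "n = Suc k" "1 \<le> k" by (cases n; cases "n - 1") auto
  then show ?thesis
  proof cases
    case 1
    have "weber_y 1 holomorphic_on - {0, 1, - 1}"
      unfolding weber_y_def[abs_def] by (auto intro!: holomorphic_intros)
    then show ?thesis using smooth2_snd[OF open_regular] by (simp add: 1)
  next
    case 2
    have h: "(\<lambda>z. z * (z\<^sup>2 - 1) / (2 * (z\<^sup>2 - 1)\<^sup>2)) holomorphic_on - {0, 1, - 1 :: complex}"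
      "(\<lambda>z. z * (z\<^sup>2 + 1) / (2 * (z\<^sup>2 - 1)\<^sup>2)) holomorphic_on - {0, 1, - 1 :: complex}"
      by (auto intro!: holomorphic_intros simp: power2_eq_1_iff)
    have "smooth2 (- {0, 1, - 1}) (\<lambda>x. fst x * (snd x * ((snd x)\<^sup>2 - 1) / (2 * ((snd x)\<^sup>2 - 1)\<^sup>2))
        + (- 1) * (snd x * ((snd x)\<^sup>2 + 1) / (2 * ((snd x)\<^sup>2 - 1)\<^sup>2)))"
      by (intro smooth2_add smooth2_mult smooth2_const smooth2_fst smooth2_snd[OF open_regular] h)
    then show ?thesis
      unfolding 2 by (rule smooth2_cong[OF _ open_regular])
        (simp add: riccati_first algebra_simps add_divide_distrib diff_divide_distrib del: riccati_coeff.simps One_nat_def)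
  next
    case 3
    have "smooth2 (- {0, 1, - 1}) (\<lambda>x. fps_nth (chi (fst (fst x, cay (snd x))) (snd (fst x, cay (snd x)))) k * dw_dx (snd x))"
      by (intro smooth2_mult smooth2_snd[OF open_regular dw_dx_holomorphic] smooth2_comp[OF smooth2_chi, of _ cay dcay])
        (auto simp: cay_nonzero intro!: has_field_derivative_cay)
    then show ?thesis
      unfolding 3(1) by (rule smooth2_cong[OF _ open_regular])
        (use 3(2) in \<open>simp add: riccati_eq_chi del: riccati_coeff.simps\<close>)
  qed
qed

text \<open>
  The derivation \<open>d/dx\<close> for \<open>\<lambda> = 1\<close>.
\<close>

definition ddx :: "(complex \<Rightarrow> complex) \<Rightarrow> complex \<Rightarrow> complex" where
  "ddx f z = deriv f z / deriv (weber_x 1) z"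

lemma ddx_holomorphic:
  assumes "f holomorphic_on - {0, 1, - 1}" shows "ddx f holomorphic_on - {0, 1, - 1}"
proof -
  have "weber_x 1 holomorphic_on - {0, 1, - 1}"
    unfolding weber_x_def[abs_def] by (auto intro!: holomorphic_intros)
  then show ?thesis
    unfolding ddx_def[abs_def]
    by (intro holomorphic_intros holomorphic_deriv assms open_regular) (use weber_nonzero[of 1] in auto)
qed

lemma DERIV_ddx:
  assumes "f holomorphic_on - {0, 1, - 1}" "z \<in> - {0, 1, - 1}"
  shows "(f has_field_derivative deriv (weber_x 1) z * ddx f z) (at z)"
  using holomorphic_derivI[OF assms(1) open_regular assms(2)] weber_nonzero(2)[of 1 z] assms(2)
  by (simp add: ddx_def)

lemma DERIV_weber_x: "z \<in> - {0, 1, - 1} \<Longrightarrow> (weber_x 1 has_field_derivative deriv (weber_x 1) z) (at z)"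
  by (rule holomorphic_derivI[OF _ open_regular])
    (auto simp: weber_x_def[abs_def] intro!: holomorphic_intros)

text \<open>
  The Riccati equation depends on \<open>\<lambda> - \<hbar>\<nu>/2\<close> only, and a dilation of \<open>x\<close>, \<open>\<lambda>\<close>, \<open>\<hbar>\<close> by weights \<open>1\<close>, \<open>2\<close>, \<open>2\<close> preserves it.
  Eliminating the derivative in \<open>\<lambda>\<close> expresses the derivative of \<open>S\<^sub>n\<close> in \<open>\<nu>\<close> by the dilation operator on \<open>S\<^sub>n\<^sub>-\<^sub>1\<close>. The
  proof applies \<open>x d/dx\<close> to the quadratic recursion and checks that the claimed derivatives \<open>E\<close> satisfy the
  \<open>\<nu>\<close>-derivative of it.
\<close>

theorem riccati_shift:
  assumes "z \<in> - {0, 1, - 1}"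
  shows "((\<lambda>\<nu>. riccati_coeff 1 \<nu> (Suc n) z) has_field_derivative
    (weber_x 1 z * ddx (riccati_coeff 1 \<nu> n) z + (2 * of_nat n - 1) * riccati_coeff 1 \<nu> n z) / 4) (at \<nu>)"
  using assms
proof (induction n arbitrary: \<nu> z rule: less_induct)
  case (less n)
  define R where "R = riccati_coeff 1"
  define E where "E \<nu> n z = (weber_x 1 z * ddx (R \<nu> n) z + (2 * of_nat n - 1) * R \<nu> n z) / 4" for \<nu> n z
  note z = less.prems
  have z0: "z \<noteq> 0" "z \<noteq> 1" "z \<noteq> - 1" using z by auto
  define y where "y = weber_y 1 z"
  have y: "y \<noteq> 0" using weber_nonzero(1)[of 1 z] z by (simp add: y_def)
  have hR: "R \<nu> j holomorphic_on - {0, 1, - 1}" for \<nu> j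
    unfolding R_def by (rule riccati_coeff_holomorphic) simp
  have rec: "R \<nu> (Suc j) u = ((if j = 0 then \<nu> / 2 else 0) - ddx (R \<nu> j) u
      - (\<Sum>i\<in>{1..j}. R \<nu> i u * R \<nu> (Suc j - i) u)) / (2 * weber_y 1 u)" for \<nu> j u
    unfolding R_def ddx_def by simp
  have R0: "R \<nu> 0 u = weber_y 1 u" for \<nu> u by (simp add: R_def)
  have IH: "((\<lambda>\<nu>. R \<nu> (Suc j) u) has_field_derivative E \<nu> j u) (at \<nu>)"
    if "j < n" "u \<in> - {0, 1, - 1}" for j u \<nu>
    using less.IH[OF that] unfolding R_def E_def .
  have "((\<lambda>\<nu>. R \<nu> (Suc n) z) has_field_derivative E \<nu> n z) (at \<nu>)"
  proof (cases n)
    case 0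
    have dy: "ddx (R \<nu> 0) z = (z\<^sup>2 + 1) / (2 * (z\<^sup>2 - 1))" for \<nu>
    proof -
      have "(weber_y 1 has_field_derivative (z\<^sup>2 + 1) / (2 * z\<^sup>2)) (at z)"
        unfolding weber_y_def[abs_def] using z0
        by (auto intro!: derivative_eq_intros simp: field_simps power2_eq_square)
      then have "ddx (weber_y 1) z = (z\<^sup>2 + 1) / (2 * z\<^sup>2) / ((z\<^sup>2 - 1) / z\<^sup>2)"
        unfolding ddx_def deriv_x_eq[OF z0] by (simp add: DERIV_imp_deriv)
      moreover have "R \<nu> 0 = weber_y 1" by (simp add: R_def)
      moreover have "A / (2 * z\<^sup>2) / (D / z\<^sup>2) = A / (2 * D)" for A D using z0 by simp
      ultimately show ?thesis by simp
    qed
    have "((\<lambda>\<nu>. (\<nu> / 2 - (z\<^sup>2 + 1) / (2 * (z\<^sup>2 - 1))) / (2 * y)) has_field_derivative 1 / (4 * y)) (at \<nu>)"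
      using y by (auto intro!: derivative_eq_intros)
    moreover have "1 / (4 * y) = E \<nu> 0 z"
    proof -
      have w: "y = (z\<^sup>2 - 1) / (2 * z)" "weber_x 1 z = (z\<^sup>2 + 1) / z"
        using z0 by (simp_all add: y_def weber_y_def weber_x_def field_simps power2_eq_square)
      have d: "z\<^sup>2 - 1 \<noteq> 0" by (rule z_nonzero(3)[OF z0])
      have "(z\<^sup>2 + 1) / z * ((z\<^sup>2 + 1) / (2 * (z\<^sup>2 - 1))) - (z\<^sup>2 - 1) / (2 * z) =
          ((z\<^sup>2 + 1)\<^sup>2 - (z\<^sup>2 - 1)\<^sup>2) / (2 * z * (z\<^sup>2 - 1))"
        using z0 d by (simp add: divide_simps) (simp add: power2_eq_square algebra_simps)
      also have "(z\<^sup>2 + 1)\<^sup>2 - (z\<^sup>2 - 1)\<^sup>2 = 4 * z\<^sup>2" by (simp add: power2_eq_square algebra_simps)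
      also have "4 * z\<^sup>2 / (2 * z * (z\<^sup>2 - 1)) = 2 * z / (z\<^sup>2 - 1)"
      proof -
        have "4 * z\<^sup>2 / (2 * z * D) = 2 * z / D" for D using z0 by (simp add: power2_eq_square)
        then show ?thesis .
      qed
      finally have f: "(z\<^sup>2 + 1) / z * ((z\<^sup>2 + 1) / (2 * (z\<^sup>2 - 1))) - (z\<^sup>2 - 1) / (2 * z) = 2 * z / (z\<^sup>2 - 1)" .
      have "E \<nu> 0 z = 2 * z / (z\<^sup>2 - 1) / 4"
        unfolding f[symmetric] E_def dy R0 y_def[symmetric] w
        by (simp only: of_nat_0 mult_zero_right diff_0 mult_minus1 add_uminus_conv_diff)
      moreover have "1 / (4 * (D / (2 * z))) = 2 * z / D / 4" for D
        by (cases "D = 0") (use z0 in \<open>simp_all add: field_simps\<close>)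
      ultimately show ?thesis unfolding w(1) by simp
    qed
    ultimately show ?thesis unfolding 0 rec dy y_def by simp
  next
    case (Suc k)
    have k: "k < n" using Suc by simp
    have dE: "((\<lambda>u. E \<nu> k u) has_field_derivative deriv (weber_x 1) z *
        ((weber_x 1 z * ddx (ddx (R \<nu> k)) z + 2 * of_nat k * ddx (R \<nu> k) z) / 4)) (at z)" for \<nu>
    proof -
      have "((\<lambda>u. E \<nu> k u) has_field_derivative
        (deriv (weber_x 1) z * ddx (R \<nu> k) z + (deriv (weber_x 1) z * ddx (ddx (R \<nu> k)) z) * weber_x 1 z
         + (2 * of_nat k - 1) * (deriv (weber_x 1) z * ddx (R \<nu> k) z)) / 4) (at z)"
        unfolding E_def
        by (intro DERIV_cdivide DERIV_add DERIV_mult DERIV_cmult DERIV_weber_x DERIV_ddx ddx_holomorphic hR z)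
      then show ?thesis by (rule DERIV_cong) (simp add: field_simps)
    qed
    define F where "F = (weber_x 1 z * ddx (ddx (R \<nu> k)) z + 2 * of_nat k * ddx (R \<nu> k) z) / 4"
    have dd: "((\<lambda>\<nu>. ddx (R \<nu> n) z) has_field_derivative F) (at \<nu>)"
    proof -
      have "((\<lambda>\<nu>. deriv (R \<nu> n) z) has_field_derivative deriv (weber_x 1) z * F) (at \<nu>)"
      proof (rule mixed_partials[where f = "\<lambda>x. R (fst x) n (snd x)" and ?g1.0 = "\<lambda>\<nu>. E \<nu> k"
            and ?g2.0 = "\<lambda>\<nu>. deriv (R \<nu> n)", OF _ open_regular _ _ z])
        show "((\<lambda>w. E \<nu> k w) has_field_derivative deriv (weber_x 1) z * F) (at z)"
          using dE[of \<nu>] unfolding F_def .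
        show "smooth2 (- {0, 1, - 1}) (\<lambda>x. R (fst x) n (snd x))" unfolding R_def by (rule smooth2_riccati)
        show "((\<lambda>\<nu>. R (fst (\<nu>, w)) n (snd (\<nu>, w))) has_field_derivative E \<nu> k w) (at \<nu>)"
          if "w \<in> - {0, 1, - 1}" for \<nu> w using IH[OF k that] Suc by simp
        show "((\<lambda>w. R (fst (\<nu>, w)) n (snd (\<nu>, w))) has_field_derivative deriv (R \<nu> n) w) (at w)"
          if "w \<in> - {0, 1, - 1}" for \<nu> w using holomorphic_derivI[OF hR open_regular that] by simp
      qed
      from DERIV_cdivide[OF this, of "deriv (weber_x 1) z"] show ?thesis
        using weber_nonzero(2)[of 1 z] z by (simp add: ddx_def)
    qed
    define T where "T = (\<Sum>i\<in>{1..n}. R \<nu> i z * E \<nu> (n - i) z)"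
    have dS: "((\<lambda>\<nu>. \<Sum>i\<in>{1..n}. R \<nu> i z * R \<nu> (Suc n - i) z) has_field_derivative 2 * T) (at \<nu>)"
    proof -
      have "((\<lambda>\<nu>. \<Sum>i\<in>{1..n}. R \<nu> i z * R \<nu> (Suc n - i) z) has_field_derivative
        (\<Sum>i\<in>{1..n}. E \<nu> (i - 1) z * R \<nu> (Suc n - i) z + E \<nu> (n - i) z * R \<nu> i z)) (at \<nu>)"
      proof (intro DERIV_sum DERIV_mult)
        fix i assume i: "i \<in> {1..n}"
        then have i1: "i - 1 < n" "Suc (i - 1) = i" by auto
        show "((\<lambda>\<nu>. R \<nu> i z) has_field_derivative E \<nu> (i - 1) z) (at \<nu>)"
          using IH[OF i1(1) z, of \<nu>] unfolding i1(2) .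
        show "((\<lambda>\<nu>. R \<nu> (Suc n - i) z) has_field_derivative E \<nu> (n - i) z) (at \<nu>)"
        proof -
          have i2: "n - i < n" "Suc (n - i) = Suc n - i" using i by auto
          show ?thesis using IH[OF i2(1) z, of \<nu>] unfolding i2(2) .
        qed
      qed
      moreover have "(\<Sum>i\<in>{1..n}. E \<nu> (i - 1) z * R \<nu> (Suc n - i) z) = T"
        unfolding T_def by (rule sum.reindex_bij_witness[of _ "\<lambda>i. Suc n - i" "\<lambda>i. Suc n - i"]) auto
      ultimately show ?thesis by (simp add: sum.distrib T_def mult.commute)
    qed
    have "((\<lambda>\<nu>. (0 - ddx (R \<nu> n) z - (\<Sum>i\<in>{1..n}. R \<nu> i z * R \<nu> (Suc n - i) z)) / (2 * y))
        has_field_derivative (0 - F - 2 * T) / (2 * y)) (at \<nu>)"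
      by (intro DERIV_cdivide DERIV_diff DERIV_const dd dS)
    then have main: "((\<lambda>\<nu>. R \<nu> (Suc n) z) has_field_derivative (0 - F - 2 * T) / (2 * y)) (at \<nu>)"
      unfolding rec y_def using Suc by simp
    define P where "P u = (\<Sum>i\<le>n. R \<nu> i u * R \<nu> (n - i) u)" for u
    have P: "P u = (if k = 0 then \<nu> / 2 else 0) - ddx (R \<nu> k) u" if "u \<in> - {0, 1, - 1}" for u
    proof -
      have "{..n} = insert 0 (insert n {1..k})" using Suc by auto
      then have "P u = 2 * weber_y 1 u * R \<nu> n u + (\<Sum>i\<in>{1..k}. R \<nu> i u * R \<nu> (Suc k - i) u)"
        unfolding P_def using Suc by (simp add: R0)
      also have "2 * weber_y 1 u * R \<nu> n u = (if k = 0 then \<nu> / 2 else 0) - ddx (R \<nu> k) u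
          - (\<Sum>i\<in>{1..k}. R \<nu> i u * R \<nu> (Suc k - i) u)"
        unfolding Suc rec using weber_nonzero(1)[of 1 u] that by simp
      finally show ?thesis by simp
    qed
    define A where "A = (\<Sum>i\<le>n. R \<nu> i z * ddx (R \<nu> (n - i)) z)"
    have A: "2 * A = - ddx (ddx (R \<nu> k)) z"
    proof -
      let ?x = "deriv (weber_x 1) z"
      have "(P has_field_derivative (\<Sum>i\<le>n. ?x * ddx (R \<nu> i) z * R \<nu> (n - i) z
           + ?x * ddx (R \<nu> (n - i)) z * R \<nu> i z)) (at z)"
        unfolding P_def by (intro DERIV_sum DERIV_mult DERIV_ddx hR z)
      moreover have "(P has_field_derivative 0 - ?x * ddx (ddx (R \<nu> k)) z) (at z)"
      proof (rule has_field_derivative_transform_within_open[OF _ open_regular z P[symmetric]])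
        show "((\<lambda>u. (if k = 0 then \<nu> / 2 else 0) - ddx (R \<nu> k) u) has_field_derivative
            0 - ?x * ddx (ddx (R \<nu> k)) z) (at z)"
          by (intro DERIV_diff DERIV_const DERIV_ddx ddx_holomorphic hR z)
      qed
      ultimately have e: "(\<Sum>i\<le>n. ?x * ddx (R \<nu> i) z * R \<nu> (n - i) z
           + ?x * ddx (R \<nu> (n - i)) z * R \<nu> i z) = 0 - ?x * ddx (ddx (R \<nu> k)) z"
        by (rule DERIV_unique)
      have r: "(\<Sum>i\<le>n. ?x * ddx (R \<nu> i) z * R \<nu> (n - i) z) = ?x * A"
        unfolding A_def sum_distrib_left
        by (rule sum.reindex_bij_witness[of _ "\<lambda>i. n - i" "\<lambda>i. n - i"]) auto
      have "(\<Sum>i\<le>n. ?x * ddx (R \<nu> (n - i)) z * R \<nu> i z) = ?x * A"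
        unfolding A_def sum_distrib_left by (rule sum.cong) auto
      then have "?x * (2 * A) = ?x * (- ddx (ddx (R \<nu> k)) z)"
        using e r by (simp add: sum.distrib algebra_simps)
      moreover have "?x \<noteq> 0" using weber_nonzero(2)[of 1 z] z by simp
      ultimately show ?thesis using mult_left_cancel[of ?x "2 * A" "- ddx (ddx (R \<nu> k)) z"] by blast
    qed
    \<comment> \<open>Symmetrizing in \<open>i\<close> and \<open>n - i\<close> replaces the weight \<open>n - i\<close> by \<open>n / 2\<close>.\<close>
    have N: "2 * (\<Sum>i\<le>n. of_nat (n - i) * (R \<nu> i z * R \<nu> (n - i) z)) = of_nat n * P z"
    proof -
      have "(\<Sum>i\<le>n. of_nat (n - i) * (R \<nu> i z * R \<nu> (n - i) z)) = (\<Sum>i\<le>n. of_nat i * (R \<nu> i z * R \<nu> (n - i) z))"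
        by (rule sum.reindex_bij_witness[of _ "\<lambda>i. n - i" "\<lambda>i. n - i"]) auto
      then have "2 * (\<Sum>i\<le>n. of_nat (n - i) * (R \<nu> i z * R \<nu> (n - i) z)) =
        (\<Sum>i\<le>n. of_nat i * (R \<nu> i z * R \<nu> (n - i) z) + of_nat (n - i) * (R \<nu> i z * R \<nu> (n - i) z))"
        by (simp add: sum.distrib)
      also have "\<dots> = (\<Sum>i\<le>n. of_nat n * (R \<nu> i z * R \<nu> (n - i) z))"
        by (rule sum.cong) (auto simp: distrib_right[symmetric] simp flip: of_nat_add)
      finally show ?thesis by (simp add: P_def sum_distrib_left)
    qed
    have four: "x = 0" if "4 * x = 0" for x :: complex using that by simp
    have alg: "4 * (r * ((X * d + (2 * j - 1) * q) / 4)) = X * (r * d) + 2 * (j * (r * q)) - r * q"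
      for r X d j q :: complex by (simp add: field_simps)
    have "4 * (\<Sum>i\<le>n. R \<nu> i z * E \<nu> (n - i) z) = weber_x 1 z * A
        + 2 * (\<Sum>i\<le>n. of_nat (n - i) * (R \<nu> i z * R \<nu> (n - i) z)) - P z"
      unfolding A_def P_def sum_distrib_left sum.distrib[symmetric] sum_subtractf[symmetric]
      by (rule sum.cong[OF refl]) (simp only: E_def alg)
    also have "\<dots> = weber_x 1 z * A + of_nat k * P z" unfolding N by (simp add: Suc algebra_simps)
    also have "of_nat k * P z = - (of_nat k * ddx (R \<nu> k) z)" using P[OF z] by auto
    finally have h: "4 * (\<Sum>i\<le>n. R \<nu> i z * E \<nu> (n - i) z) = weber_x 1 z * A + - (of_nat k * ddx (R \<nu> k) z)" .
    have "4 * (2 * (\<Sum>i\<le>n. R \<nu> i z * E \<nu> (n - i) z) + F) = 2 * (4 * (\<Sum>i\<le>n. R \<nu> i z * E \<nu> (n - i) z)) + 4 * F" by (simp add: distrib_left)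
    also have "\<dots> = weber_x 1 z * (2 * A) - 2 * of_nat k * ddx (R \<nu> k) z + 4 * F"
      unfolding h by (simp add: algebra_simps)
    also have "\<dots> = 0" unfolding A F_def by (simp add: algebra_simps)
    finally have "2 * (\<Sum>i\<le>n. R \<nu> i z * E \<nu> (n - i) z) + F = 0"
      by (rule four)
    moreover have "(\<Sum>i\<le>n. R \<nu> i z * E \<nu> (n - i) z) = y * E \<nu> n z + T"
    proof -
      have "{..n} = insert 0 {1..n}" by auto
      then show ?thesis unfolding T_def by (simp add: R0 y_def)
    qed
    ultimately have "2 * (y * E \<nu> n z + T) + F = 0" by simp
    moreover have "0 - F - 2 * T = E \<nu> n z * (2 * y) - (2 * (y * E \<nu> n z + T) + F)" by (simp add: algebra_simps)
    ultimately have "0 - F - 2 * T = E \<nu> n z * (2 * y)" by simp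
    then have "(0 - F - 2 * T) / (2 * y) = E \<nu> n z" using y by simp
    then show ?thesis using main by simp
  qed
  then show ?case unfolding R_def E_def .
qed

section \<open>The endpoints\<close>

lemma cay_cay: "z \<noteq> 1 \<Longrightarrow> cay (cay z) = z"
  by (simp add: cay_def divide_simps)

lemma cay_regular: "z \<in> - {0, 1, - 1} \<Longrightarrow> cay z \<in> - {0, 1, - 1}"
  by (auto simp: cay_def divide_simps eq_neg_iff_add_eq_0 split: if_splits)

lemma x_dw_dx:
  assumes "w \<in> - {0, 1, - 1}"
  shows "weber_x 1 (cay w) * dw_dx (cay w) = - (w ^ 4 - 1) / (4 * w)"
proof -
  define a b where "a = w - 1" and "b = w + 1"
  have w: "w \<noteq> 0" and ab: "a \<noteq> 0" "b \<noteq> 0" using assms by (auto simp: a_def b_def eq_neg_iff_add_eq_0)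
  have c: "cay w = b / a" "cay w - 1 = 2 / a" "cay w + 1 = 2 * w / a"
    using ab unfolding cay_def by (auto simp: a_def b_def field_simps)
  have "b / a + 1 / (b / a) = (a\<^sup>2 + b\<^sup>2) / (a * b)"
    using ab by (simp add: divide_simps) (simp add: power2_eq_square algebra_simps)
  then have "weber_x 1 (cay w) * dw_dx (cay w) =
      (a\<^sup>2 + b\<^sup>2) / (a * b) * (- 2 * (b / a)\<^sup>2 / ((2 / a) ^ 3 * (2 * w / a)))"
    unfolding weber_x_def dw_dx_def c(2,3) by (simp add: c(1))
  also have "\<dots> = - ((a\<^sup>2 + b\<^sup>2) * (a * b)) / (8 * w)"
    using ab w by (simp add: divide_simps) (simp add: eval_nat_numeral)
  also have "(a\<^sup>2 + b\<^sup>2) * (a * b) = 2 * (w ^ 4 - 1)"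
    by (simp add: a_def b_def eval_nat_numeral algebra_simps)
  also have "- (2 * (w ^ 4 - 1)) / (8 * w) = - (w ^ 4 - 1) / (4 * w)"
  proof -
    have "- (2 * t) / (8 * w) = - t / (4 * w)" for t using w by (simp add: divide_simps)
    then show ?thesis .
  qed
  finally show ?thesis .
qed

text \<open>
  Integrating \<open>riccati_shift\<close> in \<open>x\<close>: by parts, the integral of \<open>x dS\<^sub>k + (2k + 1) S\<^sub>k dx\<close> is \<open>x S\<^sub>k\<close> plus \<open>2k\<close> times the
  integral of \<open>S\<^sub>k\<close>. So the function \<open>Q\<close> in the proof is constant in \<open>w\<close>, and its term \<open>x S\<^sub>k\<close> vanishes at both endpoints.
\<close>

theorem log_Psi_shift:
  assumes "1 \<le> k"
    and D: "((\<lambda>\<nu>. fps_nth (fps_log (Psi \<nu> 1)) (Suc k)) has_field_derivative a) (at \<nu>)"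
      "((\<lambda>\<nu>. fps_nth (fps_log (Psi \<nu> (- 1))) (Suc k)) has_field_derivative b) (at \<nu>)"
  shows "a - of_nat k / 2 * fps_nth (fps_log (Psi \<nu> 1)) k =
    b - of_nat k / 2 * fps_nth (fps_log (Psi \<nu> (- 1))) k"
proof -
  define L where "L m \<nu> w = fps_nth (fps_log (Psi \<nu> w)) m" for m \<nu> w
  have dL: "((\<lambda>w. L m \<nu> w) has_field_derivative fps_nth (chi \<nu> w) m) (at w)" if "w \<noteq> 0" for m \<nu> w
    using fps_has_deriv_log_Psi[OF that] unfolding fps_has_deriv_def L_def by blast
  have dchi: "((\<lambda>w. fps_nth (chi \<nu> w) m) has_field_derivative fps_nth (dchi \<nu> w) m) (at w)" if "w \<noteq> 0" for m \<nu> w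
    using fps_has_deriv_chi[OF that] unfolding fps_has_deriv_def by blast
  from smooth2_log_Psi[of "Suc k"] obtain f1 f2 f12 where
    f: "\<And>\<nu> w. w \<in> - {0} \<Longrightarrow> ((\<lambda>\<nu>. L (Suc k) \<nu> w) has_field_derivative f1 \<nu> w) (at \<nu>)"
    "\<And>\<nu> w. w \<in> - {0} \<Longrightarrow> ((\<lambda>w. L (Suc k) \<nu> w) has_field_derivative f2 \<nu> w) (at w)"
    "\<And>\<nu> w. w \<in> - {0} \<Longrightarrow> ((\<lambda>w. f1 \<nu> w) has_field_derivative f12 \<nu> w) (at w)"
    "\<And>\<nu> w. w \<in> - {0} \<Longrightarrow> ((\<lambda>\<nu>. f2 \<nu> w) has_field_derivative f12 \<nu> w) (at \<nu>)"
    by (rule smooth2E) (auto simp: L_def)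
  have f2: "f2 \<nu> w = fps_nth (chi \<nu> w) (Suc k)" if "w \<noteq> 0" for \<nu> w
    by (rule DERIV_unique[OF f(2) dL]) (use that in auto)
  \<comment> \<open>The last term is \<open>- x S\<^sub>k / 4\<close>, written in the coordinate \<open>w\<close>.\<close>
  define Q where "Q w = f1 \<nu> w - of_nat k / 2 * L k \<nu> w + (w ^ 4 - 1) / (16 * w) * fps_nth (chi \<nu> w) k" for w
  have cont: "continuous_on (- {0}) Q"
  proof -
    have "continuous_on (- {0}) (\<lambda>w. f1 \<nu> w)" "continuous_on (- {0}) (\<lambda>w. L k \<nu> w)"
      "continuous_on (- {0}) (\<lambda>w. fps_nth (chi \<nu> w) k)"
      by (auto intro!: continuous_at_imp_continuous_on DERIV_isCont[OF f(3)] DERIV_isCont[OF dL] DERIV_isCont[OF dchi])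
    then show ?thesis unfolding Q_def by (intro continuous_intros) auto
  qed
  have zero: "(Q has_field_derivative 0) (at w)" if w: "w \<in> - {0, 1, - 1}" for w
  proof -
    define z where "z = cay w"
    have z: "z \<in> - {0, 1, - 1}" and zw: "cay z = w" using cay_regular[OF w] cay_cay[of w] w by (auto simp: z_def)
    then have z0: "z \<noteq> 0" "z \<noteq> 1" "z \<noteq> - 1" by auto
    have w0: "w \<in> - {0}" using w by auto
    define R where "R = riccati_coeff 1"
    have hR: "R \<nu> j holomorphic_on - {0, 1, - 1}" for j
      unfolding R_def by (rule riccati_coeff_holomorphic) simp
    define x where "x = weber_x 1 z"
    define dx where "dx = deriv (weber_x 1) z"
    have Rk: "R \<nu> (Suc (Suc k)) z = fps_nth (chi \<nu> w) (Suc k) * dw_dx z" for \<nu>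
      unfolding R_def by (rule riccati_eq_chi[OF z, of "Suc k", unfolded zw]) simp
    have "((\<lambda>\<nu>. R \<nu> (Suc (Suc k)) z) has_field_derivative f12 \<nu> w * dw_dx z) (at \<nu>)"
      unfolding Rk using DERIV_cmult_right[OF f(4)[OF w0, of \<nu>], of "dw_dx z"] f2[of w] w0 by simp
    from DERIV_unique[OF this riccati_shift[OF z, of "Suc k" \<nu>, folded R_def]]
    have F12: "f12 \<nu> w * dw_dx z = (x * ddx (R \<nu> (Suc k)) z + (2 * of_nat k + 1) * R \<nu> (Suc k) z) / 4"
      by (simp add: x_def algebra_simps)
    have Rk1: "R \<nu> (Suc k) u = fps_nth (chi \<nu> (cay u)) k * dw_dx u" if "u \<in> - {0, 1, - 1}" for u
      unfolding R_def by (rule riccati_eq_chi[OF that assms(1)])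
    have dc: "dcay z = dw_dx z * dx" unfolding dx_def by (rule dw_dx_eq[OF z0, symmetric])
    \<comment> \<open>\<open>V\<close> is \<open>Q\<close> in the coordinate \<open>z\<close>, where the Riccati coefficients live.\<close>
    define V where "V u = f1 \<nu> (cay u) - of_nat k / 2 * L k \<nu> (cay u) - weber_x 1 u * R \<nu> (Suc k) u / 4" for u
    have ch: "((\<lambda>u. g (cay u)) has_field_derivative D * dcay z) (at z)" if "(g has_field_derivative D) (at w)" for g D
      by (rule DERIV_chain2[OF _ has_field_derivative_cay[OF z0(2)]]) (use that zw in simp)
    have "(V has_field_derivative f12 \<nu> w * dcay z - of_nat k / 2 * (fps_nth (chi \<nu> w) k * dcay z)
       - (dx * R \<nu> (Suc k) z + dx * ddx (R \<nu> (Suc k)) z * x) / 4) (at z)"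
      unfolding V_def x_def dx_def
      by (intro DERIV_diff DERIV_cmult DERIV_cdivide DERIV_mult ch f(3) dL DERIV_weber_x DERIV_ddx hR z)
        (use w0 in auto)
    also have "f12 \<nu> w * dcay z = dx * ((x * ddx (R \<nu> (Suc k)) z + (2 * of_nat k + 1) * R \<nu> (Suc k) z) / 4)"
      unfolding dc F12[symmetric] by simp
    also have "fps_nth (chi \<nu> w) k * dcay z = dx * R \<nu> (Suc k) z"
      unfolding dc Rk1[OF z] zw by simp
    also have "dx * ((x * ddx (R \<nu> (Suc k)) z + (2 * of_nat k + 1) * R \<nu> (Suc k) z) / 4)
        - of_nat k / 2 * (dx * R \<nu> (Suc k) z)
        - (dx * R \<nu> (Suc k) z + dx * ddx (R \<nu> (Suc k)) z * x) / 4 = 0"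
      by (simp add: field_simps)
    finally have "(V has_field_derivative 0) (at (cay w))" by (simp add: z_def)
    from DERIV_chain2[OF this has_field_derivative_cay]
    have "((\<lambda>w. V (cay w)) has_field_derivative 0 * dcay w) (at w)" using w by blast
    then have "((\<lambda>w. V (cay w)) has_field_derivative 0) (at w)" by simp
    then show ?thesis
    proof (rule has_field_derivative_transform_within_open[OF _ open_regular w])
      fix u :: complex assume u: "u \<in> - {0, 1, - 1}"
      then have cu: "cay (cay u) = u" by (intro cay_cay) auto
      have "weber_x 1 (cay u) * R \<nu> (Suc k) (cay u) = - (u ^ 4 - 1) / (4 * u) * fps_nth (chi \<nu> u) k"
        unfolding Rk1[OF cay_regular[OF u]] cu x_dw_dx[OF u, symmetric] by simp
      then have W: "weber_x 1 (cay u) * R \<nu> (Suc k) (cay u) = - (u ^ 4 - 1) / (4 * u) * fps_nth (chi \<nu> u) k" .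
      have "A - - t / (4 * u) * X / 4 = A + t / (16 * u) * X" for A t X by simp
      then show "V (cay u) = Q u" unfolding V_def Q_def cu W .
    qed
  qed
  have "Q 1 = Q (- 1)"
  proof (rule has_derivative_zero_unique_strong_connected[of "- {0}" "{1, - 1}" Q "- 1" "Q (- 1)" 1])
    show "connected (- {0 :: complex})" by (intro connected_punctured_universe) simp
    show "(Q has_derivative (\<lambda>h. 0)) (at u within - {0})" if "u \<in> - {0} - {1, - 1}" for u
    proof -
      have "(Q has_derivative (\<lambda>h. 0)) (at u)"
        using zero[of u] that by (simp add: has_field_derivative_def lambda_zero)
      then show ?thesis by (rule has_derivative_at_withinI)
    qed
  qed (auto intro: cont)
  moreover have "f1 \<nu> 1 = a" "f1 \<nu> (- 1) = b"
    using DERIV_unique[OF f(1)[of 1] D(1)[folded L_def]] DERIV_unique[OF f(1)[of "- 1"] D(2)[folded L_def]] by auto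
  ultimately show ?thesis by (simp add: Q_def L_def)
qed

text \<open>
  The wave function at the endpoints of the Voros path, where every integration is \<open>c\<close> times the half period.
\<close>

definition period_wave :: "complex \<Rightarrow> complex fps" where
  "period_wave c = Abs_fps (\<lambda>d. \<Sum>n\<le>3 * d. c ^ n * (disc d (replicate n half_period) / fact n))"

lemma disc_replicate_scale: "disc d (P @ replicate n (\<lambda>k. a * l k)) = a ^ n * disc d (P @ replicate n l)"
proof (induction n arbitrary: P)
  case (Suc n)
  have "disc d (P @ replicate (Suc n) (\<lambda>k. a * l k)) = disc d ((\<lambda>k. a * l k) # P @ replicate n (\<lambda>k. a * l k))"
    by (rule disc_perm) simp
  also have "\<dots> = a * disc d ((l # P) @ replicate n (\<lambda>k. a * l k))"
    using form_scale_arg[OF form_disc_1] by simp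
  also have "\<dots> = a ^ Suc n * disc d ((l # P) @ replicate n l)"
    unfolding Suc.IH by simp
  also have "disc d ((l # P) @ replicate n l) = disc d (P @ replicate (Suc n) l)"
    by (rule disc_perm) simp
  finally show ?case .
qed simp

lemma divisor_endpoints:
  "divisor \<nu> 1 = (\<lambda>k. (1 - \<nu>) * half_period k)" "divisor \<nu> (- 1) = (\<lambda>k. (- 1 - \<nu>) * half_period k)"
proof -
  have "(- 1 :: complex) powi (2 * k + 1) = - 1" for k
    by (simp add: power_int_add power_int_mult)
  then show "divisor \<nu> (- 1) = (\<lambda>k. (- 1 - \<nu>) * half_period k)"
    by (simp add: divisor_def half_period_def)
qed (simp add: divisor_def half_period_def)

lemma Psi_endpoints: "Psi \<nu> 1 = period_wave (1 - \<nu>)" "Psi \<nu> (- 1) = period_wave (- 1 - \<nu>)"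
  using disc_replicate_scale[of _ "[]"]
  by (simp_all add: Psi_def psi_def period_wave_def divisor_endpoints)

lemma period_wave_nth_0: "fps_nth (period_wave c) 0 = 1"
  by (simp add: period_wave_def)

text \<open>
  The coefficient of \<open>\<hbar>\<^sup>m\<close> in the series \<open>G(c)\<close>, for \<open>\<lambda> = 1\<close>.
\<close>

definition log_period_wave :: "nat \<Rightarrow> complex \<Rightarrow> complex" where
  "log_period_wave m c = fps_nth (fps_log (period_wave c)) m"

lemma log_period_wave_poly: "\<exists>p. \<forall>c. log_period_wave m c = poly p c"
  unfolding log_period_wave_def
proof (rule fps_log_coeff_closed[where P = "\<lambda>f. \<exists>p. \<forall>c. f c = poly p c", OF period_wave_nth_0])
  show "\<exists>p. \<forall>c. fps_nth (period_wave c) n = poly p c" for n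
    by (rule exI[of _ "\<Sum>i\<le>3 * n. monom (disc n (replicate i half_period) / fact i) i"])
      (simp add: period_wave_def poly_sum poly_monom mult.commute)
  show "\<exists>p. \<forall>x. c = poly p x" for c :: complex by (rule exI[of _ "[:c:]"]) simp
  show "\<exists>p. \<forall>c. f c + g c = poly p c" if "\<exists>p. \<forall>c. f c = poly p c" "\<exists>p. \<forall>c. g c = poly p c"
    for f g :: "complex \<Rightarrow> complex" using that by (metis poly_add)
  show "\<exists>p. \<forall>c. f c * g c = poly p c" if "\<exists>p. \<forall>c. f c = poly p c" "\<exists>p. \<forall>c. g c = poly p c"
    for f g :: "complex \<Rightarrow> complex" using that by (metis poly_mult)
qed

lemma period_wave_0: "period_wave 0 = 1"
proof (rule fps_ext)
  fix d
  have d0: "disc 0 [] = 1" by simp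
  have "(\<Sum>n\<le>3 * d. 0 ^ n * (disc d (replicate n half_period) / fact n)) =
      (\<Sum>n\<le>3 * d. if n = 0 then disc d [] else 0)"
    by (rule sum.cong) auto
  then show "fps_nth (period_wave 0) d = fps_nth 1 d"
    using d0 by (cases d) (simp_all add: period_wave_def disc_Nil del: disc.simps)
qed

lemma log_period_wave_0: "log_period_wave m 0 = 0"
proof -
  have "fps_nth (fps_log 1) n = 0" for n
    by (cases n) (simp_all add: fps_log_nth_0 fps_log_nth_Suc del: of_nat_Suc)
  then show ?thesis by (simp add: log_period_wave_def period_wave_0)
qed

lemma DERIV_log_period_wave_0: "(log_period_wave m has_field_derivative disc m [half_period]) (at 0)"
proof -
  have "fps_has_deriv period_wave (Abs_fps (\<lambda>d. disc d [half_period])) 0"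
    unfolding fps_has_deriv_def
  proof
    fix d
    let ?a = "\<lambda>n. disc d (replicate n half_period) / fact n"
    have "((\<lambda>c. \<Sum>n\<le>3 * d. c ^ n * ?a n) has_field_derivative
        (\<Sum>n\<le>3 * d. (of_nat n * 0 ^ (n - 1)) * ?a n)) (at 0)"
      by (intro DERIV_sum DERIV_cmult_right) (auto intro!: derivative_eq_intros)
    moreover have "(\<Sum>n\<le>3 * d. (of_nat n * 0 ^ (n - 1)) * ?a n) = (\<Sum>n\<le>3 * d. if n = 1 then ?a 1 else 0)"
      by (rule sum.cong) (auto simp: power_0_left)
    moreover have "\<dots> = disc d [half_period]" by (cases d) simp_all
    ultimately show "((\<lambda>w. fps_nth (period_wave w) d) has_field_derivative
        fps_nth (Abs_fps (\<lambda>d. disc d [half_period])) d) (at 0)"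
      by (simp add: period_wave_def)
  qed
  from fps_has_deriv_log[OF period_wave_nth_0 this] show ?thesis
    unfolding fps_has_deriv_def period_wave_0 log_period_wave_def[abs_def] by simp
qed

text \<open>
  By \<open>log_Psi_shift\<close> at the endpoints, the polynomial \<open>G\<^sub>k\<^sub>+\<^sub>1' + k/2 G\<^sub>k\<close> has period \<open>2\<close>. Hence it is constant,
  and its value at \<open>0\<close> is read off from the linear term of \<open>period_wave\<close>.
\<close>

theorem DERIV_log_period_wave:
  assumes "1 \<le> k"
  shows "(log_period_wave (Suc k) has_field_derivative conn (Suc k) [half_period] - of_nat k / 2 * log_period_wave k c) (at c)"
proof -
  obtain p q where p: "log_period_wave (Suc k) = poly p" and q: "log_period_wave k = poly q"
    using log_period_wave_poly[of "Suc k"] log_period_wave_poly[of k] by (metis ext)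
  define H where "H = pderiv p + smult (of_nat k / 2) q"
  have per: "poly H (1 - \<nu>) = poly H (- 1 - \<nu>)" for \<nu>
  proof -
    have "((\<lambda>\<nu>. poly p (1 - \<nu>)) has_field_derivative poly (pderiv p) (1 - \<nu>) * (- 1)) (at \<nu>)"
      "((\<lambda>\<nu>. poly p (- 1 - \<nu>)) has_field_derivative poly (pderiv p) (- 1 - \<nu>) * (- 1)) (at \<nu>)"
      by (rule DERIV_chain2[OF poly_DERIV]; auto intro!: derivative_eq_intros)+
    from log_Psi_shift[OF assms this[unfolded p[symmetric] log_period_wave_def, folded Psi_endpoints]]
    have "- poly H (1 - \<nu>) = - poly H (- 1 - \<nu>)"
      unfolding Psi_endpoints log_period_wave_def[symmetric] q by (simp add: H_def algebra_simps)
    then show ?thesis by simp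
  qed
  have even: "poly H (2 * of_nat n) = poly H 0" for n
  proof (induction n)
    case (Suc n)
    have "poly H (2 * of_nat (Suc n)) = poly H (1 - (- 1 - 2 * of_nat n))" by simp
    also have "\<dots> = poly H (2 * of_nat n)" unfolding per by simp
    finally show ?case using Suc by simp
  qed simp
  have "H - [:poly H 0:] = 0"
  proof (rule ccontr)
    assume "H - [:poly H 0:] \<noteq> 0"
    then have "finite {x. poly (H - [:poly H 0:]) x = 0}" by (rule poly_roots_finite)
    moreover have "range (\<lambda>n. 2 * of_nat n) \<subseteq> {x. poly (H - [:poly H 0:]) x = 0}" using even by auto
    ultimately have "finite (range (\<lambda>n. 2 * of_nat n :: complex))" by (rule finite_subset[rotated])
    then show False by (rule range_inj_infinite[THEN notE, rotated]) (auto intro: injI)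
  qed
  then have Heq: "H = [:poly H 0:]" by simp
  have const: "poly H c = poly H 0" for c using arg_cong[OF Heq, of "\<lambda>p. poly p c"] by simp
  have "poly H 0 = conn (Suc k) [half_period]"
    using DERIV_unique[OF DERIV_log_period_wave_0[of "Suc k", unfolded p] poly_DERIV] log_period_wave_0[of k, unfolded q]
    by (simp add: H_def disc_single del: disc.simps conn.simps)
  then have "poly (pderiv p) c = conn (Suc k) [half_period] - of_nat k / 2 * log_period_wave k c"
    using const[of c] unfolding H_def q by (simp add: algebra_simps)
  then show ?thesis using poly_DERIV[of p c] unfolding p by metis
qed

text \<open>
  The initial case, from \<open>W\<^sub>1\<^sub>,\<^sub>1\<close> and \<open>W\<^sub>0\<^sub>,\<^sub>3\<close>.
\<close>

lemma log_period_wave_1: "log_period_wave 1 c = c ^ 3 / 48 - c / 24"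
proof -
  have "log_period_wave 1 c = fps_nth (period_wave c) 1"
    using period_wave_nth_0[of c] by (simp add: log_period_wave_def fps_log_nth_Suc[of _ 0, simplified])
  moreover have "disc (Suc 0) [half_period] = - 1 / 24"
    by (simp add: one_point_def pull_m_def half_period_def)
  moreover have "disc (Suc 0) [half_period, half_period] = 0"
    by simp
  moreover have "disc (Suc 0) [half_period, half_period, half_period] = 1 / 8"
    by (simp add: three_point_def half_period_def)
  moreover have "{..3 :: nat} = {0, 1, 2, 3}" by auto
  moreover have "replicate 2 half_period = [half_period, half_period]"
    "replicate 3 half_period = [half_period, half_period, half_period]" by (simp_all add: eval_nat_numeral)
  ultimately show ?thesis
    by (simp add: period_wave_def fact_numeral del: disc.simps) (simp add: field_simps disc_Nil del: disc.simps)?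
qed

section \<open>The Voros coefficient\<close>

text \<open>
  The coefficient of \<open>\<hbar>\<^sup>n\<close> of the Riccati equation is linear in \<open>S\<^sub>n\<^sub>-\<^sub>1\<close> with the invertible factor \<open>2 S\<^sub>-\<^sub>1\<close>, so the
  branch of \<open>S\<^sub>-\<^sub>1\<close> determines the solution.
\<close>

theorem riccati_solution_coeff:
  assumes s: "s \<noteq> 0" and sol: "riccati_solution lam s \<nu> S" and "z \<in> - {0, 1, - 1}"
  shows "fls_nth (S z) (int n - 1) = riccati_coeff s \<nu> n z"
  using assms(3)
proof (induction n arbitrary: z rule: less_induct)
  case (less n)
  note z = less.prems
  define a where "a j z = fls_nth (S z) (int j - 1)" for j z
  have hol: "(\<lambda>z. fls_nth (S z) m) holomorphic_on - {0, 1, - 1}" for m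
    using sol unfolding riccati_solution_def by blast
  have low: "fls_nth (S u) m = 0" if "m < - 1" "u \<in> - {0, 1, - 1}" for m u
    using sol that unfolding riccati_solution_def by blast
  have a0: "a 0 z = weber_y s z"
    using sol z unfolding riccati_solution_def a_def by simp
  have eq: "fls_X ^ 2 * (fls_ddx s S z + S z ^ 2) =
      fls_const ((weber_x s z)\<^sup>2 / 4 - lam) + fls_const (\<nu> / 2) * fls_X"
    using sol z unfolding riccati_solution_def by blast
  have dlow: "deriv (\<lambda>w. fls_nth (S w) m) z = 0" if "m < - 1" for m
  proof -
    have "deriv (\<lambda>w. fls_nth (S w) m) z = deriv (\<lambda>w. 0) z"
      by (rule complex_derivative_transform_within_open[OF hol _ open_regular z]) (auto simp: low that)
    then show ?thesis by simp
  qed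
  have ddx_nth: "fls_nth (fls_ddx s S z) m = deriv (\<lambda>w. fls_nth (S w) m) z / deriv (weber_x s) z" for m
    unfolding fls_ddx_def by (rule nth_Abs_fls_lower_bound[of "- 1"]) (auto simp: dlow)
  let ?D = "Abs_fps (\<lambda>j. deriv (a j) z / deriv (weber_x s) z)"
  let ?A = "Abs_fps (\<lambda>j. a j z)"
  have XS: "fls_X * S z = fps_to_fls ?A"
    by (rule fls_eqI) (auto simp: fls_X_times_conv_shift a_def low[OF _ z])
  have XD: "fls_X * fls_ddx s S z = fps_to_fls ?D"
    by (rule fls_eqI) (auto simp: fls_X_times_conv_shift ddx_nth a_def[abs_def] dlow)
  have "fls_X ^ 2 * (fls_ddx s S z + S z ^ 2) = fls_X * (fls_X * fls_ddx s S z) + (fls_X * S z) ^ 2"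
    by (simp add: algebra_simps power2_eq_square)
  also have "\<dots> = fps_to_fls (fps_X * ?D + ?A ^ 2)"
    unfolding XS XD by (simp add: fls_times_fps_to_fls fps_to_fls_power)
  finally have "fps_to_fls (fps_X * ?D + ?A ^ 2) =
      fps_to_fls (fps_const ((weber_x s z)\<^sup>2 / 4 - lam) + fps_const (\<nu> / 2) * fps_X)"
    unfolding eq by (simp add: fls_times_fps_to_fls)
  then have feq: "fps_X * ?D + ?A ^ 2 = fps_const ((weber_x s z)\<^sup>2 / 4 - lam) + fps_const (\<nu> / 2) * fps_X"
    by (rule fps_to_fls_eq_imp_fps_eq)
  have "a n z = riccati_coeff s \<nu> n z"
  proof (cases n)
    case 0
    then show ?thesis using a0 by simp
  next
    case (Suc m)
    have IH: "a j u = riccati_coeff s \<nu> j u" if "j \<le> m" "u \<in> - {0, 1, - 1}" for j u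
      using less.IH[of j u] that Suc unfolding a_def by simp
    have dm: "deriv (a m) z = deriv (riccati_coeff s \<nu> m) z"
    proof (rule complex_derivative_transform_within_open[OF _ riccati_coeff_holomorphic[OF s] open_regular z])
      show "a m holomorphic_on - {0, 1, - 1}" unfolding a_def[abs_def] by (rule hol)
    qed (rule IH[OF le_refl])
    have "fps_nth (fps_X * ?D + ?A ^ 2) (Suc m) =
      fps_nth (fps_const ((weber_x s z)\<^sup>2 / 4 - lam) + fps_const (\<nu> / 2) * fps_X) (Suc m)"
      using feq by (rule arg_cong)
    then have c: "deriv (a m) z / deriv (weber_x s) z + (\<Sum>i=0..Suc m. a i z * a (Suc m - i) z) =
        (if m = 0 then \<nu> / 2 else 0)"
      by (simp add: power2_eq_square[of ?A] fps_mult_nth[of ?A ?A])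
    have "(\<Sum>i=0..Suc m. a i z * a (Suc m - i) z) =
        2 * weber_y s z * a (Suc m) z + (\<Sum>i\<in>{1..m}. a i z * a (Suc m - i) z)"
    proof -
      have "{0..Suc m} = insert 0 (insert (Suc m) {1..m})" by auto
      then show ?thesis using a0 by simp
    qed
    also have "(\<Sum>i\<in>{1..m}. a i z * a (Suc m - i) z) =
        (\<Sum>i\<in>{1..m}. riccati_coeff s \<nu> i z * riccati_coeff s \<nu> (Suc m - i) z)"
    proof (rule sum.cong[OF refl])
      fix i assume "i \<in> {1..m}"
      then have "i \<le> m" "Suc m - i \<le> m" by auto
      then show "a i z * a (Suc m - i) z = riccati_coeff s \<nu> i z * riccati_coeff s \<nu> (Suc m - i) z"
        using IH z by metis
    qed
    finally have "a (Suc m) z * (2 * weber_y s z) = (if m = 0 then \<nu> / 2 else 0)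
        - deriv (riccati_coeff s \<nu> m) z / deriv (weber_x s) z
        - (\<Sum>i\<in>{1..m}. riccati_coeff s \<nu> i z * riccati_coeff s \<nu> (Suc m - i) z)"
      using c unfolding dm by (simp add: algebra_simps)
    then show ?thesis
      unfolding Suc riccati_coeff.simps(2) using weber_nonzero(1)[OF s z]
      by (simp only: eq_divide_eq mult_eq_0_iff) simp
  qed
  then show ?case unfolding a_def .
qed

text \<open>
  The integrand has the primitive \<open>log Psi\<close>, which is single-valued and regular away from \<open>w = 0\<close> and
  \<open>w = \<infinity>\<close>, in particular at both ends of the path.
\<close>

theorem voros_nth:
  assumes s: "s \<noteq> 0" and sol: "riccati_solution lam s \<nu> S"
    and path: "path_0_to_infinity \<gamma>" and m: "1 \<le> m"
  shows "fps_nth (voros s S \<gamma>) m = (1 / s\<^sup>2) ^ m * (log_period_wave m (1 - \<nu>) - log_period_wave m (- 1 - \<nu>))"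
proof -
  define c where "c = (1 / s\<^sup>2) ^ m"
  define L where "L w = fps_nth (fps_log (Psi \<nu> w)) m" for w
  define f where "f z = fls_nth (S z) (int m) * deriv (weber_x s) z" for z
  define g where "g z = c * (fps_nth (chi \<nu> (cay z)) m * dcay z)" for z
  have dL: "(L has_field_derivative fps_nth (chi \<nu> w) m) (at w)" if "w \<noteq> 0" for w
    using fps_has_deriv_log_Psi[OF that] unfolding fps_has_deriv_def L_def[abs_def] by blast
  have f: "f z = g z" if z: "z \<in> - {0, 1, - 1}" for z
  proof -
    have z0: "z \<noteq> 0" "z \<noteq> 1" "z \<noteq> - 1" using z by auto
    have "fls_nth (S z) (int m) = riccati_coeff s \<nu> (Suc m) z"
      using riccati_solution_coeff[OF s sol z, of "Suc m"] by (simp del: riccati_coeff.simps)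
    also have "\<dots> = s powi (1 - 2 * int (Suc m)) * (fps_nth (chi \<nu> (cay z)) m * dw_dx z)"
      unfolding riccati_coeff_scale[OF s z] riccati_eq_chi[OF z m] ..
    finally have "f z = (s powi (1 - 2 * int (Suc m)) * s) * (fps_nth (chi \<nu> (cay z)) m *
        (dw_dx z * deriv (weber_x 1) z))"
      unfolding f_def deriv_weber_x_scale[OF z0(1), of s] by (simp only: mult_ac)
    also have "s powi (1 - 2 * int (Suc m)) * s = c"
    proof -
      have "s powi (1 - 2 * int (Suc m)) * s powi 1 = s powi (1 - 2 * int (Suc m) + 1)"
        by (rule power_int_add[symmetric]) (use s in simp)
      also have "1 - 2 * int (Suc m) + 1 = - int (2 * m)" by simp
      also have "s powi (- int (2 * m)) = c"
        unfolding c_def by (simp only: power_int_minus power_int_of_nat power_mult power_one_over inverse_eq_divide)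
      finally show ?thesis by simp
    qed
    finally show ?thesis unfolding g_def dw_dx_eq[OF z0] .
  qed
  have cont: "isCont g z" if "z \<in> - {1, - 1}" for z
  proof -
    have op: "open (- {1, - 1 :: complex})" by (intro open_Compl finite_imp_closed) auto
    have "continuous_on (- {1, - 1}) dcay"
      by (intro holomorphic_on_imp_continuous_on holomorphic_dcay) simp
    then have d: "isCont dcay z" using that op continuous_on_eq_continuous_at by blast
    have z1: "z \<noteq> 1" "z \<noteq> - 1" using that by auto
    have "((\<lambda>w. fps_nth (chi \<nu> w) m) has_field_derivative fps_nth (dchi \<nu> (cay z)) m) (at (cay z))"
      using fps_has_deriv_chi[OF cay_nonzero[OF z1], of \<nu>] unfolding fps_has_deriv_def by blast
    from DERIV_isCont[OF DERIV_chain2[OF this has_field_derivative_cay[OF z1(1)]]]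
    have "isCont (\<lambda>z. fps_nth (chi \<nu> (cay z)) m) z" .
    then show ?thesis
      unfolding g_def[abs_def] by (intro continuous_mult continuous_const d)
  qed
  have rem: "remove_sings f z = g z" if z: "z \<in> - {1, - 1}" for z
  proof (rule remove_sings_eqI)
    have "open (- {1, - 1 :: complex})" by (intro open_Compl finite_imp_closed) auto
    then have "eventually (\<lambda>u. u \<in> - {1, - 1}) (at z)" by (rule eventually_at_in_open') (rule z)
    moreover have "eventually (\<lambda>u. u \<noteq> 0) (at z)" by (rule eventually_neq_at_within)
    ultimately have "eventually (\<lambda>u. g u = f u) (at z)" by eventually_elim (auto simp: f)
    then show "f \<midarrow>z\<rightarrow> g z" using cont[OF z] unfolding isCont_def by (rule Lim_transform_eventually[rotated])
  qed
  have prim: "((\<lambda>z. c * L (cay z)) has_field_derivative remove_sings f z) (at z within - {1, - 1})"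
    if z: "z \<in> - {1, - 1}" for z
    unfolding rem[OF z] g_def
    by (intro DERIV_cmult DERIV_chain2[OF dL] has_field_derivative_cay cay_nonzero) (use z in auto)
  have val: "contour_integral (subpath 0 T \<gamma>) (remove_sings f) = c * L (cay (\<gamma> T)) - c * L (- 1)"
    if T: "T \<in> {0<..<1}" for T
  proof -
    have "path_image (subpath 0 T \<gamma>) = \<gamma> ` {0..T}" using T by (simp add: path_image_subpath)
    also have "\<dots> \<subseteq> - {1, - 1}" using path T unfolding path_0_to_infinity_def by auto
    finally have "(remove_sings f has_contour_integral
        (c * L (cay (pathfinish (subpath 0 T \<gamma>))) - c * L (cay (pathstart (subpath 0 T \<gamma>))))) (subpath 0 T \<gamma>)"
      using path T unfolding path_0_to_infinity_def
      by (intro contour_integral_primitive[OF prim]) auto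
    moreover have "\<gamma> 0 = 0" using path unfolding path_0_to_infinity_def by blast
    ultimately show ?thesis by (simp add: contour_integral_unique cay_def)
  qed
  have inf: "filterlim \<gamma> at_infinity (at_left 1)" using path unfolding path_0_to_infinity_def by blast
  have ev: "eventually (\<lambda>T. T \<in> {0<..<1 :: real}) (at_left 1)" by (rule eventually_at_left_real) simp
  have "((\<lambda>T. 1 + 2 / (- 1 + \<gamma> T)) \<longlongrightarrow> 1 + 0) (at_left 1)"
    by (intro tendsto_add tendsto_divide_0[OF tendsto_const] tendsto_add_filterlim_at_infinity[OF tendsto_const inf] tendsto_const)
  moreover have "eventually (\<lambda>T. 1 + 2 / (- 1 + \<gamma> T) = cay (\<gamma> T)) (at_left 1)"
    using ev
  proof eventually_elim
    case (elim T)
    then have "\<gamma> T \<noteq> 1" using path unfolding path_0_to_infinity_def by auto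
    then show ?case by (simp add: cay_def field_simps)
  qed
  ultimately have "((\<lambda>T. cay (\<gamma> T)) \<longlongrightarrow> 1 + 0) (at_left 1)"
    by (rule Lim_transform_eventually)
  then have l: "((\<lambda>T. cay (\<gamma> T)) \<longlongrightarrow> 1) (at_left 1)" by simp
  have i: "isCont L 1" by (rule DERIV_isCont[OF dL]) simp
  have "((\<lambda>T. L (cay (\<gamma> T))) \<longlongrightarrow> L 1) (at_left 1)"
    by (rule isCont_tendsto_compose[OF i l])
  then have "((\<lambda>T. c * L (cay (\<gamma> T)) - c * L (- 1)) \<longlongrightarrow> c * L 1 - c * L (- 1)) (at_left 1)"
    by (intro tendsto_intros)
  moreover have "eventually (\<lambda>T. c * L (cay (\<gamma> T)) - c * L (- 1) =
      contour_integral (subpath 0 T \<gamma>) (remove_sings f)) (at_left 1)"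
    using ev by eventually_elim (simp add: val)
  ultimately have "((\<lambda>T. contour_integral (subpath 0 T \<gamma>) (remove_sings f)) \<longlongrightarrow> c * L 1 - c * L (- 1)) (at_left 1)"
    by (rule Lim_transform_eventually)
  then have "Lim (at_left 1) (\<lambda>T. contour_integral (subpath 0 T \<gamma>) (remove_sings f)) = c * L 1 - c * L (- 1)"
    by (intro tendsto_Lim) auto
  moreover have "fps_nth (voros s S \<gamma>) m = Lim (at_left 1) (\<lambda>T. contour_integral (subpath 0 T \<gamma>) (remove_sings f))"
    using m by (simp add: voros_def f_def[abs_def])
  ultimately show ?thesis
    unfolding L_def Psi_endpoints log_period_wave_def c_def[symmetric] by (simp add: right_diff_distrib)
qed

section \<open>Taylor expansion of the free energy\<close>

lemma deriv_homogeneous: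
  assumes "open U" "0 \<notin> U" "u \<in> U" and F: "\<And>v. v \<in> U \<Longrightarrow> F v = a / v ^ p"
  shows "deriv F u = - of_nat p * a / u ^ Suc p"
proof -
  have u: "u \<noteq> 0" using assms by auto
  have "((\<lambda>v. a * v powi (- int p)) has_field_derivative a * (of_int (- int p) * u powi (- int p - 1) * 1)) (at u)"
    by (intro DERIV_cmult DERIV_power_int DERIV_ident) (use u in simp)
  then have "(F has_field_derivative a * (of_int (- int p) * u powi (- int p - 1) * 1)) (at u)"
    by (rule has_field_derivative_transform_within_open[OF _ assms(1,3)])
      (simp add: F power_int_minus divide_inverse)
  moreover have "u powi (- int p - 1) = 1 / u ^ Suc p"
  proof -
    have "- int p - 1 = - int (Suc p)" by simp
    then show ?thesis by (simp only: power_int_minus power_int_of_nat inverse_eq_divide)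
  qed
  ultimately show ?thesis by (simp add: DERIV_imp_deriv)
qed

lemma homogeneous_iterate:
  assumes "open U" "0 \<notin> U" and F: "\<And>v. v \<in> U \<Longrightarrow> (deriv ^^ n) F v = a / v ^ p"
  shows "\<exists>b. \<forall>v\<in>U. (deriv ^^ (n + j)) F v = b / v ^ (p + j)"
proof (induction j)
  case 0
  show ?case using F by auto
next
  case (Suc j)
  then obtain b where "\<And>v. v \<in> U \<Longrightarrow> (deriv ^^ (n + j)) F v = b / v ^ (p + j)" by blast
  from deriv_homogeneous[OF assms(1,2) _ this] have
    "\<forall>v\<in>U. (deriv ^^ (n + Suc j)) F v = (- of_nat (p + j) * b) / v ^ (p + Suc j)" by simp
  then show ?case by blast
qed

context
  fixes U :: "complex set" and sq lg :: "complex \<Rightarrow> complex" and \<Phi> :: "complex \<Rightarrow> complex \<Rightarrow> complex"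
    and lam :: complex
  assumes U: "open U" and lam: "lam \<in> U" and sq: "\<And>u. u \<in> U \<Longrightarrow> (sq u)\<^sup>2 = u"
    and lg: "lg holomorphic_on U" "\<And>u. u \<in> U \<Longrightarrow> exp (lg u) = u"
    and \<Phi>: "\<And>u. u \<in> U \<Longrightarrow> ydx_primitive (sq u) (\<Phi> u)"
begin

text \<open>
  The coefficient of \<open>\<hbar>\<^sup>k\<close> in the free energy, as a function of \<open>\<lambda>\<close>.
\<close>

definition F_coeff :: "int \<Rightarrow> complex \<Rightarrow> complex" where
  "F_coeff k u = fls_nth (total_free_energy sq lg \<Phi> u) k"

lemma zero_outside: "0 \<notin> U"
  using lg(2)[of 0] by auto

lemma F_coeff_eq: "F_coeff k = (if k \<ge> - 2 \<and> even k then free_energy sq lg \<Phi> (nat ((k + 2) div 2)) else (\<lambda>u. 0))"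
  by (rule ext) (simp add: F_coeff_def fls_nth_total_free_energy)

lemma DERIV_lg: "u \<in> U \<Longrightarrow> (lg has_field_derivative 1 / u) (at u)"
proof -
  assume u: "u \<in> U"
  have d: "(lg has_field_derivative deriv lg u) (at u)" by (rule holomorphic_derivI[OF lg(1) U u])
  have "((\<lambda>u. exp (lg u)) has_field_derivative exp (lg u) * deriv lg u) (at u)"
    by (rule DERIV_chain2[OF DERIV_exp d])
  moreover have "((\<lambda>u. exp (lg u)) has_field_derivative 1) (at u)"
    by (rule has_field_derivative_transform_within_open[OF DERIV_ident U u]) (simp add: lg(2))
  ultimately have "exp (lg u) * deriv lg u = 1" by (rule DERIV_unique)
  moreover have "u \<noteq> 0" using u zero_outside by auto
  ultimately have "deriv lg u = 1 / u" unfolding lg(2)[OF u] by (simp add: eq_divide_eq mult.commute)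
  then show ?thesis using d by simp
qed

lemma free_energy_0_derivs:
  assumes "u \<in> U"
  shows "deriv (free_energy sq lg \<Phi> 0) u = u * lg u - u"
    and "(deriv ^^ 2) (free_energy sq lg \<Phi> 0) u = lg u"
    and "(deriv ^^ 3) (free_energy sq lg \<Phi> 0) u = 1 / u ^ 1"
proof -
  have F: "free_energy sq lg \<Phi> 0 = (\<lambda>u. - 3 / 4 * u\<^sup>2 + 1 / 2 * u\<^sup>2 * lg u)"
    by (simp add: free_energy_def fun_eq_iff)
  have 1: "deriv (free_energy sq lg \<Phi> 0) u = u * lg u - u" if u: "u \<in> U" for u
  proof -
    have "u \<noteq> 0" using u zero_outside by auto
    then have "((\<lambda>u. - 3 / 4 * u\<^sup>2 + 1 / 2 * u\<^sup>2 * lg u) has_field_derivative u * lg u - u) (at u)"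
      by (auto intro!: derivative_eq_intros DERIV_lg u simp: field_simps power2_eq_square)
    then show ?thesis unfolding F by (rule DERIV_imp_deriv)
  qed
  have 2: "deriv (deriv (free_energy sq lg \<Phi> 0)) u = lg u" if u: "u \<in> U" for u
  proof -
    have "u \<noteq> 0" using u zero_outside by auto
    then have "((\<lambda>u. u * lg u - u) has_field_derivative lg u) (at u)"
      by (auto intro!: derivative_eq_intros DERIV_lg u)
    from has_field_derivative_transform_within_open[OF this U u 1[symmetric]]
    show ?thesis by (rule DERIV_imp_deriv)
  qed
  have 3: "deriv (deriv (deriv (free_energy sq lg \<Phi> 0))) u = 1 / u"
    using has_field_derivative_transform_within_open[OF DERIV_lg[OF assms] U assms 2[symmetric]]
    by (rule DERIV_imp_deriv)
  show "deriv (free_energy sq lg \<Phi> 0) u = u * lg u - u" by (rule 1[OF assms])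
  show "(deriv ^^ 2) (free_energy sq lg \<Phi> 0) u = lg u"
    using 2[OF assms] by (simp add: numeral_2_eq_2)
  show "(deriv ^^ 3) (free_energy sq lg \<Phi> 0) u = 1 / u ^ 1"
    using 3 by (simp add: numeral_3_eq_3)
qed

lemma free_energy_1_deriv: "u \<in> U \<Longrightarrow> deriv (free_energy sq lg \<Phi> 1) u = (- 1 / 12) / u ^ 1"
proof -
  assume u: "u \<in> U"
  have "((\<lambda>u. - 1 / 12 * lg u) has_field_derivative - 1 / 12 * (1 / u)) (at u)"
    by (intro DERIV_cmult DERIV_lg u)
  moreover have "free_energy sq lg \<Phi> 1 = (\<lambda>u. - 1 / 12 * lg u)"
    by (simp add: free_energy_def fun_eq_iff)
  ultimately show ?thesis by (simp add: DERIV_imp_deriv)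
qed

lemma free_energy_stable:
  assumes "2 \<le> g" "u \<in> U"
  shows "free_energy sq lg \<Phi> g u = 2 * conn (2 * g - 1) [half_period] / (2 - 2 * of_nat g) / u ^ (2 * g - 2)"
proof -
  have u: "u \<noteq> 0" using assms zero_outside by auto
  then have s: "sq u \<noteq> 0" using sq[OF assms(2)] by auto
  have "2 * g - 1 = Suc (2 * g - 2)" using assms by simp
  then have "2 * u * (1 / u) ^ (2 * g - 1) = 2 / u ^ (2 * g - 2)"
    using u by (simp add: power_one_over field_simps)
  then show ?thesis
    using assms free_energy_residue[OF s _ \<Phi>[OF assms(2)], of g] unfolding sq[OF assms(2)]
    by (simp add: free_energy_def)
qed

lemma deriv_zero: "(deriv ^^ n) (\<lambda>u. 0 :: complex) = (\<lambda>u. 0)"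
  by (induction n) auto

text \<open>
  Every \<open>F\<^sub>g\<close> is homogeneous in \<open>\<lambda>\<close> of degree \<open>2 - 2g\<close>, up to logarithms for \<open>g = 0\<close> and \<open>g = 1\<close> that
  disappear after three derivatives and after one derivative.
\<close>

lemma F_coeff_homogeneous:
  assumes "k \<ge> - 2" "k + int n \<ge> 1"
  shows "\<exists>a. \<forall>u\<in>U. (deriv ^^ n) (F_coeff k) u = a / u ^ nat (k + int n)"
proof (cases "even k")
  case False
  then have "F_coeff k = (\<lambda>u. 0)" by (simp add: F_coeff_eq)
  then show ?thesis by (intro exI[of _ 0]) (simp add: deriv_zero)
next
  case True
  have step: ?thesis if "n0 \<le> n" "int p = k + int n0" "\<And>u. u \<in> U \<Longrightarrow> (deriv ^^ n0) (F_coeff k) u = a / u ^ p" for n0 p a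
  proof -
    have "nat (k + int n) = p + (n - n0)" "n0 + (n - n0) = n" using that by auto
    then show ?thesis using homogeneous_iterate[OF U zero_outside that(3), of "n - n0"] by simp
  qed
  consider "k = - 2" | "k = 0" | "k \<ge> 2" using True assms(1) by (cases "k = - 1"; cases "k = 1") fastforce+
  then show ?thesis
  proof cases
    case 1
    then have "F_coeff k = free_energy sq lg \<Phi> 0" by (simp add: F_coeff_eq)
    then show ?thesis
      using assms 1 by (intro step[of 3 1 1]) (auto simp: free_energy_0_derivs(3))
  next
    case 2
    then have "F_coeff k = free_energy sq lg \<Phi> 1" by (simp add: F_coeff_eq)
    then show ?thesis
      using assms 2 free_energy_1_deriv by (intro step[of 1 1 "- 1 / 12"]) auto
  next
    case 3
    define g where "g = nat ((k + 2) div 2)"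
    have g: "2 \<le> g" "int (2 * g - 2) = k" using 3 True by (auto simp: g_def)
    have "F_coeff k = free_energy sq lg \<Phi> g" using 3 True by (simp add: F_coeff_eq g_def)
    then show ?thesis
      by (intro step[of 0 "2 * g - 2" "2 * conn (2 * g - 1) [half_period] / (2 - 2 * of_nat g)"])
        (use g free_energy_stable in auto)
  qed
qed

text \<open>
  The derivatives of the \<open>F\<^sub>g\<close> that contribute to \<open>\<hbar>\<^sup>m\<close> in the shifted free energy all have degree \<open>-m\<close> in \<open>\<lambda>\<close>; the
  power of \<open>\<lambda>\<close> makes them constants.
\<close>

definition taylor_coeff :: "nat \<Rightarrow> nat \<Rightarrow> complex" where
  "taylor_coeff m n = lam ^ m * (deriv ^^ n) (F_coeff (int m - int n)) lam"

text \<open>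
  The coefficient of \<open>\<hbar>\<^sup>m\<close> in \<open>F(\<lambda> + c\<hbar>/2) - F(\<lambda>)\<close>, times \<open>\<lambda>\<^sup>m\<close>.
\<close>

definition shift_poly :: "nat \<Rightarrow> complex \<Rightarrow> complex" where
  "shift_poly m c = (\<Sum>n\<in>{1..m + 2}. (c / 2) ^ n / fact n * taylor_coeff m n)"

lemma lam_nonzero: "lam \<noteq> 0"
  using lam zero_outside by auto

text \<open>
  Euler's relation for a function of degree \<open>-k\<close>.
\<close>

lemma taylor_coeff_Suc:
  assumes "1 \<le> k" "n \<le> k + 2"
  shows "taylor_coeff (Suc k) (Suc n) = - of_nat k * taylor_coeff k n"
proof -
  have "int k - int n \<ge> - 2" "int k - int n + int n \<ge> 1" using assms by auto
  from F_coeff_homogeneous[OF this] obtain a where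
    a: "\<And>u. u \<in> U \<Longrightarrow> (deriv ^^ n) (F_coeff (int k - int n)) u = a / u ^ k" by auto
  have "(deriv ^^ Suc n) (F_coeff (int k - int n)) lam = - of_nat k * a / lam ^ Suc k"
    using deriv_homogeneous[OF U zero_outside lam a] by simp
  moreover have "int (Suc k) - int (Suc n) = int k - int n" by simp
  ultimately have "taylor_coeff (Suc k) (Suc n) = lam ^ Suc k * (- of_nat k * a / lam ^ Suc k)"
    unfolding taylor_coeff_def by metis
  also have "\<dots> = - of_nat k * a" using lam_nonzero by simp
  also have "a = taylor_coeff k n" unfolding taylor_coeff_def a[OF lam] using lam_nonzero by simp
  finally show ?thesis .
qed

text \<open>
  Up to a factor, the dilation of \<open>F\<^sub>g\<close> is the integral of \<open>W\<^sub>g\<^sub>,\<^sub>1\<close> over the half period, by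
  \<open>free_energy_residue\<close>. For odd \<open>k\<close> both sides
  vanish, as there is no surface.
\<close>

lemma taylor_coeff_0:
  assumes "1 \<le> k"
  shows "- (of_nat k / 2) * taylor_coeff k 0 = conn (Suc k) [half_period]"
proof (cases "even k")
  case True
  define g where "g = k div 2 + 1"
  have g: "2 \<le> g" "2 * g - 2 = k" "2 * g - 1 = Suc k" using True assms by (auto simp: g_def)
  have k: "2 - 2 * of_nat g = - (of_nat k :: complex)"
  proof -
    have "2 * g = k + 2" using g by simp
    then have "2 * of_nat g = (of_nat k + 2 :: complex)" by (metis of_nat_add of_nat_mult of_nat_numeral)
    then show ?thesis by simp
  qed
  have "nat ((int k + 2) div 2) = g" unfolding g_def by simp
  then have "F_coeff (int k) = free_energy sq lg \<Phi> g" using True by (simp add: F_coeff_eq)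
  then have "taylor_coeff k 0 = 2 * conn (Suc k) [half_period] / - of_nat k"
    unfolding taylor_coeff_def using free_energy_stable[OF g(1) lam, unfolded g k] lam_nonzero by simp
  moreover have "- (K / 2) * (2 * C / - K) = C" if "K \<noteq> 0" for K C :: complex using that by simp
  ultimately show ?thesis using assms by (metis not_one_le_zero of_nat_eq_0_iff)
next
  case False
  then have "taylor_coeff k 0 = 0" by (simp add: taylor_coeff_def F_coeff_eq)
  moreover have "conn (Suc k) [half_period] = 0"
  proof (rule conn_parity)
    fix g show "Suc k + 1 \<noteq> 2 * g + length ([] :: functional list)"
    proof
      assume "Suc k + 1 = 2 * g + length ([] :: functional list)"
      then have "k + 2 = 2 * g" by simp
      then have "even (k + 2)" by simp
      then show False using False by simp
    qed
  qed
  ultimately show ?thesis by simp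
qed

lemma DERIV_shift_poly:
  assumes "1 \<le> k"
  shows "(shift_poly (Suc k) has_field_derivative conn (Suc k) [half_period] - of_nat k / 2 * shift_poly k c) (at c)"
proof -
  have "((\<lambda>c. \<Sum>n\<in>{1..Suc k + 2}. (c / 2) ^ n / fact n * taylor_coeff (Suc k) n) has_field_derivative
    (\<Sum>n\<in>{1..Suc k + 2}. of_nat n * (c / 2) ^ (n - 1) * (1 / 2) / fact n * taylor_coeff (Suc k) n)) (at c)"
    by (intro DERIV_sum DERIV_cmult_right DERIV_cdivide) (auto intro!: derivative_eq_intros)
  moreover have "(\<Sum>n\<in>{1..Suc k + 2}. of_nat n * (c / 2) ^ (n - 1) * (1 / 2) / fact n * taylor_coeff (Suc k) n) =
      (\<Sum>j\<in>{0..k + 2}. - (of_nat k / 2) * ((c / 2) ^ j / fact j * taylor_coeff k j))"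
  proof (rule sum.reindex_bij_witness[of _ Suc "\<lambda>n. n - 1"])
    fix n assume n: "n \<in> {1..Suc k + 2}"
    then obtain j where j: "n = Suc j" "j \<le> k + 2" by (cases n) auto
    have "of_nat (Suc j) * X / fact (Suc j) = X / fact j" for X :: complex
      unfolding fact_Suc using of_nat_neq_0[of j, where 'a = complex] by (simp del: of_nat_Suc)
    from this[of "(c / 2) ^ j * (1 / 2)"]
    show "- (of_nat k / 2) * ((c / 2) ^ (n - 1) / fact (n - 1) * taylor_coeff k (n - 1)) =
      of_nat n * (c / 2) ^ (n - 1) * (1 / 2) / fact n * taylor_coeff (Suc k) n"
      unfolding j(1) taylor_coeff_Suc[OF assms j(2)] diff_Suc_1 mult.assoc[symmetric] by simp
  qed auto
  moreover have "\<dots> = - (of_nat k / 2) * taylor_coeff k 0 - of_nat k / 2 * shift_poly k c"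
  proof -
    have "{0..k + 2} = insert 0 {1..k + 2}" by auto
    then have "(\<Sum>j\<in>{0..k + 2}. (c / 2) ^ j / fact j * taylor_coeff k j) = taylor_coeff k 0 + shift_poly k c"
      unfolding shift_poly_def by (simp only:) (subst sum.insert, simp_all)
    moreover have "(\<Sum>j\<in>{0..k + 2}. - (of_nat k / 2) * ((c / 2) ^ j / fact j * taylor_coeff k j)) =
        - (of_nat k / 2) * (\<Sum>j\<in>{0..k + 2}. (c / 2) ^ j / fact j * taylor_coeff k j)"
      by (rule sum_distrib_left[symmetric])
    moreover have "- K * (a + b) = - K * a - K * b" for K a b :: complex by (simp add: algebra_simps)
    ultimately show ?thesis by (simp only:)
  qed
  ultimately show ?thesis unfolding taylor_coeff_0[OF assms] shift_poly_def[abs_def] by simp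
qed

lemma shift_poly_1: "shift_poly 1 c = log_period_wave 1 c"
proof -
  have "F_coeff 0 = free_energy sq lg \<Phi> 1" "F_coeff (- 1) = (\<lambda>u. 0)" "F_coeff (- 2) = free_energy sq lg \<Phi> 0"
    by (simp_all add: F_coeff_eq)
  then have "taylor_coeff 1 1 = - 1 / 12" "taylor_coeff 1 2 = 0" "taylor_coeff 1 3 = 1"
    using free_energy_1_deriv[OF lam] free_energy_0_derivs(3)[OF lam] lam_nonzero
    by (simp_all add: taylor_coeff_def deriv_zero)
  moreover have "{1..1 + 2 :: nat} = {1, 2, 3}" by auto
  ultimately show ?thesis
    by (simp add: shift_poly_def log_period_wave_1 fact_numeral power_divide del: One_nat_def)
qed

text \<open>
  Both sides vanish at \<open>c = 0\<close>, and their derivatives satisfy the same recursion.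
\<close>

theorem log_period_wave_eq_shift_poly: "1 \<le> m \<Longrightarrow> log_period_wave m c = shift_poly m c"
proof (induction m arbitrary: c rule: nat_induct_at_least)
  case base
  show ?case by (rule shift_poly_1[symmetric])
next
  case (Suc k)
  have "((\<lambda>c. log_period_wave (Suc k) c - shift_poly (Suc k) c) has_field_derivative
      (conn (Suc k) [half_period] - of_nat k / 2 * log_period_wave k c) - (conn (Suc k) [half_period] - of_nat k / 2 * shift_poly k c))
      (at c within UNIV)" for c
    by (intro DERIV_diff DERIV_log_period_wave DERIV_shift_poly Suc.hyps)
  then have "\<exists>d. \<forall>c\<in>UNIV. log_period_wave (Suc k) c - shift_poly (Suc k) c = d"
    by (intro has_field_derivative_zero_constant) (simp_all add: Suc.IH)
  then obtain d where d: "\<And>c. log_period_wave (Suc k) c - shift_poly (Suc k) c = d" by blast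
  have "shift_poly (Suc k) 0 = 0" by (simp add: shift_poly_def sum.neutral)
  then have "d = 0" using d[of 0] by (simp add: log_period_wave_0)
  then show ?case using d[of c] by simp
qed

lemma hbar_shift_nth:
  assumes "1 \<le> m"
  shows "fls_nth (hbar_shift (c / 2) (total_free_energy sq lg \<Phi>) lam) (int m) =
    F_coeff (int m) lam + (1 / lam) ^ m * log_period_wave m c"
proof -
  have "nat (int m + 2) = m + 2" by simp
  then have "fls_nth (hbar_shift (c / 2) (total_free_energy sq lg \<Phi>) lam) (int m) =
      (\<Sum>n\<le>m + 2. (c / 2) ^ n / fact n * (deriv ^^ n) (F_coeff (int m - int n)) lam)"
    unfolding fls_nth_hbar_shift F_coeff_def[symmetric] F_coeff_def[abs_def, symmetric] by simp
  also have "\<dots> = (\<Sum>n\<le>m + 2. (1 / lam) ^ m * ((c / 2) ^ n / fact n * taylor_coeff m n))"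
    using lam_nonzero by (intro sum.cong) (auto simp: taylor_coeff_def power_one_over)
  also have "{..m + 2} = insert 0 {1..m + 2}" by auto
  also have "(\<Sum>n\<in>insert 0 {1..m + 2}. (1 / lam) ^ m * ((c / 2) ^ n / fact n * taylor_coeff m n)) =
      (1 / lam) ^ m * taylor_coeff m 0 + (1 / lam) ^ m * shift_poly m c"
    unfolding shift_poly_def sum_distrib_left by (subst sum.insert) simp_all
  also have "(1 / lam) ^ m * taylor_coeff m 0 = F_coeff (int m) lam"
    using lam_nonzero by (simp add: taylor_coeff_def power_one_over)
  finally show ?thesis unfolding log_period_wave_eq_shift_poly[OF assms] .
qed

text \<open>
  In the powers \<open>\<hbar>\<^sup>-\<^sup>1\<close> and \<open>\<hbar>\<^sup>0\<close> the difference of the shifted free energies consists of derivatives of \<open>F\<^sub>0\<close>, which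
  the last two terms cancel; in positive powers, the unshifted terms cancel.
\<close>

theorem voros_free_energy:
  assumes sol: "riccati_solution lam (sq lam) \<nu> S" and path: "path_0_to_infinity \<gamma>"
  shows "fps_to_fls (voros (sq lam) S \<gamma>) =
      hbar_shift (- \<nu> / 2 + 1 / 2) (total_free_energy sq lg \<Phi>) lam
    - hbar_shift (- \<nu> / 2 - 1 / 2) (total_free_energy sq lg \<Phi>) lam
    - fls_X_inv * fls_const (deriv (free_energy sq lg \<Phi> 0) lam)
    + fls_const (\<nu> / 2 * (deriv ^^ 2) (free_energy sq lg \<Phi> 0) lam)"
proof (rule fls_eqI)
  fix k :: int
  let ?F = "total_free_energy sq lg \<Phi>"
  let ?G = "free_energy sq lg \<Phi> 0"
  have s: "sq lam \<noteq> 0" using sq[OF lam] lam_nonzero by auto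
  have args: "- \<nu> / 2 + 1 / 2 = (1 - \<nu>) / 2" "- \<nu> / 2 - 1 / 2 = (- 1 - \<nu>) / 2"
    by (simp_all add: field_simps)
  have X: "fls_nth (fls_X_inv * fls_const a) k = (if k = - 1 then a else 0)" for a :: complex
    using fls_X_inv_times_conv_shift(1)[of "fls_const a"] by (auto simp: eq_neg_iff_add_eq_0)
  have low: "fls_nth (hbar_shift c ?F lam) k = (\<Sum>n\<le>nat (k + 2). c ^ n / fact n * (deriv ^^ n) (F_coeff (k - int n)) lam)"
    if "- 2 \<le> k" for c
    using that unfolding fls_nth_hbar_shift F_coeff_def[symmetric] F_coeff_def[abs_def, symmetric] by simp
  have f2: "F_coeff (- 2) = ?G" and f1: "F_coeff (- 1) = (\<lambda>u. 0)" by (simp_all add: F_coeff_eq)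
  consider "k < - 2" | "k = - 2" | "k = - 1" | "k = 0" | m where "1 \<le> m" "k = int m"
    by (cases "k \<ge> 1") (metis nonneg_int_cases zero_le_one order_trans of_nat_1 of_nat_le_iff, fastforce)
  then show "fls_nth (fps_to_fls (voros (sq lam) S \<gamma>)) k =
    fls_nth (hbar_shift (- \<nu> / 2 + 1 / 2) ?F lam - hbar_shift (- \<nu> / 2 - 1 / 2) ?F lam
      - fls_X_inv * fls_const (deriv ?G lam) + fls_const (\<nu> / 2 * (deriv ^^ 2) ?G lam)) k"
  proof cases
    case 1
    then show ?thesis by (simp add: X fls_nth_hbar_shift)
  next
    case 2
    then have "fls_nth (hbar_shift c ?F lam) k = F_coeff (- 2) lam" for c using low[of c] by simp
    then show ?thesis unfolding fls_plus_nth fls_minus_nth X using 2 by simp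
  next
    case 3
    then have "fls_nth (hbar_shift c ?F lam) k = F_coeff (- 1) lam + c * deriv ?G lam" for c
      unfolding low[OF order.trans[OF _ eq_refl[OF 3[symmetric]]], simplified] by (simp add: f2)
    then show ?thesis using 3 by (simp add: X algebra_simps)
  next
    case 4
    have S2: "{..2 :: nat} = {0, 1, 2}" by auto
    have "fls_nth (hbar_shift c ?F lam) k = F_coeff 0 lam + c\<^sup>2 / 2 * (deriv ^^ 2) ?G lam" for c
      using low[of c] unfolding 4 by (simp add: S2 f1 f2 deriv_zero fact_2 del: One_nat_def)
    moreover have "fls_nth (fps_to_fls (voros (sq lam) S \<gamma>)) k = 0" by (simp add: 4 voros_def)
    moreover have "(- \<nu> / 2 + 1 / 2)\<^sup>2 / 2 * D - (- \<nu> / 2 - 1 / 2)\<^sup>2 / 2 * D + \<nu> / 2 * D = 0" for D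
      by (simp add: power2_eq_square field_simps)
    ultimately show ?thesis using 4 by (simp add: X)
  next
    case 5
    have "fls_nth (fps_to_fls (voros (sq lam) S \<gamma>)) k = (1 / lam) ^ m * (log_period_wave m (1 - \<nu>) - log_period_wave m (- 1 - \<nu>))"
      using voros_nth[OF s sol path 5(1)] 5 by (simp add: sq[OF lam])
    moreover have "fls_nth (fls_const (\<nu> / 2 * (deriv ^^ 2) ?G lam)) k = 0" using 5 by simp
    ultimately show ?thesis
      unfolding args fls_plus_nth fls_minus_nth X using 5
      by (simp add: hbar_shift_nth right_diff_distrib)
  qed
qed

end

section \<open>The relation between the Voros coefficient and the free energy\<close>

theorem theorem1p1:
  fixes lam \<nu> :: complex
    and U :: "complex set"
    and sq lg :: "complex \<Rightarrow> complex"
    and \<Phi> :: "complex \<Rightarrow> complex \<Rightarrow> complex"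
    and S :: "complex \<Rightarrow> complex fls"
    and \<gamma> :: "real \<Rightarrow> complex"
  assumes "lam \<noteq> 0"
    and "open U" and "lam \<in> U"
    and "sq holomorphic_on U" and "\<And>u. u \<in> U \<Longrightarrow> (sq u)\<^sup>2 = u"
    and "lg holomorphic_on U" and "\<And>u. u \<in> U \<Longrightarrow> exp (lg u) = u"
    and "\<And>u. u \<in> U \<Longrightarrow> ydx_primitive (sq u) (\<Phi> u)"
    and "riccati_solution lam (sq lam) \<nu> S"
    and "path_0_to_infinity \<gamma>"
  shows "fps_to_fls (voros (sq lam) S \<gamma>) =
      hbar_shift (- \<nu> / 2 + 1 / 2) (total_free_energy sq lg \<Phi>) lam
    - hbar_shift (- \<nu> / 2 - 1 / 2) (total_free_energy sq lg \<Phi>) lam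
    - fls_X_inv * fls_const (deriv (free_energy sq lg \<Phi> 0) lam)
    + fls_const (\<nu> / 2 * (deriv ^^ 2) (free_energy sq lg \<Phi> 0) lam)"
  by (rule voros_free_energy[OF assms(2,3,5,6,7,8,9,10)])

end
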